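(* Let $T$ be a Calderón--Zygmund operator with Dini-continuous kernel. Let $1<r<s<\infty$ and suppose $X$ is an $r$-convex and $s$-concave Banach function space over $\mathbf{R}^d$ such that $$M:X\to X,\qquad M:X'\to X'$$ are bounded. Then for every $b\in\mathrm{CMO}$ the commutator $[b,T]:X\to X$ is a compact operator.
   Context: Calderón--Zygmund operator with Dini-continuous kernel: a bounded linear operator $T:L^2(\mathbf{R}^d)\to L^2(\mathbf{R}^d)$ such that for any $f\in C_c^\infty(\mathbf{R}^d)$ $$Tf(x)=\int_{\mathbf{R}^d}K(x,y)f(y)\,dy,\qquad x\in\mathbf{R}^d\setminus\operatorname{supp}(f),$$ where the kernel satisfies $$|K(x,y)-K(x',y)|\le\tfrac{1}{|x-y|^d}\,\omega\big(\tfrac{|x-x'|}{|x-y|}\big),\quad 0<|x-x'|<\tfrac12|x-y|,$$ $$|K(x,y)-K(x,y')|\le\tfrac{1}{|x-y|^d}\,\omega\big(\tfrac{|y-y'|}{|x-y|}\big),\quad 0<|y-y'|<\tfrac12|x-y|,$$ for some increasing, subadditive $\omega:[0,1]\to[0,\infty)$ with $\int_0^1\omega(t)\frac{dt}{t}<\infty$. For $b\in L^1_{\mathrm{loc}}(\mathbf{R}^d)$ the commutator is $[b,T]f:=bT(f)-T(bf)$. $\mathrm{CMO}$ is the closure of $C_c^\infty(\mathbf{R}^d)$ with respect to the norm of $\mathrm{BMO}$, the classical space of functions of bounded mean oscillation on $\mathbf{R}^d$. $L^0(\mathbf{R}^d)$ is the space of measurable functions on $\mathbf{R}^d$ (Lebesgue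 measure, modulo a.e. equality). Banach function space over $\mathbf{R}^d$: a vector space $X\subseteq L^0(\mathbf{R}^d)$ with a norm $\|\cdot\|_X$ satisfying: (ideal property) if $f\in X$, $g\in L^0(\mathbf{R}^d)$ and $|g|\le|f|$, then $g\in X$ and $\|g\|_X\le\|f\|_X$; (Fatou property) if $0\le f_n\uparrow f$ with $f_n\in X$ and $\sup_n\|f_n\|_X<\infty$, then $f\in X$ and $\|f\|_X=\sup_n\|f_n\|_X$; (saturation property) every measurable $E\subseteq\mathbf{R}^d$ of positive measure has a measurable subset $F\subseteq E$ of positive measure with $\mathbf{1}_F\in X$. The associate space $X'$ is the space of $g\in L^0(\mathbf{R}^d)$ with $\|g\|_{X'}:=\sup_{\|f\|_X\le1}\int_{\mathbf{R}^d}|fg|<\infty$. $X$ is $r$-convex if $\big\|(|f|^r+|g|^r)^{1/r}\big\|_X\le(\|f\|_X^r+\|g\|_X^r)^{1/r}$ for all $f,g\in X$, and $s$-concave if $(\|f\|_X^s+\|g\|_X^s)^{1/s}\le\big\|(|f|^s+|g|^s)^{1/s}\big\|_X$ for all $f,g\in X$. $M$ is the Hardy--Littlewood maximal operator $Mf=\sup_Q\big(\frac1{|Q|}\int_Q|f|\big)\mathbf{1}_Q$, the supremum being over all cubes $Q\subseteq\mathbf{R}^d$. *)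

theory Defs
  imports "HOL-Analysis.Analysis"
begin

text \<open>
  \<open>R\<^sup>d\<close> is an arbitrary Euclidean space \<open>'a\<close> with \<open>d = DIM('a)\<close>; scalars are complex.
  Spaces of measurable functions modulo a.e. equality are represented by sets of functions
  together with a norm on representatives (a seminorm vanishing exactly on the a.e. null functions).
  Operators act on representatives and respect a.e. equality.
\<close>

definition L0 :: "('a::euclidean_space \<Rightarrow> complex) set" where
  "L0 = borel_measurable lebesgue"

definition L2 :: "('a::euclidean_space \<Rightarrow> complex) set" where
  "L2 = {f \<in> L0. integrable lebesgue (\<lambda>x. (norm (f x))\<^sup>2)}"

definition L2_norm :: "('a::euclidean_space \<Rightarrow> complex) \<Rightarrow> real" where
  "L2_norm f = sqrt (\<integral>x. (norm (f x))\<^sup>2 \<partial>lebesgue)"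

definition L1_loc :: "('a::euclidean_space \<Rightarrow> complex) set" where
  "L1_loc = {f \<in> L0. \<forall>A. compact A \<longrightarrow> f absolutely_integrable_on A}"

primrec Ck :: "nat \<Rightarrow> ('a::euclidean_space \<Rightarrow> complex) \<Rightarrow> bool" where
  "Ck 0 f \<longleftrightarrow> continuous_on UNIV f"
| "Ck (Suc k) f \<longleftrightarrow>
     (\<forall>x. f differentiable (at x)) \<and> (\<forall>i\<in>Basis. Ck k (\<lambda>x. frechet_derivative f (at x) i))"

definition supp :: "('a::euclidean_space \<Rightarrow> complex) \<Rightarrow> 'a set" where
  "supp f = closure {x. f x \<noteq> 0}"

definition Cc_infty :: "('a::euclidean_space \<Rightarrow> complex) set" where
  "Cc_infty = {f. (\<forall>k. Ck k f) \<and> compact (supp f)}"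


subsection \<open>Linear operators modulo a.e. equality\<close>

definition linear_operator ::
  "('a::euclidean_space \<Rightarrow> complex) set \<Rightarrow> ('a \<Rightarrow> complex) set
    \<Rightarrow> (('a \<Rightarrow> complex) \<Rightarrow> ('a \<Rightarrow> complex)) \<Rightarrow> bool" where
  "linear_operator X Y T \<longleftrightarrow>
     (\<forall>f\<in>X. T f \<in> Y) \<and>
     (\<forall>f\<in>X. \<forall>g\<in>X. (AE x in lebesgue. f x = g x) \<longrightarrow> (AE x in lebesgue. T f x = T g x)) \<and>
     (\<forall>f\<in>X. \<forall>g\<in>X. AE x in lebesgue. T (\<lambda>x. f x + g x) x = T f x + T g x) \<and>
     (\<forall>c. \<forall>f\<in>X. AE x in lebesgue. T (\<lambda>x. c * f x) x = c * T f x)"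


subsection \<open>Calderon--Zygmund operators with Dini-continuous kernel\<close>

definition dini_modulus :: "(real \<Rightarrow> real) \<Rightarrow> bool" where
  "dini_modulus \<omega> \<longleftrightarrow>
     (\<forall>t\<in>{0..1}. 0 \<le> \<omega> t) \<and>
     mono_on {0..1} \<omega> \<and>
     (\<forall>s t. 0 \<le> s \<and> 0 \<le> t \<and> s + t \<le> 1 \<longrightarrow> \<omega> (s + t) \<le> \<omega> s + \<omega> t) \<and>
     (\<integral>\<^sup>+t\<in>{0..1}. ennreal (\<omega> t / t) \<partial>lborel) < \<infinity>"

text \<open>Nothing is assumed about the values of the kernel on the diagonal.\<close>

definition dini_kernel :: "('a::euclidean_space \<Rightarrow> 'a \<Rightarrow> complex) \<Rightarrow> bool" where
  "dini_kernel K \<longleftrightarrow> (\<exists>\<omega>. dini_modulus \<omega> \<and>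
     (\<forall>x x' y. 0 < norm (x - x') \<and> norm (x - x') < 1/2 * norm (x - y) \<longrightarrow>
        norm (K x y - K x' y)
          \<le> 1 / norm (x - y) ^ DIM('a) * \<omega> (norm (x - x') / norm (x - y))) \<and>
     (\<forall>x y y'. 0 < norm (y - y') \<and> norm (y - y') < 1/2 * norm (x - y) \<longrightarrow>
        norm (K x y - K x y')
          \<le> 1 / norm (x - y) ^ DIM('a) * \<omega> (norm (y - y') / norm (x - y))))"

text \<open>
  Since \<open>T f\<close> is only determined almost everywhere, the kernel representation is required
  for almost every \<open>x\<close> outside \<open>supp f\<close>. The Dini condition forces
  \<open>\<omega> t \<longlonglongrightarrow> 0\<close> as \<open>t\<close> tends to \<open>0\<close>, so \<open>K\<close> is continuous off the diagonal and the integrand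
  is integrable for such \<open>x\<close>.
\<close>

definition dini_calderon_zygmund ::
  "(('a::euclidean_space \<Rightarrow> complex) \<Rightarrow> ('a \<Rightarrow> complex)) \<Rightarrow> bool" where
  "dini_calderon_zygmund T \<longleftrightarrow>
     linear_operator L2 L2 T \<and>
     (\<exists>C. \<forall>f\<in>L2. L2_norm (T f) \<le> C * L2_norm f) \<and>
     (\<exists>K. dini_kernel K \<and>
        (\<forall>f\<in>Cc_infty. AE x in lebesgue. x \<notin> supp f \<longrightarrow>
           T f x = (\<integral>y. K x y * f y \<partial>lebesgue)))"


subsection \<open>Cubes, BMO, CMO and the maximal operator\<close>

definition cubes :: "'a::euclidean_space set set" where
  "cubes = {cbox a (a + l *\<^sub>R One) | a l. 0 < l}"

definition cube_mean :: "('a::euclidean_space \<Rightarrow> complex) \<Rightarrow> 'a set \<Rightarrow> complex" where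
  "cube_mean b Q = (LINT x:Q|lebesgue. b x) / of_real (measure lebesgue Q)"

definition BMO_norm :: "('a::euclidean_space \<Rightarrow> complex) \<Rightarrow> ennreal" where
  "BMO_norm b =
     (SUP Q\<in>cubes. (\<integral>\<^sup>+x\<in>Q. ennreal (norm (b x - cube_mean b Q)) \<partial>lebesgue) / emeasure lebesgue Q)"

definition BMO :: "('a::euclidean_space \<Rightarrow> complex) set" where
  "BMO = {b \<in> L1_loc. BMO_norm b < \<infinity>}"

definition CMO :: "('a::euclidean_space \<Rightarrow> complex) set" where
  "CMO = {b \<in> BMO. \<forall>\<epsilon>>0. \<exists>\<phi>\<in>Cc_infty. BMO_norm (\<lambda>x. b x - \<phi> x) < ennreal \<epsilon>}"

definition maximal :: "('a::euclidean_space \<Rightarrow> complex) \<Rightarrow> 'a \<Rightarrow> ennreal" where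
  "maximal f x =
     (SUP Q\<in>cubes. (\<integral>\<^sup>+y\<in>Q. ennreal (norm (f y)) \<partial>lebesgue) / emeasure lebesgue Q * indicator Q x)"

text \<open>The a.e. finiteness clause is needed because \<open>enn2real \<infinity> = 0\<close>.\<close>

definition maximal_bounded_on ::
  "('a::euclidean_space \<Rightarrow> complex) set \<Rightarrow> (('a \<Rightarrow> complex) \<Rightarrow> real) \<Rightarrow> bool" where
  "maximal_bounded_on X N \<longleftrightarrow> (\<exists>C. \<forall>f\<in>X.
     (AE x in lebesgue. maximal f x < \<infinity>) \<and>
     (\<lambda>x. of_real (enn2real (maximal f x))) \<in> X \<and>
     N (\<lambda>x. of_real (enn2real (maximal f x))) \<le> C * N f)"


subsection \<open>Banach function spaces\<close>

text \<open>
  In the Fatou property the monotone limit \<open>G\<close> is finite-valued, i.e. an element of \<open>L0\<close>;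
  by saturation a monotone limit of a norm-bounded sequence is automatically finite a.e.
\<close>

definition banach_function_space ::
  "('a::euclidean_space \<Rightarrow> complex) set \<Rightarrow> (('a \<Rightarrow> complex) \<Rightarrow> real) \<Rightarrow> bool" where
  "banach_function_space X N \<longleftrightarrow>
     \<comment> \<open>normed vector space of measurable functions\<close>
     X \<subseteq> L0 \<and> (\<lambda>x. 0) \<in> X \<and>
     (\<forall>f\<in>X. \<forall>g\<in>X. (\<lambda>x. f x + g x) \<in> X \<and> N (\<lambda>x. f x + g x) \<le> N f + N g) \<and>
     (\<forall>c. \<forall>f\<in>X. (\<lambda>x. c * f x) \<in> X \<and> N (\<lambda>x. c * f x) = norm c * N f) \<and>
     (\<forall>f\<in>X. 0 \<le> N f \<and> (N f = 0 \<longleftrightarrow> (AE x in lebesgue. f x = 0))) \<and>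
     \<comment> \<open>ideal property\<close>
     (\<forall>f\<in>X. \<forall>g\<in>L0. (AE x in lebesgue. norm (g x) \<le> norm (f x)) \<longrightarrow> g \<in> X \<and> N g \<le> N f) \<and>
     \<comment> \<open>Fatou property\<close>
     (\<forall>(F :: nat \<Rightarrow> 'a \<Rightarrow> real) G.
        (\<forall>n. (\<lambda>x. of_real (F n x)) \<in> X) \<and>
        (AE x in lebesgue. \<forall>n. 0 \<le> F n x \<and> F n x \<le> F (Suc n) x) \<and>
        (AE x in lebesgue. (\<lambda>n. F n x) \<longlonglongrightarrow> G x) \<and>
        bdd_above (range (\<lambda>n. N (\<lambda>x. of_real (F n x)))) \<longrightarrow>
        (\<lambda>x. of_real (G x)) \<in> X \<and>
        N (\<lambda>x. of_real (G x)) = (SUP n. N (\<lambda>x. of_real (F n x)))) \<and>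
     \<comment> \<open>saturation property\<close>
     (\<forall>E\<in>sets lebesgue. 0 < emeasure lebesgue E \<longrightarrow>
        (\<exists>F\<in>sets lebesgue. F \<subseteq> E \<and> 0 < emeasure lebesgue F \<and> indicator F \<in> X))"

definition associate_enorm ::
  "('a::euclidean_space \<Rightarrow> complex) set \<Rightarrow> (('a \<Rightarrow> complex) \<Rightarrow> real) \<Rightarrow> ('a \<Rightarrow> complex) \<Rightarrow> ennreal" where
  "associate_enorm X N g =
     (SUP f\<in>{f \<in> X. N f \<le> 1}. \<integral>\<^sup>+x. ennreal (norm (f x * g x)) \<partial>lebesgue)"

definition associate_space ::
  "('a::euclidean_space \<Rightarrow> complex) set \<Rightarrow> (('a \<Rightarrow> complex) \<Rightarrow> real) \<Rightarrow> ('a \<Rightarrow> complex) set" where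
  "associate_space X N = {g \<in> L0. associate_enorm X N g < \<infinity>}"

definition associate_norm ::
  "('a::euclidean_space \<Rightarrow> complex) set \<Rightarrow> (('a \<Rightarrow> complex) \<Rightarrow> real) \<Rightarrow> ('a \<Rightarrow> complex) \<Rightarrow> real" where
  "associate_norm X N g = enn2real (associate_enorm X N g)"

definition r_convex ::
  "real \<Rightarrow> ('a::euclidean_space \<Rightarrow> complex) set \<Rightarrow> (('a \<Rightarrow> complex) \<Rightarrow> real) \<Rightarrow> bool" where
  "r_convex r X N \<longleftrightarrow> (\<forall>f\<in>X. \<forall>g\<in>X.
     N (\<lambda>x. of_real ((norm (f x) powr r + norm (g x) powr r) powr (1 / r)))
       \<le> (N f powr r + N g powr r) powr (1 / r))"

definition s_concave ::
  "real \<Rightarrow> ('a::euclidean_space \<Rightarrow> complex) set \<Rightarrow> (('a \<Rightarrow> complex) \<Rightarrow> real) \<Rightarrow> bool" where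
  "s_concave s X N \<longleftrightarrow> (\<forall>f\<in>X. \<forall>g\<in>X.
     (N f powr s + N g powr s) powr (1 / s)
       \<le> N (\<lambda>x. of_real ((norm (f x) powr s + norm (g x) powr s) powr (1 / s))))"


subsection \<open>Compact operators and commutators\<close>

text \<open>
  The topology of the norm on representatives. It does not separate functions that agree a.e.;
  its Kolmogorov quotient is the normed space \<open>X\<close> modulo a.e. equality, and a set has compact
  closure here iff its image there does.
\<close>

definition norm_topology ::
  "('a::euclidean_space \<Rightarrow> complex) set \<Rightarrow> (('a \<Rightarrow> complex) \<Rightarrow> real) \<Rightarrow> ('a \<Rightarrow> complex) topology" where
  "norm_topology X N =
     topology (\<lambda>U. U \<subseteq> X \<and> (\<forall>f\<in>U. \<exists>\<epsilon>>0. \<forall>g\<in>X. N (\<lambda>x. g x - f x) < \<epsilon> \<longrightarrow> g \<in> U))"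

lemma openin_norm_topology:
  "openin (norm_topology X N) U \<longleftrightarrow>
     U \<subseteq> X \<and> (\<forall>f\<in>U. \<exists>\<epsilon>>0. \<forall>g\<in>X. N (\<lambda>x. g x - f x) < \<epsilon> \<longrightarrow> g \<in> U)"
proof -
  let ?P = "\<lambda>U. U \<subseteq> X \<and> (\<forall>f\<in>U. \<exists>\<epsilon>>0. \<forall>g\<in>X. N (\<lambda>x. g x - f x) < \<epsilon> \<longrightarrow> g \<in> U)"
  have "?P (S \<inter> T)" if S: "?P S" and T: "?P T" for S T
  proof (intro conjI ballI)
    show "S \<inter> T \<subseteq> X" using S by blast
    fix f assume "f \<in> S \<inter> T"
    then obtain d e where "d > 0" "\<forall>g\<in>X. N (\<lambda>x. g x - f x) < d \<longrightarrow> g \<in> S"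
      and "e > 0" "\<forall>g\<in>X. N (\<lambda>x. g x - f x) < e \<longrightarrow> g \<in> T"
      using S T by blast
    then show "\<exists>\<epsilon>>0. \<forall>g\<in>X. N (\<lambda>x. g x - f x) < \<epsilon> \<longrightarrow> g \<in> S \<inter> T"
      by (intro exI[of _ "min d e"]) auto
  qed
  moreover have "?P (\<Union>\<K>)" if "\<forall>S\<in>\<K>. ?P S" for \<K>
  proof (intro conjI ballI)
    show "\<Union>\<K> \<subseteq> X" using that by blast
    fix f assume "f \<in> \<Union>\<K>"
    then obtain S where "S \<in> \<K>" "f \<in> S" by blast
    then show "\<exists>\<epsilon>>0. \<forall>g\<in>X. N (\<lambda>x. g x - f x) < \<epsilon> \<longrightarrow> g \<in> \<Union>\<K>"
      using that by (meson UnionI)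
  qed
  ultimately have "istopology ?P"
    unfolding istopology_def by blast
  then show ?thesis
    by (simp add: norm_topology_def)
qed

definition compact_operator ::
  "('a::euclidean_space \<Rightarrow> complex) set \<Rightarrow> (('a \<Rightarrow> complex) \<Rightarrow> real)
    \<Rightarrow> (('a \<Rightarrow> complex) \<Rightarrow> ('a \<Rightarrow> complex)) \<Rightarrow> bool" where
  "compact_operator X N S \<longleftrightarrow>
     linear_operator X X S \<and>
     compactin (norm_topology X N) (norm_topology X N closure_of (S ` {f \<in> X. N f \<le> 1}))"

definition commutator ::
  "('a::euclidean_space \<Rightarrow> complex) \<Rightarrow> (('a \<Rightarrow> complex) \<Rightarrow> ('a \<Rightarrow> complex))
    \<Rightarrow> ('a \<Rightarrow> complex) \<Rightarrow> ('a \<Rightarrow> complex)" where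
  "commutator b T f = (\<lambda>x. b x * T f x - T (\<lambda>y. b y * f y) x)"

text \<open>
  As \<open>T\<close> is given on \<open>L2\<close> only, the formula for the commutator makes sense
  for those \<open>f\<close> in \<open>X\<close> for which both \<open>f\<close> and \<open>b f\<close> lie in \<open>L2\<close>.
\<close>

definition commutator_domain ::
  "('a::euclidean_space \<Rightarrow> complex) set \<Rightarrow> ('a \<Rightarrow> complex) \<Rightarrow> ('a \<Rightarrow> complex) set" where
  "commutator_domain X b = {f \<in> X. f \<in> L2 \<and> (\<lambda>x. b x * f x) \<in> L2}"

text \<open>
  The commutator is a compact operator on \<open>X\<close>: it is densely defined in \<open>X\<close> and its
  (by density unique) continuous extension to \<open>X\<close> is compact.
\<close>

definition commutator_compact_on ::
  "('a::euclidean_space \<Rightarrow> complex) set \<Rightarrow> (('a \<Rightarrow> complex) \<Rightarrow> real)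
    \<Rightarrow> ('a \<Rightarrow> complex) \<Rightarrow> (('a \<Rightarrow> complex) \<Rightarrow> ('a \<Rightarrow> complex)) \<Rightarrow> bool" where
  "commutator_compact_on X N b T \<longleftrightarrow>
     norm_topology X N closure_of commutator_domain X b = X \<and>
     (\<exists>S. compact_operator X N S \<and>
        (\<forall>f\<in>commutator_domain X b. AE x in lebesgue. S f x = commutator b T f x))"

end

theory Submission
 imports Defs
begin

text \<open>
 Let \<open>f\<close> be bounded with bounded support. On a cube \<open>Q\<close> with a dilate \<open>hat Q\<close>, the function
 \<open>T (f 1\<^bsub>hat Q\<^esub>)\<close> is at most a constant times the mean of \<open>|f|\<close> over \<open>hat Q\<close>, except
 on disjoint subcubes \<open>P\<close> of total measure at most \<open>|Q| / 2\<close>, and on \<open>P\<close> the same holds after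
 \<open>f 1\<^bsub>hat P\<^esub>\<close> has been removed (\<open>stopping_cubes\<close>; this is the weak type (1,1) of \<open>T\<close> and the
 Dini condition). Applied to \<open>f\<close> and \<open>(b - c) f\<close> with a mean value \<open>c\<close> of \<open>b\<close>, and iterated
 over the subcubes, it gives
 \<open>\<integral> |[b,T]f g| \<le> C \<parallel>b\<parallel> \<integral> (M f M M g + M M f M g)\<close> with the \<open>BMO\<close> norm of \<open>b\<close>
 (\<open>commutator_form_bound\<close>). As \<open>M\<close> is bounded on \<open>X\<close> and on \<open>X'\<close>, the right side is at most
 \<open>C \<parallel>b\<parallel> N f N' g\<close>, and since \<open>X\<close> is its own second associate space (\<open>X_duality\<close>),
 \<open>[b,T]\<close> is bounded on \<open>X\<close> with norm at most \<open>C \<parallel>b\<parallel>\<close> (\<open>commutator_bound\<close>).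

 Hence the commutators with symbol \<open>b\<close> in \<open>CMO\<close> are operator norm limits of commutators with
 a continuous compactly supported symbol \<open>phi\<close>, and total boundedness of the latter is enough
 (\<open>continuous_symbol_net\<close>). Cut space into cells of side \<open>h\<close>. On a cell \<open>c\<close> the part
 \<open>[phi,T](f 1\<^bsub>hat c\<^esub>)\<close> sees only values of \<open>phi\<close> that differ little from each other, so the same
 form bound makes its norm small with \<open>h\<close> (\<open>local_part_bound\<close>). The remaining part is an
 integral against \<open>(phi x - phi y) K x y\<close> over \<open>y\<close> at distance at least \<open>h\<close> from \<open>x\<close>; there the
 kernel is uniformly continuous, so freezing \<open>x\<close> on a much finer grid gives a finite rank
 operator. What is lost near infinity is controlled by \<open>|y|\<^sup>-\<^sup>d\<close> outside a large ball, in \<open>X'\<close> and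
 in \<open>X\<close>. This function is dominated by the maximal function of a bump, and its tails tend to \<open>0\<close>
 in \<open>X'\<close> by \<open>r\<close>-convexity (\<open>assoc_tail\<close>) and in \<open>X\<close> by \<open>s\<close>-concavity (\<open>X_order_continuous\<close>).

 The truncations of an element of \<open>X\<close> converge to it, again by \<open>s\<close>-concavity. So \<open>[b,T]\<close> extends
 from truncated functions to all of \<open>X\<close>, and the extension is compact because \<open>X\<close> is complete.

 Throughout, \<open>LN\<close> and \<open>LI\<close> are the nonnegative and the Bochner integral against Lebesgue measure.
\<close>

abbreviation Lmeas :: "('a::euclidean_space \<Rightarrow> 'b::topological_space) set" where
 "Lmeas \<equiv> borel_measurable lebesgue"

abbreviation vol :: "'a::euclidean_space set \<Rightarrow> ennreal" where
 "vol A \<equiv> emeasure lebesgue A"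

abbreviation enorm :: "'a::real_normed_vector \<Rightarrow> ennreal" where
 "enorm z \<equiv> ennreal (norm z)"

abbreviation ind :: "'a set \<Rightarrow> 'a \<Rightarrow> 'b::zero_neq_one" where
 "ind A x \<equiv> indicator A x"

abbreviation tends :: "(nat \<Rightarrow> 'a::topological_space) \<Rightarrow> 'a \<Rightarrow> bool" (infix "--->" 60) where
 "u ---> L \<equiv> (u \<longlongrightarrow> L) sequentially"

syntax
 "_LN" :: "pttrn \<Rightarrow> ennreal \<Rightarrow> ennreal" ("(3LN _./ _)" [0, 10] 10)
 "_LNset" :: "pttrn \<Rightarrow> 'a set \<Rightarrow> ennreal \<Rightarrow> ennreal" ("(3LN _\<in>_./ _)" [0, 60, 10] 10)
 "_LI" :: "pttrn \<Rightarrow> 'b \<Rightarrow> 'b" ("(3LI _./ _)" [0, 10] 10)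
 "_AEL" :: "pttrn \<Rightarrow> bool \<Rightarrow> bool" ("(3AE _./ _)" [0, 10] 10)
translations
 "LN x. u" => "CONST nn_integral (CONST lebesgue) (\<lambda>x. u)"
 "LN x\<in>A. u" => "CONST nn_integral (CONST lebesgue) (\<lambda>x. u * CONST indicator A x)"
 "LI x. u" => "CONST lebesgue_integral (CONST lebesgue) (\<lambda>x. u)"
 "AE x. P" => "CONST almost_everywhere (CONST lebesgue) (\<lambda>x. P)"

section \<open>Smooth approximation of boxes\<close>

definition flat :: "nat => real => real" where
 "flat m t = (if 0 < t then exp (- 1 / t) / t ^ m else 0)"

lemma flat_nonneg: "0 <= flat m t"
 by (simp add: flat_def)

lemma flat_le_1: "flat 0 t <= 1"
 by (simp add: flat_def)

lemma flat_tendsto_0: "(flat m \<longlongrightarrow> 0) (at 0)"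
proof -
have "((%t. inverse t ^ m / exp (inverse t)) \<longlongrightarrow> 0) (at_right (0::real))"
 using filterlim_compose[OF tendsto_power_div_exp_0 filterlim_inverse_at_top_right] .
moreover have "\<forall>\<^sub>F t in at_right (0::real). inverse t ^ m / exp (inverse t) = flat m t"
 unfolding eventually_at_right_field
 by (rule exI[of _ 1]) (auto simp: flat_def exp_minus field_simps)
ultimately have R: "(flat m \<longlongrightarrow> 0) (at_right 0)"
 by (rule Lim_transform_eventually)
have "\<forall>\<^sub>F t in at_left (0::real). 0 = flat m t"
 unfolding eventually_at_left_field
 by (rule exI[of _ "-1"]) (auto simp: flat_def)
with tendsto_const have L: "(flat m \<longlongrightarrow> 0) (at_left 0)"
 by (rule Lim_transform_eventually)
show ?thesis
 using L R by (simp add: filterlim_at_split)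
qed

lemma flat_has_derivative:
 "(flat m has_real_derivative (flat (m + 2) t - m * flat (m + 1) t)) (at t)"
proof -
consider "t < 0" | "t = 0" | "0 < t" by linarith
then show ?thesis
proof cases
 case 1
 have "((%_. 0) has_real_derivative 0) (at t)" by simp
 then show ?thesis
  by (rule has_field_derivative_transform_within_open[of _ _ _ "{..<0}", THEN DERIV_cong])
   (use 1 in \<open>auto simp: flat_def\<close>)
next
 case 2
 have "((%h. (flat m (0 + h) - flat m 0) / h) \<longlongrightarrow> 0) (at 0)"
  by (rule Lim_transform_eventually[OF flat_tendsto_0[of "Suc m"]])
   (auto simp: flat_def eventually_at_filter)
 then show ?thesis
  using 2 by (simp add: DERIV_def flat_def)
next
 case 3
 have eq: "flat k u = exp (- inverse u) * inverse u ^ k" if "0 < u" for k u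
  using that by (simp add: flat_def divide_inverse power_inverse)
 have "((%t. exp (- inverse t) * inverse t ^ m) has_real_derivative
   exp (- inverse t) * (inverse t ^ 2) * inverse t ^ m
    + exp (- inverse t) * (m * inverse t ^ (m - 1) * (- (inverse t ^ 2)))) (at t)"
  using 3 by (auto intro!: derivative_eq_intros simp: power2_eq_square)
 moreover have "exp (- inverse t) * (inverse t ^ 2) * inverse t ^ m
    + exp (- inverse t) * (m * inverse t ^ (m - 1) * (- (inverse t ^ 2)))
   = flat (m + 2) t - m * flat (m + 1) t"
  using 3 by (cases m) (simp_all add: eq power_add power2_eq_square)
 ultimately have "((%t. exp (- inverse t) * inverse t ^ m) has_real_derivative
   (flat (m + 2) t - m * flat (m + 1) t)) (at t)"
  by simp
 then show ?thesis
  by (rule has_field_derivative_transform_within_open[of _ _ _ "{0<..}"])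
   (use 3 eq in auto)
qed
qed

text \<open>
 Closed under differentiation, so that all members are smooth: the derivative of \<open>flat
 m\<close> is a combination of \<open>flat (m + 2)\<close> and \<open>flat (m + 1)\<close>.
\<close>

inductive_set flat_algebra :: "('a::euclidean_space => complex) set" where
 const: "(%x. c) \<in> flat_algebra"
| flat: "(%x. of_real (flat m (s * (x \<bullet> i) + t))) \<in> flat_algebra"
| add: "f \<in> flat_algebra ==> g \<in> flat_algebra ==> (%x. f x + g x) \<in> flat_algebra"
| mult: "f \<in> flat_algebra ==> g \<in> flat_algebra ==> (%x. f x * g x) \<in> flat_algebra"

lemma flat_algebra_derivative:
 assumes "f \<in> flat_algebra"
 shows "EX f'. (ALL x. (f has_derivative f' x) (at x)) \<and> (ALL h. (%x. f' x h) \<in> flat_algebra)"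
 using assms
proof induction
case (const c)
show ?case
 by (rule exI[of _ "%x h. 0"]) (auto intro: flat_algebra.const)
next
case (flat m s i t)
define f' :: "'a => 'a => complex" where "f' x h = of_real ((flat (m + 2) (s * (x \<bullet> i) + t) - m * flat (m + 1) (s * (x \<bullet> i) + t))
  * (s * (h \<bullet> i)))" for x h
have "((%x. of_real (flat m (s * (x \<bullet> i) + t))) has_derivative f' x) (at x)" for x
proof -
 have 1: "((%x. s * (x \<bullet> i) + t) has_derivative (%h. s * (h \<bullet> i))) (at x)"
  by (auto intro!: derivative_eq_intros)
 have 2: "(flat m has_derivative (%u. (flat (m + 2) (s * (x \<bullet> i) + t) - m * flat (m + 1) (s * (x \<bullet> i) + t)) * u))
   (at (s * (x \<bullet> i) + t))"
  using flat_has_derivative has_field_derivative_def by metis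
 show ?thesis
  using has_derivative_of_real[OF has_derivative_compose[OF 1 2]]
  by (simp add: f'_def[abs_def])
qed
moreover have "(%x. f' x h) \<in> flat_algebra" for h
proof -
 have "(%x. of_real (s * (h \<bullet> i)) * of_real (flat (m + 2) (s * (x \<bullet> i) + t))
   + of_real (- (m * (s * (h \<bullet> i)))) * of_real (flat (m + 1) (s * (x \<bullet> i) + t))) \<in> flat_algebra"
  by (intro flat_algebra.intros)
 then show ?thesis by (simp add: f'_def algebra_simps)
qed
ultimately show ?case by blast
next
case (add f g)
then obtain f' g' where "!!x. (f has_derivative f' x) (at x)" "!!h. (%x. f' x h) \<in> flat_algebra"
 "!!x. (g has_derivative g' x) (at x)" "!!h. (%x. g' x h) \<in> flat_algebra"
 by blast
then show ?case
 by (intro exI[of _ "%x h. f' x h + g' x h"]) (auto intro: flat_algebra.intros derivative_intros)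
next
case (mult f g)
then obtain f' g' where "!!x. (f has_derivative f' x) (at x)" "!!h. (%x. f' x h) \<in> flat_algebra"
 "!!x. (g has_derivative g' x) (at x)" "!!h. (%x. g' x h) \<in> flat_algebra"
 by blast
then show ?case
 using mult.hyps
 by (intro exI[of _ "%x h. f x * g' x h + f' x h * g x"])
  (intro conjI allI has_derivative_mult flat_algebra.add flat_algebra.mult; simp)
qed

lemma flat_algebra_Ck: "f \<in> flat_algebra ==> Ck k f"
proof (induction k arbitrary: f)
case 0
then obtain f' where "!!x. (f has_derivative f' x) (at x)"
 using flat_algebra_derivative by blast
then show ?case
 using has_derivative_continuous_on[where f' = f' and s = UNIV and f = f] by auto
next
case (Suc k)
then obtain f' where f': "!!x. (f has_derivative f' x) (at x)" "!!h. (%x. f' x h) \<in> flat_algebra"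
 using flat_algebra_derivative by blast
have "frechet_derivative f (at x) = f' x" for x
 using frechet_derivative_at f'(1) by metis
then show ?case
 using f' Suc.IH by (auto simp: differentiable_def)
qed

lemma flat_algebra_prod:
 assumes "finite I" "!!i. i \<in> I ==> f i \<in> flat_algebra"
 shows "(%x. \<Prod>i\<in>I. f i x) \<in> flat_algebra"
 using assms by (induction I) (auto intro: flat_algebra.intros)

lemma flat_algebra_power:
 assumes "f \<in> flat_algebra"
 shows "(%x. f x ^ n) \<in> flat_algebra"
 using assms by (induction n) (auto intro: flat_algebra.intros)

text \<open>
 \<open>flat 0 (s (x \<bullet> i - a \<bullet> i))\<close> tends to \<open>1\<close> for \<open>x
 \<bullet> i > a \<bullet> i\<close> as \<open>s\<close> grows; products of such factors
 approximate the open box.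
\<close>

lemma smooth_approximation_box:
 fixes a b :: "'a::euclidean_space"
 obtains phi :: "nat => 'a => complex"
 where "!!n. phi n \<in> Cc_infty" "!!n. supp (phi n) \<subseteq> cbox a b" "!!n x. norm (phi n x) <= 1"
  "!!n x. x ~: box a b ==> phi n x = 0"
  "!!x. (%n. phi n x) ---> ind (box a b) x"
proof
define psi :: "'a => real" where
 "psi x = (\<Prod>i\<in>Basis. flat 0 (x \<bullet> i - a \<bullet> i) * flat 0 (b \<bullet> i - x \<bullet> i))" for x
define phi :: "nat => 'a => complex" where "phi n x = of_real (1 - (1 - psi x) ^ n)" for n x
have psi01: "0 <= psi x" "psi x <= 1" for x
 unfolding psi_def by (auto intro!: prod_nonneg prod_le_1 mult_le_one simp: flat_nonneg flat_le_1)
have psipos: "0 < psi x" if "x \<in> box a b" for x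
 unfolding psi_def using that by (intro prod_pos) (auto simp: flat_def mem_box)
have psi0: "psi x = 0" if "x ~: box a b" for x
 unfolding psi_def using that by (intro prod_zero) (force simp: flat_def mem_box)+
show zero: "phi n x = 0" if "x ~: box a b" for n x
 using psi0[OF that] by (simp add: phi_def)
show sub: "supp (phi n) \<subseteq> cbox a b" for n
 unfolding supp_def using zero box_subset_cbox[of a b]
 by (intro closure_minimal) (auto simp: closed_cbox)
have "of_real \<circ> psi \<in> flat_algebra"
proof -
 have "(%x. \<Prod>i\<in>Basis. complex_of_real (flat 0 (1 * (x \<bullet> i) + (- (a \<bullet> i)))) * of_real (flat 0 ((-1) * (x \<bullet> i) + b \<bullet> i)))
   \<in> flat_algebra"
  by (intro flat_algebra_prod flat_algebra.intros finite_Basis)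
 then show ?thesis by (simp add: psi_def comp_def)
qed
then have "(%x. 1 + (- 1) * (1 + (- 1) * (of_real \<circ> psi) x) ^ n) \<in> flat_algebra" for n
 by (intro flat_algebra.intros flat_algebra_power)
then have "phi n \<in> flat_algebra" for n
 by (simp add: phi_def[abs_def])
moreover have "compact (supp (phi n))" for n
 using sub[of n] by (metis supp_def bounded_cbox bounded_subset closed_closure compact_eq_bounded_closed)
ultimately show "phi n \<in> Cc_infty" for n
 by (simp add: Cc_infty_def flat_algebra_Ck)
show "norm (phi n x) <= 1" for n x
 unfolding phi_def norm_of_real using psi01[of x] by (auto simp: abs_le_iff power_le_one)
show "(%n. phi n x) ---> ind (box a b) x" for x
proof (cases "x \<in> box a b")
 case True
 have "(%n. 1 - (1 - psi x) ^ n) ---> 1 - 0"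
  using psi01[of x] psipos[OF True] by (intro tendsto_intros LIMSEQ_power_zero) auto
 then have "(%n. complex_of_real (1 - (1 - psi x) ^ n)) ---> of_real (1 - 0)"
  by (rule tendsto_of_real)
 then show ?thesis using True by (simp add: phi_def)
next
 case False
 then show ?thesis by (simp add: zero)
qed
qed

section \<open>Half-open cubes and dyadic grids\<close>

definition hcube :: "'a::euclidean_space => real => 'a set" where
 "hcube a l = {x. \<forall>i\<in>Basis. a \<bullet> i <= x \<bullet> i \<and> x \<bullet> i < a \<bullet> i + l}"

lemma hcube_empty [simp]: "l <= 0 ==> hcube a l = {}"
 using SOME_Basis by (fastforce simp: hcube_def)

lemma hcube_imp_pos: "x \<in> hcube a l ==> 0 < l"
 using hcube_empty[of l a] by (cases "0 < l") auto

lemma hcube_borel [measurable]: "hcube a l \<in> sets borel"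
proof -
have "hcube a l = (\<Inter>i\<in>Basis. {x. a \<bullet> i <= x \<bullet> i} \<inter> {x. x \<bullet> i < a \<bullet> i + l})"
 by (auto simp: hcube_def)
also have "... \<in> sets borel"
 by (intro sets.finite_INT) auto
finally show ?thesis .
qed

lemma hcube_lebesgue [measurable]: "hcube a l \<in> sets lebesgue"
 using hcube_borel by (metis sets_completionI_sets sets_lborel)

lemma corner_in_hcube: "0 < l ==> a \<in> hcube a l"
 by (simp add: hcube_def)

lemma box_subset_hcube: "box a (a + l *\<^sub>R One) \<subseteq> hcube a l"
 by (force simp: hcube_def mem_box inner_add_left)

lemma hcube_subset_cbox: "hcube a l \<subseteq> cbox a (a + l *\<^sub>R One)"
 by (force simp: hcube_def mem_box inner_add_left)

lemma bounded_hcube: "bounded (hcube a l)"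
 using hcube_subset_cbox bounded_cbox bounded_subset by blast

lemma cbox_minus_hcube_null: "cbox a (a + l *\<^sub>R One) - hcube a l \<in> null_sets lebesgue"
proof -
have "negligible (cbox a (a + l *\<^sub>R One) - box a (a + l *\<^sub>R One))"
 using negligible_frontier_interval by blast
then have "negligible (cbox a (a + l *\<^sub>R One) - hcube a l)"
 by (rule negligible_subset) (use box_subset_hcube in blast)
then show ?thesis
 by (simp add: negligible_iff_null_sets)
qed

lemma AE_hcube_iff_cbox: "AE x. x \<in> hcube a l \<longleftrightarrow> x \<in> cbox a (a + l *\<^sub>R One)"
 by (rule AE_I'[OF cbox_minus_hcube_null[of a l]]) (use hcube_subset_cbox in auto)

lemma emeasure_cube_cbox:
 fixes a :: "'a::euclidean_space"
 assumes "0 <= l"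
 shows "vol (cbox a (a + l *\<^sub>R One)) = ennreal (l ^ DIM('a))"
proof -
have "emeasure lborel (cbox a (a + l *\<^sub>R One)) = ennreal (\<Prod>i\<in>Basis. (a + l *\<^sub>R One - a) \<bullet> i)"
 using assms by (intro emeasure_lborel_cbox) (auto simp: inner_add_left)
then show ?thesis by simp
qed

lemma emeasure_hcube:
 fixes a :: "'a::euclidean_space"
 assumes "0 <= l"
 shows "vol (hcube a l) = ennreal (l ^ DIM('a))"
proof -
have "vol (hcube a l) = vol (cbox a (a + l *\<^sub>R One))"
 by (rule emeasure_eq_AE) (use AE_hcube_iff_cbox in auto)
then show ?thesis using emeasure_cube_cbox[OF assms, of a] by simp
qed

lemma hcube_subset_iff:
 assumes "0 < r"
 shows "hcube c r \<subseteq> hcube a l \<longleftrightarrow> (\<forall>i\<in>Basis. a \<bullet> i <= c \<bullet> i \<and> c \<bullet> i + r <= a \<bullet> i + l)"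
proof
assume sub: "hcube c r \<subseteq> hcube a l"
show "\<forall>i\<in>Basis. a \<bullet> i <= c \<bullet> i \<and> c \<bullet> i + r <= a \<bullet> i + l"
proof
 fix i :: 'a assume i: "i \<in> Basis"
 have "c \<in> hcube a l" using sub corner_in_hcube[OF assms] by blast
 then have c: "a \<bullet> i <= c \<bullet> i" "c \<bullet> i < a \<bullet> i + l" using i by (auto simp: hcube_def)
 have "c \<bullet> i + r <= a \<bullet> i + l"
 proof (rule ccontr)
  assume n: "\<not> ?thesis"
  define z where "z = c + (a \<bullet> i + l - c \<bullet> i) *\<^sub>R i"
  have "z \<in> hcube c r"
   using i c n assms by (auto simp: z_def hcube_def inner_add_left inner_Basis)
  then have "z \<in> hcube a l" using sub by blast
  then show False using i by (auto simp: z_def hcube_def inner_add_left inner_Basis)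
 qed
 then show "a \<bullet> i <= c \<bullet> i \<and> c \<bullet> i + r <= a \<bullet> i + l" using c by simp
qed
qed (force simp: hcube_def)

lemma hcube_subset_imp_le:
 assumes "0 < r" "hcube c r \<subseteq> hcube a l"
 shows "r <= l"
proof -
obtain i :: 'a where "i \<in> Basis" using nonempty_Basis by blast
then show ?thesis using assms hcube_subset_iff[OF assms(1), of c a l] by force
qed

lemma norm_diff_hcube:
 fixes x y :: "'a::euclidean_space" and r :: real
 assumes "x \<in> hcube c r" "y \<in> hcube c r"
 shows "norm (x - y) <= real DIM('a) * r"
proof -
have "norm (x - y) <= (\<Sum>i\<in>Basis. \<bar>(x - y) \<bullet> i\<bar>)" by (rule norm_le_l1)
also have "... <= (\<Sum>i::'a\<in>Basis. r)"
proof (rule sum_mono)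
 fix i :: 'a assume "i \<in> Basis"
 then have "c \<bullet> i <= x \<bullet> i" "x \<bullet> i < c \<bullet> i + r" "c \<bullet> i <= y \<bullet> i" "y \<bullet> i < c \<bullet> i + r"
  using assms by (auto simp: hcube_def)
 then show "\<bar>(x - y) \<bullet> i\<bar> <= r" by (simp add: inner_diff_left abs_le_iff)
qed
finally show ?thesis by simp
qed

text \<open>
 The lower corner of the cell containing \<open>x\<close> in the grid of side \<open>l\<close>
 based at \<open>a\<close>.
\<close>

definition gridc :: "'a::euclidean_space => real => 'a => 'a" where
 "gridc a l x = a + (\<Sum>i\<in>Basis. (l * of_int \<lfloor>((x - a) \<bullet> i) / l\<rfloor>) *\<^sub>R i)"

lemma gridc_inner:
 "i \<in> Basis ==> gridc a l x \<bullet> i = a \<bullet> i + l * of_int \<lfloor>((x - a) \<bullet> i) / l\<rfloor>"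
 by (simp add: gridc_def inner_add_left inner_sum_left_Basis)

lemma gridc_eq_iff:
 assumes "0 < l"
 shows "gridc a l x = gridc a l y \<longleftrightarrow>
  (\<forall>i\<in>Basis. \<lfloor>((x - a) \<bullet> i) / l\<rfloor> = \<lfloor>((y - a) \<bullet> i) / l\<rfloor>)"
 using assms by (auto simp: euclidean_eq_iff[of "gridc a l x"] gridc_inner)

lemma mem_cell_iff:
 assumes "0 < l"
 shows "y \<in> hcube (gridc a l x) l \<longleftrightarrow> gridc a l y = gridc a l x"
proof -
have "(gridc a l x \<bullet> i <= y \<bullet> i \<and> y \<bullet> i < gridc a l x \<bullet> i + l) \<longleftrightarrow>
  \<lfloor>((y - a) \<bullet> i) / l\<rfloor> = \<lfloor>((x - a) \<bullet> i) / l\<rfloor>" if i: "i \<in> Basis" for i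
proof -
 have "\<lfloor>((y - a) \<bullet> i) / l\<rfloor> = k \<longleftrightarrow> a \<bullet> i + l * of_int k <= y \<bullet> i \<and> y \<bullet> i < a \<bullet> i + l * of_int k + l" for k
  using assms by (auto simp: floor_eq_iff field_simps inner_diff_left)
 then show ?thesis using i by (simp add: gridc_inner)
qed
then show ?thesis
 unfolding gridc_eq_iff[OF assms] hcube_def by simp
qed

lemma mem_own_cell: "0 < l ==> x \<in> hcube (gridc a l x) l"
 by (simp add: mem_cell_iff)

lemma gridc_root:
 assumes "x \<in> hcube a l"
 shows "gridc a l x = a"
proof -
have "0 < l" using assms by (rule hcube_imp_pos)
have "gridc a l a = a" by (simp add: gridc_def)
then show ?thesis using mem_cell_iff[OF \<open>0 < l\<close>, of x a a] assms by simp
qed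

lemma gridc_double:
 assumes "0 < l" "gridc a (l / 2) x = gridc a (l / 2) y"
 shows "gridc a l x = gridc a l y"
proof -
have *: "\<lfloor>t / l\<rfloor> = \<lfloor>t / (l / 2)\<rfloor> div 2" for t
 using floor_divide_real_eq_div[of 2 "t / (l / 2)"] by (simp add: field_simps)
have "\<forall>i\<in>Basis. \<lfloor>((x - a) \<bullet> i) / (l / 2)\<rfloor> = \<lfloor>((y - a) \<bullet> i) / (l / 2)\<rfloor>"
 using assms gridc_eq_iff[of "l / 2" a x y] by simp
then show ?thesis
 unfolding gridc_eq_iff[OF assms(1)] * by (intro ballI) (drule bspec, assumption, simp only:)
qed

lemma gridc_coarser:
 assumes "0 < l" "m <= n" "gridc a (l / 2 ^ n) x = gridc a (l / 2 ^ n) y"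
 shows "gridc a (l / 2 ^ m) x = gridc a (l / 2 ^ m) y"
 using assms(2,3)
proof (induction n rule: dec_induct)
case (step n)
have "gridc a (l / 2 ^ n / 2) x = gridc a (l / 2 ^ n / 2) y"
 using step.prems by (simp add: mult.commute)
then have "gridc a (l / 2 ^ n) x = gridc a (l / 2 ^ n) y"
 using assms(1) gridc_double[of "l / 2 ^ n" a x y] by simp
then show ?case by (rule step.IH)
qed auto

lemma countable_range_gridc:
 fixes a :: "'a::euclidean_space"
 assumes "0 < l"
 shows "countable (range (gridc a l))"
proof -
obtain D :: "'a set" where D: "countable D" "!!X. open X ==> X ~= {} ==> \<exists>d\<in>D. d \<in> X"
 by (metis countable_dense_setE)
have "range (gridc a l) \<subseteq> gridc a l ` D"
proof
 fix c assume "c \<in> range (gridc a l)"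
 then obtain x where c: "c = gridc a l x" by blast
 have "box c (c + l *\<^sub>R One) ~= {}"
  using assms by (simp add: box_ne_empty inner_add_left)
 then obtain d where "d \<in> D" "d \<in> box c (c + l *\<^sub>R One)"
  using D(2) open_box by blast
 then have "d \<in> hcube c l" using box_subset_hcube by blast
 then have "gridc a l d = c" using c mem_cell_iff[OF assms, of d a x] by simp
 then show "c \<in> gridc a l ` D" using \<open>d \<in> D\<close> by blast
qed
then show ?thesis using D(1) countable_subset by blast
qed

lemma cell_subset_root:
 assumes "x \<in> hcube a l"
 shows "hcube (gridc a (l / 2 ^ n) x) (l / 2 ^ n) \<subseteq> hcube a l"
proof
have l: "0 < l" using assms by (rule hcube_imp_pos)
fix y assume "y \<in> hcube (gridc a (l / 2 ^ n) x) (l / 2 ^ n)"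
then have "gridc a (l / 2 ^ n) y = gridc a (l / 2 ^ n) x"
 using l by (simp add: mem_cell_iff)
then have "gridc a (l / 2 ^ 0) y = gridc a (l / 2 ^ 0) x"
 by (rule gridc_coarser[OF l le0])
then show "y \<in> hcube a l"
 using gridc_root[OF assms] mem_cell_iff[OF l, of y a x] by simp
qed

abbreviation UQ :: "(nat \<Rightarrow> 'a::euclidean_space) \<Rightarrow> (nat \<Rightarrow> real) \<Rightarrow> 'a set" where
 "UQ c r \<equiv> (\<Union>k. hcube (c k) (r k))"

text \<open>
 Empty members, those with \<open>r k = 0\<close>, are permitted; this indexes finite and infinite
 families alike by \<open>nat\<close>.
\<close>

definition packing :: "(nat => 'a::euclidean_space) => (nat => real) => 'a => real => bool" where
 "packing c r a l \<longleftrightarrow> (ALL k. 0 <= r k) \<and> disjoint_family (%k. hcube (c k) (r k)) \<and>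
   (ALL k. hcube (c k) (r k) \<subseteq> hcube a l)"

text \<open>
 The maximal dyadic subcubes of a cube that are bad: \<open>bad n x\<close> refers to the cell of
 generation \<open>n\<close> containing \<open>x\<close>, and the first bad generation is taken.
\<close>

lemma dyadic_selection:
 fixes a :: "'a::euclidean_space"
 assumes l: "0 < l"
  and cong: "!!n x y. gridc a (l / 2 ^ n) x = gridc a (l / 2 ^ n) y ==> bad n x = bad n y"
 obtains c r where "packing c r a l"
  "(UQ c r) = {x \<in> hcube a l. EX n. bad n x}"
  "!!k. 0 < r k ==> EX n x. x \<in> hcube a l \<and> bad n x \<and> (\<forall>m<n. \<not> bad m x) \<and>
    c k = gridc a (l / 2 ^ n) x \<and> r k = l / 2 ^ n"
proof -
define first where "first n x \<longleftrightarrow> x \<in> hcube a l \<and> bad n x \<and> (\<forall>m<n. \<not> bad m x)" for n x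
define S where "S = {(gridc a (l / 2 ^ n) x, l / 2 ^ n) | n x. first n x}"
have "S \<subseteq> (\<Union>n. (%c. (c, l / 2 ^ n)) ` range (gridc a (l / 2 ^ n)))"
 by (auto simp: S_def)
moreover have "countable (\<Union>n. (%c. (c, l / 2 ^ n)) ` range (gridc a (l / 2 ^ n)))"
 using l by (intro countable_UN countable_image countable_range_gridc) auto
ultimately have cS: "countable S" using countable_subset by blast
define J where "J = to_nat_on S ` S"
define c where "c k = fst (from_nat_into S k)" for k
define r where "r k = (if k \<in> J then snd (from_nat_into S k) else 0)" for k
have J: "k \<in> J ==> from_nat_into S k \<in> S" for k
 unfolding J_def using cS by auto
have rep: "EX n x. first n x \<and> c k = gridc a (l / 2 ^ n) x \<and> r k = l / 2 ^ n" if "k \<in> J" for k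
proof -
 obtain n x where "from_nat_into S k = (gridc a (l / 2 ^ n) x, l / 2 ^ n)" "first n x"
  using J[OF \<open>k \<in> J\<close>] unfolding S_def by blast
 then show ?thesis using that by (intro exI[of _ n] exI[of _ x]) (simp add: c_def r_def)
qed
have r0: "0 <= r k" for k
 using rep[of k] l by (cases "k \<in> J") (auto simp: r_def)
have rJ: "0 < r k ==> k \<in> J" for k by (auto simp: r_def split: if_splits)
have uniq: "m = n \<and> gridc a (l / 2 ^ n) x = gridc a (l / 2 ^ n) z"
 if "first n x" "gridc a (l / 2 ^ n) z = gridc a (l / 2 ^ n) x" "first m z" for m n x z
proof -
 have "bad k z = bad k x" if "k <= n" for k
  using gridc_coarser[OF l that \<open>gridc a (l / 2 ^ n) z = _\<close>] cong by blast
 then have "bad n z" "\<forall>k<n. \<not> bad k z" using that(1) by (auto simp: first_def)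
 then have "m = n" using that(3) unfolding first_def by (metis linorder_neqE_nat)
 then show ?thesis using that by simp
qed
have fz: "EX m. first m z" if "first n x" "gridc a (l / 2 ^ n) z = gridc a (l / 2 ^ n) x" for n x z
proof -
 have "bad n z" using that cong unfolding first_def by metis
 moreover have "z \<in> hcube a l"
  using that l cell_subset_root[of x a l n] mem_cell_iff[of "l / 2 ^ n" z a x] by (auto simp: first_def)
 ultimately show ?thesis
  unfolding first_def using exists_least_iff[of "%m. bad m z"] by blast
qed
have "disjoint_family (%k. hcube (c k) (r k))"
 unfolding disjoint_family_on_def
proof (intro ballI impI)
 fix j k :: nat assume "j ~= k"
 show "hcube (c j) (r j) \<inter> hcube (c k) (r k) = {}"
 proof (rule ccontr)
  assume "\<not> ?thesis"
  then obtain z where z: "z \<in> hcube (c j) (r j)" "z \<in> hcube (c k) (r k)" by blast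
  then have pos: "0 < r j" "0 < r k" by (auto intro: hcube_imp_pos)
  obtain n x where j: "first n x" "c j = gridc a (l / 2 ^ n) x" "r j = l / 2 ^ n"
   using rep rJ pos by blast
  obtain n' x' where k: "first n' x'" "c k = gridc a (l / 2 ^ n') x'" "r k = l / 2 ^ n'"
   using rep rJ pos by blast
  have zj: "gridc a (l / 2 ^ n) z = gridc a (l / 2 ^ n) x"
   using z(1) j l mem_cell_iff[of "l / 2 ^ n" z a x] by simp
  have zk: "gridc a (l / 2 ^ n') z = gridc a (l / 2 ^ n') x'"
   using z(2) k l mem_cell_iff[of "l / 2 ^ n'" z a x'] by simp
  obtain m where m: "first m z" using fz[OF j(1) zj] by blast
  have "n = n'" using uniq[OF j(1) zj m] uniq[OF k(1) zk m] by simp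
  then have "c j = c k" "r j = r k" using j k zj zk by simp_all
  moreover have J': "j \<in> J" "k \<in> J" using rJ pos by auto
  ultimately have "fst (from_nat_into S j) = fst (from_nat_into S k)"
   and "snd (from_nat_into S j) = snd (from_nat_into S k)"
   unfolding c_def r_def by simp_all
  then have "from_nat_into S j = from_nat_into S k" by (rule prod_eqI)
  moreover note J'
  ultimately have "j = k"
   unfolding J_def using cS by (metis (no_types, lifting) from_nat_into_to_nat_on imageE)
  then show False using \<open>j ~= k\<close> by simp
 qed
qed
moreover have "hcube (c k) (r k) \<subseteq> hcube a l" for k
proof (cases "k \<in> J")
 case True
 then obtain n x where nx: "first n x" "c k = gridc a (l / 2 ^ n) x" "r k = l / 2 ^ n"
  using rep by blast
 then have "x \<in> hcube a l" by (simp add: first_def)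
 then show ?thesis unfolding nx(2,3) by (rule cell_subset_root)
qed (simp add: r_def)
ultimately have "packing c r a l" using r0 by (simp add: packing_def)
moreover have "(UQ c r) = {x \<in> hcube a l. EX n. bad n x}"
proof (intro equalityI subsetI)
 fix z assume "z \<in> (UQ c r)"
 then obtain k where z: "z \<in> hcube (c k) (r k)" by blast
 then have "0 < r k" by (rule hcube_imp_pos)
 then obtain n x where k: "first n x" "c k = gridc a (l / 2 ^ n) x" "r k = l / 2 ^ n"
  using rep rJ by blast
 have "gridc a (l / 2 ^ n) z = gridc a (l / 2 ^ n) x"
  using z k l mem_cell_iff[of "l / 2 ^ n" z a x] by simp
 then show "z \<in> {x \<in> hcube a l. EX n. bad n x}"
  using fz[OF k(1)] unfolding first_def by blast
next
 fix z assume z: "z \<in> {x \<in> hcube a l. EX n. bad n x}"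
 then obtain n where n: "first n z"
  unfolding first_def using exists_least_iff[of "%m. bad m z"] by blast
 define p where "p = (gridc a (l / 2 ^ n) z, l / 2 ^ n)"
 have p: "p \<in> S" using n unfolding S_def p_def by blast
 define k where "k = to_nat_on S p"
 have "k \<in> J" "from_nat_into S k = p"
  using p cS unfolding J_def k_def by (blast, simp)
 then have "c k = gridc a (l / 2 ^ n) z" "r k = l / 2 ^ n"
  by (simp_all add: c_def r_def p_def)
 then have "z \<in> hcube (c k) (r k)"
  using l mem_own_cell[of "l / 2 ^ n" z a] by simp
 then show "z \<in> (UQ c r)" by blast
qed
moreover have "EX n x. x \<in> hcube a l \<and> bad n x \<and> (\<forall>m<n. \<not> bad m x) \<and>
   c k = gridc a (l / 2 ^ n) x \<and> r k = l / 2 ^ n" if "0 < r k" for k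
 using rep[OF rJ[OF that]] unfolding first_def by blast
ultimately show thesis using that by blast
qed

section \<open>Selection of cubes and iteration\<close>

lemma emeasure_lborel_hcube [simp]:
 fixes a :: "'a::euclidean_space"
 assumes "0 <= l"
 shows "emeasure lborel (hcube a l) = ennreal (l ^ DIM('a))"
 using emeasure_hcube[OF assms, of a] by simp

lemma nn_integral_UN_mono:
 fixes u v :: "'a::euclidean_space => ennreal"
 assumes [measurable]: "u \<in> Lmeas" "v \<in> Lmeas"
  and B: "!!n::nat. B n \<in> sets lebesgue" "disjoint_family B"
  and le: "!!n. (LN x\<in>B n. u x) <= (LN x\<in>B n. v x)"
 shows "(LN x\<in>(\<Union>n. B n). u x) <= (LN x\<in>(\<Union>n. B n). v x)"
 using nn_integral_disjoint_family[OF assms(1) B] nn_integral_disjoint_family[OF assms(2) B]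
  suminf_le[OF le summableI summableI]
 by simp

lemma packing_sets [measurable]: "(\<Union>k::nat. hcube (c k) (r k)) \<in> sets lebesgue"
 by (intro sets.countable_UN) auto

lemma nn_integral_const_hcube:
 fixes a :: "'a::euclidean_space"
 assumes "0 <= l" "0 <= mu"
 shows "(LN x\<in>hcube a l. ennreal mu) = ennreal (mu * l ^ DIM('a))"
 using assms by (simp add: nn_integral_cmult_indicator emeasure_hcube ennreal_mult)

text \<open>
 The stopping condition is that the mean of \<open>h\<close> exceeds \<open>mu\<close>. A selected
 cube has a parent with mean at most \<open>mu\<close>, which gives the factor
 \<open>2\<^sup>d\<close>; off the selected cubes all dyadic means are at most \<open>mu\<close>.
\<close>

lemma calderon_zygmund_cubes:
 fixes a :: "'a::euclidean_space" and h :: "'a => ennreal"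
 assumes h[measurable]: "h \<in> Lmeas" and l: "0 < l" and lam: "0 < mu"
  and avg: "(LN x\<in>hcube a l. h x) <= ennreal (mu * l ^ DIM('a))"
 obtains c r where "packing c r a l"
  "!!k. 0 < r k ==> ennreal (mu * r k ^ DIM('a)) <= (LN x\<in>hcube (c k) (r k). h x)"
  "!!k. 0 < r k ==> (LN x\<in>hcube (c k) (r k). h x) <= ennreal (2 ^ DIM('a) * mu * r k ^ DIM('a))"
  "ennreal mu * vol (UQ c r) <= (LN x\<in>hcube a l. h x)"
  "AE x. x \<in> hcube a l - (UQ c r) --> h x <= ennreal mu"
proof -
define cell where "cell n x = hcube (gridc a (l / 2 ^ n) x) (l / 2 ^ n)" for n x
define bad where "bad n x \<longleftrightarrow> ennreal (mu * (l / 2 ^ n) ^ DIM('a)) < (LN y\<in>cell n x. h y)" for n x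
have cong: "bad n x = bad n y" if "gridc a (l / 2 ^ n) x = gridc a (l / 2 ^ n) y" for n x y
 using that by (simp add: bad_def cell_def)
obtain c r where cr: "packing c r a l"
 "(UQ c r) = {x \<in> hcube a l. EX n. bad n x}"
 "!!k. 0 < r k ==> EX n x. x \<in> hcube a l \<and> bad n x \<and> (\<forall>m<n. \<not> bad m x) \<and>
   c k = gridc a (l / 2 ^ n) x \<and> r k = l / 2 ^ n"
 by (rule dyadic_selection[of l a bad, OF l cong]) (assumption, rule that)
have r0: "0 <= r k" for k using cr(1) by (simp add: packing_def)
have disj: "disjoint_family (%k. hcube (c k) (r k))" using cr(1) by (simp add: packing_def)
have low: "ennreal (mu * r k ^ DIM('a)) <= (LN x\<in>hcube (c k) (r k). h x)" if "0 < r k" for k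
 using cr(3)[OF that] by (auto simp: bad_def cell_def intro: less_imp_le)
have up: "(LN x\<in>hcube (c k) (r k). h x) <= ennreal (2 ^ DIM('a) * mu * r k ^ DIM('a))" if "0 < r k" for k
proof -
 obtain n x where nx: "x \<in> hcube a l" "bad n x" "\<forall>m<n. \<not> bad m x"
  "c k = gridc a (l / 2 ^ n) x" "r k = l / 2 ^ n"
  using cr(3)[OF \<open>0 < r k\<close>] by blast
 have "\<not> bad 0 x"
  using avg gridc_root[OF nx(1)] by (simp add: bad_def cell_def not_less)
 then obtain m where n: "n = Suc m" using nx(2) by (cases n) auto
 have "cell n x \<subseteq> cell m x"
 proof
  fix y assume "y \<in> cell n x"
  then have "gridc a (l / 2 ^ n) y = gridc a (l / 2 ^ n) x"
   using l by (simp add: cell_def mem_cell_iff)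
  then have "gridc a (l / 2 ^ m) y = gridc a (l / 2 ^ m) x"
   using gridc_coarser[OF l, of m n a y x] n by simp
  then show "y \<in> cell m x" using l by (simp add: cell_def mem_cell_iff)
 qed
 then have "(LN y\<in>cell n x. h y) <= (LN y\<in>cell m x. h y)"
  by (intro nn_integral_mono) (auto split: split_indicator)
 also have "... <= ennreal (mu * (l / 2 ^ m) ^ DIM('a))"
  using nx(3) n by (auto simp: bad_def not_less)
 also have "(l / 2 ^ m) ^ DIM('a) = 2 ^ DIM('a) * r k ^ DIM('a)"
  by (simp add: nx(5) n power_divide power_mult_distrib)
 finally show ?thesis by (simp add: nx(4,5) cell_def mult_ac)
qed
have meas: "ennreal mu * vol (UQ c r) <= (LN x\<in>hcube a l. h x)"
proof -
 have "ennreal mu * vol (UQ c r) =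
   (LN x\<in>(UQ c r). ennreal mu)"
  by (rule nn_integral_cmult_indicator[symmetric]) measurable
 also have "... <= (LN x\<in>(UQ c r). h x)"
 proof (rule nn_integral_UN_mono)
  fix k
  show "(LN x\<in>hcube (c k) (r k). ennreal mu) <= (LN x\<in>hcube (c k) (r k). h x)"
   using low[of k] r0[of k] lam by (cases "r k = 0") (auto simp: nn_integral_const_hcube)
 qed (use disj in auto)
 also have "... <= (LN x\<in>hcube a l. h x)"
  using cr(2) by (intro nn_integral_mono) (auto split: split_indicator)
 finally show ?thesis .
qed
define G where "G = hcube a l - (UQ c r)"
have [measurable]: "G \<in> sets lebesgue" unfolding G_def by measurable
have nbad: "\<not> bad n x" if "x \<in> G" for n x using that cr(2) by (auto simp: G_def)
have null: "AE x. x \<in> G --> h x < ennreal (mu + e)" if e: "0 < e" for e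
proof -
 define A where "A = {x \<in> G. ennreal (mu + e) <= h x}"
 have "A = G \<inter> {x \<in> space lebesgue. ennreal (mu + e) <= h x}" by (auto simp: A_def)
 also have "... \<in> sets lebesgue" by measurable
 finally have A[measurable]: "A \<in> sets lebesgue" .
 have AG: "A \<subseteq> G" "A \<subseteq> hcube a l" by (auto simp: A_def G_def)
 then have "vol A <= vol (hcube a l)" by (intro emeasure_mono) auto
 then have fin: "vol A ~= \<infinity>" using l emeasure_hcube[of l a] by (auto simp: top_unique)
 define alpha where "alpha = measure lebesgue A"
 have alpha: "vol A = ennreal alpha" "0 <= alpha"
  using fin by (auto simp: alpha_def emeasure_eq_ennreal_measure)
 have key: "(mu + e) * alpha <= mu * (alpha + eta)" if eta: "0 < eta" for eta
 proof -
  obtain U where U: "open U" "A \<subseteq> U" "U - A \<in> lmeasurable" "vol (U - A) < ennreal eta"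
   using sets_lebesgue_outer_open[OF A eta] by blast
  have Um[measurable]: "U \<in> sets lebesgue" using U(1) by auto
  have "vol U = vol A + vol (U - A)"
   using plus_emeasure[of A lebesgue "U - A"] U(2) by (simp add: Un_absorb1)
  also have "... <= ennreal (alpha + eta)"
   using U(4) alpha eta by (simp add: add_left_mono less_imp_le)
  finally have mU: "vol U <= ennreal (alpha + eta)" .
  define bd where "bd n x \<longleftrightarrow> cell n x \<subseteq> U \<and> (\<exists>z\<in>A. gridc a (l / 2 ^ n) z = gridc a (l / 2 ^ n) x)" for n x
  have congb: "bd n x = bd n y" if "gridc a (l / 2 ^ n) x = gridc a (l / 2 ^ n) y" for n x y
   using that by (simp add: bd_def cell_def)
  obtain c' r' where cr': "packing c' r' a l"
   "(\<Union>k. hcube (c' k) (r' k)) = {x \<in> hcube a l. EX n. bd n x}"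
   "!!k. 0 < r' k ==> EX n x. x \<in> hcube a l \<and> bd n x \<and> (\<forall>m<n. \<not> bd m x) \<and>
     c' k = gridc a (l / 2 ^ n) x \<and> r' k = l / 2 ^ n"
   by (rule dyadic_selection[of l a bd, OF l congb]) (assumption, rule that)
  have sub: "A \<subseteq> (\<Union>k. hcube (c' k) (r' k))"
  proof
   fix x assume x: "x \<in> A"
   obtain eps where eps: "0 < eps" "ball x eps \<subseteq> U" using U(1,2) x openE by blast
   obtain n where n: "real DIM('a) * l / eps < 2 ^ n"
    using real_arch_pow[of 2] by auto
   have "cell n x \<subseteq> ball x eps"
   proof
    fix y assume y: "y \<in> cell n x"
    have "norm (x - y) <= real DIM('a) * (l / 2 ^ n)"
     using y mem_own_cell[of "l / 2 ^ n" x a] l by (intro norm_diff_hcube) (auto simp: cell_def)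
    also have "... < eps" using n eps(1) by (simp add: field_simps)
    finally show "y \<in> ball x eps" by (simp add: dist_norm)
   qed
   then have "bd n x" using eps(2) x by (auto simp: bd_def)
   then show "x \<in> (\<Union>k. hcube (c' k) (r' k))" using x AG unfolding cr'(2) by blast
  qed
  have subU: "(\<Union>k. hcube (c' k) (r' k)) \<subseteq> U"
  proof
   fix x assume "x \<in> (\<Union>k. hcube (c' k) (r' k))"
   then obtain n where "cell n x \<subseteq> U" unfolding cr'(2) bd_def by blast
   moreover have "x \<in> cell n x" using l mem_own_cell[of "l / 2 ^ n" x a] by (simp add: cell_def)
   ultimately show "x \<in> U" by blast
  qed
  have "ennreal ((mu + e) * alpha) = (LN x\<in>A. ennreal (mu + e))"
   using alpha lam e by (simp add: nn_integral_cmult_indicator ennreal_mult)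
  also have "... <= (LN x\<in>(\<Union>k. hcube (c' k) (r' k)). h x)"
   using sub by (intro nn_integral_mono) (auto split: split_indicator simp: A_def)
  also have "... <= (LN x\<in>(\<Union>k. hcube (c' k) (r' k)). ennreal mu)"
  proof (rule nn_integral_UN_mono)
   show "disjoint_family (%k. hcube (c' k) (r' k))" using cr'(1) by (simp add: packing_def)
   fix k
   show "(LN x\<in>hcube (c' k) (r' k). h x) <= (LN x\<in>hcube (c' k) (r' k). ennreal mu)"
   proof (cases "0 < r' k")
    case True
    then obtain n x z where nx: "z \<in> A" "gridc a (l / 2 ^ n) z = gridc a (l / 2 ^ n) x"
     "c' k = gridc a (l / 2 ^ n) x" "r' k = l / 2 ^ n"
     using cr'(3)[OF True] unfolding bd_def by blast
    have "\<not> bad n z" using nbad AG(1) nx(1) by blast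
    then have "(LN x\<in>hcube (c' k) (r' k). h x) <= ennreal (mu * r' k ^ DIM('a))"
     using nx by (simp add: bad_def cell_def not_less)
    then show ?thesis using True lam by (simp add: nn_integral_const_hcube)
   qed auto
  qed auto
  also have "... = ennreal mu * vol (\<Union>k. hcube (c' k) (r' k))"
   by (rule nn_integral_cmult_indicator) measurable
  also have "... <= ennreal mu * ennreal (alpha + eta)"
   by (rule mult_left_mono[OF order_trans[OF emeasure_mono[OF subU Um] mU]]) simp
  also have "... = ennreal (mu * (alpha + eta))" using lam by (simp add: ennreal_mult')
  finally show ?thesis using lam alpha eta by (subst (asm) ennreal_le_iff) auto
 qed
 have "alpha = 0"
 proof (rule ccontr)
  assume "alpha ~= 0"
  then have "0 < e * alpha / (2 * mu)" using alpha(2) e lam by simp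
  from key[OF this] have "(mu + e) * alpha <= mu * (alpha + e * alpha / (2 * mu))" .
  also have "... = mu * alpha + e * alpha / 2"
   using lam by (simp add: field_simps)
  finally have "(mu + e) * alpha <= mu * alpha + e * alpha / 2" .
  then have "e * alpha <= e * alpha / 2" by (simp add: algebra_simps)
  then show False using \<open>alpha ~= 0\<close> alpha(2) e by simp
 qed
 then have "A \<in> null_sets lebesgue" using alpha by (auto simp: null_sets_def)
 then show ?thesis by (rule AE_I') (auto simp: A_def not_less)
qed
have "AE x. \<forall>j::nat. x \<in> G --> h x < ennreal (mu + 1 / Suc j)"
 unfolding AE_all_countable using null by simp
then have "AE x. x \<in> G --> h x <= ennreal mu"
proof (rule AE_mp, intro AE_I2 impI)
 fix x assume x: "\<forall>j::nat. x \<in> G --> h x < ennreal (mu + 1 / Suc j)" "x \<in> G"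
 show "h x <= ennreal mu"
 proof (rule ennreal_le_epsilon)
  fix e :: real assume "0 < e"
  then obtain j where j: "1 / real (Suc j) < e" using nat_approx_posE by blast
  have "h x < ennreal (mu + 1 / Suc j)" using x by blast
  also have "... <= ennreal (mu + e)" using j by (intro ennreal_leI) auto
  also have "... = ennreal mu + ennreal e" using lam \<open>0 < e\<close> by simp
  finally show "h x <= ennreal mu + ennreal e" by simp
 qed
qed
then show thesis using that[OF cr(1) low up meas] by (simp add: G_def)
qed

text \<open>
 Repeating the step \<open>n\<close> times leaves an error supported on cubes of total measure
 \<open>2\<^sup>-\<^sup>n l\<^sup>d\<close>, where the crude bound \<open>base\<close> suffices.
\<close>

lemma cube_iteration:
 fixes I :: "'a::euclidean_space => real => ennreal"
 assumes W[measurable]: "W \<in> Lmeas" and C: "0 <= C"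
  and base: "!!a l. 0 < l ==> I a l <= ennreal (C * l ^ DIM('a))"
  and step: "!!a l. 0 < l ==> EX c r. packing c r a l \<and>
    vol (UQ c r) <= ennreal (l ^ DIM('a) / 2) \<and>
    I a l <= (LN x\<in>hcube a l - (UQ c r). W x)
     + (\<Sum>k. if 0 < r k then I (c k) (r k) else 0)"
  and l: "0 < l"
 shows "I a l <= (LN x\<in>hcube a l. W x)"
proof -
have claim: "I a l <= (LN x\<in>hcube a l. W x) + ennreal (C * (1/2) ^ n * l ^ DIM('a))"
 if "0 < l" for n a l
 using that
proof (induction n arbitrary: a l)
 case 0
 then show ?case using base[OF 0] by (simp add: add_increasing)
next
 case (Suc n)
 obtain c r where cr: "packing c r a l"
  "vol (UQ c r) <= ennreal (l ^ DIM('a) / 2)"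
  "I a l <= (LN x\<in>hcube a l - (UQ c r). W x)
    + (\<Sum>k. if 0 < r k then I (c k) (r k) else 0)"
  using step[OF Suc.prems] by blast
 let ?P = "%k. hcube (c k) (r k)" and ?D = "C * (1/2) ^ n"
 have P: "!!k. 0 <= r k" "disjoint_family ?P" "(\<Union>k. ?P k) \<subseteq> hcube a l"
  using cr(1) by (auto simp: packing_def)
 have D: "0 <= ?D" using C by simp
 have e1: "(\<Sum>k. LN x\<in>?P k. W x) = (LN x\<in>(\<Union>k. ?P k). W x)"
  by (rule nn_integral_disjoint_family[symmetric]) (use P(2) in auto)
 have e2: "(\<Sum>k. vol (?P k)) = vol (\<Union>k. ?P k)"
  by (rule suminf_emeasure) (use P(2) in auto)
 have "(if 0 < r k then I (c k) (r k) else 0) <=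
   (LN x\<in>?P k. W x) + ennreal ?D * vol (?P k)" for k
  using Suc.IH[of "r k" "c k"] P(1)[of k] D by (simp add: emeasure_hcube ennreal_mult)
 then have "(\<Sum>k. if 0 < r k then I (c k) (r k) else 0) <=
   (\<Sum>k. (LN x\<in>?P k. W x) + ennreal ?D * vol (?P k))"
  by (intro suminf_le summableI)
 also have "... = (\<Sum>k. LN x\<in>?P k. W x) + (\<Sum>k. ennreal ?D * vol (?P k))"
  by (intro suminf_add[symmetric] summableI)
 also have "... = (LN x\<in>(\<Union>k. ?P k). W x) + ennreal ?D * vol (\<Union>k. ?P k)"
  by (simp only: ennreal_suminf_cmult e1 e2)
 also have "... <= (LN x\<in>(\<Union>k. ?P k). W x) + ennreal ?D * ennreal (l ^ DIM('a) / 2)"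
  using cr(2) by (intro add_left_mono mult_left_mono) auto
 also have "ennreal ?D * ennreal (l ^ DIM('a) / 2) = ennreal (C * (1/2) ^ Suc n * l ^ DIM('a))"
  using D Suc.prems by (subst ennreal_mult[symmetric]) auto
 finally have "I a l <= (LN x\<in>hcube a l - (\<Union>k. ?P k). W x) +
   ((LN x\<in>(\<Union>k. ?P k). W x) + ennreal (C * (1/2) ^ Suc n * l ^ DIM('a)))"
  using cr(3) by (meson add_left_mono order_trans)
 also have "... = (LN x\<in>(hcube a l - (\<Union>k. ?P k)) \<union> (\<Union>k. ?P k). W x)
   + ennreal (C * (1/2) ^ Suc n * l ^ DIM('a))"
  by (subst nn_integral_disjoint_pair) (auto simp: add.assoc)
 also have "(hcube a l - (\<Union>k. ?P k)) \<union> (\<Union>k. ?P k) = hcube a l" using P(3) by blast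
 finally show ?case .
qed
show ?thesis
proof (rule ennreal_le_epsilon)
 fix e :: real assume e: "0 < e"
 have "(%n. C * (1/2) ^ n * l ^ DIM('a)) ---> C * 0 * l ^ DIM('a)"
  by (intro tendsto_intros LIMSEQ_power_zero) auto
 then have "\<forall>\<^sub>F n in sequentially. C * (1/2) ^ n * l ^ DIM('a) < e"
  using e by (intro order_tendstoD) auto
 then obtain n where "C * (1/2) ^ n * l ^ DIM('a) < e"
  by (meson eventually_sequentially order_refl)
 then have "ennreal (C * (1/2) ^ n * l ^ DIM('a)) <= ennreal e" by (intro ennreal_leI) simp
 then show "I a l <= (LN x\<in>hcube a l. W x) + ennreal e"
  using claim[OF l, of a n] by (meson add_left_mono order_trans)
qed
qed

section \<open>The maximal function\<close>

abbreviation mass :: "('a::euclidean_space => complex) => 'a set => ennreal" where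
 "mass f A \<equiv> (LN x\<in>A. enorm (f x))"

lemma mass_mono: "A \<subseteq> B ==> mass f A <= mass f B"
 by (intro nn_integral_mono) (auto split: split_indicator)

lemma nn_integral_hcube_eq_cbox:
 "(LN x\<in>hcube a l. f x) = (LN x\<in>cbox a (a + l *\<^sub>R One). f x)"
 by (rule nn_integral_cong_AE, rule AE_mp[OF AE_hcube_iff_cbox[of a l]])
  (auto split: split_indicator)

lemma maximal_ge_cbox:
 fixes a :: "'a::euclidean_space"
 assumes "x \<in> cbox a (a + l *\<^sub>R One)" "0 < l"
 shows "mass f (cbox a (a + l *\<^sub>R One)) <= ennreal (l ^ DIM('a)) * maximal f x"
proof -
let ?Q = "cbox a (a + l *\<^sub>R One)"
have "?Q \<in> cubes" using assms(2) by (auto simp: cubes_def)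
then have "mass f ?Q / vol ?Q * ind ?Q x <= maximal f x"
 unfolding maximal_def by (rule SUP_upper)
then have "mass f ?Q / ennreal (l ^ DIM('a)) <= maximal f x"
 using assms emeasure_cube_cbox[of l a] by simp
then have "ennreal (l ^ DIM('a)) * (mass f ?Q / ennreal (l ^ DIM('a))) <= ennreal (l ^ DIM('a)) * maximal f x"
 by (rule mult_left_mono) simp
moreover have "ennreal (l ^ DIM('a)) * (mass f ?Q / ennreal (l ^ DIM('a))) = mass f ?Q"
 using assms(2)
 by (simp add: ennreal_times_divide mult.commute[of "ennreal (l ^ DIM('a))"] ennreal_mult_divide_eq)
ultimately show ?thesis by simp
qed

lemma maximal_ge_hcube:
 fixes a :: "'a::euclidean_space"
 assumes "x \<in> hcube a l"
 shows "mass f (hcube a l) <= ennreal (l ^ DIM('a)) * maximal f x"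
 unfolding nn_integral_hcube_eq_cbox
 using assms hcube_subset_cbox hcube_imp_pos by (intro maximal_ge_cbox) blast+

lemma maximal_le:
 assumes "!!x. norm (f x) <= B" "0 <= B"
 shows "maximal f x <= ennreal B"
 unfolding maximal_def
proof (rule SUP_least)
fix Q :: "'a set" assume "Q \<in> cubes"
then obtain a l where Q: "Q = cbox a (a + l *\<^sub>R One)" "0 < l" by (auto simp: cubes_def)
have "mass f Q <= (LN x\<in>Q. ennreal B)"
 using assms by (intro nn_integral_mono mult_right_mono ennreal_leI) auto
also have "... = ennreal B * vol Q"
 by (rule nn_integral_cmult_indicator) (simp add: Q)
finally have le: "mass f Q <= ennreal B * vol Q" .
have "mass f Q / vol Q <= ennreal B"
 using le Q emeasure_cube_cbox[of l a] by (intro divide_le_posI_ennreal) (auto simp: mult.commute)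
then show "mass f Q / vol Q * ind Q x <= ennreal B"
 by (auto split: split_indicator)
qed

lemma maximal_gtE:
 fixes f :: "'a::euclidean_space => complex"
 assumes "ennreal t < maximal f x" "0 <= t"
 obtains a l where "0 < l" "x \<in> cbox a (a + l *\<^sub>R One)"
  "ennreal (t * l ^ DIM('a)) < mass f (cbox a (a + l *\<^sub>R One))"
proof -
obtain Q where Q: "Q \<in> cubes" "ennreal t < mass f Q / vol Q * ind Q x"
 using assms(1) unfolding maximal_def less_SUP_iff by blast
then have x: "x \<in> Q" by (auto split: split_indicator_asm)
obtain a l where al: "Q = cbox a (a + l *\<^sub>R One)" "0 < l" using Q(1) by (auto simp: cubes_def)
have "ennreal t < mass f Q / ennreal (l ^ DIM('a))"
 using Q(2) x al emeasure_cube_cbox[of l a] by simp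
have "ennreal (t * l ^ DIM('a)) < mass f Q"
proof (rule ccontr)
 assume "\<not> ?thesis"
 then have "mass f Q / ennreal (l ^ DIM('a)) <= ennreal (t * l ^ DIM('a)) / ennreal (l ^ DIM('a))"
  by (intro divide_right_mono_ennreal) simp
 also have "... = ennreal t" using al(2) assms(2) by (subst divide_ennreal) auto
 finally show False using \<open>ennreal t < mass f Q / ennreal (l ^ DIM('a))\<close> by simp
qed
then show thesis using that[of l a] al x by blast
qed

lemma open_maximal_gt:
 fixes f :: "'a::euclidean_space => complex"
 assumes "0 <= t"
 shows "open {x. ennreal t < maximal f x}"
proof (rule openI)
fix x assume "x \<in> {x. ennreal t < maximal f x}"
then obtain a l where al: "0 < l" "x \<in> cbox a (a + l *\<^sub>R One)"
 "ennreal (t * l ^ DIM('a)) < mass f (cbox a (a + l *\<^sub>R One))"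
 using maximal_gtE[of t f x] assms by blast
let ?Q = "%e. cbox (a - e *\<^sub>R One) ((a - e *\<^sub>R One) + (l + 2 * e) *\<^sub>R One)"
have "((%e. ennreal (t * (l + 2 * e) ^ DIM('a))) \<longlongrightarrow> ennreal (t * (l + 2 * 0) ^ DIM('a))) (at_right 0)"
 by (intro tendsto_intros)
then have "\<forall>\<^sub>F e in at_right 0. ennreal (t * (l + 2 * e) ^ DIM('a)) < mass f (cbox a (a + l *\<^sub>R One))"
 using al(3) by (intro order_tendstoD) auto
then obtain e where e: "0 < e" "ennreal (t * (l + 2 * e) ^ DIM('a)) < mass f (cbox a (a + l *\<^sub>R One))"
 using eventually_happens[OF eventually_conj[OF eventually_at_right_less[of "0::real"]]]
  trivial_limit_at_right_real by blast
have "ball x e \<subseteq> {x. ennreal t < maximal f x}"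
proof
 fix y assume y: "y \<in> ball x e"
 have yi: "\<bar>(x - y) \<bullet> i\<bar> < e" if "i \<in> Basis" for i
  using Basis_le_norm[OF that, of "x - y"] y by (simp add: dist_norm)
 have yQ: "y \<in> ?Q e"
  unfolding mem_box
 proof
  fix i :: 'a assume i: "i \<in> Basis"
  have "a \<bullet> i <= x \<bullet> i" "x \<bullet> i <= a \<bullet> i + l" using al(2) i by (auto simp: mem_box inner_add_left)
  then show "(a - e *\<^sub>R One) \<bullet> i <= y \<bullet> i \<and> y \<bullet> i <= (a - e *\<^sub>R One + (l + 2 * e) *\<^sub>R One) \<bullet> i"
   using yi[OF i] i by (simp add: inner_diff_left inner_add_left abs_less_iff)
 qed
 have sub: "cbox a (a + l *\<^sub>R One) \<subseteq> ?Q e"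
  using e(1) by (auto simp: mem_box inner_diff_left inner_add_left) (smt (verit))+
 have "ennreal (t * (l + 2 * e) ^ DIM('a)) < mass f (?Q e)"
  using e(2) mass_mono[OF sub, of f] by order
 also have "... <= ennreal ((l + 2 * e) ^ DIM('a)) * maximal f y"
  using e(1) al(1) yQ by (intro maximal_ge_cbox) auto
 finally have lt: "ennreal ((l + 2 * e) ^ DIM('a)) * ennreal t < ennreal ((l + 2 * e) ^ DIM('a)) * maximal f y"
  using assms e(1) al(1) by (simp add: ennreal_mult mult.commute)
 have "ennreal t < maximal f y"
 proof (rule ccontr)
  assume "\<not> ?thesis"
  then have "ennreal ((l + 2 * e) ^ DIM('a)) * maximal f y <= ennreal ((l + 2 * e) ^ DIM('a)) * ennreal t"
   by (intro mult_left_mono) auto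
  then show False using lt by simp
 qed
 then show "y \<in> {x. ennreal t < maximal f x}" by simp
qed
then show "\<exists>e>0. ball x e \<subseteq> {x. ennreal t < maximal f x}" using e(1) by blast
qed

lemma maximal_measurable_borel: "maximal f \<in> borel_measurable borel"
proof (rule borel_measurableI_greater)
fix y :: ennreal
show "{x \<in> space borel. y < maximal f x} \<in> sets borel"
proof (cases y)
 case (real t)
 then show ?thesis using open_maximal_gt[of t f] by simp
qed simp
qed

lemma maximal_measurable [measurable]: "maximal f \<in> Lmeas"
 using maximal_measurable_borel by (intro measurable_completion) simp

lemma cball_subset_cube:
 fixes x :: "'a::euclidean_space"
 shows "cball x s \<subseteq> cbox (x - s *\<^sub>R One) ((x - s *\<^sub>R One) + (2 * s) *\<^sub>R One)"
proof
fix y assume y: "y \<in> cball x s"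
show "y \<in> cbox (x - s *\<^sub>R One) ((x - s *\<^sub>R One) + (2 * s) *\<^sub>R One)"
 unfolding mem_box
proof
 fix i :: 'a assume i: "i \<in> Basis"
 have "\<bar>(x - y) \<bullet> i\<bar> <= s"
  using Basis_le_norm[OF i, of "x - y"] y by (simp add: dist_norm)
 then show "(x - s *\<^sub>R One) \<bullet> i <= y \<bullet> i \<and> y \<bullet> i <= (x - s *\<^sub>R One + (2 * s) *\<^sub>R One) \<bullet> i"
  using i by (simp add: inner_diff_left inner_add_left abs_le_iff)
qed
qed

lemma emeasure_cball_le:
 fixes x :: "'a::euclidean_space"
 assumes "0 <= s"
 shows "vol (cball x s) <= ennreal ((2 * s) ^ DIM('a))"
 using emeasure_mono[OF cball_subset_cube[of x s], of lebesgue]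
  emeasure_cube_cbox[of "2 * s" "x - s *\<^sub>R One"] assms
 by simp

lemma mass_cball_le_maximal:
 fixes x :: "'a::euclidean_space"
 assumes "0 < s"
 shows "mass f (cball x s) <= ennreal ((2 * s) ^ DIM('a)) * maximal f x"
proof -
have "mass f (cball x s) <= mass f (cbox (x - s *\<^sub>R One) ((x - s *\<^sub>R One) + (2 * s) *\<^sub>R One))"
 by (rule mass_mono[OF cball_subset_cube])
also have "... <= ennreal ((2 * s) ^ DIM('a)) * maximal f x"
 using cball_subset_cube[of x s] assms by (intro maximal_ge_cbox) auto
finally show ?thesis .
qed

lemma maximal_weak_type:
 fixes f :: "'a::euclidean_space => complex"
 assumes [measurable]: "f \<in> Lmeas" and t: "0 < t"
  and fin: "mass f UNIV < \<infinity>"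
 shows "ennreal t * vol {x. ennreal t < maximal f x}
  <= ennreal ((10 * real DIM('a)) ^ DIM('a)) * mass f UNIV"
proof -
let ?d = "real DIM('a)" and ?E = "{x. ennreal t < maximal f x}"
obtain F where F: "mass f UNIV = ennreal F" "0 <= F" using fin by (cases "mass f UNIV") auto
have "ALL x. EX p. x \<in> ?E --> 0 < snd p \<and> x \<in> cbox (fst p) (fst p + snd p *\<^sub>R One) \<and>
  ennreal (t * snd p ^ DIM('a)) < mass f (cbox (fst p) (fst p + snd p *\<^sub>R One))"
proof
 fix x
 show "EX p. x \<in> ?E --> 0 < snd p \<and> x \<in> cbox (fst p) (fst p + snd p *\<^sub>R One) \<and>
  ennreal (t * snd p ^ DIM('a)) < mass f (cbox (fst p) (fst p + snd p *\<^sub>R One))"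
 proof (cases "x \<in> ?E")
  case True
  then have "ennreal t < maximal f x" by simp
  then obtain a l where "0 < l" "x \<in> cbox a (a + l *\<^sub>R One)"
   "ennreal (t * l ^ DIM('a)) < mass f (cbox a (a + l *\<^sub>R One))"
   by (rule maximal_gtE[OF _ less_imp_le[OF t]])
  then show ?thesis by (intro exI[of _ "(a, l)"]) simp
 qed blast
qed
from choice[OF this] obtain p where p: "!!x. x \<in> ?E ==> 0 < snd (p x) \<and>
  x \<in> cbox (fst (p x)) (fst (p x) + snd (p x) *\<^sub>R One) \<and>
  ennreal (t * snd (p x) ^ DIM('a)) < mass f (cbox (fst (p x)) (fst (p x) + snd (p x) *\<^sub>R One))"
 by blast
define a l where "a x = fst (p x)" and "l x = snd (p x)" for x
have al: "0 < l x" "x \<in> cbox (a x) (a x + l x *\<^sub>R One)"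
 "ennreal (t * l x ^ DIM('a)) < mass f (cbox (a x) (a x + l x *\<^sub>R One))" if "x \<in> ?E" for x
 unfolding a_def l_def using p[OF that] by blast+
have sub: "cbox (a x) (a x + l x *\<^sub>R One) \<subseteq> cball x (?d * l x)" if x: "x \<in> ?E" for x
proof
 fix y assume y: "y \<in> cbox (a x) (a x + l x *\<^sub>R One)"
 have "norm (x - y) <= (\<Sum>i\<in>Basis. \<bar>(x - y) \<bullet> i\<bar>)" by (rule norm_le_l1)
 also have "... <= (\<Sum>i::'a\<in>Basis. l x)"
 proof (rule sum_mono)
  fix i :: 'a assume "i \<in> Basis"
  then show "\<bar>(x - y) \<bullet> i\<bar> <= l x"
   using al(2)[OF x] y unfolding mem_box by (force simp: inner_diff_left inner_add_left abs_le_iff)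
 qed
 finally show "y \<in> cball x (?d * l x)" by (simp add: dist_norm)
qed
have lb: "?d * l x <= ?d * (F / t + 1)" if x: "x \<in> ?E" for x
proof (cases "l x <= 1")
 case True
 then show ?thesis using F t by (intro mult_left_mono) (auto simp: add_increasing)
next
 case False
 have "ennreal (t * l x ^ DIM('a)) < ennreal F"
  using al(3)[OF x] mass_mono[of "cbox (a x) (a x + l x *\<^sub>R One)" UNIV f] F by simp
 then have "t * l x ^ DIM('a) < F"
  using F(2) ennreal_less_iff[of "t * l x ^ DIM('a)" F] t al(1)[OF x] by simp
 moreover have "l x ^ 1 <= l x ^ DIM('a)" using False by (intro power_increasing) (auto simp: Suc_leI)
 ultimately have "t * l x <= F" using t by (smt (verit) mult_left_mono power_one_right)
 then show ?thesis using t by (intro mult_left_mono) (auto simp: field_simps)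
qed
have pos: "0 < ?d * l x \<and> ?d * l x <= ?d * (F / t + 1)" if "x \<in> ?E" for x
 using al(1)[OF that] lb[OF that] by simp
have cov: "?E \<subseteq> (\<Union>x\<in>?E. cball x (?d * l x))"
proof
 fix x assume x: "x \<in> ?E"
 have "x \<in> cball x (?d * l x)" using pos[OF x] by simp
 then show "x \<in> (\<Union>x\<in>?E. cball x (?d * l x))" using x by blast
qed
obtain C where C: "countable C" "C \<subseteq> ?E" "pairwise (%i j. disjnt (cball i (?d * l i)) (cball j (?d * l j))) C"
 "?E \<subseteq> (\<Union>i\<in>C. cball i (5 * (?d * l i)))"
 by (rule Vitali_covering_lemma_cballs[OF cov pos]) (assumption, rule that)
define J where "J = to_nat_on C ` C"
define x where "x k = from_nat_into C k" for k
have xC: "x k \<in> C" if "k \<in> J" for k using that C(1) by (auto simp: J_def x_def)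
have xinj: "j = k" if "j \<in> J" "k \<in> J" "x j = x k" for j k
 using that C(1) unfolding J_def x_def by (metis (no_types, lifting) from_nat_into_to_nat_on imageE)
have xsurj: "\<exists>k\<in>J. x k = i" if "i \<in> C" for i
 using that C(1) by (intro bexI[of _ "to_nat_on C i"]) (auto simp: J_def x_def)
define B where "B k = (if k \<in> J then cbox (a (x k)) (a (x k) + l (x k) *\<^sub>R One) else {})" for k
define B5 where "B5 k = (if k \<in> J then cball (x k) (5 * (?d * l (x k))) else {})" for k
have [measurable]: "B k \<in> sets lebesgue" "B5 k \<in> sets lebesgue" for k by (auto simp: B_def B5_def)
have dB: "disjoint_family B"
 unfolding disjoint_family_on_def
proof (intro ballI impI)
 fix j k :: nat assume "j ~= k"
 show "B j \<inter> B k = {}"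
 proof (cases "j \<in> J \<and> k \<in> J")
  case True
  then have "x j ~= x k" "x j \<in> C" "x k \<in> C" using xinj xC \<open>j ~= k\<close> by auto
  then have "disjnt (cball (x j) (?d * l (x j))) (cball (x k) (?d * l (x k)))"
   using C(3) by (auto simp: pairwise_def)
  moreover have "B j \<subseteq> cball (x j) (?d * l (x j))" "B k \<subseteq> cball (x k) (?d * l (x k))"
   using True sub xC C(2) unfolding B_def by auto
  ultimately show ?thesis unfolding disjnt_def by blast
 qed (auto simp: B_def)
qed
have each: "ennreal t * vol (B5 k) <= ennreal ((10 * ?d) ^ DIM('a)) * mass f (B k)" for k
proof (cases "k \<in> J")
 case True
 then have xk: "x k \<in> ?E" using xC C(2) by blast
 have "vol (B5 k) <= ennreal ((2 * (5 * (?d * l (x k)))) ^ DIM('a))"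
  using True emeasure_cball_le[of "5 * (?d * l (x k))" "x k"] al(1)[OF xk] by (simp add: B5_def)
 then have "ennreal t * vol (B5 k) <= ennreal t * ennreal ((2 * (5 * (?d * l (x k)))) ^ DIM('a))"
  by (rule mult_left_mono) simp
 also have "... = ennreal ((10 * ?d) ^ DIM('a)) * ennreal (t * l (x k) ^ DIM('a))"
  using t al(1)[OF xk] by (simp add: ennreal_mult[symmetric] power_mult_distrib mult_ac)
 also have "... <= ennreal ((10 * ?d) ^ DIM('a)) * mass f (B k)"
  using al(3)[OF xk] True by (intro mult_left_mono) (auto simp: B_def)
 finally show ?thesis .
qed (simp add: B5_def)
have "?E \<subseteq> (\<Union>k. B5 k)"
proof
 fix y assume "y \<in> ?E"
 then obtain i where i: "i \<in> C" "y \<in> cball i (5 * (?d * l i))" using C(4) by blast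
 obtain k where "k \<in> J" "x k = i" using xsurj[OF i(1)] by blast
 then have "y \<in> B5 k" using i by (simp add: B5_def)
 then show "y \<in> (\<Union>k. B5 k)" by blast
qed
then have "vol ?E <= vol (\<Union>k. B5 k)" by (intro emeasure_mono) auto
also have "... <= (\<Sum>k. vol (B5 k))"
 by (rule emeasure_subadditive_countably) auto
finally have "ennreal t * vol ?E <= ennreal t * (\<Sum>k. vol (B5 k))"
 by (rule mult_left_mono) simp
also have "... = (\<Sum>k. ennreal t * vol (B5 k))" by (simp only: ennreal_suminf_cmult)
also have "... <= (\<Sum>k. ennreal ((10 * ?d) ^ DIM('a)) * mass f (B k))"
 by (intro suminf_le each summableI)
also have "... = ennreal ((10 * ?d) ^ DIM('a)) * (\<Sum>k. mass f (B k))" by (simp only: ennreal_suminf_cmult)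
also have "(\<Sum>k. mass f (B k)) = mass f (\<Union>k. B k)"
 by (rule nn_integral_disjoint_family[symmetric]) (use dB in auto)
also have "ennreal ((10 * ?d) ^ DIM('a)) * mass f (\<Union>k. B k) <= ennreal ((10 * ?d) ^ DIM('a)) * mass f UNIV"
 by (intro mult_left_mono mass_mono) auto
finally show ?thesis .
qed

section \<open>Bounded functions of bounded support and the operator on square integrable functions\<close>

definition Linf_c :: "('a::euclidean_space => complex) set" where
 "Linf_c = {f \<in> Lmeas. (EX B. ALL x. norm (f x) <= B) \<and> bounded {x. f x ~= 0}}"

definition restr :: "'a set => ('a => complex) => 'a => complex" where
 "restr A f x = (if x \<in> A then f x else 0)"

lemma restr_measurable [measurable]:
 assumes "A \<in> sets lebesgue" "f \<in> Lmeas"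
 shows "restr A f \<in> Lmeas"
proof -
have "restr A f = (%x. ind A x * f x)"
 by (auto simp: restr_def fun_eq_iff split: split_indicator)
then show ?thesis using assms by simp
qed

lemma Linf_cI:
 assumes "f \<in> Lmeas" "!!x. norm (f x) <= B" "!!x. f x ~= 0 ==> norm x <= R"
 shows "f \<in> Linf_c"
proof -
have "bounded {x. f x ~= 0}" unfolding bounded_iff using assms(3) by blast
then show ?thesis using assms(1,2) unfolding Linf_c_def by blast
qed

lemma Linf_cE:
 assumes "f \<in> Linf_c"
 obtains B R where "0 < B" "0 < R" "!!x. norm (f x) <= B" "!!x. f x ~= 0 ==> norm x <= R"
proof -
obtain B where B: "!!x. norm (f x) <= B" using assms by (auto simp: Linf_c_def)
obtain R where R: "0 < R" "\<forall>x\<in>{x. f x ~= 0}. norm x <= R"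
 using assms unfolding Linf_c_def bounded_pos by blast
show thesis
proof (rule that[of "max B 1" R])
 show "norm (f x) <= max B 1" for x using B[of x] by simp
qed (use R in auto)
qed

lemma Linf_c_measurable [measurable_dest]: "f \<in> Linf_c ==> f \<in> Lmeas"
 by (simp add: Linf_c_def)

lemma Linf_c_dominated:
 assumes f: "f \<in> Linf_c" and g: "g \<in> Lmeas" and le: "!!x. norm (g x) <= C * norm (f x)"
 shows "g \<in> Linf_c"
proof -
obtain B R where BR: "0 < B" "0 < R" "!!x. norm (f x) <= B" "!!x. f x ~= 0 ==> norm x <= R"
 using Linf_cE[OF f] by blast
show ?thesis
proof (rule Linf_cI[OF g, of "\<bar>C\<bar> * B" R])
 fix x
 have "norm (g x) <= C * norm (f x)" by (rule le)
 also have "... <= \<bar>C\<bar> * norm (f x)" by (rule mult_right_mono) auto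
 also have "... <= \<bar>C\<bar> * B" by (rule mult_left_mono) (use BR in auto)
 finally show "norm (g x) <= \<bar>C\<bar> * B" .
 assume "g x ~= 0"
 then have "f x ~= 0" using le[of x] by auto
 then show "norm x <= R" by (rule BR(4))
qed
qed

lemma Linf_c_add:
 assumes f: "f \<in> Linf_c" and g: "g \<in> Linf_c"
 shows "(%x. f x + g x) \<in> Linf_c"
proof -
obtain B R where BR: "0 < B" "0 < R" "!!x. norm (f x) <= B" "!!x. f x ~= 0 ==> norm x <= R"
 using Linf_cE[OF f] by blast
obtain B' R' where BR': "0 < B'" "0 < R'" "!!x. norm (g x) <= B'" "!!x. g x ~= 0 ==> norm x <= R'"
 using Linf_cE[OF g] by blast
show ?thesis
proof (rule Linf_cI[of _ "B + B'" "max R R'"])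
 show "(%x. f x + g x) \<in> Lmeas" using f g by measurable
 fix x
 show "norm (f x + g x) <= B + B'" using norm_triangle_ineq[of "f x" "g x"] BR(3)[of x] BR'(3)[of x] by linarith
 assume "f x + g x ~= 0"
 then have "f x ~= 0 \<or> g x ~= 0" by auto
 then show "norm x <= max R R'" using BR(4)[of x] BR'(4)[of x] by auto
qed
qed

lemma Linf_c_cmult: "f \<in> Linf_c ==> (%x. c * f x) \<in> Linf_c"
 by (rule Linf_c_dominated[of f _ "norm c"]) (auto simp: norm_mult)

lemma Linf_c_diff:
 assumes "f \<in> Linf_c" "g \<in> Linf_c"
 shows "(%x. f x - g x) \<in> Linf_c"
 using Linf_c_add[OF assms(1) Linf_c_cmult[OF assms(2), of "-1"]] by simp

lemma Linf_c_restr: "f \<in> Linf_c ==> A \<in> sets lebesgue ==> restr A f \<in> Linf_c"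
 by (rule Linf_c_dominated[of f _ 1]) (auto simp: restr_def)

lemma Linf_c_mult:
 assumes f: "f \<in> Linf_c" and [measurable]: "b \<in> Lmeas" and b: "!!x. norm (b x) <= B"
 shows "(%x. b x * f x) \<in> Linf_c"
proof (rule Linf_c_dominated[OF f, of _ B])
show "(%x. b x * f x) \<in> Lmeas" using f by measurable
show "norm (b x * f x) <= B * norm (f x)" for x
 unfolding norm_mult by (rule mult_right_mono[OF b]) simp
qed

lemma Linf_c_indicator:
 assumes "A \<in> sets lebesgue" "bounded A"
 shows "(%x. c * ind A x) \<in> Linf_c"
proof -
obtain R where R: "\<forall>x\<in>A. norm x <= R" using assms(2) unfolding bounded_iff by blast
show ?thesis
 by (rule Linf_cI[of _ "norm c" R]) (use assms R in \<open>auto split: split_indicator\<close>)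
qed

lemma Linf_c_integrable:
 assumes "f \<in> Linf_c"
 shows "integrable lebesgue f"
proof -
obtain B R where BR: "0 < B" "0 < R" "!!x. norm (f x) <= B" "!!x. f x ~= 0 ==> norm x <= R"
 using Linf_cE[OF assms] by blast
have "vol (cball 0 R :: 'a set) < \<infinity>"
 using emeasure_bounded_finite[of "cball 0 R :: 'a set"] by simp
then have "integrable lebesgue (%x::'a. B * ind (cball 0 R) x)"
 by (intro integrable_mult_right) (auto simp: integrable_indicator_iff)
then show ?thesis
proof (rule Bochner_Integration.integrable_bound)
 show "f \<in> Lmeas" using assms by measurable
 show "AE x. norm (f x) <= norm (B * ind (cball 0 R) x)"
 proof (rule AE_I2)
  fix x show "norm (f x) <= norm (B * ind (cball 0 R) x :: real)"
   using BR(3)[of x] BR(4)[of x] BR(1) by (cases "f x = 0") auto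
 qed
qed
qed

lemma Linf_c_subset_L2: "f \<in> Linf_c ==> f \<in> L2"
proof -
assume f: "f \<in> Linf_c"
obtain B R where BR: "0 < B" "0 < R" "!!x. norm (f x) <= B" "!!x. f x ~= 0 ==> norm x <= R"
 using Linf_cE[OF f] by blast
have "(%x. of_real (norm (f x)) * f x) \<in> Linf_c"
 by (rule Linf_c_mult[OF f, of _ B]) (use f BR(3) in auto)
then have "integrable lebesgue (%x. norm (of_real (norm (f x)) * f x))"
 by (intro integrable_norm Linf_c_integrable)
then show ?thesis
 using f by (simp add: L2_def L0_def norm_mult power2_eq_square Linf_c_measurable)
qed

lemma L2_measurable [measurable_dest]: "f \<in> L2 ==> f \<in> Lmeas"
 by (simp add: L2_def L0_def)

lemma L2_dominated:
 assumes "f \<in> L2" "g \<in> Lmeas" "AE x. norm (g x) <= C * norm (f x)"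
 shows "g \<in> L2"
proof -
have "integrable lebesgue (%x. C\<^sup>2 * (norm (f x))\<^sup>2)" using assms(1) by (simp add: L2_def)
then have "integrable lebesgue (%x. (norm (g x))\<^sup>2)"
proof (rule Bochner_Integration.integrable_bound)
 show "(%x. (norm (g x))\<^sup>2) \<in> Lmeas" using assms(2) by measurable
 show "AE x. norm ((norm (g x))\<^sup>2) <= norm (C\<^sup>2 * (norm (f x))\<^sup>2)"
  using assms(3)
 proof eventually_elim
  case (elim x)
  then have "(norm (g x))\<^sup>2 <= (C * norm (f x))\<^sup>2" by (intro power_mono) auto
  then show ?case by (simp add: power_mult_distrib)
 qed
qed
then show ?thesis using assms(2) by (simp add: L2_def L0_def)
qed

lemma L2_cmult: "f \<in> L2 ==> (%x. c * f x) \<in> L2"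
 by (rule L2_dominated[of f _ "norm c"]) (auto simp: norm_mult)

lemma L2_add:
 assumes "f \<in> L2" "g \<in> L2"
 shows "(%x. f x + g x) \<in> L2"
proof -
have m: "(%x. f x + g x) \<in> Lmeas"
 by (rule borel_measurable_add) (use assms L2_measurable in auto)
have "integrable lebesgue (%x. 2 * (norm (f x))\<^sup>2 + 2 * (norm (g x))\<^sup>2)"
 by (intro Bochner_Integration.integrable_add integrable_mult_right) (use assms in \<open>auto simp: L2_def\<close>)
then have "integrable lebesgue (%x. (norm (f x + g x))\<^sup>2)"
proof (rule Bochner_Integration.integrable_bound)
 show "(%x. (norm (f x + g x))\<^sup>2) \<in> Lmeas" using m by simp
 show "AE x. norm ((norm (f x + g x))\<^sup>2) <= norm (2 * (norm (f x))\<^sup>2 + 2 * (norm (g x))\<^sup>2)"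
 proof (rule AE_I2)
  fix x
  have "(norm (f x + g x))\<^sup>2 <= (norm (f x) + norm (g x))\<^sup>2"
   by (intro power_mono norm_triangle_ineq) auto
  also have "... <= 2 * (norm (f x))\<^sup>2 + 2 * (norm (g x))\<^sup>2"
   using sum_squares_bound[of "norm (f x)" "norm (g x)"] by (simp add: power2_sum)
  finally show "norm ((norm (f x + g x))\<^sup>2) <= norm (2 * (norm (f x))\<^sup>2 + 2 * (norm (g x))\<^sup>2)" by simp
 qed
qed
then show ?thesis using m by (simp add: L2_def L0_def)
qed

lemma L2_diff:
 assumes "f \<in> L2" "g \<in> L2"
 shows "(%x. f x - g x) \<in> L2"
 using L2_add[OF assms(1) L2_cmult[OF assms(2), of "-1"]] by simp

lemma L2_nn: "f \<in> L2 ==> (LN x. ennreal ((norm (f x))\<^sup>2)) = ennreal ((L2_norm f)\<^sup>2)"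
 by (simp add: L2_def L2_norm_def nn_integral_eq_integral)

lemma finite_gridc:
 fixes a :: "'a::euclidean_space"
 assumes l: "0 < l" and S: "bounded S"
 shows "finite (gridc a l ` S)"
proof -
obtain R where R: "\<forall>x\<in>S. norm x <= R" using S unfolding bounded_iff by blast
define m where "m = \<lceil>(R + norm a) / l\<rceil>"
define P where "P = PiE (Basis::'a set) (%_. {-m..m})"
have "gridc a l ` S \<subseteq> (%k. a + (\<Sum>i\<in>Basis. (l * of_int (k i)) *\<^sub>R i)) ` P"
proof
 fix c assume "c \<in> gridc a l ` S"
 then obtain x where x: "x \<in> S" "c = gridc a l x" by blast
 define k where "k = restrict (%i. \<lfloor>((x - a) \<bullet> i) / l\<rfloor>) (Basis::'a set)"
 have "k i \<in> {-m..m}" if i: "i \<in> Basis" for i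
 proof -
  have "\<bar>(x - a) \<bullet> i\<bar> <= norm (x - a)" by (rule Basis_le_norm[OF i])
  also have "... <= R + norm a" using R x(1) norm_triangle_ineq4[of x a] by force
  finally have "\<bar>((x - a) \<bullet> i) / l\<bar> <= (R + norm a) / l"
   using l by (simp add: divide_right_mono)
  then have "((x - a) \<bullet> i) / l <= of_int m" "- of_int m <= ((x - a) \<bullet> i) / l"
   unfolding m_def abs_le_iff using le_of_int_ceiling[of "(R + norm a) / l"] by linarith+
  then show ?thesis using i by (simp add: k_def le_floor_iff floor_le_iff)
 qed
 then have "k \<in> P" by (auto simp: P_def k_def)
 moreover have "c = a + (\<Sum>i\<in>Basis. (l * of_int (k i)) *\<^sub>R i)"
  by (simp add: x(2) gridc_def k_def)
 ultimately show "c \<in> (%k. a + (\<Sum>i\<in>Basis. (l * of_int (k i)) *\<^sub>R i)) ` P" by blast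
qed
moreover have "finite P" unfolding P_def by (intro finite_PiE) auto
ultimately show ?thesis by (meson finite_imageI finite_subset)
qed

lemma grid_decomposition:
 fixes f :: "'a::euclidean_space => complex"
 assumes "0 < l" "finite (gridc a l ` {x. f x ~= 0})"
 shows "f x = (\<Sum>c\<in>gridc a l ` {x. f x ~= 0}. restr (hcube c l) f x)"
proof -
let ?G = "gridc a l ` {x. f x ~= 0}"
have "restr (hcube c l) f x = (if c = gridc a l x then f x else 0)" if "c \<in> ?G" for c
proof -
 obtain y where "c = gridc a l y" using \<open>c \<in> ?G\<close> by blast
 then show ?thesis using mem_cell_iff[OF assms(1), of x a y] by (auto simp: restr_def)
qed
then have "(\<Sum>c\<in>?G. restr (hcube c l) f x) = (\<Sum>c\<in>?G. if c = gridc a l x then f x else 0)"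
 by (rule sum.cong[OF refl])
also have "... = f x" using assms(2) by (auto simp: sum.delta)
finally show ?thesis by simp
qed

locale dini_operator =
 fixes T :: "('a::euclidean_space => complex) => ('a => complex)"
  and K :: "'a => 'a => complex" and omega :: "real => real" and CT :: real
 assumes lin: "linear_operator L2 L2 T"
  and CT: "0 <= CT" and bd: "!!f. f \<in> L2 ==> L2_norm (T f) <= CT * L2_norm f"
  and dini: "dini_modulus omega"
  and Kx: "!!x x' y. 0 < norm (x - x') ==> norm (x - x') < 1/2 * norm (x - y) ==>
    norm (K x y - K x' y) <= 1 / norm (x - y) ^ DIM('a) * omega (norm (x - x') / norm (x - y))"
  and Ky: "!!x y y'. 0 < norm (y - y') ==> norm (y - y') < 1/2 * norm (x - y) ==>
    norm (K x y - K x y') <= 1 / norm (x - y) ^ DIM('a) * omega (norm (y - y') / norm (x - y))"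
  and rep: "!!f. f \<in> Cc_infty ==> AE x. x ~: supp f -->
    T f x = (LI y. K x y * f y)"
begin

lemma T_L2: "f \<in> L2 ==> T f \<in> L2"
 using lin by (simp add: linear_operator_def)

lemma T_cong: "f \<in> L2 ==> g \<in> L2 ==> AE x. f x = g x ==> AE x. T f x = T g x"
 using lin unfolding linear_operator_def by blast

lemma T_add: "f \<in> L2 ==> g \<in> L2 ==> AE x. T (%x. f x + g x) x = T f x + T g x"
 using lin unfolding linear_operator_def by blast

lemma T_cmult: "f \<in> L2 ==> AE x. T (%x. c * f x) x = c * T f x"
 using lin unfolding linear_operator_def by blast

lemma T_diff:
 assumes "f \<in> L2" "g \<in> L2"
 shows "AE x. T (%x. f x - g x) x = T f x - T g x"
 using T_add[OF assms(1) L2_cmult[OF assms(2), of "-1"]] T_cmult[OF assms(2), of "-1"]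
 by eventually_elim simp

lemma T_sum:
 assumes "finite I" "!!i. i \<in> I ==> f i \<in> L2"
 shows "(%x. \<Sum>i\<in>I. f i x) \<in> L2 \<and> (AE x. T (%x. \<Sum>i\<in>I. f i x) x = (\<Sum>i\<in>I. T (f i) x))"
 using assms
proof (induction I)
case empty
have z: "(%x::'a. 0::complex) \<in> L2" by (simp add: L2_def L0_def)
show ?case using T_cmult[OF z, of 0] z by simp
next
case (insert i I)
then have IH: "(%x. \<Sum>i\<in>I. f i x) \<in> L2" "AE x. T (%x. \<Sum>i\<in>I. f i x) x = (\<Sum>i\<in>I. T (f i) x)"
 by auto
have fi: "f i \<in> L2" using insert by blast
have "AE x. T (%x. f i x + (\<Sum>i\<in>I. f i x)) x = T (f i) x + (\<Sum>i\<in>I. T (f i) x)"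
 using T_add[OF fi IH(1)] IH(2) by eventually_elim simp
then show ?case using insert L2_add[OF fi IH(1)] by simp
qed

lemma T_bound:
 assumes "f \<in> L2"
 shows "(LN x. ennreal ((norm (T f x))\<^sup>2)) <= ennreal (CT\<^sup>2) * (LN x. ennreal ((norm (f x))\<^sup>2))"
proof -
have "0 <= L2_norm (T f)" by (simp add: L2_norm_def)
then have "(L2_norm (T f))\<^sup>2 <= (CT * L2_norm f)\<^sup>2" using bd[OF assms] by (intro power_mono)
then show ?thesis
 unfolding L2_nn[OF assms] L2_nn[OF T_L2[OF assms]]
 by (subst ennreal_mult[symmetric]) (auto simp: power_mult_distrib intro: ennreal_leI)
qed

text \<open>
 The convergence of \<open>f n\<close> holds in the mean square, hence so does that of \<open>T (f
 n)\<close>, and a subsequence converges almost everywhere.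
\<close>

lemma T_dominated:
 assumes w: "w \<in> L2" and fn: "!!n::nat. f n \<in> Lmeas"
  and dom: "!!n. AE x. norm (f n x) <= norm (w x)"
  and g: "g \<in> Lmeas" and lim: "AE x. (%n. f n x) ---> g x"
 shows "g \<in> L2 \<and> (EX r. strict_mono r \<and> (AE x. (%k. T (f (r k)) x) ---> T g x))"
proof -
note fn[measurable] g[measurable]
have fL: "f n \<in> L2" for n
 by (rule L2_dominated[OF w fn, of _ 1]) (use dom in simp)
have gw: "AE x. norm (g x) <= norm (w x)"
proof -
 have "AE x. ALL n. norm (f n x) <= norm (w x)" using dom by (simp add: AE_all_countable)
 with lim show ?thesis
 proof eventually_elim
  case (elim x)
  show ?case by (rule Lim_bounded[OF tendsto_norm[OF elim(1)], of 0]) (use elim(2) in auto)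
 qed
qed
have gL: "g \<in> L2" by (rule L2_dominated[OF w g, of 1]) (use gw in simp)
let ?d = "%n x. f n x - g x"
have dL: "?d n \<in> L2" for n by (intro L2_diff fL gL)
have "(%n. LI x. (norm (?d n x))\<^sup>2) ---> (\<integral>x. 0 \<partial>(lebesgue::'a measure))"
proof (rule integral_dominated_convergence)
 show "integrable lebesgue (%x. 4 * (norm (w x))\<^sup>2)" using w by (simp add: L2_def)
 show "AE x. (%n. (norm (?d n x))\<^sup>2) ---> 0"
  using lim
 proof eventually_elim
  case (elim x)
  have "(%n. (norm (?d n x))\<^sup>2) ---> (norm (g x - g x))\<^sup>2" by (intro tendsto_intros elim)
  then show ?case by simp
 qed
 show "AE x. norm ((norm (?d n x))\<^sup>2) <= 4 * (norm (w x))\<^sup>2" for n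
  using gw dom[of n]
 proof eventually_elim
  case (elim x)
  have "norm (?d n x) <= 2 * norm (w x)" using norm_triangle_ineq4[of "f n x" "g x"] elim by linarith
  then have "(norm (?d n x))\<^sup>2 <= (2 * norm (w x))\<^sup>2" by (intro power_mono) auto
  then show ?case by (simp add: power_mult_distrib)
 qed
qed auto
then have l0: "(%n. CT\<^sup>2 * (L2_norm (?d n))\<^sup>2) ---> 0"
 by (intro tendsto_mult_right_zero) (simp add: L2_norm_def)
have TL: "T (?d n) \<in> L2" for n by (rule T_L2[OF dL])
have "(%n. LI x. norm ((norm (T (?d n) x))\<^sup>2)) ---> 0"
proof (rule tendsto_sandwich[OF _ _ tendsto_const l0])
 show "\<forall>\<^sub>F n in sequentially. (LI x. norm ((norm (T (?d n) x))\<^sup>2)) <= CT\<^sup>2 * (L2_norm (?d n))\<^sup>2"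
 proof (rule always_eventually, rule allI)
  fix n
  have "0 <= L2_norm (T (?d n))" by (simp add: L2_norm_def)
  then have "(L2_norm (T (?d n)))\<^sup>2 <= (CT * L2_norm (?d n))\<^sup>2" using bd[OF dL] by (intro power_mono)
  then show "(LI x. norm ((norm (T (?d n) x))\<^sup>2)) <= CT\<^sup>2 * (L2_norm (?d n))\<^sup>2"
   by (simp add: L2_norm_def power_mult_distrib)
 qed
qed auto
then obtain r where r: "strict_mono r" "AE x. (%k. (norm (T (?d (r k)) x))\<^sup>2) ---> 0"
 using tendsto_L1_AE_subseq[of lebesgue "%n x. (norm (T (?d n) x))\<^sup>2"] TL by (auto simp: L2_def)
have "AE x. ALL n. T (?d n) x = T (f n) x - T g x"
 unfolding AE_all_countable using T_diff[OF fL gL] by blast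
with r(2) have "AE x. (%k. T (f (r k)) x) ---> T g x"
proof eventually_elim
 case (elim x)
 have "(%k. sqrt ((norm (T (?d (r k)) x))\<^sup>2)) ---> sqrt 0" by (intro tendsto_real_sqrt elim(1))
 then have "(%k. T (f (r k)) x - T g x) ---> 0"
  using elim(2) by (simp add: tendsto_norm_zero_iff)
 then show ?case by (simp add: LIM_zero_iff)
qed
then show ?thesis using gL r(1) by blast
qed

lemma om_nonneg: "0 <= t ==> t <= 1 ==> 0 <= omega t"
 using dini by (simp add: dini_modulus_def)

lemma om_mono: "0 <= s ==> s <= t ==> t <= 1 ==> omega s <= omega t"
 using dini unfolding dini_modulus_def mono_on_def by auto

text \<open>
 By monotonicity \<open>omega (2\<^sup>-\<^sup>k)\<close> is at most a multiple of the integral of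
 \<open>omega t / t\<close> over a dyadic interval to the right of
 \<open>2\<^sup>-\<^sup>k\<close>.
\<close>

lemma summable_om: "summable (%k. omega ((1/2) ^ k))"
proof -
let ?I = "%k. {(1/2) ^ Suc k<..(1/2::real) ^ k}"
have dj: "disjoint_family ?I"
 unfolding disjoint_family_on_def
proof (intro ballI impI)
 fix j k :: nat assume "j ~= k"
 then consider "Suc j <= k" | "Suc k <= j" by linarith
 then show "?I j \<inter> ?I k = {}"
 proof cases
  case 1
  then have "(1/2::real) ^ k <= (1/2) ^ Suc j" by (intro power_decreasing) auto
  then show ?thesis by auto
 next
  case 2
  then have "(1/2::real) ^ j <= (1/2) ^ Suc k" by (intro power_decreasing) auto
  then show ?thesis by auto
 qed
qed
define u where "u k = ennreal (omega ((1/2) ^ Suc k) * 2 ^ k)" for k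
have "(\<Sum>k. u k * emeasure lborel (?I k)) = (\<integral>\<^sup>+t. (\<Sum>k. u k * ind (?I k) t) \<partial>lborel)"
 by (subst nn_integral_suminf) (auto simp: nn_integral_cmult_indicator)
also have "... <= (\<integral>\<^sup>+t\<in>{0..1}. ennreal (omega t / t) \<partial>lborel)"
proof (rule nn_integral_mono)
 fix t :: real
 show "(\<Sum>k. u k * ind (?I k) t) <= ennreal (omega t / t) * ind {0..1} t"
 proof (cases "EX k. t \<in> ?I k")
  case True
  then obtain k where k: "t \<in> ?I k" by blast
  have z: "u j * ind (?I j) t = 0" if "j ~: {k}" for j
  proof -
   have "?I j \<inter> ?I k = {}" using disjoint_family_onD[OF dj, of j k] that by blast
   then have "t ~: ?I j" using k by blast
   then have "ind (?I j) t = (0::ennreal)" by (rule indicator_simps(2))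
   then show ?thesis by (simp only: mult_zero_right)
  qed
  have "(\<Sum>k. u k * ind (?I k) t) = (\<Sum>j\<in>{k}. u j * ind (?I j) t)"
   by (rule suminf_finite) (use z in auto)
  also have "... = u k" using k by simp
  also have "... <= ennreal (omega t / t)"
  proof -
   have t: "(1/2) ^ Suc k < t" "t <= (1/2) ^ k" using k by auto
   have k1: "(1/2::real) ^ k <= 1" by (simp add: power_le_one)
   have t0: "0 < t" using t(1) by (meson less_trans zero_less_power half_gt_zero zero_less_one)
   have "omega ((1/2) ^ Suc k) <= omega t" using t k1 by (intro om_mono) auto
   moreover have "2 ^ k <= 1 / t" using t(2) t0 by (simp add: field_simps power_divide)
   moreover have "0 <= omega t" using t k1 t0 by (intro om_nonneg) auto
   ultimately have "omega ((1/2) ^ Suc k) * 2 ^ k <= omega t * (1 / t)"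
    by (intro mult_mono) auto
   then show ?thesis unfolding u_def by (intro ennreal_leI) simp
  qed
  also have "... = ennreal (omega t / t) * ind {0..1} t"
  proof -
   have "(1/2::real) ^ k <= 1" by (simp add: power_le_one)
   moreover have "0 < (1/2::real) ^ Suc k" by simp
   ultimately have "t \<in> {0..1}" using k by auto
   then show ?thesis by simp
  qed
  finally show ?thesis .
 next
  case False
  then have "(\<Sum>k. u k * ind (?I k) t) = 0" by simp
  then show ?thesis by simp
 qed
qed
also have "... < \<infinity>" using dini by (simp add: dini_modulus_def)
finally have fin: "(\<Sum>k. u k * emeasure lborel (?I k)) < \<infinity>" .
have "u k * emeasure lborel (?I k) = ennreal (omega ((1/2) ^ Suc k) / 2)" for k
proof -
 have "0 <= omega ((1/2) ^ Suc k)" by (rule om_nonneg) (auto simp: power_le_one simp del: power_Suc)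
 moreover have "emeasure lborel (?I k) = ennreal ((1/2) ^ Suc k)"
 proof -
  have "(1/2::real) ^ Suc k <= (1/2) ^ k" by simp
  then have "emeasure lborel (?I k) = ennreal ((1/2) ^ k - (1/2) ^ Suc k)" by (rule emeasure_lborel_Ioc)
  then show ?thesis by simp
 qed
 ultimately have "u k * emeasure lborel (?I k) = ennreal (omega ((1/2) ^ Suc k) * 2 ^ k * (1/2) ^ Suc k)"
  unfolding u_def by (simp only: ennreal_mult'[symmetric] mult_nonneg_nonneg zero_le_power zero_le_numeral)
 also have "omega ((1/2) ^ Suc k) * 2 ^ k * (1/2) ^ Suc k = omega ((1/2) ^ Suc k) / 2"
  by (simp add: power_one_over)
 finally show ?thesis .
qed
then have "(\<Sum>k. ennreal (omega ((1/2) ^ Suc k) / 2)) ~= \<infinity>" using fin by auto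
moreover have "0 <= omega ((1/2) ^ Suc k) / 2" for k
proof -
 have "0 <= omega ((1/2) ^ Suc k)" by (rule om_nonneg) (auto simp: power_le_one simp del: power_Suc)
 then show ?thesis by simp
qed
ultimately have "summable (%k. omega ((1/2) ^ Suc k) / 2)"
 by (intro summable_suminf_not_top) auto
then have "summable (%k. 2 * (omega ((1/2) ^ Suc k) / 2))" by (rule summable_mult)
then show ?thesis using summable_Suc_iff[of "%k. omega ((1/2) ^ k)"] by simp
qed

lemma om_small:
 assumes "0 < eps"
 obtains delta where "0 < delta" "delta <= 1/2" "!!t. 0 <= t ==> t <= delta ==> omega t < eps"
proof -
have "\<forall>\<^sub>F k in sequentially. omega ((1/2) ^ k) < eps"
 using order_tendstoD(2)[OF summable_LIMSEQ_zero[OF summable_om] assms] .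
then obtain n where n: "!!k. k \<ge> n ==> omega ((1/2) ^ k) < eps" unfolding eventually_sequentially by blast
have le: "(1/2::real) ^ Suc n <= (1/2) ^ 1" by (rule power_decreasing) auto
show thesis
proof (rule that[of "(1/2) ^ Suc n"])
 fix t :: real assume "0 <= t" "t <= (1/2) ^ Suc n"
 then have "omega t <= omega ((1/2) ^ Suc n)" using le by (intro om_mono) auto
 then show "omega t < eps" using n[of "Suc n"] by simp
qed (use le in auto)
qed

lemma K_smooth_x:
 assumes "norm (x - x') < 1/2 * norm (x - y)"
 shows "norm (K x y - K x' y) <= 1 / norm (x - y) ^ DIM('a) * omega (norm (x - x') / norm (x - y))"
proof (cases "x = x'")
case True
then show ?thesis using om_nonneg[of 0] by simp
qed (use Kx assms in auto)

lemma K_smooth_y: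
 assumes "norm (y - y') < 1/2 * norm (x - y)"
 shows "norm (K x y - K x y') <= 1 / norm (x - y) ^ DIM('a) * omega (norm (y - y') / norm (x - y))"
proof (cases "y = y'")
case True
then show ?thesis using om_nonneg[of 0] by simp
qed (use Ky assms in auto)

lemma K_isCont:
 assumes "x ~= y"
 shows "isCont (K x) y"
 unfolding continuous_at_eps_delta
proof (intro allI impI)
fix e :: real assume e: "0 < e"
let ?D = "norm (x - y)"
have D: "0 < ?D" using assms by simp
obtain delta where delta: "0 < delta" "delta <= 1/2" "!!t. 0 <= t ==> t <= delta ==> omega t < e * ?D ^ DIM('a)"
 using om_small[of "e * ?D ^ DIM('a)"] e D by auto
show "\<exists>d>0. ALL y'. dist y' y < d --> dist (K x y') (K x y) < e"
proof (intro exI[of _ "delta * ?D"] conjI allI impI)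
 show "0 < delta * ?D" using delta D by simp
 fix y' assume "dist y' y < delta * ?D"
 then have y': "norm (y - y') < delta * ?D" by (simp add: dist_norm norm_minus_commute)
 also have "... <= 1/2 * ?D" using delta D by (intro mult_right_mono) auto
 finally have "norm (K x y - K x y') <= 1 / ?D ^ DIM('a) * omega (norm (y - y') / ?D)" by (rule K_smooth_y)
 also have "... < 1 / ?D ^ DIM('a) * (e * ?D ^ DIM('a))"
  using D y' by (intro mult_strict_left_mono delta(3)) (auto simp: field_simps)
 also have "... = e" using D by simp
 finally show "dist (K x y') (K x y) < e" by (simp add: dist_norm norm_minus_commute)
qed
qed

lemma K_measurable [measurable]: "K x \<in> Lmeas"
proof -
have "continuous_on (- {x}) (K x)"
 by (intro continuous_at_imp_continuous_on ballI K_isCont) auto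
then have "(%y. ind (- {x}) y *\<^sub>R K x y) \<in> borel_measurable borel"
 by (intro borel_measurable_continuous_on_indicator) auto
then have "(%y. if y = x then K x x else ind (- {x}) y *\<^sub>R K x y) \<in> borel_measurable borel"
 by measurable
also have "(%y. if y = x then K x x else ind (- {x}) y *\<^sub>R K x y) = K x"
 by (auto simp: fun_eq_iff)
finally show ?thesis by (intro measurable_completion) simp
qed

lemma K_bounded_off:
 assumes "0 < delta"
 obtains C where "0 <= C" "!!y. norm y <= R ==> delta <= norm (x - y) ==> norm (K x y) <= C"
proof -
let ?S = "cball 0 R - ball x delta"
have "compact ?S" by (intro compact_diff) auto
moreover have "continuous_on ?S (K x)"
 by (intro continuous_at_imp_continuous_on ballI K_isCont) (use assms in auto)
ultimately have "bounded (K x ` ?S)" by (intro compact_imp_bounded compact_continuous_image)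
then obtain C where C: "0 < C" "\<forall>z\<in>K x ` ?S. norm z <= C" unfolding bounded_pos by blast
show thesis
proof (rule that[of C])
 fix y assume "norm y <= R" "delta <= norm (x - y)"
 then have "y \<in> ?S" by (simp add: dist_norm not_less)
 then show "norm (K x y) <= C" using C by blast
qed (use C in simp)
qed

lemma K_mult_Linf_c:
 assumes f: "f \<in> Linf_c" and "0 < delta" "!!y. f y ~= 0 ==> delta <= norm (x - y)"
 shows "(%y. K x y * f y) \<in> Linf_c"
proof -
obtain B R where BR: "0 < B" "0 < R" "!!x. norm (f x) <= B" "!!x. f x ~= 0 ==> norm x <= R"
 using Linf_cE[OF f] by blast
obtain C where C: "0 <= C" "!!y. norm y <= R ==> delta <= norm (x - y) ==> norm (K x y) <= C"
 using K_bounded_off[OF assms(2)] by blast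
show ?thesis
proof (rule Linf_c_dominated[OF f, of _ C])
 show "(%y. K x y * f y) \<in> Lmeas" using f by measurable
 show "norm (K x y * f y) <= C * norm (f y)" for y
 proof (cases "f y = 0")
  case False
  then show ?thesis unfolding norm_mult using C(2)[of y] BR(4)[of y] assms(3)[of y] by (intro mult_right_mono) auto
 qed simp
qed
qed

end

section \<open>Banach function spaces\<close>

lemma INF_tail_tendsto:
 fixes a :: "nat => real"
 assumes nn: "!!n. 0 <= a n" and lim: "a ---> L"
 shows "(%n. INF m\<in>{n..}. a m) ---> L"
proof (rule LIMSEQ_I)
fix e :: real assume e: "0 < e"
obtain n0 where n0: "!!n. n \<ge> n0 ==> norm (a n - L) < e / 2"
 using LIMSEQ_D[OF lim, of "e / 2"] e by auto
have bd: "bdd_below (a ` {n..})" for n using nn by (intro bdd_belowI[of _ 0]) auto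
show "EX no. \<forall>n\<ge>no. norm ((INF m\<in>{n..}. a m) - L) < e"
proof (intro exI[of _ n0] allI impI)
 fix n assume n: "n0 <= n"
 have "L - e / 2 <= (INF m\<in>{n..}. a m)"
 proof (rule cINF_greatest)
  fix m assume "m \<in> {n..}"
  then have "norm (a m - L) < e / 2" using n0[of m] n by simp
  then show "L - e / 2 <= a m" unfolding real_norm_def abs_less_iff by linarith
 qed auto
 moreover have "(INF m\<in>{n..}. a m) <= a n" by (rule cINF_lower[OF bd]) auto
 moreover have "a n < L + e / 2" using n0[OF n] unfolding real_norm_def abs_less_iff by linarith
 ultimately show "norm ((INF m\<in>{n..}. a m) - L) < e" using e unfolding real_norm_def by linarith
qed
qed

locale function_space =
 fixes X :: "('a::euclidean_space => complex) set" and N :: "('a => complex) => real"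
 assumes bfs: "banach_function_space X N"
begin

lemma bfs_axioms:
 "X \<subseteq> L0" "(%x. 0) \<in> X"
 "\<forall>f\<in>X. \<forall>g\<in>X. (%x. f x + g x) \<in> X \<and> N (%x. f x + g x) <= N f + N g"
 "ALL c. \<forall>f\<in>X. (%x. c * f x) \<in> X \<and> N (%x. c * f x) = norm c * N f"
 "\<forall>f\<in>X. 0 <= N f \<and> (N f = 0 \<longleftrightarrow> (AE x. f x = 0))"
 "\<forall>f\<in>X. \<forall>g\<in>L0. (AE x. norm (g x) <= norm (f x)) --> g \<in> X \<and> N g <= N f"
 "\<forall>(F :: nat => 'a => real) G.
    (ALL n. (%x. of_real (F n x)) \<in> X) \<and>
    (AE x. ALL n. 0 <= F n x \<and> F n x <= F (Suc n) x) \<and>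
    (AE x. (%n. F n x) ---> G x) \<and>
    bdd_above (range (%n. N (%x. of_real (F n x)))) -->
    (%x. of_real (G x)) \<in> X \<and>
    N (%x. of_real (G x)) = (SUP n. N (%x. of_real (F n x)))"
 "\<forall>E\<in>sets lebesgue. 0 < vol E -->
    (\<exists>F\<in>sets lebesgue. F \<subseteq> E \<and> 0 < vol F \<and> ind F \<in> X)"
 using bfs unfolding banach_function_space_def by - (elim conjE, assumption)+

lemma X_measurable [measurable_dest]: "f \<in> X ==> f \<in> Lmeas"
 using bfs_axioms(1) unfolding L0_def by blast

lemma X_zero: "(%x. 0) \<in> X"
 by (rule bfs_axioms(2))

lemma X_add: "f \<in> X ==> g \<in> X ==> (%x. f x + g x) \<in> X"
 and N_add: "f \<in> X ==> g \<in> X ==> N (%x. f x + g x) <= N f + N g"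
 using bfs_axioms(3) by blast+

lemma X_cmult: "f \<in> X ==> (%x. c * f x) \<in> X"
 and N_cmult: "f \<in> X ==> N (%x. c * f x) = norm c * N f"
 using bfs_axioms(4) by blast+

lemma N_nonneg: "f \<in> X ==> 0 <= N f"
 and N_eq_0: "f \<in> X ==> N f = 0 \<longleftrightarrow> (AE x. f x = 0)"
 using bfs_axioms(5) by blast+

lemma X_ideal:
 assumes "f \<in> X" "g \<in> Lmeas" "AE x. norm (g x) <= norm (f x)"
 shows "g \<in> X" "N g <= N f"
 using bfs_axioms(6) assms unfolding L0_def by blast+

lemma X_diff:
 assumes "f \<in> X" "g \<in> X"
 shows "(%x. f x - g x) \<in> X" "N (%x. f x - g x) <= N f + N g"
 using X_add[OF assms(1) X_cmult[OF assms(2), of "-1"]] N_add[OF assms(1) X_cmult[OF assms(2), of "-1"]]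
  N_cmult[OF assms(2), of "-1"] by simp_all

lemma N_diff_commute:
 assumes "f \<in> X" "g \<in> X"
 shows "N (%x. f x - g x) = N (%x. g x - f x)"
 using N_cmult[OF X_diff(1)[OF assms], of "-1"] by simp

lemma N_triangle:
 assumes "f \<in> X" "g \<in> X" "h \<in> X"
 shows "N (%x. f x - h x) <= N (%x. f x - g x) + N (%x. g x - h x)"
 using N_add[OF X_diff(1)[OF assms(1,2)] X_diff(1)[OF assms(2,3)]] by simp

lemma X_ideal_mult:
 assumes "f \<in> X" "g \<in> Lmeas" "AE x. norm (g x) <= C * norm (f x)" "0 <= C"
 shows "g \<in> X" "N g <= C * N f"
proof -
have 1: "AE x. norm (g x) <= norm (complex_of_real C * f x)"
 using assms(3,4) by (simp add: norm_mult)
show "g \<in> X" by (rule X_ideal(1)[OF X_cmult[OF assms(1), of "of_real C"] assms(2) 1])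
show "N g <= C * N f"
 using X_ideal(2)[OF X_cmult[OF assms(1), of "of_real C"] assms(2) 1] N_cmult[OF assms(1), of "of_real C"] assms(4)
 by simp
qed

lemma X_cong:
 assumes "f \<in> X" "g \<in> Lmeas" "AE x. g x = f x"
 shows "g \<in> X" "N g = N f"
proof -
have 1: "AE x. norm (g x) <= norm (f x)" using assms(3) by eventually_elim simp
show g: "g \<in> X" by (rule X_ideal(1)[OF assms(1,2) 1])
have 2: "AE x. norm (f x) <= norm (g x)" using assms(3) by eventually_elim simp
show "N g = N f"
 using X_ideal(2)[OF assms(1,2) 1] X_ideal(2)[OF g X_measurable[OF assms(1)] 2] by simp
qed

lemma X_norm:
 assumes "f \<in> X"
 shows "(%x. of_real (norm (f x))) \<in> X" "N (%x. of_real (norm (f x))) = N f"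
proof -
have m: "(%x. complex_of_real (norm (f x))) \<in> Lmeas"
 using X_measurable[OF assms] by simp
show 1: "(%x. of_real (norm (f x))) \<in> X" by (rule X_ideal(1)[OF assms m]) simp
have "N f <= N (%x. of_real (norm (f x)))" by (rule X_ideal(2)[OF 1 X_measurable[OF assms]]) simp
then show "N (%x. of_real (norm (f x))) = N f" using X_ideal(2)[OF assms m] by simp
qed

lemma X_restr: "f \<in> X ==> A \<in> sets lebesgue ==> restr A f \<in> X"
 and N_restr: "f \<in> X ==> A \<in> sets lebesgue ==> N (restr A f) <= N f"
 by (rule X_ideal[of f]; simp add: X_measurable restr_def)+

lemma X_sum:
 assumes "finite I" "!!i. i \<in> I ==> f i \<in> X"
 shows "(%x. \<Sum>i\<in>I. f i x) \<in> X \<and> N (%x. \<Sum>i\<in>I. f i x) <= (\<Sum>i\<in>I. N (f i))"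
 using assms
proof (induction I)
case empty
then show ?case using X_zero N_eq_0[OF X_zero] by simp
next
case (insert i I)
then have IH: "(%x. \<Sum>i\<in>I. f i x) \<in> X" "N (%x. \<Sum>i\<in>I. f i x) <= (\<Sum>i\<in>I. N (f i))" and fi: "f i \<in> X"
 by auto
show ?case using X_add[OF fi IH(1)] N_add[OF fi IH(1)] IH(2) insert.hyps by simp
qed

lemma X_monotone_limit:
 assumes "!!n. (%x. of_real (F n x)) \<in> X"
  and "AE x. \<forall>n::nat. 0 <= F n x \<and> F n x <= F (Suc n) x"
  and "AE x. (%n. F n x) ---> G x"
  and "!!n. N (%x. of_real (F n x)) <= c"
 shows "(%x. of_real (G x)) \<in> X" "N (%x. of_real (G x)) = (SUP n. N (%x. of_real (F n x)))"
  "N (%x. of_real (G x)) <= c"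
proof -
have bdd: "bdd_above (range (%n. N (%x. of_real (F n x))))"
 using assms(4) by (intro bdd_aboveI[of _ c]) auto
have *: "(%x. of_real (G x)) \<in> X \<and> N (%x. of_real (G x)) = (SUP n. N (%x. of_real (F n x)))"
 using bfs_axioms(7)[rule_format, of F G] assms(1-3) bdd by blast
then show "(%x. of_real (G x)) \<in> X" "N (%x. of_real (G x)) = (SUP n. N (%x. of_real (F n x)))"
 by blast+
show "N (%x. of_real (G x)) <= c"
 using * assms(4) by (auto intro: cSUP_least)
qed

text \<open>
 Apply the monotone Fatou property to the infima of the tails of \<open>|h n|\<close>.
\<close>

lemma X_fatou:
 assumes h: "!!n::nat. h n \<in> X" "!!n. N (h n) <= c"
  and lim: "AE x. (%n. h n x) ---> g x" and g: "g \<in> Lmeas"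
 shows "g \<in> X" "N g <= c"
proof -
define F where "F n x = (INF m\<in>{n..}. norm (h m x))" for n x
have bd: "bdd_below ((%m. norm (h m x)) ` {n..})" for n x
 by (intro bdd_belowI[of _ 0]) auto
have F0: "0 <= F n x" for n x unfolding F_def by (rule cINF_greatest) auto
have Fle: "F n x <= norm (h n x)" for n x unfolding F_def by (rule cINF_lower[OF bd]) auto
have Fm: "F n \<in> Lmeas" for n
 unfolding F_def using X_measurable[OF h(1)] bd by (intro borel_measurable_cINF) auto
have FX: "(%x. complex_of_real (F n x)) \<in> X" "N (%x. complex_of_real (F n x)) <= N (h n)" for n
 by (rule X_ideal[OF h(1)[of n]]; use Fm[of n] F0 Fle in simp)+
have inc: "F n x <= F (Suc n) x" for n x
 unfolding F_def by (rule cINF_superset_mono[OF _ bd]) auto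
have limF: "AE x. (%n. F n x) ---> norm (g x)"
 using lim
proof eventually_elim
 case (elim x)
 show ?case unfolding F_def by (rule INF_tail_tendsto) (use tendsto_norm[OF elim] in auto)
qed
have Nc: "N (%x. complex_of_real (F n x)) <= c" for n using FX(2)[of n] h(2)[of n] by linarith
have mon: "AE x. ALL n. 0 <= F n x \<and> F n x <= F (Suc n) x" using F0 inc by simp
note gX = X_monotone_limit[OF FX(1) mon limF Nc]
show "g \<in> X" by (rule X_ideal(1)[OF gX(1) g]) simp
have "N g <= N (%x. complex_of_real (norm (g x)))" by (rule X_ideal(2)[OF gX(1) g]) simp
then show "N g <= c" using gX(3) by simp
qed

text \<open>
 Otherwise infinitely many disjoint pieces \<open>f 1\<^bsub>E n - E m\<^esub>\<close> have norm
 bounded below by some \<open>delta\<close>; by \<open>s\<close>-concavity the sum of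
 \<open>J\<close> of them has norm at least \<open>J\<^bsup>1/s\<^esup> delta\<close>, yet it is
 dominated by \<open>f\<close>.
\<close>

lemma X_order_continuous:
 assumes conc: "s_concave s X N" and s: "0 < s" and f: "f \<in> X"
  and E: "!!n::nat. E n \<in> sets lebesgue" "!!n. E (Suc n) \<subseteq> E n" "AE x. EX n. x ~: E n"
 shows "(%n. N (restr (E n) f)) ---> 0"
proof -
have dec: "E m \<subseteq> E n" if "n <= m" for n m using that by (rule lift_Suc_antimono_le[of E, OF E(2)])
have small: "EX n. N (restr (E n) f) < delta" if delta: "0 < delta" for delta
proof (rule ccontr)
 assume "\<not> ?thesis"
 then have ge: "delta <= N (restr (E n) f)" for n by (simp add: not_less)
 have piece: "\<exists>m\<ge>n. delta / 2 <= N (restr (E n - E m) f)" for n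
 proof (rule ccontr)
  assume "\<not> ?thesis"
  then have lt: "N (restr (E n - E m) f) <= delta / 2" if "n <= m" for m using that by force
  have "N (restr (E n) f) <= delta / 2"
  proof (rule X_fatou(2)[of "%k. restr (E n - E (n + k)) f"])
   show "restr (E n - E (n + k)) f \<in> X" for k using E f by (intro X_restr) auto
   show "N (restr (E n - E (n + k)) f) <= delta / 2" for k by (rule lt) simp
   show "restr (E n) f \<in> Lmeas" using E f by (auto simp: X_measurable)
   show "AE x. (%k. restr (E n - E (n + k)) f x) ---> restr (E n) f x"
    using E(3)
   proof eventually_elim
    case (elim x)
    then obtain k where k: "x ~: E k" by blast
    have "\<forall>\<^sub>F j in sequentially. restr (E n) f x = restr (E n - E (n + j)) f x"
     unfolding eventually_sequentially
    proof (intro exI[of _ k] allI impI)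
     fix j assume "k <= j"
     then have "x ~: E (n + j)" using dec[of k "n + j"] k by auto
     then show "restr (E n) f x = restr (E n - E (n + j)) f x" by (simp add: restr_def)
    qed
    with tendsto_const show ?case by (rule Lim_transform_eventually)
   qed
  qed
  then show False using ge[of n] delta by simp
 qed
 have claim: "\<exists>m\<ge>n. real J * (delta / 2) powr s <= N (restr (E n - E m) f) powr s" for n J
 proof (induction J)
  case 0
  then show ?case by auto
 next
  case (Suc J)
  then obtain m where m: "n <= m" "real J * (delta / 2) powr s <= N (restr (E n - E m) f) powr s" by blast
  obtain m' where m': "m <= m'" "delta / 2 <= N (restr (E m - E m') f)" using piece by blast
  let ?u = "restr (E n - E m) f" and ?v = "restr (E m - E m') f"
  have X: "?u \<in> X" "?v \<in> X" using E f by (auto intro: X_restr)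
  have eq: "(norm (?u x) powr s + norm (?v x) powr s) powr (1 / s) = norm (restr (E n - E m') f x)" for x
   using dec[OF m(1)] dec[OF m'(1)] s by (auto simp: restr_def powr_powr)
  have "(N ?u powr s + N ?v powr s) powr (1 / s) <= N (%x. of_real (norm (restr (E n - E m') f x)))"
   using conc X unfolding s_concave_def eq[symmetric] by blast
  also have "... = N (restr (E n - E m') f)" using E f by (intro X_norm(2) X_restr) auto
  finally have "((N ?u powr s + N ?v powr s) powr (1 / s)) powr s <= N (restr (E n - E m') f) powr s"
   using s by (intro powr_mono2) auto
  then have "N ?u powr s + N ?v powr s <= N (restr (E n - E m') f) powr s"
   using s by (simp add: powr_powr)
  moreover have "(delta / 2) powr s <= N ?v powr s" using m'(2) delta s by (intro powr_mono2) auto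
  ultimately have "real (Suc J) * (delta / 2) powr s <= N (restr (E n - E m') f) powr s"
   using m(2) by (simp add: algebra_simps)
  then show ?case using m(1) m'(1) order_trans by blast
 qed
 obtain J :: nat where J: "N f powr s / (delta / 2) powr s < real J" using reals_Archimedean2 by blast
 obtain m where m: "real J * (delta / 2) powr s <= N (restr (E 0 - E m) f) powr s" using claim by blast
 also have "... <= N f powr s" using E f s by (intro powr_mono2 N_restr N_nonneg X_restr) auto
 finally show False using J delta by (simp add: field_simps)
qed
show ?thesis
proof (rule LIMSEQ_I)
 fix e :: real assume "0 < e"
 then obtain n0 where n0: "N (restr (E n0) f) < e" using small by blast
 show "EX no. \<forall>n\<ge>no. norm (N (restr (E n) f) - 0) < e"
 proof (intro exI[of _ n0] allI impI)
  fix n assume "n0 <= n"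
  then have "E n \<subseteq> E n0" by (rule dec)
  then have "N (restr (E n) f) <= N (restr (E n0) f)"
   using E f by (intro X_ideal(2) X_restr restr_measurable X_measurable AE_I2) (auto simp: restr_def)
  moreover have "0 <= N (restr (E n) f)" using E f by (intro N_nonneg X_restr) auto
  ultimately show "norm (N (restr (E n) f) - 0) < e" using n0 by simp
 qed
qed
qed

end

locale maximal_function_space = function_space +
 assumes MX: "maximal_bounded_on X N"
begin

definition M_const :: real where
 "M_const = (SOME C. \<forall>f\<in>X.
   (AE x. maximal f x < \<infinity>) \<and>
   (%x. of_real (enn2real (maximal f x))) \<in> X \<and>
   N (%x. of_real (enn2real (maximal f x))) <= C * N f)"

lemma M_bound:
 assumes "f \<in> X"
 shows "AE x. maximal f x < \<infinity>" "(%x. of_real (enn2real (maximal f x))) \<in> X"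
  "N (%x. of_real (enn2real (maximal f x))) <= M_const * N f"
proof -
have "EX C. \<forall>f\<in>X. (AE x. maximal f x < \<infinity>) \<and>
  (%x. of_real (enn2real (maximal f x))) \<in> X \<and>
  N (%x. of_real (enn2real (maximal f x))) <= C * N f"
 using MX unfolding maximal_bounded_on_def .
from someI_ex[OF this] assms
show "AE x. maximal f x < \<infinity>" "(%x. of_real (enn2real (maximal f x))) \<in> X"
 "N (%x. of_real (enn2real (maximal f x))) <= M_const * N f"
 unfolding M_const_def by blast+
qed

text \<open>
 Saturation gives one set of positive measure whose indicator lies in \<open>X\<close>; the maximal
 function of this indicator is bounded below on any cube.
\<close>

lemma indicator_cube_in_X: "(%x. ind (hcube a l) x) \<in> X"
proof -
have "0 < vol (UNIV :: 'a set)" by simp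
then obtain F where F: "F \<in> sets lebesgue" "0 < vol F" "ind F \<in> X"
 using bfs_axioms(8)[rule_format, of UNIV] by auto
let ?P = "%n::nat. hcube ((- real n) *\<^sub>R One) (2 * real n) :: 'a set"
have inP: "x \<in> ?P n" if "norm x < real n" for n and x :: 'a
 unfolding hcube_def
proof (intro CollectI ballI)
 fix i :: 'a assume i: "i \<in> Basis"
 have "\<bar>x \<bullet> i\<bar> < real n" using Basis_le_norm[OF i, of x] that by linarith
 then show "((- real n) *\<^sub>R One) \<bullet> i <= x \<bullet> i \<and> x \<bullet> i < ((- real n) *\<^sub>R One) \<bullet> i + 2 * real n"
  using i by (simp add: abs_less_iff)
qed
have "EX n. 0 < vol (F \<inter> ?P n)"
proof (rule ccontr)
 assume "\<not> ?thesis"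
 then have "F \<inter> ?P n \<in> null_sets lebesgue" for n using F(1) by (auto simp: null_sets_def)
 then have "(\<Union>n. F \<inter> ?P n) \<in> null_sets lebesgue" by (intro null_sets_UN)
 moreover have "(\<Union>n. F \<inter> ?P n) = F"
 proof
  show "F \<subseteq> (\<Union>n. F \<inter> ?P n)"
  proof
   fix x assume "x \<in> F"
   moreover obtain n :: nat where "norm x < real n" using reals_Archimedean2 by blast
   ultimately show "x \<in> (\<Union>n. F \<inter> ?P n)" using inP by blast
  qed
 qed blast
 ultimately show False using F(2) by auto
qed
then obtain n0 where n0: "0 < vol (F \<inter> ?P n0)" by blast
obtain R where R: "\<forall>x\<in>hcube a l. norm x <= R" using bounded_hcube[of a l] unfolding bounded_iff by blast
obtain n1 :: nat where n1: "R < real n1" using reals_Archimedean2 by blast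
define n where "n = max (max n0 n1) 1"
have "?P n0 \<subseteq> ?P n"
 by (auto simp: hcube_def n_def)
then have "vol (F \<inter> ?P n0) <= vol (F \<inter> ?P n)"
 using F(1) by (intro emeasure_mono) auto
then have posn: "0 < vol (F \<inter> ?P n)" using n0 by simp
have sub: "hcube a l \<subseteq> ?P n"
proof
 fix x assume "x \<in> hcube a l"
 then have "norm x < real n" using R n1 by (force simp: n_def)
 then show "x \<in> ?P n" by (rule inP)
qed
let ?f = "ind F :: 'a => complex"
have mass: "mass ?f (?P n) = vol (F \<inter> ?P n)"
proof -
 have "mass ?f (?P n) = (LN x. ind (F \<inter> ?P n) x)"
  by (intro nn_integral_cong) (auto split: split_indicator)
 then show ?thesis using F(1) by simp
qed
have le1: "maximal ?f x <= ennreal 1" for x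
 by (rule maximal_le) (auto split: split_indicator)
define q where "q = (2 * real n) ^ DIM('a)"
have q: "0 < q" by (simp add: q_def n_def)
have "vol (F \<inter> ?P n) <= vol (?P n)" using F(1) by (intro emeasure_mono) auto
also have "... = ennreal q" by (subst emeasure_hcube) (auto simp: q_def)
finally obtain mu where mu: "vol (F \<inter> ?P n) = ennreal mu" "0 <= mu"
 by (cases "vol (F \<inter> ?P n)") (auto simp: top_unique)
then have mu0: "0 < mu" using posn by (cases "mu = 0") auto
have ge: "mu <= q * enn2real (maximal ?f x)" if "x \<in> hcube a l" for x
proof -
 have "ennreal mu <= ennreal q * maximal ?f x"
  using maximal_ge_hcube[of x "(- real n) *\<^sub>R One" "2 * real n" ?f] sub that mass mu by (auto simp: q_def)
 also have "maximal ?f x = ennreal (enn2real (maximal ?f x))"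
  using le_less_trans[OF le1[of x] ennreal_less_top] by simp
 finally show ?thesis using q by (simp add: ennreal_mult[symmetric])
qed
show ?thesis
proof (rule X_ideal_mult(1)[OF M_bound(2)[OF F(3)], of _ "q / mu"])
 show "AE x. norm (ind (hcube a l) x :: complex) <= q / mu * norm (complex_of_real (enn2real (maximal ?f x)))"
  using ge mu0 q by (intro AE_I2) (auto split: split_indicator simp: field_simps)
qed (use q mu0 in auto)
qed

text \<open>
 On the cube, the maximal function of \<open>f\<close> is at least the mean of \<open>|f|\<close>
 over the cube.
\<close>

lemma X_cube_bound:
 assumes l: "0 < l"
 obtains C where "0 <= C" "!!f. f \<in> X ==> mass f (hcube a l) <= ennreal (C * N f)"
proof -
let ?i = "%x. ind (hcube a l) x :: complex"
define q where "q = l ^ DIM('a)"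
have q: "0 < q" using l by (simp add: q_def)
have emq: "vol (hcube a l) = ennreal q" using l by (subst emeasure_hcube) (auto simp: q_def)
have iX: "?i \<in> X" by (rule indicator_cube_in_X)
have ipos: "0 < N ?i"
proof -
 have "\<not> (AE x. ?i x = 0)"
 proof
  assume "AE x. ?i x = 0"
  then have "AE x. x ~: hcube a l" by eventually_elim (auto split: split_indicator_asm)
  then have "vol (hcube a l) = 0" by (subst (asm) AE_iff_measurable[OF _ refl]) auto
  then show False using emq q by simp
 qed
 then show ?thesis using N_eq_0[OF iX] N_nonneg[OF iX] by linarith
qed
show thesis
proof (rule that[of "q * \<bar>M_const\<bar> / N ?i"])
 fix f assume f: "f \<in> X"
 have "\<exists>x\<in>hcube a l. maximal f x < \<infinity>"
 proof (rule ccontr)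
  assume no: "\<not> ?thesis"
  have "AE x. x ~: hcube a l" using M_bound(1)[OF f] by eventually_elim (use no in auto)
  then have "vol (hcube a l) = 0" by (subst (asm) AE_iff_measurable[OF _ refl]) auto
  then show False using emq q by simp
 qed
 then obtain x0 where x0: "x0 \<in> hcube a l" "maximal f x0 < \<infinity>" by blast
 have "mass f (hcube a l) <= ennreal q * maximal f x0"
  using maximal_ge_hcube[OF x0(1)] by (simp add: q_def)
 also have "... < \<infinity>" using x0(2) by (simp add: ennreal_mult_less_top)
 finally obtain mu where mu: "mass f (hcube a l) = ennreal mu" "0 <= mu"
  by (cases "mass f (hcube a l)") auto
 have "AE x. norm (complex_of_real mu * ?i x) <= q * norm (complex_of_real (enn2real (maximal f x)))"
  using M_bound(1)[OF f]
 proof eventually_elim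
  case (elim x)
  show ?case
  proof (cases "x \<in> hcube a l")
   case True
   have "ennreal mu <= ennreal q * maximal f x" using maximal_ge_hcube[OF True, of f] mu by (simp add: q_def)
   also have "maximal f x = ennreal (enn2real (maximal f x))" using elim by simp
   finally have "mu <= q * enn2real (maximal f x)" using q by (simp add: ennreal_mult[symmetric])
   then show ?thesis using True mu by simp
  qed (use q in simp)
 qed
 then have "N (%x. complex_of_real mu * ?i x) <= q * N (%x. of_real (enn2real (maximal f x)))"
  by (intro X_ideal_mult(2)[OF M_bound(2)[OF f]]) (use q in auto)
 also have "... <= q * (M_const * N f)" using M_bound(3)[OF f] q by (intro mult_left_mono) auto
 also have "... <= q * (\<bar>M_const\<bar> * N f)" using q N_nonneg[OF f] by (intro mult_left_mono mult_right_mono) auto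
 finally have "mu * N ?i <= q * (\<bar>M_const\<bar> * N f)" using N_cmult[OF iX, of "of_real mu"] mu(2) by simp
 then have "mu <= q * \<bar>M_const\<bar> / N ?i * N f" using ipos by (simp add: field_simps)
 then show "mass f (hcube a l) <= ennreal (q * \<bar>M_const\<bar> / N ?i * N f)" using mu by (simp add: ennreal_leI)
qed (use q ipos in auto)
qed

lemma Linf_c_in_X:
 assumes "f \<in> Linf_c"
 shows "f \<in> X"
proof -
obtain B R where BR: "0 < B" "0 < R" "!!x. norm (f x) <= B" "!!x. f x ~= 0 ==> norm x <= R"
 using Linf_cE[OF assms] by blast
let ?P = "hcube ((- (R + 1)) *\<^sub>R One) (2 * (R + 1)) :: 'a set"
have inP: "x \<in> ?P" if "norm x <= R" for x :: 'a
 unfolding hcube_def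
proof (intro CollectI ballI)
 fix i :: 'a assume i: "i \<in> Basis"
 have "\<bar>x \<bullet> i\<bar> <= R" using Basis_le_norm[OF i, of x] that by linarith
 then show "((- (R + 1)) *\<^sub>R One) \<bullet> i <= x \<bullet> i \<and> x \<bullet> i < ((- (R + 1)) *\<^sub>R One) \<bullet> i + 2 * (R + 1)"
  using i by (simp add: abs_le_iff)
qed
show ?thesis
proof (rule X_ideal_mult(1)[OF indicator_cube_in_X[of "(- (R + 1)) *\<^sub>R One" "2 * (R + 1)"], of _ B])
 show "AE x. norm (f x) <= B * norm (ind ?P x :: complex)"
 proof (rule AE_I2)
  fix x show "norm (f x) <= B * norm (ind ?P x :: complex)"
   using BR(3)[of x] BR(4)[of x] inP[of x] by (cases "f x = 0") auto
 qed
qed (use assms BR(1) in \<open>auto simp: Linf_c_measurable\<close>)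
qed

lemma AE_summable:
 assumes u: "!!n::nat. u n \<in> X" "summable (%n. N (u n))"
 shows "AE x. summable (%n. norm (u n x))"
proof -
let ?P = "%k::nat. hcube ((- real (Suc k)) *\<^sub>R One) (2 * real (Suc k)) :: 'a set"
have each: "AE x. x \<in> ?P k --> summable (%n. norm (u n x))" for k
proof -
 obtain C where C: "0 <= C" "!!f. f \<in> X ==> mass f (?P k) <= ennreal (C * N f)"
  by (rule X_cube_bound[of "2 * real (Suc k)" "(- real (Suc k)) *\<^sub>R One"]) auto
 have [measurable]: "u n \<in> Lmeas" for n by (rule X_measurable[OF u(1)])
 have "(LN x. (\<Sum>n. enorm (u n x) * ind (?P k) x)) = (\<Sum>n. mass (u n) (?P k))"
  by (subst nn_integral_suminf) auto
 also have "... <= (\<Sum>n. ennreal (C * N (u n)))" by (intro suminf_le C(2) u(1) summableI)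
 also have "... = ennreal (\<Sum>n. C * N (u n))"
  using C(1) N_nonneg[OF u(1)] u(2) by (intro suminf_ennreal2 summable_mult mult_nonneg_nonneg)
 also have "... < \<infinity>" by simp
 finally have "AE x. (\<Sum>n. enorm (u n x) * ind (?P k) x) ~= \<infinity>"
  by (intro nn_integral_PInf_AE) auto
 then show ?thesis
 proof eventually_elim
  case (elim x)
  show ?case
  proof
   assume "x \<in> ?P k"
   then have "(\<Sum>n. enorm (u n x)) ~= top" using elim by simp
   then show "summable (%n. norm (u n x))" by (intro summable_suminf_not_top) auto
  qed
 qed
qed
have "AE x. ALL k. x \<in> ?P k --> summable (%n. norm (u n x))"
 using each unfolding AE_all_countable by blast
then show ?thesis
proof eventually_elim
 case (elim x)
 obtain k :: nat where k: "norm x < real k" using reals_Archimedean2 by blast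
 have "x \<in> ?P k"
  unfolding hcube_def
 proof (intro CollectI ballI)
  fix i :: 'a assume i: "i \<in> Basis"
  have "\<bar>x \<bullet> i\<bar> < real (Suc k)" using Basis_le_norm[OF i, of x] k by simp
  then show "((- real (Suc k)) *\<^sub>R One) \<bullet> i <= x \<bullet> i \<and> x \<bullet> i < ((- real (Suc k)) *\<^sub>R One) \<bullet> i + 2 * real (Suc k)"
   using i by (simp add: abs_less_iff)
 qed
 then show ?case using elim by blast
qed
qed

text \<open>
 The increments are summable almost everywhere, and the Fatou property estimates the distance to
 the limit.
\<close>

lemma X_complete:
 assumes f: "!!n::nat. f n \<in> X" "!!n. N (%x. f (Suc n) x - f n x) <= (1/2) ^ n"
 obtains g where "g \<in> X" "!!n. N (%x. f n x - g x) <= 2 * (1/2) ^ n"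
  "AE x. (%n. f n x) ---> g x"
proof -
define g where "g x = lim (%n. f n x)" for x
have [measurable]: "f n \<in> Lmeas" for n by (rule X_measurable[OF f(1)])
have gm[measurable]: "g \<in> Lmeas" unfolding g_def by measurable
have uX: "(%x. f (Suc n) x - f n x) \<in> X" for n by (intro X_diff f)
have "summable (%n. N (%x. f (Suc n) x - f n x))"
proof (rule summable_comparison_test')
 show "summable (%n. (1/2::real) ^ n)" by (rule summable_geometric) simp
 show "norm (N (%x. f (Suc n) x - f n x)) <= (1/2) ^ n" for n
  using f(2)[of n] N_nonneg[OF uX[of n]] by simp
qed
from AE_summable[OF uX this] have lim: "AE x. (%n. f n x) ---> g x"
proof eventually_elim
 case (elim x)
 have "summable (%n. f (Suc n) x - f n x)" by (rule summable_norm_cancel[OF elim])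
 then have "convergent (%n. \<Sum>i<n. f (Suc i) x - f i x)" by (simp only: summable_iff_convergent)
 then have "convergent (%n. f n x - f 0 x)" by (simp only: sum_lessThan_telescope[of "%n. f n x"])
 then have "convergent (%n. f n x)" by (simp only: convergent_diff_const_right_iff)
 then show ?case by (simp add: g_def convergent_LIMSEQ_iff)
qed
have tail: "N (%x. f n x - f (n + k) x) <= 2 * (1/2) ^ n - 2 * (1/2) ^ (n + k)" for n k
proof (induction k)
 case 0
 then show ?case using N_eq_0[OF X_zero] by simp
next
 case (Suc k)
 have "N (%x. f n x - f (n + Suc k) x) <= N (%x. f n x - f (n + k) x) + N (%x. f (n + k) x - f (n + Suc k) x)"
  by (rule N_triangle[OF f(1) f(1) f(1)])
 moreover have "N (%x. f (n + k) x - f (n + Suc k) x) <= (1/2) ^ (n + k)"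
  using f(2)[of "n + k"] N_diff_commute[OF f(1)[of "n + k"] f(1)[of "Suc (n + k)"]] by simp
 ultimately show ?case using Suc by simp
qed
have dX: "(%x. f n x - g x) \<in> X \<and> N (%x. f n x - g x) <= 2 * (1/2) ^ n" for n
proof -
 have 1: "(%x. f n x - f (n + k) x) \<in> X" for k by (intro X_diff f)
 have 2: "N (%x. f n x - f (n + k) x) <= 2 * (1/2) ^ n" for k
 proof -
  have "0 <= (1/2::real) ^ (n + k)" by simp
  then show ?thesis using tail[of n k] by linarith
 qed
 have 3: "AE x. (%k. f n x - f (n + k) x) ---> f n x - g x"
  using lim
 proof eventually_elim
  case (elim x)
  have "(%k. f (n + k) x) ---> g x" using LIMSEQ_ignore_initial_segment[OF elim, of n] by (simp add: add.commute)
  then show ?case by (intro tendsto_intros)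
 qed
 show ?thesis using X_fatou[OF 1 2 3] by simp
qed
have "(%x. f 0 x - (f 0 x - g x)) \<in> X" by (rule X_diff(1)[OF f(1)[of 0] conjunct1[OF dX[of 0]]])
then have "g \<in> X" by simp
then show thesis using that dX lim by blast
qed

end

context dini_operator
begin

section \<open>The kernel representation off a closed set\<close>

definition rep_on :: "'a set => ('a => complex) => bool" where
 "rep_on F f \<longleftrightarrow> (AE x. x ~: F --> T f x = (LI y. K x y * f y))"

lemma gap_off_compact:
 assumes "compact F" "x ~: F"
 obtains delta where "0 < delta" "!!y. y \<in> F ==> delta <= norm (x - y)"
proof -
have "open (- F)" using assms(1) compact_imp_closed by blast
then obtain delta where "0 < delta" "ball x delta \<subseteq> - F" using assms(2) openE by blast
then show thesis using that[of delta] by (force simp: dist_norm subset_eq not_less)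
qed

lemma integrable_K_off:
 assumes "f \<in> Linf_c" "compact F" "!!y. y ~: F ==> f y = 0" "x ~: F"
 shows "integrable lebesgue (%y. K x y * f y)"
proof -
obtain delta where "0 < delta" "!!y. y \<in> F ==> delta <= norm (x - y)"
 using gap_off_compact[OF assms(2,4)] by blast
then show ?thesis
 by (intro Linf_c_integrable K_mult_Linf_c[OF assms(1), of delta]) (use assms(3) in blast)+
qed

lemma bounded_vanish_Linf_c:
 assumes "f \<in> Lmeas" "!!x. norm (f x) <= B" "!!x. x ~: F ==> f x = 0" "bounded F"
 shows "f \<in> Linf_c"
proof -
obtain R where R: "\<forall>x\<in>F. norm x <= R" using assms(4) unfolding bounded_iff by blast
show ?thesis by (rule Linf_cI[of f B R]) (use assms R in auto)
qed

text \<open>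
 Both sides pass to bounded pointwise limits of functions vanishing off a common compact set.
\<close>

lemma rep_on_limit:
 assumes F: "compact F" and fm: "!!n::nat. f n \<in> Lmeas"
  and B: "!!n x. norm (f n x) <= B" and van: "!!n x. x ~: F ==> f n x = 0"
  and lim: "!!x. (%n. f n x) ---> g x" and rp: "!!n. rep_on F (f n)"
 shows "rep_on F g"
proof -
have gm: "g \<in> Lmeas" by (rule borel_measurable_LIMSEQ_metric[OF fm]) (rule lim)
have B0: "0 <= B" using B[of 0 undefined] norm_ge_zero order_trans by blast
let ?w = "%x. complex_of_real B * ind F x"
have Fs: "F \<in> sets lebesgue" "bounded F"
 using fmeasurableD[OF lmeasurable_compact[OF F]] compact_imp_bounded[OF F] by auto
have wL: "?w \<in> Linf_c" by (rule Linf_c_indicator[OF Fs])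
have dom: "norm (f n x) <= norm (?w x)" for n x
 using B[of n x] van[of x n] B0 by (cases "x \<in> F") (auto simp: norm_mult)
have dom': "AE x. norm (f n x) <= norm (?w x)" for n
 by (rule AE_I2) (rule dom)
have lim': "AE x. (%n. f n x) ---> g x"
 by (rule AE_I2) (rule lim)
obtain r where r: "strict_mono r" "AE x. (%k. T (f (r k)) x) ---> T g x"
 using T_dominated[of ?w f g, OF Linf_c_subset_L2[OF wL] fm dom' gm lim'] by blast
have "AE x. ALL n. x ~: F --> T (f n) x = (LI y. K x y * f n y)"
 using rp unfolding AE_all_countable rep_on_def by blast
with r(2) show ?thesis
 unfolding rep_on_def
proof eventually_elim
 case (elim x)
 show ?case
 proof
  assume x: "x ~: F"
  have "(%k. LI y. K x y * f (r k) y) ---> (LI y. K x y * g y)"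
  proof (rule integral_dominated_convergence)
   show "integrable lebesgue (%y. norm (K x y * ?w y))"
    by (intro integrable_norm integrable_K_off[OF wL F _ x]) auto
   show "(%y. K x y * g y) \<in> Lmeas" using gm by measurable
   show "(%y. K x y * f (r k) y) \<in> Lmeas" for k using fm by measurable
   show "AE y. (%k. K x y * f (r k) y) ---> K x y * g y"
    using LIMSEQ_subseq_LIMSEQ[OF lim r(1)] by (intro AE_I2 tendsto_mult_left) (simp add: comp_def)
   show "AE y. norm (K x y * f (r k) y) <= norm (K x y * ?w y)" for k
    unfolding norm_mult[of "K x _"] by (intro AE_I2 mult_left_mono dom) auto
  qed
  moreover have "(%k. T (f (r k)) x) = (%k. LI y. K x y * f (r k) y)"
   using elim(2) x by auto
  ultimately show "T g x = (LI y. K x y * g y)"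
   using elim(1) LIMSEQ_unique by metis
 qed
qed
qed

lemma rep_on_cong:
 assumes "rep_on F f" "f \<in> Linf_c" "g \<in> Linf_c" "AE x. f x = g x"
 shows "rep_on F g"
proof -
have "(LI y. K x y * f y) = (LI y. K x y * g y)" for x
 by (rule integral_cong_AE) (use assms(2-4) in \<open>auto simp: Linf_c_measurable\<close>)
moreover have "AE x. T f x = T g x"
 by (rule T_cong) (use assms in \<open>auto intro: Linf_c_subset_L2\<close>)
ultimately show ?thesis
 using assms(1) unfolding rep_on_def by (auto elim: eventually_elim2)
qed

lemma rep_on_sum:
 assumes "finite I" "compact F" "!!i. i \<in> I ==> f i \<in> Linf_c" "!!i x. i \<in> I ==> x ~: F ==> f i x = 0"
  "!!i. i \<in> I ==> rep_on F (f i)"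
 shows "rep_on F (%x. \<Sum>i\<in>I. f i x)"
proof -
have "AE x. T (%x. \<Sum>i\<in>I. f i x) x = (\<Sum>i\<in>I. T (f i) x)"
 using T_sum[OF assms(1), of f] assms(3) Linf_c_subset_L2 by blast
moreover have "AE x. \<forall>i\<in>I. x ~: F --> T (f i) x = (LI y. K x y * f i y)"
 using assms(1,5) unfolding rep_on_def by (intro AE_finite_allI) auto
ultimately show ?thesis
 unfolding rep_on_def
proof eventually_elim
 case (elim x)
 show ?case
 proof
  assume x: "x ~: F"
  have "(LI y. K x y * (\<Sum>i\<in>I. f i y)) = (LI y. (\<Sum>i\<in>I. K x y * f i y))"
   by (simp add: sum_distrib_left)
  also have "... = (\<Sum>i\<in>I. LI y. K x y * f i y)"
   by (intro Bochner_Integration.integral_sum integrable_K_off[OF assms(3) assms(2) assms(4) x])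
  finally show "T (%x. \<Sum>i\<in>I. f i x) x = (LI y. K x y * (\<Sum>i\<in>I. f i y))"
   using elim x by simp
 qed
qed
qed

lemma rep_on_cmult:
 assumes "f \<in> L2" "rep_on F f"
 shows "rep_on F (%x. c * f x)"
proof -
have "(LI y. K x y * (c * f y)) = c * (LI y. K x y * f y)" for x
proof -
 have "(LI y. K x y * (c * f y)) = (LI y. c * (K x y * f y))"
  by (simp add: mult_ac)
 then show ?thesis by (cases "c = 0") simp_all
qed
then show ?thesis
 using T_cmult[OF assms(1), of c] assms(2) unfolding rep_on_def by (auto elim: eventually_elim2)
qed

lemma rep_on_box:
 assumes "box a' b' \<subseteq> box a b"
 shows "rep_on (cbox a b) (ind (box a' b'))"
proof -
obtain phi :: "nat => 'a => complex"
 where phi: "!!n. phi n \<in> Cc_infty" "!!n. supp (phi n) \<subseteq> cbox a' b'" "!!n x. norm (phi n x) <= 1" "!!n x. x ~: box a' b' ==> phi n x = 0"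
 "!!x. (%n. phi n x) ---> ind (box a' b') x"
 by (rule smooth_approximation_box[of a' b']) (rule that)
have sub: "box a' b' \<subseteq> cbox a b" using assms box_subset_cbox[of a b] by blast
have sup: "supp (phi n) \<subseteq> cbox a b" for n
 unfolding supp_def using phi(4) sub by (intro closure_minimal) auto
show ?thesis
proof (rule rep_on_limit[of "cbox a b" phi 1])
 show "phi n \<in> Lmeas" for n
 proof -
  have "Ck 0 (phi n)" using phi(1) unfolding Cc_infty_def by blast
  then have "phi n \<in> borel_measurable borel" by (simp add: borel_measurable_continuous_onI)
  then show ?thesis by (intro measurable_completion) simp
 qed
 show "rep_on (cbox a b) (phi n)" for n
  using rep[OF phi(1)[of n]] unfolding rep_on_def by eventually_elim (use sup[of n] in blast)
 show "phi n x = 0" if "x ~: cbox a b" for n x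
  using phi(4) sub that by blast
qed (use phi in auto)
qed

text \<open>
 The sets with this property contain the boxes and are closed under complements and disjoint
 unions, so the \<open>\<pi>\<close>-\<open>\<lambda>\<close> theorem applies.
\<close>

lemma rep_on_borel:
 assumes A: "A \<in> sets borel"
 shows "rep_on (cbox a b) (ind (A \<inter> box a b))"
proof -
let ?G = "range (%(a, b). box a b :: 'a set)"
have sb: "sets borel = sigma_sets UNIV ?G" by (subst borel_eq_box) (simp add: sets_measure_of)
have bm: "A \<in> sets borel" if "A \<in> sigma_sets UNIV ?G" for A :: "'a set" using that sb by simp
have iL: "(ind (A \<inter> box a b) :: 'a => complex) \<in> Linf_c" if "A \<in> sets borel" for A
 using Linf_c_indicator[of "A \<inter> box a b" 1] that by (auto simp: bounded_Int)
have int: "Int_stable ?G"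
 unfolding Int_stable_def
proof (intro ballI)
 fix U V :: "'a set" assume "U \<in> ?G" "V \<in> ?G"
 then obtain a1 b1 a2 b2 where "U = box a1 b1" "V = box a2 b2" by auto
 then show "U \<inter> V \<in> ?G" using rangeI[of "%(a, b). box a b :: 'a set" "(\<Sum>i\<in>Basis. max (a1 \<bullet> i) (a2 \<bullet> i) *\<^sub>R i, \<Sum>i\<in>Basis. min (b1 \<bullet> i) (b2 \<bullet> i) *\<^sub>R i)"]
  by (simp add: box_Int_box)
qed
have cl: "?G \<subseteq> Pow UNIV" by simp
have A': "A \<in> sigma_sets UNIV ?G" using A sb by simp
show ?thesis
 using int cl A'
proof (induct rule: sigma_sets_induct_disjoint)
 case (basic A)
 then obtain a1 b1 where "A = box a1 b1" by auto
 then obtain a' b' where e: "A \<inter> box a b = box a' b'"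
  using box_Int_box[of a1 b1 a b] by blast
 show ?case unfolding e by (rule rep_on_box) (use e in blast)
next
 case empty
 have e: "{} \<inter> box a b = box b b" by simp
 show ?case unfolding e by (rule rep_on_box) simp
next
 case (compl A)
 have "(ind ((UNIV - A) \<inter> box a b) :: 'a => complex) =
   (%x. \<Sum>i\<in>{False, True}. if i then (-1) * ind (A \<inter> box a b) x else ind (box a b) x)"
  by (auto simp: fun_eq_iff split: split_indicator)
 moreover have "rep_on (cbox a b) (%x. \<Sum>i\<in>{False, True}. if i then (-1) * ind (A \<inter> box a b) x else ind (box a b) x)"
 proof (rule rep_on_sum)
  fix i assume "i \<in> {False, True}"
  have 1: "(%x. (-1) * ind (A \<inter> box a b) x :: complex) \<in> Linf_c"
   by (intro Linf_c_cmult iL bm compl)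
  have 2: "(ind (box a b) :: 'a => complex) \<in> Linf_c" using iL[of UNIV] by simp
  show "(%x. if i then (-1) * ind (A \<inter> box a b) x else ind (box a b) x :: complex) \<in> Linf_c"
   using 1 2 by (cases i) (simp_all add: indicator_def[abs_def])
  have 3: "rep_on (cbox a b) (%x. (-1) * ind (A \<inter> box a b) x)"
   by (rule rep_on_cmult[OF Linf_c_subset_L2[OF iL[OF bm[OF compl(1)]]] compl(2)])
  have 4: "rep_on (cbox a b) (ind (box a b))" by (rule rep_on_box) simp
  show "rep_on (cbox a b) (%x. if i then (-1) * ind (A \<inter> box a b) x else ind (box a b) x)"
   using 3 4 by (cases i) simp_all
  fix x assume "x ~: cbox a b"
  then have "x ~: box a b" using box_subset_cbox[of a b] by blast
  then show "(if i then (-1) * ind (A \<inter> box a b) x else ind (box a b) x :: complex) = 0" by simp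
 qed auto
 ultimately show ?case by simp
next
 case (union A)
 show ?case
 proof (rule rep_on_limit[of "cbox a b" "%n. ind ((\<Union>i<n. A i) \<inter> box a b)" 1])
  have Am: "A i \<in> sets borel" for i using union(2) bm by blast
  show "ind ((\<Union>i<n. A i) \<inter> box a b) \<in> Lmeas" for n
  proof -
   have "(\<Union>i<n. A i) \<inter> box a b \<in> sets borel" using Am by auto
   then show ?thesis by (intro borel_measurable_indicator) (metis sets_completionI_sets sets_lborel)
  qed
  show "norm (ind ((\<Union>i<n. A i) \<inter> box a b) x :: complex) <= 1" for n x
   by (auto split: split_indicator)
  show "(ind ((\<Union>i<n. A i) \<inter> box a b) x :: complex) = 0" if "x ~: cbox a b" for n x
   using that box_subset_cbox[of a b] by (auto split: split_indicator)
  show "(%n. ind ((\<Union>i<n. A i) \<inter> box a b) x) ---> (ind (\<Union> (range A) \<inter> box a b) x :: complex)" for x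
  proof (cases "x \<in> \<Union> (range A) \<inter> box a b")
   case True
   then obtain i where i: "x \<in> A i" "x \<in> box a b" by blast
   have "\<forall>\<^sub>F n in sequentially. ind (\<Union> (range A) \<inter> box a b) x = (ind ((\<Union>i<n. A i) \<inter> box a b) x :: complex)"
    unfolding eventually_sequentially
   proof (intro exI[of _ "Suc i"] allI impI)
    fix n assume "Suc i <= n"
    then have "x \<in> (\<Union>i<n. A i) \<inter> box a b" using i by auto
    then show "ind (\<Union> (range A) \<inter> box a b) x = (ind ((\<Union>i<n. A i) \<inter> box a b) x :: complex)"
     using True by simp
   qed
   with tendsto_const show ?thesis by (rule Lim_transform_eventually)
  next
   case False
   then have "x ~: (\<Union>i<n. A i) \<inter> box a b" for n by blast
   then show ?thesis using False by simp
  qed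
  show "rep_on (cbox a b) (ind ((\<Union>i<n. A i) \<inter> box a b))" for n
  proof -
   have "(ind ((\<Union>i<n. A i) \<inter> box a b) :: 'a => complex) = (%x. \<Sum>i<n. ind (A i \<inter> box a b) x)"
   proof
    fix x
    have "disjoint_family_on (%i. A i \<inter> box a b) {..<n}"
     using union(1) unfolding disjoint_family_on_def by blast
    then show "(ind ((\<Union>i<n. A i) \<inter> box a b) x :: complex) = (\<Sum>i<n. ind (A i \<inter> box a b) x)"
     using indicator_UN_disjoint[of "{..<n}" "%i. A i \<inter> box a b" x] by (simp add: Int_UN_distrib2)
   qed
   moreover have "rep_on (cbox a b) (%x. \<Sum>i<n. ind (A i \<inter> box a b) x)"
   proof (rule rep_on_sum)
    fix i x assume "x ~: cbox a b"
    then have "x ~: box a b" using box_subset_cbox[of a b] by blast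
    then show "(ind (A i \<inter> box a b) x :: complex) = 0" by simp
   qed (use iL Am union(3) in auto)
   ultimately show ?thesis by simp
  qed
 qed auto
qed
qed

lemma rep_on_Linf_c:
 assumes f: "f \<in> Linf_c" and van: "!!x. x ~: box a b ==> f x = 0"
 shows "rep_on (cbox a b) f"
proof -
obtain B R where BR: "0 < B" "0 < R" "!!x. norm (f x) <= B" "!!x. f x ~= 0 ==> norm x <= R"
 using Linf_cE[OF f] by blast
have "(%x. Re (f x)) \<in> borel_measurable (completion lborel)" "(%x. Im (f x)) \<in> borel_measurable (completion lborel)"
 using f by measurable
then obtain u v where uv: "u \<in> borel_measurable lborel" "AE x in lborel. Re (f x) = u x"
 "v \<in> borel_measurable lborel" "AE x in lborel. Im (f x) = v x"
 using completion_ex_borel_measurable_real by metis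
define g0 where "g0 x = Complex (u x) (v x)" for x
define g where "g x = (if norm (g0 x) <= B \<and> x \<in> box a b then g0 x else 0)" for x
have "g0 = (%x. complex_of_real (u x) + \<i> * complex_of_real (v x))" by (rule ext) (simp add: g0_def Complex_eq)
then have g0m[measurable]: "g0 \<in> borel_measurable borel" using uv(1,3) by simp
have gm[measurable]: "g \<in> borel_measurable borel" unfolding g_def by measurable
have gB: "norm (g x) <= B" for x using BR(1) by (simp add: g_def)
have g0: "g x = 0" if "x ~: box a b" for x using that by (simp add: g_def)
have "AE x in lborel. f x = g x"
 using uv(2,4)
proof eventually_elim
 case (elim x)
 then have "g0 x = f x" by (simp add: g0_def complex_eq_iff)
 then show ?case using BR(3)[of x] van[of x] by (auto simp: g_def)
qed
then have fg: "AE x. g x = f x" by (intro AE_completion) (auto elim: eventually_mono)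
obtain S where S: "!!i. simple_function borel (S i)" "!!x. (%i. S i x) ---> g x"
 "!!i x. dist (S i x) 0 <= 2 * dist (g x) 0"
 using borel_measurable_implies_sequence_metric[OF gm, of 0] by auto
have S0: "S i x = 0" if "x ~: box a b" for i x using S(3)[of i x] g0[OF that] by simp
have SB: "norm (S i x) <= 2 * B" for i x using S(3)[of i x] gB[of x] by simp
have Sm: "S i \<in> Lmeas" for i
 using borel_measurable_simple_function[OF S(1)[of i]] by (intro measurable_completion) simp
have gL: "g \<in> Linf_c"
proof (rule bounded_vanish_Linf_c[of g B "box a b"])
 show "g \<in> Lmeas" using gm by (intro measurable_completion) simp
qed (use gB g0 in auto)
have "rep_on (cbox a b) g"
proof (rule rep_on_limit[of "cbox a b" S "2 * B"])
 show "S i x = 0" if "x ~: cbox a b" for i x using that S0 box_subset_cbox[of a b] by blast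
 show "rep_on (cbox a b) (S i)" for i
 proof -
  let ?V = "range (S i)" and ?A = "%c. S i -` {c}"
  have fin: "finite ?V" using S(1)[of i] by (simp add: simple_function_def)
  have Ab: "?A c \<in> sets borel" for c
   using measurable_sets[OF borel_measurable_simple_function[OF S(1)[of i]], of "{c}"] by simp
  have iL: "(ind (?A c \<inter> box a b) :: 'a => complex) \<in> Linf_c" for c
   using Linf_c_indicator[of "?A c \<inter> box a b" 1] Ab[of c] by (auto simp: bounded_Int)
  have eq: "S i x = (\<Sum>c\<in>?V. c * ind (?A c \<inter> box a b) x)" for x
  proof (cases "x \<in> box a b")
   case True
   have "(\<Sum>c\<in>?V. c * ind (?A c \<inter> box a b) x) = (\<Sum>c\<in>?V. if c = S i x then c else 0)"
    using True by (intro sum.cong) (auto split: split_indicator)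
   also have "... = S i x" using fin by (simp add: sum.delta)
   finally show ?thesis by simp
  qed (simp add: S0)
  have e: "(%x. \<Sum>c\<in>?V. c * ind (?A c \<inter> box a b) x) = S i"
   by (rule ext) (rule eq[symmetric])
  have "rep_on (cbox a b) (%x. \<Sum>c\<in>?V. c * ind (?A c \<inter> box a b) x)"
  proof (rule rep_on_sum[OF fin])
   show "(%x. c * ind (?A c \<inter> box a b) x) \<in> Linf_c" for c by (intro Linf_c_cmult iL)
   show "rep_on (cbox a b) (%x. c * ind (?A c \<inter> box a b) x)" for c
    by (intro rep_on_cmult Linf_c_subset_L2 iL rep_on_borel Ab)
   show "c * ind (?A c \<inter> box a b) x = 0" if "x ~: cbox a b" for c x
    using that box_subset_cbox[of a b] by (auto split: split_indicator)
  qed auto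
  then show ?thesis unfolding e .
 qed
qed (use SB Sm S(2) in auto)
then show ?thesis using rep_on_cong[OF _ gL f fg] by blast
qed

text \<open>
 Off \<open>F\<close> the function is cut along a fine grid: at a point of positive distance to
 \<open>F\<close>, all boxes that carry a part of \<open>f\<close> eventually stay away from it.
\<close>

theorem kernel_representation:
 assumes f: "f \<in> Linf_c" and F: "closed F" and van: "!!x. x ~: F ==> f x = 0"
 shows "AE x. x ~: F --> T f x = (LI y. K x y * f y)"
proof -
let ?h = "%n::nat. 1 / real (Suc n)" and ?d = "real DIM('a)"
have bdf: "bounded {x. f x ~= 0}" using f by (simp add: Linf_c_def)
define G where "G n = gridc 0 (?h n) ` {x. f x ~= 0}" for n
have finG: "finite (G n)" for n unfolding G_def by (rule finite_gridc[OF _ bdf]) simp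
define p where "p n c = restr (hcube c (?h n)) f" for n c
have pL: "p n c \<in> Linf_c" for n c unfolding p_def by (intro Linf_c_restr f) auto
define Q where "Q n c = cbox (c - ?h n *\<^sub>R One) (c + (2 * ?h n) *\<^sub>R One)" for n and c :: 'a
have rp: "rep_on (Q n c) (p n c)" for n c
 unfolding Q_def
proof (rule rep_on_Linf_c[OF pL])
 fix x assume x: "x ~: box (c - ?h n *\<^sub>R One) (c + (2 * ?h n) *\<^sub>R One)"
 have "x ~: hcube c (?h n)"
 proof
  assume h: "x \<in> hcube c (?h n)"
  have "(c - ?h n *\<^sub>R One) \<bullet> i < x \<bullet> i \<and> x \<bullet> i < (c + (2 * ?h n) *\<^sub>R One) \<bullet> i" if i: "i \<in> Basis" for i
  proof -
   have "0 < ?h n" "c \<bullet> i <= x \<bullet> i" "x \<bullet> i < c \<bullet> i + ?h n" using h i by (auto simp: hcube_def)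
   then show ?thesis using i by (simp add: inner_diff_left inner_add_left)
  qed
  then show False using x by (simp add: mem_box)
 qed
 then show "p n c x = 0" by (simp add: p_def restr_def)
qed
have dec: "f = (%x. \<Sum>c\<in>G n. p n c x)" for n
 unfolding p_def G_def by (rule ext, rule grid_decomposition) (use finG[of n] in \<open>simp_all add: G_def\<close>)
have "AE x. ALL n. T f x = (\<Sum>c\<in>G n. T (p n c) x)"
 unfolding AE_all_countable
proof
 fix n
 have "AE x. T (%x. \<Sum>c\<in>G n. p n c x) x = (\<Sum>c\<in>G n. T (p n c) x)"
  using T_sum[OF finG, of n "p n"] pL Linf_c_subset_L2 by blast
 then show "AE x. T f x = (\<Sum>c\<in>G n. T (p n c) x)" by (simp only: dec[symmetric])
qed
moreover have "AE x. ALL n. \<forall>c\<in>G n. x ~: Q n c --> T (p n c) x = (LI y. K x y * p n c y)"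
 unfolding AE_all_countable using rp finG unfolding rep_on_def by (intro allI AE_finite_allI) auto
ultimately show ?thesis
proof eventually_elim
 case (elim x)
 show ?case
 proof
  assume x: "x ~: F"
  have "open (- F)" using F by blast
  then obtain delta where delta: "0 < delta" "ball x delta \<subseteq> - F" using x openE by blast
  have far: "delta <= norm (x - y)" if "f y ~= 0" for y
   using that van delta(2) by (force simp: dist_norm subset_eq not_less)
  obtain n where n: "?h n < delta / (3 * ?d)" using nat_approx_posE[of "delta / (3 * ?d)"] delta(1) by auto
  have xQ: "x ~: Q n c" if "c \<in> G n" for c
  proof
   assume xq: "x \<in> Q n c"
   obtain y where y: "f y ~= 0" "c = gridc 0 (?h n) y" using \<open>c \<in> G n\<close> unfolding G_def by blast
   have yc: "y \<in> hcube c (?h n)" unfolding y(2) by (rule mem_own_cell) simp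
   have "norm (x - y) <= (\<Sum>i\<in>Basis. \<bar>(x - y) \<bullet> i\<bar>)" by (rule norm_le_l1)
   also have "... <= (\<Sum>i::'a\<in>Basis. 3 * ?h n)"
   proof (rule sum_mono)
    fix i :: 'a assume i: "i \<in> Basis"
    have "c \<bullet> i <= y \<bullet> i" "y \<bullet> i < c \<bullet> i + ?h n" using yc i by (auto simp: hcube_def)
    moreover have "c \<bullet> i - ?h n <= x \<bullet> i" "x \<bullet> i <= c \<bullet> i + 2 * ?h n"
     using xq i by (auto simp: Q_def mem_box inner_diff_left inner_add_left)
    moreover have "0 < ?h n" by simp
    ultimately show "\<bar>(x - y) \<bullet> i\<bar> <= 3 * ?h n" unfolding inner_diff_left abs_le_iff by linarith
   qed
   also have "... = 3 * ?d * ?h n" by simp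
   also have "... < delta" using n by (simp add: field_simps)
   finally show False using far[OF y(1)] by simp
  qed
  have int: "integrable lebesgue (%y. K x y * p n c y)" for c
   by (intro Linf_c_integrable K_mult_Linf_c[OF pL delta(1)] far) (auto simp: p_def restr_def split: if_splits)
  have "T f x = (\<Sum>c\<in>G n. T (p n c) x)" using elim(1) by blast
  also have "... = (\<Sum>c\<in>G n. LI y. K x y * p n c y)"
   by (rule sum.cong[OF refl]) (use elim(2) xQ in blast)
  also have "... = (LI y. (\<Sum>c\<in>G n. K x y * p n c y))"
   by (rule Bochner_Integration.integral_sum[symmetric]) (rule int)
  also have "... = (LI y. K x y * (\<Sum>c\<in>G n. p n c y))" by (simp add: sum_distrib_left)
  also have "... = (LI y. K x y * f y)" by (simp only: fun_cong[OF dec[of n], symmetric])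
  finally show "T f x = (LI y. K x y * f y)" .
 qed
qed
qed

end

section \<open>Size and oscillation of the kernel\<close>

lemma cball_lebesgue [measurable]: "cball z s \<in> sets lebesgue"
 by (rule fmeasurableD[OF lmeasurable_cball])

lemma ennreal_le_suminf: "f k <= suminf f" for f :: "nat => ennreal"
 using sum_le_suminf[of f "{k}"] by simp

lemma integral_indicator_hcube:
 fixes a :: "'a::euclidean_space" and c :: complex
 assumes "0 <= l"
 shows "(LI y. c * ind (hcube a l) y) = c * of_real (l ^ DIM('a))"
proof -
have fin: "vol (hcube a l) = ennreal (l ^ DIM('a))" by (rule emeasure_hcube[OF assms])
have int: "integrable lebesgue (%y. ind (hcube a l) y :: real)"
 by (subst integrable_indicator_iff) (use fin in auto)
have "(%y. c * ind (hcube a l) y) = (%y. ind (hcube a l) y *\<^sub>R c)"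
 by (auto simp: fun_eq_iff split: split_indicator)
then have "(LI y. c * ind (hcube a l) y) = (LI y. ind (hcube a l) y *\<^sub>R c)"
 by simp
also have "... = (LI y. ind (hcube a l) y) *\<^sub>R c"
 by (rule integral_scaleR_left) (rule int)
also have "(LI y. ind (hcube a l) y) = measure lebesgue (hcube a l)"
 by (subst Bochner_Integration.integral_indicator) simp
also have "... = l ^ DIM('a)" using fin assms by (simp add: measure_def)
finally show ?thesis by (simp add: scaleR_conv_of_real mult.commute)
qed

lemma disjoint_mass_le:
 assumes [measurable]: "f \<in> Lmeas" and p: "packing c r a l"
 shows "(\<Sum>k. mass f (hcube (c k) (r k))) <= mass f (hcube a l)"
proof -
have "(\<Sum>k. mass f (hcube (c k) (r k))) = mass f (UQ c r)"
 by (rule nn_integral_disjoint_family[symmetric]) (use p in \<open>auto simp: packing_def\<close>)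
also have "... <= mass f (hcube a l)" by (rule mass_mono) (use p in \<open>auto simp: packing_def\<close>)
finally show ?thesis .
qed

lemma mass_finite:
 assumes "f \<in> Linf_c"
 obtains m where "mass f A = ennreal m" "0 <= m"
proof -
have "mass f A <= mass f UNIV" by (rule mass_mono) simp
also have "mass f UNIV < \<infinity>"
 using Linf_c_integrable[OF assms] by (simp add: integrable_iff_bounded)
finally show thesis using that by (cases "mass f A") auto
qed

text \<open>
 \<open>hat a l\<close> is the concentric dilate of \<open>hcube a l\<close> by the factor \<open>8
 d + 1\<close>: points outside it have distance at least \<open>4 d l\<close> from the cube, four
 times the bound \<open>d l\<close> for the diameter.
\<close>

definition hatc :: "'a::euclidean_space => real => 'a" where
 "hatc a l = a - (4 * real DIM('a) * l) *\<^sub>R One"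

definition hatr :: "'a::euclidean_space itself => real => real" where
 "hatr _ l = (8 * real DIM('a) + 1) * l"

abbreviation hat :: "'a::euclidean_space => real => 'a set" where
 "hat a l \<equiv> hcube (hatc a l) (hatr TYPE('a) l)"

lemma hatr_pos: "0 < l ==> 0 < hatr TYPE('a::euclidean_space) l"
 by (simp add: hatr_def add_pos_pos)

lemma mem_hat:
 "x \<in> hat a l \<longleftrightarrow> (\<forall>i\<in>Basis. a \<bullet> i - 4 * real DIM('a) * l <= x \<bullet> i \<and> x \<bullet> i < a \<bullet> i + (4 * real DIM('a) + 1) * l)"
 for x a :: "'a::euclidean_space"
 by (simp add: hcube_def hatc_def hatr_def inner_diff_left algebra_simps)

lemma hcube_subset_hat: "hcube a l \<subseteq> hat (a::'a::euclidean_space) l"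
proof
fix x assume x: "x \<in> hcube a l"
then have l: "0 < l" by (rule hcube_imp_pos)
have "0 <= 4 * real DIM('a) * l" using l by simp
show "x \<in> hat a l"
 unfolding mem_hat
proof
 fix i :: 'a assume "i \<in> Basis"
 then have "a \<bullet> i <= x \<bullet> i" "x \<bullet> i < a \<bullet> i + l" using x by (auto simp: hcube_def)
 then show "a \<bullet> i - 4 * real DIM('a) * l <= x \<bullet> i \<and> x \<bullet> i < a \<bullet> i + (4 * real DIM('a) + 1) * l"
  using \<open>0 <= 4 * real DIM('a) * l\<close> unfolding distrib_right mult_1 by linarith
qed
qed

lemma hat_mono:
 assumes "0 < r" "hcube c r \<subseteq> hcube a l"
 shows "hat (c::'a::euclidean_space) r \<subseteq> hat a l"
proof
fix x assume x: "x \<in> hat c r"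
have le: "r <= l" by (rule hcube_subset_imp_le[OF assms])
show "x \<in> hat a l"
 unfolding mem_hat
proof
 fix i :: 'a assume i: "i \<in> Basis"
 have 1: "c \<bullet> i - 4 * real DIM('a) * r <= x \<bullet> i" "x \<bullet> i < c \<bullet> i + (4 * real DIM('a) + 1) * r"
  using x i unfolding mem_hat by blast+
 have 2: "a \<bullet> i <= c \<bullet> i" "c \<bullet> i + r <= a \<bullet> i + l"
  using assms hcube_subset_iff[OF assms(1), of c a l] i by blast+
 have 3: "4 * real DIM('a) * r <= 4 * real DIM('a) * l" using le by (intro mult_left_mono) auto
 show "a \<bullet> i - 4 * real DIM('a) * l <= x \<bullet> i \<and> x \<bullet> i < a \<bullet> i + (4 * real DIM('a) + 1) * l"
  using 1 2 3 unfolding distrib_right mult_1 by linarith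
qed
qed

lemma far_off_hat:
 fixes x y :: "'a::euclidean_space"
 assumes "x \<in> hcube c r" "y ~: hat c r"
 shows "4 * (real DIM('a) * r) <= norm (x - y)"
proof -
obtain i :: 'a where i: "i \<in> Basis"
 "\<not> (c \<bullet> i - 4 * real DIM('a) * r <= y \<bullet> i \<and> y \<bullet> i < c \<bullet> i + (4 * real DIM('a) + 1) * r)"
 using assms(2) unfolding mem_hat by blast
have "c \<bullet> i <= x \<bullet> i" "x \<bullet> i < c \<bullet> i + r" using assms(1) i(1) by (auto simp: hcube_def)
then have "4 * (real DIM('a) * r) <= \<bar>(x - y) \<bullet> i\<bar>"
 using i(2) by (auto simp: inner_diff_left algebra_simps abs_if)
also have "... <= norm (x - y)" by (rule Basis_le_norm[OF i(1)])
finally show ?thesis .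
qed

lemma dyadic_annulus:
 fixes t rho :: real
 assumes "0 < rho" "rho <= t"
 obtains k where "2 ^ k * rho <= t" "t < 2 ^ Suc k * rho"
proof -
have "EX n. t < 2 ^ n * rho"
proof -
 obtain n where "t / rho < 2 ^ n" using real_arch_pow[of 2 "t / rho"] by auto
 then show ?thesis using assms by (auto simp: field_simps)
qed
then obtain n where n: "t < 2 ^ n * rho" "!!m. m < n ==> \<not> t < 2 ^ m * rho"
 using exists_least_iff[of "%n. t < 2 ^ n * rho"] by blast
have "n ~= 0" using n(1) assms by (intro notI) simp
then obtain k where "n = Suc k" by (cases n) auto
then show thesis using that[of k] n(1) n(2)[of k] by simp
qed

context dini_operator
begin

definition om_sum :: real where
 "om_sum = (\<Sum>k. omega ((1/2) ^ k))"

lemma om_pow_nonneg: "0 <= omega ((1/2) ^ k)"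
 by (rule om_nonneg) (auto simp: power_le_one)

lemma om_sum_nonneg: "0 <= om_sum"
 unfolding om_sum_def by (intro suminf_nonneg summable_om om_pow_nonneg)

lemma om_sum_ennreal: "(\<Sum>k. ennreal (omega ((1/2) ^ k))) = ennreal om_sum"
 unfolding om_sum_def by (intro suminf_ennreal2 summable_om om_pow_nonneg)

text \<open>
 The bound on the dyadic annulus with index \<open>k\<close>. Summed over \<open>k\<close> these
 bounds give the majorant \<open>tailfun\<close>, whose integral against a function is a series
 over balls with the summable weights \<open>omega (2\<^sup>-\<^sup>k)\<close>.
\<close>

lemma dini_decay:
 fixes rho t s :: real
 assumes "0 < rho" "2 ^ k * rho <= t" "0 <= s" "s <= rho"
 shows "1 / t ^ DIM('a) * omega (s / t) <= omega ((1/2) ^ k) / (2 ^ k * rho) ^ DIM('a)"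
proof -
have p: "0 < 2 ^ k * rho" using assms(1) by simp
then have t: "0 < t" using assms(2) by linarith
have st: "s / t <= (1/2) ^ k"
proof -
 have "s * 2 ^ k <= rho * 2 ^ k" using assms(4) by (rule mult_right_mono) simp
 also have "... <= t" using assms(2) by (simp add: mult.commute)
 finally show ?thesis using t by (simp add: power_one_over field_simps)
qed
have "omega (s / t) <= omega ((1/2) ^ k)"
 using st assms(3) t by (intro om_mono) (auto simp: power_le_one)
moreover have "1 / t ^ DIM('a) <= 1 / (2 ^ k * rho) ^ DIM('a)"
 using p t assms(2) by (intro divide_left_mono power_mono mult_pos_pos[OF zero_less_power zero_less_power]) auto
moreover have "0 <= omega (s / t)"
proof (rule om_nonneg)
 show "0 <= s / t" using assms(3) t by simp
 have "(1/2::real) ^ k <= 1" by (simp add: power_le_one)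
 then show "s / t <= 1" using st by linarith
qed
ultimately have "1 / t ^ DIM('a) * omega (s / t) <= 1 / (2 ^ k * rho) ^ DIM('a) * omega ((1/2) ^ k)"
 using t assms(1) by (intro mult_mono) auto
then show ?thesis by simp
qed

definition tailfun :: "'a => real => 'a => ennreal" where
 "tailfun z rho x = (\<Sum>k. ennreal (omega ((1/2) ^ k) / (2 ^ k * rho) ^ DIM('a)) * ind (cball z (2 ^ Suc k * rho)) x)"

lemma tailfun_measurable [measurable]: "tailfun z rho \<in> Lmeas"
 unfolding tailfun_def by measurable

lemma tailfun_ge:
 assumes "0 < rho" "rho <= norm (x - z)" "0 <= s" "s <= rho"
 shows "ennreal (1 / norm (x - z) ^ DIM('a) * omega (s / norm (x - z))) <= tailfun z rho x"
proof -
obtain k where k: "2 ^ k * rho <= norm (x - z)" "norm (x - z) < 2 ^ Suc k * rho"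
 using dyadic_annulus[OF assms(1,2)] by blast
let ?a = "%k. ennreal (omega ((1/2) ^ k) / (2 ^ k * rho) ^ DIM('a)) * ind (cball z (2 ^ Suc k * rho)) x"
have "ennreal (1 / norm (x - z) ^ DIM('a) * omega (s / norm (x - z))) <= ?a k"
 using dini_decay[OF assms(1) k(1) assms(3,4)] k(2)
 by (simp add: dist_norm norm_minus_commute ennreal_leI)
also have "... <= suminf ?a" by (rule ennreal_le_suminf)
finally show ?thesis by (simp add: tailfun_def)
qed

lemma nn_integral_tailfun_mult:
 assumes rho: "0 < rho" and g[measurable]: "g \<in> Lmeas"
  and bound: "!!k. (LN x\<in>cball z (2 ^ Suc k * rho). g x) <= ennreal ((2 * (2 ^ Suc k * rho)) ^ DIM('a)) * A"
 shows "(LN x. tailfun z rho x * g x) <= ennreal (4 ^ DIM('a) * om_sum) * A"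
proof -
let ?c = "%k. ennreal (omega ((1/2) ^ k) / (2 ^ k * rho) ^ DIM('a))"
have "(LN x. tailfun z rho x * g x) =
  (LN x. (\<Sum>k. ?c k * (g x * ind (cball z (2 ^ Suc k * rho)) x)))"
 unfolding tailfun_def by (intro nn_integral_cong) (simp add: ennreal_suminf_multc[symmetric] mult_ac)
also have "... = (\<Sum>k. ?c k * (LN x\<in>cball z (2 ^ Suc k * rho). g x))"
 by (subst nn_integral_suminf) (auto simp: nn_integral_cmult)
also have "... <= (\<Sum>k. ?c k * (ennreal ((2 * (2 ^ Suc k * rho)) ^ DIM('a)) * A))"
 by (intro suminf_le summableI mult_left_mono bound) auto
also have "... = (\<Sum>k. ennreal (omega ((1/2) ^ k)) * (ennreal (4 ^ DIM('a)) * A))"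
proof (rule suminf_cong)
 fix k
 have "ennreal (omega ((1/2) ^ k) / (2 ^ k * rho) ^ DIM('a)) * ennreal ((2 * (2 ^ Suc k * rho)) ^ DIM('a))
   = ennreal (omega ((1/2) ^ k) / (2 ^ k * rho) ^ DIM('a) * (2 * (2 ^ Suc k * rho)) ^ DIM('a))"
  using rho om_pow_nonneg[of k] by (intro ennreal_mult[symmetric]) auto
 also have "omega ((1/2) ^ k) / (2 ^ k * rho) ^ DIM('a) * (2 * (2 ^ Suc k * rho)) ^ DIM('a) = omega ((1/2) ^ k) * 4 ^ DIM('a)"
 proof -
  have "2 * (2 ^ Suc k * rho) = 4 * (2 ^ k * rho)" by simp
  then have "(2 * (2 ^ Suc k * rho)) ^ DIM('a) = 4 ^ DIM('a) * (2 ^ k * rho) ^ DIM('a)" by (simp only: power_mult_distrib)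
  moreover have "(2 ^ k * rho) ^ DIM('a) ~= 0" using rho by simp
  ultimately show ?thesis by (simp add: field_simps)
 qed
 also have "ennreal (omega ((1/2) ^ k) * 4 ^ DIM('a)) = ennreal (omega ((1/2) ^ k)) * ennreal (4 ^ DIM('a))"
  using om_pow_nonneg[of k] by (intro ennreal_mult) auto
 finally show "?c k * (ennreal ((2 * (2 ^ Suc k * rho)) ^ DIM('a)) * A) = ennreal (omega ((1/2) ^ k)) * (ennreal (4 ^ DIM('a)) * A)"
  by (simp only: mult.assoc[symmetric])
qed
also have "... = ennreal om_sum * (ennreal (4 ^ DIM('a)) * A)"
 by (simp only: ennreal_suminf_multc om_sum_ennreal)
also have "... = ennreal (4 ^ DIM('a) * om_sum) * A"
 using om_sum_nonneg by (simp add: ennreal_mult mult_ac)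
finally show ?thesis .
qed

lemma nn_integral_tailfun:
 assumes "0 < rho"
 shows "(LN x. tailfun z rho x) <= ennreal (4 ^ DIM('a) * om_sum)"
proof -
have "(LN x. tailfun z rho x * 1) <= ennreal (4 ^ DIM('a) * om_sum) * 1"
proof (rule nn_integral_tailfun_mult[OF assms])
 fix k
 show "(LN x\<in>cball z (2 ^ Suc k * rho). 1) <= ennreal ((2 * (2 ^ Suc k * rho)) ^ DIM('a)) * 1"
  using emeasure_cball_le[of "2 ^ Suc k * rho" z] assms by simp
qed simp
then show ?thesis by simp
qed

text \<open>
 The function vanishes near the cube, so the smoothness of \<open>K\<close> in the first variable
 applies, and the integral of the resulting majorant against \<open>|f|\<close> is a series of
 means of \<open>|f|\<close> over balls.
\<close>

lemma kernel_oscillation: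
 assumes f: "f \<in> Linf_c" and van: "!!y. y \<in> hat c r ==> f y = 0"
  and x: "x \<in> hcube c r" and x0: "x0 \<in> hcube c r"
 shows "enorm ((LI y. K x y * f y) - (LI y. K x0 y * f y))
   <= ennreal (4 ^ DIM('a) * om_sum) * maximal f x0"
proof -
let ?rho = "real DIM('a) * r"
have r: "0 < r" using x by (rule hcube_imp_pos)
then have rho: "0 < ?rho" by simp
have far: "4 * ?rho <= norm (z - y)" if "f y ~= 0" "z \<in> hcube c r" for y z
 using far_off_hat[OF that(2)] van that(1) by blast
have int: "integrable lebesgue (%y. K z y * f y)" if "z \<in> hcube c r" for z
 using far[OF _ that] rho by (intro Linf_c_integrable K_mult_Linf_c[OF f, of "4 * ?rho"]) auto
have eq: "(LI y. K x y * f y) - (LI y. K x0 y * f y) = (LI y. (K x y - K x0 y) * f y)"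
 using int[OF x] int[OF x0] by (simp add: left_diff_distrib)
have int2: "integrable lebesgue (%y. (K x y - K x0 y) * f y)"
 using int[OF x] int[OF x0] by (simp add: left_diff_distrib)
have "enorm (LI y. (K x y - K x0 y) * f y) <= (LN y. enorm ((K x y - K x0 y) * f y))"
 by (rule integral_norm_bound_ennreal[OF int2])
also have "... <= (LN y. tailfun x0 ?rho y * enorm (f y))"
proof (rule nn_integral_mono)
 fix y
 show "enorm ((K x y - K x0 y) * f y) <= tailfun x0 ?rho y * enorm (f y)"
 proof (cases "f y = 0")
  case False
  have d0: "4 * ?rho <= norm (x0 - y)" by (rule far[OF False x0])
  have dx: "norm (x0 - x) <= ?rho" by (rule norm_diff_hcube[OF x0 x])
  have "norm (K x0 y - K x y) <= 1 / norm (x0 - y) ^ DIM('a) * omega (norm (x0 - x) / norm (x0 - y))"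
   using d0 dx rho by (intro K_smooth_x) linarith
  then have "enorm (K x y - K x0 y) <= ennreal (1 / norm (y - x0) ^ DIM('a) * omega (norm (x0 - x) / norm (y - x0)))"
   by (intro ennreal_leI) (simp add: norm_minus_commute)
  also have "... <= tailfun x0 ?rho y"
   using d0 dx rho by (intro tailfun_ge) (auto simp: norm_minus_commute)
  finally have "enorm (K x y - K x0 y) * enorm (f y) <= tailfun x0 ?rho y * enorm (f y)"
   by (rule mult_right_mono) simp
  then show ?thesis by (simp add: norm_mult ennreal_mult)
 qed simp
qed
also have "... <= ennreal (4 ^ DIM('a) * om_sum) * maximal f x0"
proof (rule nn_integral_tailfun_mult[OF rho])
 show "(%y. enorm (f y)) \<in> Lmeas" using f by measurable
 fix k
 show "mass f (cball x0 (2 ^ Suc k * ?rho)) <= ennreal ((2 * (2 ^ Suc k * ?rho)) ^ DIM('a)) * maximal f x0"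
  using rho by (intro mass_cball_le_maximal) simp
qed
finally show ?thesis unfolding eq .
qed

text \<open>
 On the cubes of side \<open>rho\<close> at \<open>x\<close> and \<open>y\<close> the kernel varies
 by at most \<open>eta\<close>. So \<open>T\<close>, applied to the indicator of the second cube,
 is at least \<open>(|K x y| - eta) rho\<^sup>d\<close> in modulus on the first, and the norm of
 \<open>T\<close> on square integrable functions bounds this quantity.
\<close>

lemma kernel_size_aux:
 assumes xy: "x ~= y"
 defines "D \<equiv> norm (x - y)"
 defines "rho \<equiv> D / (8 * real DIM('a))"
 defines "eta \<equiv> 2 * 2 ^ DIM('a) * omega 1 / D ^ DIM('a)"
 shows "norm (K x y) <= eta + CT / rho ^ DIM('a)"
proof (rule ccontr)
assume neg: "\<not> ?thesis"
have D: "0 < D" using xy by (simp add: D_def)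
have rho: "0 < rho" "real DIM('a) * rho = D / 8" using D by (simp_all add: rho_def)
have om1: "0 <= omega 1" by (rule om_nonneg) auto
have om: "omega t <= omega 1" if "0 <= t" "t <= 1" for t using that by (intro om_mono) auto
have eta_eq: "eta = 2 * (2 ^ DIM('a) / D ^ DIM('a) * omega 1)" by (simp add: eta_def)
have close: "norm (K x' y' - K x y) <= eta" and apart: "D / 2 <= norm (x' - y')"
 if "x' \<in> hcube x rho" "y' \<in> hcube y rho" for x' y'
proof -
 have dx: "norm (x - x') <= D / 8"
  using norm_diff_hcube[OF corner_in_hcube[OF rho(1)] that(1)] rho(2) by simp
 have dy: "norm (y - y') <= D / 8"
  using norm_diff_hcube[OF corner_in_hcube[OF rho(1)] that(2)] rho(2) by simp
 have d1: "D * (7/8) <= norm (x' - y)"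
  using norm_triangle_ineq[of "x - x'" "x' - y"] dx by (simp add: D_def)
 show "D / 2 <= norm (x' - y')"
  using norm_triangle_ineq[of "x' - y'" "y' - y"] d1 dy D by (simp add: norm_minus_commute)
 have "norm (K x y - K x' y) <= 1 / D ^ DIM('a) * omega (norm (x - x') / D)"
  unfolding D_def by (rule K_smooth_x) (use dx D in \<open>unfold D_def, linarith\<close>)
 also have "... <= 1 / D ^ DIM('a) * omega 1"
  using dx D by (intro mult_left_mono om) (auto simp: field_simps)
 also have "... <= 2 ^ DIM('a) / D ^ DIM('a) * omega 1"
  using D om1 by (intro mult_right_mono divide_right_mono) auto
 finally have k1: "norm (K x y - K x' y) <= 2 ^ DIM('a) / D ^ DIM('a) * omega 1" .
 have "norm (K x' y - K x' y') <= 1 / norm (x' - y) ^ DIM('a) * omega (norm (y - y') / norm (x' - y))"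
  by (rule K_smooth_y) (use dy d1 D in linarith)
 also have "... <= 1 / (D / 2) ^ DIM('a) * omega 1"
 proof (rule mult_mono)
  have "D / 2 <= norm (x' - y)" using d1 D by linarith
  then show "1 / norm (x' - y) ^ DIM('a) <= 1 / (D / 2) ^ DIM('a)"
   using D by (intro divide_left_mono power_mono mult_pos_pos[OF zero_less_power zero_less_power]) auto
  have "norm (y - y') <= norm (x' - y)" using d1 dy D by linarith
  then show "omega (norm (y - y') / norm (x' - y)) <= omega 1" using d1 D by (intro om) (auto simp: divide_le_eq_1)
  show "0 <= omega (norm (y - y') / norm (x' - y))"
   using \<open>norm (y - y') <= norm (x' - y)\<close> by (intro om_nonneg) (auto simp: divide_le_eq_1)
 qed (use D in auto)
 also have "... = 2 ^ DIM('a) / D ^ DIM('a) * omega 1" by (simp add: power_divide)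
 finally have k2: "norm (K x' y - K x' y') <= 2 ^ DIM('a) / D ^ DIM('a) * omega 1" .
 have "norm (K x' y' - K x y) <= norm (K x y - K x' y) + norm (K x' y - K x' y')"
  using norm_triangle_ineq[of "K x' y' - K x' y" "K x' y - K x y"] by (simp add: norm_minus_commute)
 then show "norm (K x' y' - K x y) <= eta" using k1 k2 unfolding eta_eq by linarith
qed
let ?f = "%z. (1::complex) * ind (hcube y rho) z"
define q where "q = rho ^ DIM('a)"
have q: "0 < q" using rho by (simp add: q_def)
have emq: "vol (hcube z rho) = ennreal q" for z :: 'a
 using rho by (subst emeasure_hcube) (auto simp: q_def)
have fL: "?f \<in> Linf_c" by (rule Linf_c_indicator) (auto simp: bounded_hcube)
define F where "F = cbox y (y + rho *\<^sub>R One)"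
have hF: "hcube y rho \<subseteq> F" unfolding F_def by (rule hcube_subset_cbox)
have offF: "x' ~: F" if "x' \<in> hcube x rho" for x'
proof
 assume "x' \<in> F"
 have "norm (x' - y) <= (\<Sum>i\<in>Basis. \<bar>(x' - y) \<bullet> i\<bar>)" by (rule norm_le_l1)
 also have "... <= (\<Sum>i::'a\<in>Basis. rho)"
 proof (rule sum_mono)
  fix i :: 'a assume "i \<in> Basis"
  then show "\<bar>(x' - y) \<bullet> i\<bar> <= rho"
   using \<open>x' \<in> F\<close> unfolding F_def mem_box by (force simp: inner_diff_left inner_add_left)
 qed
 also have "... = D / 8" using rho(2) by simp
 finally have "norm (x' - y) <= D / 8" .
 moreover have "D / 2 <= norm (x' - y)" by (rule apart[OF that corner_in_hcube[OF rho(1)]])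
 ultimately show False using D by linarith
qed
define beta where "beta = norm (K x y) - eta"
have beta: "CT / q < beta" using neg by (simp add: beta_def q_def)
then have beta0: "0 < beta" using CT q by (meson divide_nonneg_pos le_less_trans)
have "AE x' in lebesgue. x' \<in> hcube x rho --> (beta * q)\<^sup>2 <= (norm (T ?f x'))\<^sup>2"
proof -
 have "AE x' in lebesgue. x' ~: F --> T ?f x' = (LI z. K x' z * ?f z)"
  by (rule kernel_representation[OF fL]) (use hF in \<open>auto simp: F_def closed_cbox indicator_def\<close>)
 then show ?thesis
 proof eventually_elim
  case (elim x')
  show ?case
  proof
   assume x': "x' \<in> hcube x rho"
   have int: "integrable lebesgue (%z. K x' z * ?f z)"
    using apart[OF x'] D
    by (intro Linf_c_integrable K_mult_Linf_c[OF fL, of "D / 2"]) (auto split: split_indicator_asm)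
   have int1: "integrable lebesgue ?f" by (rule Linf_c_integrable[OF fL])
   have ci: "(LI z. K x y * ?f z) = of_real q * K x y"
    using integral_indicator_hcube[of rho "K x y" y] rho(1) by (simp add: q_def mult.commute)
   have "T ?f x' - of_real q * K x y = (LI z. K x' z * ?f z) - (LI z. K x y * ?f z)"
    unfolding ci using elim offF[OF x'] by simp
   also have "... = (LI z. (K x' z - K x y) * ?f z)"
    using int int1 by (simp only: left_diff_distrib Bochner_Integration.integral_diff integrable_mult_right)
   finally have eq: "T ?f x' - of_real q * K x y = (LI z. (K x' z - K x y) * ?f z)" .
   have int2: "integrable lebesgue (%z. (K x' z - K x y) * ?f z)"
    using int int1 by (simp only: left_diff_distrib Bochner_Integration.integrable_diff integrable_mult_right)
   have "enorm (T ?f x' - of_real q * K x y) <= (LN z. enorm ((K x' z - K x y) * ?f z))"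
    unfolding eq by (rule integral_norm_bound_ennreal[OF int2])
   also have "... <= (LN z\<in>hcube y rho. ennreal eta)"
    using close[OF x'] by (intro nn_integral_mono) (auto split: split_indicator intro: ennreal_leI)
   also have "... = ennreal (eta * q)"
    using rho(1) D om1 by (subst nn_integral_const_hcube) (auto simp: q_def eta_def)
   finally have "norm (T ?f x' - of_real q * K x y) <= eta * q"
    using q D om1 by (subst (asm) ennreal_le_iff) (auto simp: eta_def)
   moreover have "norm (of_real q * K x y) = q * norm (K x y)" using q by (simp add: norm_mult)
   ultimately have "q * norm (K x y) - eta * q <= norm (T ?f x')"
    using norm_triangle_ineq2[of "of_real q * K x y" "T ?f x'"] by (simp add: norm_minus_commute)
   then have "beta * q <= norm (T ?f x')" by (simp add: beta_def algebra_simps)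
   then show "(beta * q)\<^sup>2 <= (norm (T ?f x'))\<^sup>2" using beta0 q by (intro power_mono) auto
  qed
 qed
qed
then have "(LN x'\<in>hcube x rho. ennreal ((beta * q)\<^sup>2)) <= (LN x'. ennreal ((norm (T ?f x'))\<^sup>2))"
 by (intro nn_integral_mono_AE) (auto elim!: eventually_mono split: split_indicator intro: ennreal_leI)
also have "... <= ennreal (CT\<^sup>2) * (LN z. ennreal ((norm (?f z))\<^sup>2))"
 by (rule T_bound[OF Linf_c_subset_L2[OF fL]])
also have "(LN z. ennreal ((norm (?f z))\<^sup>2)) = (LN z\<in>hcube y rho. ennreal 1)"
 by (intro nn_integral_cong) (auto split: split_indicator)
also have "... = ennreal (1 * q)" using rho(1) by (subst nn_integral_const_hcube) (auto simp: q_def)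
also have "(LN x'\<in>hcube x rho. ennreal ((beta * q)\<^sup>2)) = ennreal ((beta * q)\<^sup>2 * q)"
 using rho(1) by (subst nn_integral_const_hcube) (auto simp: q_def)
finally have "ennreal ((beta * q)\<^sup>2 * q) <= ennreal (CT\<^sup>2) * ennreal (1 * q)" .
then have "ennreal ((beta * q)\<^sup>2 * q) <= ennreal (CT\<^sup>2 * q)"
 using ennreal_mult[of "CT\<^sup>2" q] q by simp
then have "(beta * q)\<^sup>2 * q <= CT\<^sup>2 * q" using q by (subst (asm) ennreal_le_iff) auto
then have "(beta * q)\<^sup>2 <= CT\<^sup>2" using q by simp
then have "beta * q <= CT" by (rule power2_le_imp_le[OF _ CT])
then show False using beta q by (simp add: field_simps)
qed

lemma kernel_size:
 obtains C0 where "0 <= C0" "!!x y. x ~= y ==> norm (K x y) <= C0 / norm (x - y) ^ DIM('a)"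
proof
let ?C = "2 * 2 ^ DIM('a) * omega 1 + CT * (8 * real DIM('a)) ^ DIM('a)"
show "0 <= ?C" using om_nonneg[of 1] CT by simp
show "norm (K x y) <= ?C / norm (x - y) ^ DIM('a)" if "x ~= y" for x y
 using kernel_size_aux[OF that] by (simp add: power_divide add_divide_distrib)
qed

end

section \<open>Weak type estimate for the operator\<close>

lemma chebyshev_ennreal:
 fixes u :: "'a::euclidean_space => ennreal"
 assumes [measurable]: "u \<in> Lmeas" "S \<in> sets lebesgue" and s: "!!x. x \<in> S ==> s <= u x"
 shows "s * vol S <= (LN x\<in>S. u x)"
proof -
have "s * vol S = (LN x\<in>S. s)"
 by (rule nn_integral_cmult_indicator[symmetric]) simp
also have "... <= (LN x\<in>S. u x)"
 using s by (intro nn_integral_mono) (auto split: split_indicator)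
finally show ?thesis .
qed

lemma ennreal_le_divideI:
 assumes "0 < s" "0 <= q" "ennreal s * e <= ennreal q"
 shows "e <= ennreal (q / s)"
proof (cases e)
case (real v)
then have "s * v <= q" using assms by (simp add: ennreal_mult[symmetric])
then show ?thesis using real assms(1) by (simp add: ennreal_leI field_simps)
next
case top
then show ?thesis using assms by (simp add: ennreal_mult_top top_unique)
qed

definition rmass :: "('a::euclidean_space => complex) => 'a set => real" where
 "rmass f A = enn2real (mass f A)"

lemma rmass_nonneg: "0 <= rmass f A"
 by (simp add: rmass_def)

lemma mass_eq_rmass:
 assumes "f \<in> Linf_c"
 shows "mass f A = ennreal (rmass f A)"
proof -
obtain m where "mass f A = ennreal m" "0 <= m" by (rule mass_finite[OF assms])
then show ?thesis by (simp add: rmass_def)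
qed

lemma mass_restr: "A \<subseteq> B ==> mass (restr B f) A = mass f A"
 by (intro nn_integral_cong) (auto simp: restr_def split: split_indicator)

lemma mass_restr_UNIV: "mass (restr B f) UNIV = mass f B"
 by (intro nn_integral_cong) (auto simp: restr_def split: split_indicator)

lemma mass_UNIV_vanish: "(!!x. x ~: B ==> f x = 0) ==> mass f UNIV = mass f B"
 by (intro nn_integral_cong) (auto split: split_indicator)

lemma maximal_mono:
 assumes "!!x. norm (f x) <= norm (g x)"
 shows "maximal f x <= maximal g x"
 unfolding maximal_def
 by (intro SUP_mono bexI) (auto intro!: mult_right_mono divide_right_mono_ennreal nn_integral_mono ennreal_leI assms)

lemma AE_positive_set_ex:
 assumes "S \<in> sets M" "0 < emeasure M S" "AE x in M. P x"
 shows "\<exists>x\<in>S. P x"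
proof (rule ccontr)
assume no: "\<not> ?thesis"
have "AE x in M. x ~: S" using assms(3) by eventually_elim (use no in blast)
then have "S \<in> null_sets M" using assms(1) by (simp add: AE_iff_null_sets)
then show False using assms(2) by auto
qed

context dini_operator
begin

text \<open>
 As \<open>h\<close> has mean zero, \<open>K x y\<close> may be replaced by \<open>K x y - K x
 c\<close>, and smoothness in the second variable applies.
\<close>

lemma T_cancelling_cube:
 assumes h: "h \<in> Linf_c" and van: "!!y. y ~: hcube c r ==> h y = 0" and r: "0 < r"
  and mean: "(LI y. h y) = 0"
 shows "AE x. x ~: cball c (2 * (real DIM('a) * r)) -->
   enorm (T h x) <= tailfun c (real DIM('a) * r) x * mass h UNIV"
proof -
let ?rho = "real DIM('a) * r"
have rho: "0 < ?rho" using r by simp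
have inb: "norm (c - y) <= ?rho" if "h y ~= 0" for y
 using norm_diff_hcube[OF corner_in_hcube[OF r, of c]] van[of y] that by blast
have "AE x. x ~: cball c ?rho --> T h x = (LI y. K x y * h y)"
 by (rule kernel_representation[OF h]) (use inb in \<open>auto simp: dist_norm\<close>)
then show ?thesis
proof eventually_elim
 case (elim x)
 show ?case
 proof
  assume x: "x ~: cball c (2 * ?rho)"
  then have xc: "2 * ?rho < norm (x - c)" by (simp add: dist_norm norm_minus_commute)
  then have "x ~: cball c ?rho" using rho by (simp add: dist_norm norm_minus_commute)
  then have T: "T h x = (LI y. K x y * h y)" using elim by blast
  have far: "?rho <= norm (x - y)" if "h y ~= 0" for y
   using inb[OF that] xc norm_triangle_ineq[of "x - y" "y - c"] by (simp add: norm_minus_commute)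
  have int: "integrable lebesgue (%y. K x y * h y)"
   by (intro Linf_c_integrable K_mult_Linf_c[OF h rho] far)
  have int1: "integrable lebesgue h" by (rule Linf_c_integrable[OF h])
  have T2: "T h x = (LI y. (K x y - K x c) * h y)"
   using int int1 mean by (simp add: T left_diff_distrib)
  have int2: "integrable lebesgue (%y. (K x y - K x c) * h y)"
   using int int1 by (simp add: left_diff_distrib)
  have "enorm (T h x) <= (LN y. enorm ((K x y - K x c) * h y))"
   unfolding T2 by (rule integral_norm_bound_ennreal[OF int2])
  also have "... <= (LN y. tailfun c ?rho x * (enorm (h y) * ind UNIV y))"
  proof (rule nn_integral_mono)
   fix y
   show "enorm ((K x y - K x c) * h y) <= tailfun c ?rho x * (enorm (h y) * ind UNIV y)"
   proof (cases "h y = 0")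
    case False
    have "norm (K x c - K x y) <= 1 / norm (x - c) ^ DIM('a) * omega (norm (c - y) / norm (x - c))"
     using inb[OF False] xc by (intro K_smooth_y) linarith
    then have "enorm (K x y - K x c) <= ennreal (1 / norm (x - c) ^ DIM('a) * omega (norm (c - y) / norm (x - c)))"
     by (intro ennreal_leI) (simp add: norm_minus_commute)
    also have "... <= tailfun c ?rho x"
     using inb[OF False] xc rho by (intro tailfun_ge) auto
    finally have "enorm (K x y - K x c) * enorm (h y) <= tailfun c ?rho x * enorm (h y)"
     by (rule mult_right_mono) simp
    then show ?thesis by (simp add: norm_mult ennreal_mult)
   qed simp
  qed
  also have "... = tailfun c ?rho x * mass h UNIV"
   by (rule nn_integral_cmult) (use h in measurable)
  finally show "enorm (T h x) <= tailfun c ?rho x * mass h UNIV" .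
 qed
qed
qed

definition weak_const :: real where
 "weak_const = 12 * 2 ^ DIM('a) * CT\<^sup>2 + 4 * (4 ^ DIM('a) * om_sum) + (4 * real DIM('a)) ^ DIM('a)"

text \<open>
 The Calderon--Zygmund decomposition at height \<open>mu\<close>: the bounded part is estimated by
 square integrals and Chebyshev's inequality, the cancelling parts on the selected cubes by
 \<open>T_cancelling_cube\<close>, and the dilates of these cubes by their measure.
\<close>

lemma weak_type_level:
 assumes f: "f \<in> Linf_c" and L: "0 < L" and van: "!!x. x ~: hcube b L ==> f x = 0"
  and m: "mass f UNIV = ennreal m" "0 < m" and lam: "m <= mu * L ^ DIM('a)"
 shows "vol {x. mu < norm (T f x)} <= ennreal (weak_const * m / mu)"
proof -
let ?d = "real DIM('a)"
note fm[measurable] = Linf_c_measurable[OF f]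
have mu: "0 < mu" using lam m(2) L by (metis mult_nonpos_nonneg not_le order_trans zero_le_power less_imp_le)
have "mass f UNIV = mass f (hcube b L)" by (rule mass_UNIV_vanish) (rule van)
then have mR: "mass f (hcube b L) = ennreal m" using m(1) by (simp only:)
have hm: "(%x. enorm (f x)) \<in> Lmeas" by measurable
have avg: "mass f (hcube b L) <= ennreal (mu * L ^ DIM('a))" unfolding mR using lam by (rule ennreal_leI)
obtain c r where cr: "packing c r b L"
 "!!k. 0 < r k ==> ennreal (mu * r k ^ DIM('a)) <= mass f (hcube (c k) (r k))"
 "!!k. 0 < r k ==> mass f (hcube (c k) (r k)) <= ennreal (2 ^ DIM('a) * mu * r k ^ DIM('a))"
 "ennreal mu * vol (UQ c r) <= mass f (hcube b L)"
 "AE x. x \<in> hcube b L - (UQ c r) --> enorm (f x) <= ennreal mu"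
 by (rule calderon_zygmund_cubes[OF hm L mu avg]) (rule that)
let ?P = "%k. hcube (c k) (r k)"
have r0: "0 <= r k" and disj: "disjoint_family ?P" and sub: "?P k \<subseteq> hcube b L" for k
 using cr(1) by (auto simp: packing_def)
define av where "av k = (LI y. restr (?P k) f y) / of_real (r k ^ DIM('a))" for k
have rL: "restr A f \<in> Linf_c" if "A \<in> sets lebesgue" for A by (rule Linf_c_restr[OF f that])
have avm: "ennreal (norm (av k) * r k ^ DIM('a)) <= mass f (?P k)" for k
proof (cases "0 < r k")
 case True
 have "enorm (LI y. restr (?P k) f y) <= (LN y. enorm (restr (?P k) f y))"
  by (rule integral_norm_bound_ennreal[OF Linf_c_integrable[OF rL]]) simp
 also have "... = mass f (?P k)" using mass_restr_UNIV[of "?P k" f] by simp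
 finally show ?thesis using True by (simp add: av_def norm_divide norm_power)
next
 case False
 then show ?thesis using r0[of k] by (simp add: power_0_left)
qed
have avb: "norm (av k) <= 2 ^ DIM('a) * mu" for k
proof (cases "0 < r k")
 case True
 then have "ennreal (norm (av k) * r k ^ DIM('a)) <= ennreal (2 ^ DIM('a) * mu * r k ^ DIM('a))"
  using order_trans[OF avm[of k] cr(3)[OF True]] by simp
 then have "norm (av k) * r k ^ DIM('a) <= 2 ^ DIM('a) * mu * r k ^ DIM('a)"
  using True mu by (subst (asm) ennreal_le_iff) auto
 then show ?thesis using True by simp
next
 case False
 then show ?thesis using r0[of k] mu by (simp add: av_def zero_power[OF DIM_positive])
qed
define h where "h k = restr (?P k) (%x. f x - av k)" for k
have hm'[measurable]: "h k \<in> Lmeas" for k unfolding h_def by measurable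
obtain B where B: "0 < B" "!!x. norm (f x) <= B" using Linf_cE[OF f] by metis
define B2 where "B2 = B + 2 ^ DIM('a) * mu"
have hB: "norm (h k x) <= B2" for k x
 using B(2)[of x] avb[of k] norm_triangle_ineq4[of "f x" "av k"] B(1) mu
 by (auto simp: h_def restr_def B2_def intro: order_trans)
have hvan: "x ~: ?P k ==> h k x = 0" for k x by (simp add: h_def restr_def)
have hL: "h k \<in> Linf_c" for k
proof -
 have "(%x. f x - restr (?P k) (%x. av k) x) \<in> Linf_c"
 proof (rule Linf_c_diff[OF f])
  have "(%x. av k * ind (?P k) x) \<in> Linf_c" by (rule Linf_c_indicator) (auto simp: bounded_hcube)
  also have "(%x. av k * ind (?P k) x) = restr (?P k) (%x. av k)"
   by (auto simp: restr_def fun_eq_iff split: split_indicator)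
  finally show "restr (?P k) (%x. av k) \<in> Linf_c" .
 qed
 then have "restr (?P k) (%x. f x - restr (?P k) (%x. av k) x) \<in> Linf_c" by (rule Linf_c_restr) simp
 also have "restr (?P k) (%x. f x - restr (?P k) (%x. av k) x) = h k"
  by (auto simp: restr_def h_def fun_eq_iff)
 finally show ?thesis .
qed
have hmean: "(LI y. h k y) = 0" for k
proof -
 have i1: "integrable lebesgue (restr (?P k) f)" by (rule Linf_c_integrable[OF rL]) simp
 have i2: "integrable lebesgue (%x. av k * ind (?P k) x)"
  by (rule Linf_c_integrable[OF Linf_c_indicator]) (auto simp: bounded_hcube)
 have "h k = (%x. restr (?P k) f x - av k * ind (?P k) x)"
  by (auto simp: h_def restr_def fun_eq_iff split: split_indicator)
 then have "(LI y. h k y) = (LI y. restr (?P k) f y) - (LI y. av k * ind (?P k) y)"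
  using i1 i2 by simp
 also have "(LI y. av k * ind (?P k) y) = av k * of_real (r k ^ DIM('a))"
  by (rule integral_indicator_hcube[OF r0])
 also have "... = (LI y. restr (?P k) f y)"
 proof (cases "0 < r k")
  case False
  then have "?P k = {}" by simp
  then have "restr (?P k) f = (%y. 0)" by (auto simp: restr_def)
  then show ?thesis by (simp add: av_def)
 qed (simp add: av_def)
 finally show ?thesis by simp
qed
have hmass: "mass (h k) UNIV <= 2 * mass f (?P k)" for k
proof -
 have "mass (h k) UNIV <= (LN x. enorm (f x) * ind (?P k) x + enorm (av k) * ind (?P k) x)"
 proof (rule nn_integral_mono)
  fix x
  have "enorm (f x - av k) <= enorm (f x) + enorm (av k)"
   using norm_triangle_ineq4[of "f x" "av k"] by (simp add: ennreal_plus[symmetric] ennreal_leI del: ennreal_plus)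
  then show "enorm (h k x) * ind UNIV x <= enorm (f x) * ind (?P k) x + enorm (av k) * ind (?P k) x"
   by (auto simp: h_def restr_def split: split_indicator)
 qed
 also have "... = mass f (?P k) + (LN x\<in>?P k. enorm (av k))"
  by (rule nn_integral_add) measurable
 also have "(LN x\<in>?P k. enorm (av k)) = ennreal (norm (av k) * r k ^ DIM('a))"
  by (rule nn_integral_const_hcube) (use r0 in auto)
 also have "mass f (?P k) + ... <= mass f (?P k) + mass f (?P k)" by (intro add_left_mono avm)
 finally show ?thesis by (simp add: mult_2)
qed
define s where "s n x = (\<Sum>k<n. h k x)" for n x
define bad where "bad x = (\<Sum>k. h k x)" for x
have fin: "h k x = 0" if "x \<in> ?P j" "k ~= j" for k j x
proof -
 have "?P k \<inter> ?P j = {}" using disjoint_family_onD[OF disj, of k j] that by simp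
 then show ?thesis using that(1) hvan by blast
qed
have bad_in: "bad x = h j x" if "x \<in> ?P j" for x j
proof -
 have "bad x = (\<Sum>k\<in>{j}. h k x)" unfolding bad_def by (rule suminf_finite) (use fin[OF that] in auto)
 then show ?thesis by simp
qed
have bad_out: "bad x = 0" if "x ~: (\<Union>k. ?P k)" for x
proof -
 have "h k x = 0" for k using that hvan by blast
 then show ?thesis by (simp add: bad_def)
qed
have s_in: "s n x = (if j < n then h j x else 0)" if "x \<in> ?P j" for n x j
proof -
 have "s n x = (\<Sum>k<n. if k = j then h j x else 0)"
  unfolding s_def by (rule sum.cong) (use fin[OF that] in auto)
 then show ?thesis by (simp add: sum.delta)
qed
have s_out: "s n x = 0" if "x ~: (\<Union>k. ?P k)" for n x
proof -
 have "h k x = 0" for k using that hvan by blast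
 then show ?thesis by (simp add: s_def)
qed
have s_lim: "(%n. s n x) ---> bad x" for x
proof (cases "x \<in> (\<Union>k. ?P k)")
 case True
 then obtain j where j: "x \<in> ?P j" by blast
 have "\<forall>\<^sub>F n in sequentially. bad x = s n x"
  unfolding eventually_sequentially
  by (intro exI[of _ "Suc j"] allI impI) (simp add: s_in[OF j] bad_in[OF j])
 with tendsto_const show ?thesis by (rule Lim_transform_eventually)
qed (simp add: s_out bad_out)
let ?w = "%x. complex_of_real B2 * ind (hcube b L) x"
have wL: "?w \<in> Linf_c" by (rule Linf_c_indicator) (auto simp: bounded_hcube)
have B20: "0 <= B2" using B(1) mu by (simp add: B2_def)
have s_dom: "norm (s n x) <= norm (?w x)" for n x
proof (cases "x \<in> (\<Union>k. ?P k)")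
 case True
 then obtain j where j: "x \<in> ?P j" by blast
 then have "x \<in> hcube b L" using sub by blast
 then show ?thesis using hB[of j x] B20 by (simp add: s_in[OF j] norm_mult)
qed (simp add: s_out)
have sm[measurable]: "s n \<in> Lmeas" for n unfolding s_def by measurable
have bm[measurable]: "bad \<in> Lmeas"
 by (rule borel_measurable_LIMSEQ_metric[OF sm]) (rule s_lim)
have bdom: "norm (bad x) <= norm (?w x)" for x
 by (rule Lim_bounded[OF tendsto_norm[OF s_lim], of 0]) (use s_dom in auto)
have badL: "bad \<in> Linf_c" by (rule Linf_c_dominated[OF wL bm, of 1]) (use bdom in simp)
have dom': "AE x. norm (s n x) <= norm (?w x)" for n by (rule AE_I2) (rule s_dom)
have lim': "AE x. (%n. s n x) ---> bad x" by (rule AE_I2) (rule s_lim)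
obtain q where q: "strict_mono q" "AE x. (%k. T (s (q k)) x) ---> T bad x"
 using T_dominated[of ?w s bad, OF Linf_c_subset_L2[OF wL] sm dom' bm lim'] by blast
have "AE x. ALL n. T (s n) x = (\<Sum>k<n. T (h k) x)"
 unfolding AE_all_countable s_def using T_sum[of "{..<_}" h] hL Linf_c_subset_L2 by blast
with q(2) have Tbad: "AE x. enorm (T bad x) <= (\<Sum>k. enorm (T (h k) x))"
proof eventually_elim
 case (elim x)
 have "(%k. enorm (T (s (q k)) x)) ---> enorm (T bad x)"
  by (intro tendsto_ennrealI tendsto_norm elim(1))
 then show ?case
 proof (rule Lim_bounded[of _ _ 0], intro allI impI)
  fix k
  have "norm (T (s (q k)) x) <= (\<Sum>j<q k. norm (T (h j) x))" using elim(2) norm_sum by simp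
  then have "enorm (T (s (q k)) x) <= (\<Sum>j<q k. enorm (T (h j) x))"
   by (simp add: sum_ennreal ennreal_leI)
  also have "... <= (\<Sum>k. enorm (T (h k) x))" by (intro sum_le_suminf summableI) auto
  finally show "enorm (T (s (q k)) x) <= (\<Sum>k. enorm (T (h k) x))" .
 qed
qed
define star where "star k = (if 0 < r k then cball (c k) (2 * (?d * r k)) else {})" for k
have star_m[measurable]: "star k \<in> sets lebesgue" for k by (simp add: star_def)
have each: "AE x. x ~: star k --> enorm (T (h k) x) <= tailfun (c k) (?d * r k) x * (2 * mass f (?P k))" for k
proof (cases "0 < r k")
 case True
 have "AE x. x ~: cball (c k) (2 * (?d * r k)) -->
   enorm (T (h k) x) <= tailfun (c k) (?d * r k) x * mass (h k) UNIV"
  by (rule T_cancelling_cube[OF hL _ True hmean]) (rule hvan)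
 then show ?thesis
 proof eventually_elim
  case (elim x)
  show ?case
  proof
   assume "x ~: star k"
   then have "enorm (T (h k) x) <= tailfun (c k) (?d * r k) x * mass (h k) UNIV"
    using elim True by (simp add: star_def)
   also have "... <= tailfun (c k) (?d * r k) x * (2 * mass f (?P k))" by (intro mult_left_mono hmass) simp
   finally show "enorm (T (h k) x) <= tailfun (c k) (?d * r k) x * (2 * mass f (?P k))" .
  qed
 qed
next
 case False
 then have "h k = (%x. 0)" using hvan by auto
 then have "h k = (%x. 0 * h k x)" by simp
 then have "AE x. T (h k) x = 0"
  using T_cmult[OF Linf_c_subset_L2[OF hL[of k]], of 0] by simp
 then show ?thesis by eventually_elim simp
qed
have Tm[measurable]: "T (h k) \<in> Lmeas" "T bad \<in> Lmeas" for k
 by (rule L2_measurable[OF T_L2[OF Linf_c_subset_L2[OF hL]]], rule L2_measurable[OF T_L2[OF Linf_c_subset_L2[OF badL]]])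
define US where "US = (\<Union>k. star k)"
have Om[measurable]: "US \<in> sets lebesgue" unfolding US_def by (intro sets.countable_UN) auto
have massP: "(\<Sum>k. mass f (?P k)) <= ennreal m" using disjoint_mass_le[OF fm cr(1)] mR by simp
have "(LN x\<in>- US. enorm (T bad x)) <= (LN x. (\<Sum>k. tailfun (c k) (?d * r k) x * (2 * mass f (?P k))))"
proof (rule nn_integral_mono_AE)
 have "AE x. ALL k. x ~: star k --> enorm (T (h k) x) <= tailfun (c k) (?d * r k) x * (2 * mass f (?P k))"
  using each unfolding AE_all_countable by blast
 with Tbad show "AE x. enorm (T bad x) * ind (- US) x <= (\<Sum>k. tailfun (c k) (?d * r k) x * (2 * mass f (?P k)))"
 proof eventually_elim
  case (elim x)
  show ?case
  proof (cases "x \<in> US")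
   case False
   have "(\<Sum>k. enorm (T (h k) x)) <= (\<Sum>k. tailfun (c k) (?d * r k) x * (2 * mass f (?P k)))"
    using elim(2) False by (intro suminf_le summableI) (auto simp: US_def)
   then show ?thesis using elim(1) False by (auto intro: order_trans)
  qed simp
 qed
qed
also have "... = (\<Sum>k. (LN x. tailfun (c k) (?d * r k) x) * (2 * mass f (?P k)))"
 by (subst nn_integral_suminf) (auto simp: nn_integral_multc)
also have "... <= (\<Sum>k. ennreal (4 ^ DIM('a) * om_sum) * (2 * mass f (?P k)))"
proof (intro suminf_le summableI)
 fix k
 show "(LN x. tailfun (c k) (?d * r k) x) * (2 * mass f (?P k)) <= ennreal (4 ^ DIM('a) * om_sum) * (2 * mass f (?P k))"
 proof (cases "0 < r k")
  case True
  then show ?thesis by (intro mult_right_mono nn_integral_tailfun) auto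
 qed simp
qed
also have "... = ennreal (4 ^ DIM('a) * om_sum) * (2 * (\<Sum>k. mass f (?P k)))"
 by (simp only: ennreal_suminf_cmult)
also have "... <= ennreal (4 ^ DIM('a) * om_sum) * (2 * ennreal m)"
 by (intro mult_left_mono massP) auto
also have "... = ennreal (2 * (4 ^ DIM('a) * om_sum) * m)"
 using m(2) om_sum_nonneg by (simp add: ennreal_mult mult_ac)
finally have int_bad: "(LN x\<in>- US. enorm (T bad x)) <= ennreal (2 * (4 ^ DIM('a) * om_sum) * m)" .
define S2 where "S2 = {x \<in> space lebesgue. mu / 2 < norm (T bad x)} - US"
have S2m[measurable]: "S2 \<in> sets lebesgue" unfolding S2_def by measurable
have "ennreal (mu / 2) * vol S2 <= (LN x\<in>S2. enorm (T bad x))"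
 by (rule chebyshev_ennreal[OF _ S2m]) (auto simp: S2_def intro: ennreal_leI)
also have "... <= (LN x\<in>- US. enorm (T bad x))"
 by (intro nn_integral_mono) (auto simp: S2_def split: split_indicator)
finally have "ennreal (mu / 2) * vol S2 <= ennreal (2 * (4 ^ DIM('a) * om_sum) * m)"
 using int_bad by order
then have mS2: "vol S2 <= ennreal (2 * (4 ^ DIM('a) * om_sum) * m / (mu / 2))"
 using mu m(2) om_sum_nonneg by (intro ennreal_le_divideI) auto
have mUS: "vol US <= ennreal ((4 * ?d) ^ DIM('a) * m / mu)"
proof -
 have "vol US <= (\<Sum>k. vol (star k))"
  unfolding US_def by (rule emeasure_subadditive_countably) auto
 also have "... <= (\<Sum>k. ennreal ((4 * ?d) ^ DIM('a)) * vol (?P k))"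
 proof (intro suminf_le summableI)
  fix k
  show "vol (star k) <= ennreal ((4 * ?d) ^ DIM('a)) * vol (?P k)"
  proof (cases "0 < r k")
   case True
   have "vol (star k) <= ennreal ((2 * (2 * (?d * r k))) ^ DIM('a))"
    using True emeasure_cball_le[of "2 * (?d * r k)" "c k"] by (simp add: star_def)
   also have "(2 * (2 * (?d * r k))) ^ DIM('a) = (4 * ?d) ^ DIM('a) * r k ^ DIM('a)"
   proof -
    have "2 * (2 * (?d * r k)) = (4 * ?d) * r k" by simp
    then show ?thesis by (simp only: power_mult_distrib)
   qed
   also have "ennreal ... = ennreal ((4 * ?d) ^ DIM('a)) * vol (?P k)"
    using r0[of k] by (simp add: ennreal_mult)
   finally show ?thesis .
  qed (simp add: star_def)
 qed
 also have "... = ennreal ((4 * ?d) ^ DIM('a)) * (\<Sum>k. vol (?P k))"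
  by (simp only: ennreal_suminf_cmult)
 also have "(\<Sum>k. vol (?P k)) = vol (\<Union>k. ?P k)"
  by (rule suminf_emeasure) (use disj in auto)
 also have "vol (\<Union>k. ?P k) <= ennreal (m / mu)"
  using cr(4) mR mu m(2) by (intro ennreal_le_divideI) auto
 finally show ?thesis using mu m(2) by (simp add: ennreal_mult[symmetric] mult_left_mono)
qed
let ?g = "%x. f x - bad x"
have gL: "?g \<in> Linf_c" by (rule Linf_c_diff[OF f badL])
have gbound: "AE x. norm (?g x) <= 2 ^ DIM('a) * mu"
 using cr(5)
proof eventually_elim
 case (elim x)
 have le: "mu <= 2 ^ DIM('a) * mu" using mu by simp
 show ?case
 proof (cases "x \<in> (\<Union>k. ?P k)")
  case True
  then obtain j where j: "x \<in> ?P j" by blast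
  then have "?g x = av j" using bad_in[OF j] by (simp add: h_def restr_def)
  then show ?thesis using avb by simp
 next
  case False
  then have g: "?g x = f x" by (simp add: bad_out)
  show ?thesis
  proof (cases "x \<in> hcube b L")
   case True
   then have "norm (f x) <= mu" using elim False mu by (simp add: ennreal_le_iff)
   then show ?thesis using g le by simp
  qed (use g van mu in simp)
 qed
qed
have gmass: "mass ?g UNIV <= ennreal (3 * m)"
proof -
 have "mass bad UNIV <= (LN x. (\<Sum>k. enorm (h k x) * ind UNIV x))"
 proof (rule nn_integral_mono)
  fix x
  show "enorm (bad x) * ind UNIV x <= (\<Sum>k. enorm (h k x) * ind UNIV x)"
  proof (cases "x \<in> (\<Union>k. ?P k)")
   case True
   then obtain j where j: "x \<in> ?P j" by blast
   show ?thesis unfolding bad_in[OF j] by (rule ennreal_le_suminf)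
  qed (simp add: bad_out)
 qed
 also have "... = (\<Sum>k. mass (h k) UNIV)" by (rule nn_integral_suminf) measurable
 also have "... <= (\<Sum>k. 2 * mass f (?P k))" by (intro suminf_le summableI hmass)
 also have "... = 2 * (\<Sum>k. mass f (?P k))" by (simp only: ennreal_suminf_cmult)
 also have "... <= 2 * ennreal m" by (intro mult_left_mono massP) simp
 finally have mb: "mass bad UNIV <= 2 * ennreal m" .
 have "mass ?g UNIV <= (LN x. enorm (f x) * ind UNIV x + enorm (bad x) * ind UNIV x)"
 proof (rule nn_integral_mono)
  fix x
  show "enorm (f x - bad x) * ind UNIV x <= enorm (f x) * ind UNIV x + enorm (bad x) * ind UNIV x"
   using norm_triangle_ineq4[of "f x" "bad x"] by (simp add: ennreal_plus[symmetric] ennreal_leI del: ennreal_plus)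
 qed
 also have "... = mass f UNIV + mass bad UNIV" by (rule nn_integral_add) measurable
 also have "... <= ennreal m + 2 * ennreal m" unfolding m(1) by (intro add_left_mono mb)
 also have "... = ennreal m + ennreal (2 * m)" using ennreal_mult[of 2 m] m(2) by simp
 also have "... = ennreal (m + 2 * m)" by (rule ennreal_plus[symmetric]) (use m(2) in auto)
 finally show ?thesis by simp
qed
have "(LN x. ennreal ((norm (?g x))\<^sup>2)) <= (LN x. ennreal (2 ^ DIM('a) * mu) * (enorm (?g x) * ind UNIV x))"
 using gbound
proof (intro nn_integral_mono_AE, eventually_elim)
 case (elim x)
 have "(norm (?g x))\<^sup>2 <= 2 ^ DIM('a) * mu * norm (?g x)"
  unfolding power2_eq_square by (intro mult_right_mono elim) simp
 then show ?case using mu by (simp add: ennreal_mult[symmetric] ennreal_leI)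
qed
also have "... = ennreal (2 ^ DIM('a) * mu) * mass ?g UNIV"
 by (rule nn_integral_cmult) measurable
also have "... <= ennreal (2 ^ DIM('a) * mu) * ennreal (3 * m)" by (intro mult_left_mono gmass) simp
finally have g2: "(LN x. ennreal ((norm (?g x))\<^sup>2)) <= ennreal (2 ^ DIM('a) * mu) * ennreal (3 * m)" .
have Tg[measurable]: "T ?g \<in> Lmeas" by (intro L2_measurable T_L2 Linf_c_subset_L2 gL)
define S1 where "S1 = {x \<in> space lebesgue. mu / 2 < norm (T ?g x)}"
have S1m[measurable]: "S1 \<in> sets lebesgue" unfolding S1_def by measurable
have "ennreal ((mu / 2)\<^sup>2) * vol S1 <= (LN x\<in>S1. ennreal ((norm (T ?g x))\<^sup>2))"
 by (rule chebyshev_ennreal[OF _ S1m]) (use mu in \<open>auto simp: S1_def intro!: ennreal_leI power_mono\<close>)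
also have "... <= (LN x. ennreal ((norm (T ?g x))\<^sup>2))"
 by (intro nn_integral_mono) (auto split: split_indicator)
also have "... <= ennreal (CT\<^sup>2) * (LN x. ennreal ((norm (?g x))\<^sup>2))"
 by (rule T_bound[OF Linf_c_subset_L2[OF gL]])
also have "... <= ennreal (CT\<^sup>2) * (ennreal (2 ^ DIM('a) * mu) * ennreal (3 * m))"
 by (intro mult_left_mono g2) simp
also have "... = ennreal (CT\<^sup>2 * (2 ^ DIM('a) * mu * (3 * m)))"
 using mu m(2) by (simp add: ennreal_mult)
finally have mS1: "vol S1 <= ennreal (CT\<^sup>2 * (2 ^ DIM('a) * mu * (3 * m)) / (mu / 2)\<^sup>2)"
 using mu m(2) by (intro ennreal_le_divideI) auto
have "AE x. x \<in> {x. mu < norm (T f x)} --> x \<in> S1 \<union> (S2 \<union> US)"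
 using T_diff[OF Linf_c_subset_L2[OF f] Linf_c_subset_L2[OF badL]]
proof eventually_elim
 case (elim x)
 show ?case
 proof
  assume "x \<in> {x. mu < norm (T f x)}"
  then have "mu < norm (T f x)" by simp
  also have "... <= norm (T ?g x) + norm (T bad x)"
   using norm_triangle_ineq[of "T ?g x" "T bad x"] elim by simp
  finally have "mu / 2 < norm (T ?g x) \<or> mu / 2 < norm (T bad x)" by linarith
  then show "x \<in> S1 \<union> (S2 \<union> US)" by (auto simp: S1_def S2_def)
 qed
qed
then have "vol {x. mu < norm (T f x)} <= vol (S1 \<union> (S2 \<union> US))"
 by (intro emeasure_mono_AE) auto
also have "... <= vol S1 + vol (S2 \<union> US)" by (rule emeasure_subadditive) auto
also have "... <= vol S1 + (vol S2 + vol US)"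
 by (intro add_left_mono emeasure_subadditive) auto
also have "... <= ennreal (CT\<^sup>2 * (2 ^ DIM('a) * mu * (3 * m)) / (mu / 2)\<^sup>2)
  + (ennreal (2 * (4 ^ DIM('a) * om_sum) * m / (mu / 2)) + ennreal ((4 * ?d) ^ DIM('a) * m / mu))"
 by (intro add_mono mS1 mS2 mUS)
also have "... = ennreal (CT\<^sup>2 * (2 ^ DIM('a) * mu * (3 * m)) / (mu / 2)\<^sup>2
  + (2 * (4 ^ DIM('a) * om_sum) * m / (mu / 2) + (4 * ?d) ^ DIM('a) * m / mu))"
 using mu m(2) om_sum_nonneg by simp
also have "CT\<^sup>2 * (2 ^ DIM('a) * mu * (3 * m)) / (mu / 2)\<^sup>2
  + (2 * (4 ^ DIM('a) * om_sum) * m / (mu / 2) + (4 * ?d) ^ DIM('a) * m / mu) = weak_const * m / mu"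
 using mu by (simp add: weak_const_def field_simps power2_eq_square)
finally show ?thesis .
qed

end

section \<open>Stopping cubes\<close>

definition kap :: "'a::euclidean_space itself => real" where
 "kap _ = 8 * real DIM('a) + 1"

lemma kap_ge_1: "1 <= kap TYPE('a::euclidean_space)"
 by (simp add: kap_def)

lemma hatr_eq: "hatr TYPE('a::euclidean_space) l = kap TYPE('a) * l"
 by (simp add: hatr_def kap_def)

lemma emeasure_UN_bool_le:
 assumes "!!i::bool. S i \<in> sets M" "!!i. emeasure M (S i) <= ennreal q" "0 <= q"
 shows "emeasure M (\<Union>i. S i) <= ennreal (2 * q)"
proof -
have "(\<Union>i. S i) = S True \<union> S False" by (auto simp: UNIV_bool)
then have "emeasure M (\<Union>i. S i) <= emeasure M (S True) + emeasure M (S False)"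
 using emeasure_subadditive[OF assms(1) assms(1)] by simp
also have "... <= ennreal q + ennreal q" by (intro add_mono assms(2))
also have "... = ennreal (2 * q)" using assms(3) by (simp flip: ennreal_plus)
finally show ?thesis .
qed

context dini_operator
begin

text \<open>
 The weak type bound at a level that is a large multiple of the mean.
\<close>

lemma local_weak_type:
 assumes eps: "0 < eps"
 shows "\<exists>A>0. ALL b L f. f \<in> Linf_c --> 0 < L --> (ALL x. x ~: hcube b L --> f x = 0) -->
  vol {x. A * rmass f UNIV < L ^ DIM('a) * norm (T f x)} <= ennreal (eps * L ^ DIM('a))"
proof -
have wc: "0 <= weak_const" using om_sum_nonneg by (simp add: weak_const_def)
define A where "A = max 1 (weak_const / eps)"
have A: "1 <= A" "weak_const / eps <= A" by (auto simp: A_def)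
show ?thesis
proof (intro exI[of _ A] conjI allI impI)
 show "0 < A" using A(1) by linarith
 fix b :: 'a and L :: real and f :: "'a => complex"
 assume f: "f \<in> Linf_c" and L: "0 < L" and van': "ALL x. x ~: hcube b L --> f x = 0"
 then have van: "!!x. x ~: hcube b L ==> f x = 0" by blast
 let ?m = "rmass f UNIV"
 have m: "mass f UNIV = ennreal ?m" by (rule mass_eq_rmass[OF f])
 have Ld: "0 < L ^ DIM('a)" using L by simp
 show "vol {x. A * ?m < L ^ DIM('a) * norm (T f x)} <= ennreal (eps * L ^ DIM('a))"
 proof (cases "?m = 0")
  case True
  have "(LN x. enorm (f x)) = 0" using m True by simp
  then have "AE x. enorm (f x) = 0"
   by (subst (asm) nn_integral_0_iff_AE) (use f in auto)
  then have "AE x. f x = 0 * f x" by eventually_elim simp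
  then have "AE x. T f x = T (%x. 0 * f x) x"
   by (intro T_cong L2_cmult Linf_c_subset_L2 f)
  with T_cmult[OF Linf_c_subset_L2[OF f], of 0] have "AE x. x \<in> {x. A * ?m < L ^ DIM('a) * norm (T f x)} --> x \<in> {}"
   by eventually_elim (simp add: True)
  then have "vol {x. A * ?m < L ^ DIM('a) * norm (T f x)} <= vol ({} :: 'a set)"
   by (rule emeasure_mono_AE) simp
  then show ?thesis by simp
 next
  case False
  then have m0: "0 < ?m" using rmass_nonneg[of f UNIV] by linarith
  let ?mu = "A * ?m / L ^ DIM('a)"
  have "vol {x. ?mu < norm (T f x)} <= ennreal (weak_const * ?m / ?mu)"
  proof (rule weak_type_level[OF f L van m m0])
   show "?m <= ?mu * L ^ DIM('a)" using Ld A(1) m0 L by simp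
  qed
  also have "weak_const * ?m / ?mu = weak_const / A * L ^ DIM('a)" using m0 by simp
  also have "ennreal ... <= ennreal (eps * L ^ DIM('a))"
  proof (intro ennreal_leI mult_right_mono)
   show "weak_const / A <= eps" using A eps by (simp add: field_simps)
  qed (use Ld in simp)
  also have "{x. ?mu < norm (T f x)} = {x. A * ?m < L ^ DIM('a) * norm (T f x)}"
   using Ld by (auto simp: field_simps)
  finally show ?thesis .
 qed
qed
qed

text \<open>
 Two functions are treated at once because the commutator involves both \<open>T f\<close> and
 \<open>T ((b - c) f)\<close> on the same cubes. The cubes are the Calderon--Zygmund cubes of the
 indicator of the exceptional set, where an image under \<open>T\<close> or a maximal function is
 large. It fills at most half of each selected cube, so that each contains a good point, at which
 \<open>T\<close> is small and from which \<open>kernel_oscillation\<close> transports the bound to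
 the whole cube.
\<close>

theorem stopping_cubes:
 shows "\<exists>A>0. ALL a l f. 0 < l --> (\<forall>i::bool. f i \<in> Linf_c) --> (EX c r. packing c r a l \<and>
  vol (UQ c r) <= ennreal (l ^ DIM('a) / 2) \<and>
  (ALL i. AE x. x \<in> hcube a l - (UQ c r) -->
    l ^ DIM('a) * norm (T (restr (hat a l) (f i)) x) <= A * rmass (f i) (hat a l)) \<and>
  (ALL i k. 0 < r k --> (AE x. x \<in> hcube (c k) (r k) -->
    l ^ DIM('a) * norm (T (%x. restr (hat a l) (f i) x - restr (hat (c k) (r k)) (f i) x) x) <= A * rmass (f i) (hat a l))))"
proof -
let ?kappa = "kap TYPE('a)" and ?d = "DIM('a)"
define theta :: real where "theta = 1 / (16 * 2 ^ ?d)"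
have theta: "0 < theta" "theta <= 1/16" by (simp_all add: theta_def divide_le_eq)
have kappa: "1 <= ?kappa" by (rule kap_ge_1)
have kappad: "1 <= ?kappa ^ ?d" using kappa by (rule one_le_power)
have "0 < theta / ?kappa ^ ?d" using theta(1) kappa by simp
then obtain A1 where A1: "0 < A1" and A1': "ALL b L f. f \<in> Linf_c --> 0 < L --> (ALL x. x ~: hcube b L --> f x = 0) -->
 vol {x. A1 * rmass f UNIV < L ^ ?d * norm (T f x)} <= ennreal (theta / ?kappa ^ ?d * L ^ ?d)"
 using local_weak_type[of "theta / ?kappa ^ ?d"] by blast
define A2 where "A2 = (10 * real ?d) ^ ?d / theta"
have A2: "0 < A2" using theta by (simp add: A2_def)
define C4 where "C4 = 4 ^ ?d * om_sum"
have C4: "0 <= C4" using om_sum_nonneg by (simp add: C4_def)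
define A where "A = A1 + A1 * A2 + C4 * A2"
have A: "A1 <= A" "0 < A" using A1 A2 C4 by (auto simp: A_def add_pos_nonneg)
show ?thesis
proof (intro exI[of _ A] conjI A(2), intro allI impI)
 fix a :: 'a and l :: real and f :: "bool => 'a => complex"
 assume l: "0 < l" and "ALL i. f i \<in> Linf_c"
 then have f: "f i \<in> Linf_c" for i by blast
 let ?R = "%i. restr (hat a l) (f i)" and ?m = "%i. rmass (f i) (hat a l)"
 have ld: "0 < l ^ ?d" using l by simp
 have RL: "restr (hat b q) (f i) \<in> Linf_c" for b q i by (intro Linf_c_restr f) simp
 have Rm: "rmass (restr B (f i)) UNIV = rmass (f i) B" for B i
  unfolding rmass_def mass_restr_UNIV ..
 have TRm[measurable]: "T (restr (hat b q) (f i)) \<in> Lmeas" for b q i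
  by (intro L2_measurable T_L2 Linf_c_subset_L2 RL)
 define W where "W b q i = {x \<in> space lebesgue. A1 * rmass (f i) (hat b q) < (?kappa * q) ^ ?d * norm (T (restr (hat b q) (f i)) x)}" for b q i
 have Wm[measurable]: "W b q i \<in> sets lebesgue" for b q i unfolding W_def by measurable
 have Wb: "vol (W b q i) <= ennreal (theta * q ^ ?d)" if q: "0 < q" for b q i
 proof -
  have "vol {x. A1 * rmass (restr (hat b q) (f i)) UNIV < (?kappa * q) ^ ?d * norm (T (restr (hat b q) (f i)) x)}
    <= ennreal (theta / ?kappa ^ ?d * (?kappa * q) ^ ?d)"
  proof (rule A1'[rule_format, OF RL])
   show "0 < ?kappa * q" using kappa q by simp
   show "restr (hat b q) (f i) x = 0" if "x ~: hcube (hatc b q) (?kappa * q)" for x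
    using that by (simp add: restr_def hatr_eq)
  qed
  also have "theta / ?kappa ^ ?d * (?kappa * q) ^ ?d = theta * q ^ ?d" using kappa by (simp add: power_mult_distrib)
  finally show ?thesis by (simp add: W_def Rm)
 qed
 define V where "V i = {x \<in> space lebesgue. ennreal (A2 * ?m i / l ^ ?d) < maximal (?R i) x}" for i
 have Vm[measurable]: "V i \<in> sets lebesgue" for i unfolding V_def by measurable
 have Vb: "vol (V i) <= ennreal (theta * l ^ ?d)" for i
 proof (cases "?m i = 0")
  case True
  have z: "mass (?R i) B = 0" for B
  proof -
   have "mass (?R i) B <= mass (?R i) UNIV" by (rule mass_mono) simp
   also have "... = ennreal (?m i)" unfolding mass_restr_UNIV by (rule mass_eq_rmass[OF f])
   finally show ?thesis using True by simp
  qed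
  have "maximal (?R i) x = 0" for x unfolding maximal_def z by (intro antisym SUP_least) auto
  then have "V i = {}" by (simp add: V_def)
  then show ?thesis by simp
 next
  case False
  then have m0: "0 < ?m i" using rmass_nonneg[of "f i" "hat a l"] by linarith
  have t: "0 < A2 * ?m i / l ^ ?d" using m0 A2 ld by simp
  have mU: "mass (?R i) UNIV = ennreal (?m i)" unfolding mass_restr_UNIV by (rule mass_eq_rmass[OF f])
  have "ennreal (A2 * ?m i / l ^ ?d) * vol {x. ennreal (A2 * ?m i / l ^ ?d) < maximal (?R i) x}
    <= ennreal ((10 * real ?d) ^ ?d) * mass (?R i) UNIV"
   by (rule maximal_weak_type[OF Linf_c_measurable[OF RL] t]) (simp only: mU ennreal_less_top infinity_ennreal_def)
  also have "... = ennreal ((10 * real ?d) ^ ?d * ?m i)" unfolding mU using m0 by (simp add: ennreal_mult)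
  finally have "vol (V i) <= ennreal ((10 * real ?d) ^ ?d * ?m i / (A2 * ?m i / l ^ ?d))"
   using t m0 by (intro ennreal_le_divideI) (auto simp: V_def)
  also have "(10 * real ?d) ^ ?d * ?m i / (A2 * ?m i / l ^ ?d) = theta * l ^ ?d"
   using m0 theta(1) by (simp add: A2_def)
  finally show ?thesis .
 qed
 define E where "E = hcube a l \<inter> ((\<Union>i. W a l i) \<union> (\<Union>i. V i))"
 have UWm: "(\<Union>i. W a l i) \<in> sets lebesgue" "(\<Union>i. V i) \<in> sets lebesgue"
  by (intro sets.countable_UN'' Wm Vm; simp)+
 have Em[measurable]: "E \<in> sets lebesgue" unfolding E_def using UWm by (intro sets.Int sets.Un) auto
 have Eb: "vol E <= ennreal (4 * theta * l ^ ?d)"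
 proof -
  have "vol E <= vol ((\<Union>i. W a l i) \<union> (\<Union>i. V i))"
   using UWm by (intro emeasure_mono) (auto simp: E_def)
  also have "... <= vol (\<Union>i. W a l i) + vol (\<Union>i. V i)"
   using UWm by (intro emeasure_subadditive)
  also have "... <= ennreal (2 * (theta * l ^ ?d)) + ennreal (2 * (theta * l ^ ?d))"
   using theta ld by (intro add_mono emeasure_UN_bool_le Wm Vm Wb l Vb) auto
  also have "... = ennreal (4 * theta * l ^ ?d)" using theta ld by (simp flip: ennreal_plus)
  finally show ?thesis .
 qed
 define mu :: real where "mu = 1 / (2 * 2 ^ ?d)"
 have mu: "0 < mu" "mu < 1" "mu = 8 * theta" "2 ^ ?d * mu = 1/2"
 proof -
  have "(1::real) < 2 ^ Suc ?d" by (rule one_less_power) auto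
  then show "mu < 1" unfolding mu_def power_Suc by (simp add: divide_less_eq del: zero_less_power)
 qed (simp_all add: mu_def theta_def)
 let ?h = "%x. ind E x :: ennreal"
 have Eint: "(LN x\<in>B. ?h x) = vol (E \<inter> B)" if "B \<in> sets lebesgue" for B
 proof -
  have "(LN x\<in>B. ?h x) = (LN x. ind (E \<inter> B) x)"
   by (intro nn_integral_cong) (auto split: split_indicator)
  then show ?thesis using that by simp
 qed
 have EQ: "(LN x\<in>hcube a l. ?h x) <= ennreal (4 * theta * l ^ ?d)"
 proof -
  have "E \<inter> hcube a l = E" by (auto simp: E_def)
  then show ?thesis using Eb Eint[OF hcube_lebesgue, of a l] by simp
 qed
 have avg: "(LN x\<in>hcube a l. ?h x) <= ennreal (mu * l ^ ?d)"
  by (rule order_trans[OF EQ]) (use mu(3) theta ld in \<open>auto intro!: ennreal_leI\<close>)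
 have hm: "?h \<in> Lmeas" by measurable
 obtain c r where cr: "packing c r a l"
  "!!k. 0 < r k ==> ennreal (mu * r k ^ ?d) <= (LN x\<in>hcube (c k) (r k). ?h x)"
  "!!k. 0 < r k ==> (LN x\<in>hcube (c k) (r k). ?h x) <= ennreal (2 ^ ?d * mu * r k ^ ?d)"
  "ennreal mu * vol (UQ c r) <= (LN x\<in>hcube a l. ?h x)"
  "AE x. x \<in> hcube a l - (UQ c r) --> ?h x <= ennreal mu"
  by (rule calderon_zygmund_cubes[OF hm l mu(1) avg]) (rule that)
 have half: "vol (UQ c r) <= ennreal (l ^ ?d / 2)"
 proof -
  have "vol (UQ c r) <= ennreal (4 * theta * l ^ ?d / mu)"
   by (rule ennreal_le_divideI[OF mu(1) _ order_trans[OF cr(4) EQ]]) (use theta ld in auto)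
  also have "4 * theta * l ^ ?d / mu = l ^ ?d / 2" using theta(1) by (simp add: mu(3))
  finally show ?thesis .
 qed
 have off: "AE x. x \<in> hcube a l - (UQ c r) --> l ^ ?d * norm (T (?R i) x) <= A * ?m i" for i
  using cr(5)
 proof eventually_elim
  case (elim x)
  show ?case
  proof
   assume x: "x \<in> hcube a l - (UQ c r)"
   then have "?h x <= ennreal mu" using elim by blast
   then have "x ~: E" using mu(2) by (cases "x \<in> E") auto
   then have "x ~: W a l i" using x by (auto simp: E_def)
   then have "(?kappa * l) ^ ?d * norm (T (?R i) x) <= A1 * ?m i" by (simp add: W_def not_less)
   moreover have "l ^ ?d * norm (T (?R i) x) <= (?kappa * l) ^ ?d * norm (T (?R i) x)"
    using kappad ld by (intro mult_right_mono) (auto simp: power_mult_distrib)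
   moreover have "A1 * ?m i <= A * ?m i" by (intro mult_right_mono A rmass_nonneg)
   ultimately show "l ^ ?d * norm (T (?R i) x) <= A * ?m i" by linarith
  qed
 qed
 have inside: "AE x. x \<in> hcube (c k) (r k) -->
   l ^ ?d * norm (T (%x. ?R i x - restr (hat (c k) (r k)) (f i) x) x) <= A * ?m i" if r: "0 < r k" for i k
 proof -
  let ?P = "hcube (c k) (r k)" and ?S = "restr (hat (c k) (r k)) (f i)"
  let ?G = "%x. ?R i x - ?S x"
  have sub: "?P \<subseteq> hcube a l" using cr(1) by (simp add: packing_def)
  have hsub: "hat (c k) (r k) \<subseteq> hat a l" by (rule hat_mono[OF r sub])
  have GL: "?G \<in> Linf_c" by (rule Linf_c_diff[OF RL RL])
  have Gvan: "?G y = 0" if "y \<in> hat (c k) (r k)" for y using that hsub by (auto simp: restr_def)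
  have Gle: "norm (?G y) <= norm (?R i y)" for y using hsub by (auto simp: restr_def)
  have rd: "0 < r k ^ ?d" using r by simp
  have emP: "vol ?P = ennreal (r k ^ ?d)" by (rule emeasure_hcube) (use r in simp)
  let ?J = "%x. LI y. K x y * ?G y"
  define F where "F = {y. \<forall>x\<in>?P. 4 * (real ?d * r k) <= norm (x - y)}"
  have Fc: "closed F"
  proof -
   have "F = (\<Inter>x\<in>?P. {y. 4 * (real ?d * r k) <= norm (x - y)})" by (auto simp: F_def)
   also have "closed ..." by (intro closed_INT ballI closed_Collect_le continuous_intros)
   finally show ?thesis .
  qed
  have Fv: "?G y = 0" if "y ~: F" for y
   using that Gvan far_off_hat[of _ "c k" "r k" y] by (auto simp: F_def)
  have PF: "x ~: F" if "x \<in> ?P" for x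
  proof
   assume "x \<in> F"
   then have "4 * (real ?d * r k) <= norm (x - x)" using that unfolding F_def by blast
   then have "4 * (real ?d * r k) <= 0" by (simp only: diff_self norm_zero)
   moreover have "0 < 4 * (real ?d * r k)" using r by simp
   ultimately show False by (rule notE[OF leD])
  qed
  have "AE x. x ~: F --> T ?G x = ?J x"
   by (rule kernel_representation[OF GL Fc]) (rule Fv)
  then have rep: "AE x. x \<in> ?P --> T ?G x = ?J x"
   by eventually_elim (use PF in blast)
  have lin: "AE x. T ?G x = T (?R i) x - T ?S x"
   by (rule T_diff[OF Linf_c_subset_L2[OF RL] Linf_c_subset_L2[OF RL]])
  define Z where "Z = ?P - E - W (c k) (r k) i"
  have Zm: "Z \<in> sets lebesgue" unfolding Z_def by (intro sets.Diff Em Wm) simp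
  have "0 < vol Z"
  proof (rule ccontr)
   assume "\<not> ?thesis"
   then have Z0: "vol Z = 0" by simp
   have "?P \<subseteq> Z \<union> ((E \<inter> ?P) \<union> W (c k) (r k) i)" by (auto simp: Z_def)
   then have "vol ?P <= vol (Z \<union> ((E \<inter> ?P) \<union> W (c k) (r k) i))"
    using Zm by (intro emeasure_mono) auto
   also have "... <= vol Z + vol ((E \<inter> ?P) \<union> W (c k) (r k) i)"
    using Zm by (intro emeasure_subadditive) auto
   also have "... <= 0 + (vol (E \<inter> ?P) + vol (W (c k) (r k) i))"
    unfolding Z0 by (intro add_mono emeasure_subadditive) auto
   also have "... <= 0 + (ennreal (2 ^ ?d * mu * r k ^ ?d) + ennreal (theta * r k ^ ?d))"
    using cr(3)[OF r] Eint[OF hcube_lebesgue, of "c k" "r k"] Wb[OF r, of "c k" i] by (intro add_mono) auto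
   also have "... = ennreal (r k ^ ?d / 2 + theta * r k ^ ?d)"
    unfolding mu(4) using theta rd by (simp flip: ennreal_plus)
   finally have "r k ^ ?d <= r k ^ ?d / 2 + theta * r k ^ ?d"
    unfolding emP using theta rd by (subst (asm) ennreal_le_iff) auto
   moreover have "theta * r k ^ ?d <= 1/16 * r k ^ ?d" using theta(2) rd by (intro mult_right_mono) auto
   ultimately show False using rd by linarith
  qed
  moreover have "AE x. (x \<in> ?P --> T ?G x = ?J x) \<and> T ?G x = T (?R i) x - T ?S x"
   using rep lin by eventually_elim blast
  ultimately obtain z where z: "z \<in> Z" "z \<in> ?P --> T ?G z = ?J z" "T ?G z = T (?R i) z - T ?S z"
   using AE_positive_set_ex[OF Zm] by blast
  have zP: "z \<in> ?P" "z \<in> hcube a l" "z ~: W a l i" "z ~: W (c k) (r k) i" "z ~: V i"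
   using z(1) sub by (auto simp: Z_def E_def)
  have m0: "0 <= ?m i" by (rule rmass_nonneg)
  have Mz: "maximal (?R i) z <= ennreal (A2 * ?m i / l ^ ?d)" using zP(5) by (simp add: V_def not_less)
  have t1: "l ^ ?d * norm (T (?R i) z) <= A1 * ?m i"
  proof -
   have "(?kappa * l) ^ ?d * norm (T (?R i) z) <= A1 * ?m i" using zP(3) by (simp add: W_def not_less)
   moreover have "l ^ ?d * norm (T (?R i) z) <= (?kappa * l) ^ ?d * norm (T (?R i) z)"
    using kappad ld by (intro mult_right_mono) (auto simp: power_mult_distrib)
   ultimately show ?thesis by linarith
  qed
  have t2: "l ^ ?d * norm (T ?S z) <= A1 * A2 * ?m i"
  proof -
   have Kr: "0 < (?kappa * r k) ^ ?d" using kappa r by simp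
   have "ennreal (rmass (f i) (hat (c k) (r k))) = mass (?R i) (hat (c k) (r k))"
    unfolding mass_restr[OF hsub] by (rule mass_eq_rmass[OF f, symmetric])
   also have "... <= ennreal ((?kappa * r k) ^ ?d) * maximal (?R i) z"
    using maximal_ge_hcube[of z "hatc (c k) (r k)" "hatr TYPE('a) (r k)"] hcube_subset_hat zP(1)
    by (auto simp: hatr_eq)
   also have "... <= ennreal ((?kappa * r k) ^ ?d) * ennreal (A2 * ?m i / l ^ ?d)" by (intro mult_left_mono Mz) simp
   also have "... = ennreal ((?kappa * r k) ^ ?d * (A2 * ?m i / l ^ ?d))"
    using Kr by (intro ennreal_mult'[symmetric]) simp
   finally have "rmass (f i) (hat (c k) (r k)) <= (?kappa * r k) ^ ?d * (A2 * ?m i / l ^ ?d)"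
    using Kr A2 m0 ld by (subst (asm) ennreal_le_iff) auto
   then have "A1 * rmass (f i) (hat (c k) (r k)) <= A1 * ((?kappa * r k) ^ ?d * (A2 * ?m i / l ^ ?d))"
    using A1 by (intro mult_left_mono) auto
   moreover have "(?kappa * r k) ^ ?d * norm (T ?S z) <= A1 * rmass (f i) (hat (c k) (r k))"
    using zP(4) by (simp add: W_def not_less)
   ultimately have "(?kappa * r k) ^ ?d * norm (T ?S z) <= (?kappa * r k) ^ ?d * (A1 * (A2 * ?m i / l ^ ?d))"
    by (simp only: mult.left_commute)
   then have "norm (T ?S z) <= A1 * (A2 * ?m i / l ^ ?d)" using Kr by (simp only: mult_le_cancel_left_pos)
   then show ?thesis using ld by (simp add: field_simps)
  qed
  show ?thesis
   using rep
  proof eventually_elim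
   case (elim x)
   show ?case
   proof
    assume x: "x \<in> ?P"
    have "enorm (?J x - ?J z) <= ennreal (4 ^ ?d * om_sum) * maximal ?G z"
     by (rule kernel_oscillation[OF GL Gvan x zP(1)])
    also have "... <= ennreal C4 * ennreal (A2 * ?m i / l ^ ?d)"
     unfolding C4_def by (intro mult_left_mono order_trans[OF maximal_mono Mz] Gle) simp
    also have "... = ennreal (C4 * (A2 * ?m i / l ^ ?d))" using C4 by (intro ennreal_mult'[symmetric])
    finally have "norm (?J x - ?J z) <= C4 * (A2 * ?m i / l ^ ?d)"
     using C4 A2 m0 ld by (subst (asm) ennreal_le_iff) auto
    then have "l ^ ?d * norm (?J x - ?J z) <= C4 * A2 * ?m i" using ld by (simp add: field_simps)
    moreover have "norm (T ?G x) <= norm (?J x - ?J z) + (norm (T (?R i) z) + norm (T ?S z))"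
    proof -
     have "norm (T ?G x) <= norm (?J x - ?J z) + norm (?J z)"
      using elim x norm_triangle_ineq[of "?J x - ?J z" "?J z"] by simp
     moreover have "norm (?J z) <= norm (T (?R i) z) + norm (T ?S z)"
      using z(2,3) zP(1) norm_triangle_ineq4[of "T (?R i) z" "T ?S z"] by simp
     ultimately show ?thesis by linarith
    qed
    then have "l ^ ?d * norm (T ?G x) <= l ^ ?d * (norm (?J x - ?J z) + (norm (T (?R i) z) + norm (T ?S z)))"
     using ld by (intro mult_left_mono) auto
    ultimately show "l ^ ?d * norm (T ?G x) <= A * ?m i"
     using t1 t2 unfolding A_def distrib_left distrib_right by linarith
   qed
  qed
 qed
 show "EX c r. packing c r a l \<and>
  vol (UQ c r) <= ennreal (l ^ ?d / 2) \<and>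
  (ALL i. AE x. x \<in> hcube a l - (UQ c r) -->
    l ^ ?d * norm (T (?R i) x) <= A * ?m i) \<and>
  (ALL i k. 0 < r k --> (AE x. x \<in> hcube (c k) (r k) -->
    l ^ ?d * norm (T (%x. ?R i x - restr (hat (c k) (r k)) (f i) x) x) <= A * ?m i))"
  using cr(1) half off inside by (intro exI[of _ c] exI[of _ r] conjI allI impI)
qed
qed

end

section \<open>The associate space and duality\<close>

lemma parallelogram_gap:
 fixes A B D a b z :: real
 assumes "A < D + a" "B < D + b" "D <= z"
 shows "2 * A + 2 * B - 4 * z <= 2 * (D + a) + 2 * (D + b) - 4 * D"
 by (rule diff_mono[OF add_mono]) (use assms in auto)

lemma nn_integral_restr_sup:
 fixes u :: "'a::euclidean_space => ennreal"
 assumes u[measurable]: "u \<in> Lmeas"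
  and E: "!!n::nat. E n \<in> sets lebesgue" "!!n. E (Suc n) \<subseteq> E n" "AE x. EX n. x ~: E n"
  and A[measurable]: "A \<in> sets lebesgue"
  and gt: "t < (LN x\<in>A. u x)"
 shows "\<exists>m\<ge>n. t < (LN x\<in>A - E m. u x)"
proof -
note E(1)[measurable]
let ?f = "%m x. u x * ind (A - E (n + m)) x"
have dec: "E k \<subseteq> E j" if "j <= k" for j k using that by (rule lift_Suc_antimono_le[of E, OF E(2)])
have inc: "incseq ?f"
proof (rule incseq_SucI, rule le_funI)
 fix m x show "?f m x <= ?f (Suc m) x"
  using E(2)[of "n + m"] by (auto split: split_indicator)
qed
have "(%m. integral\<^sup>N lebesgue (?f m)) ---> (LN x. (SUP m. ?f m x))"
proof (rule nn_integral_LIMSEQ[OF inc])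
 show "(%m. ?f m x) ---> (SUP m. ?f m x)" for x
  using inc by (intro LIMSEQ_SUP) (auto simp: incseq_def le_fun_def)
qed measurable
also have "(LN x. (SUP m. ?f m x)) = (LN x\<in>A. u x)"
 using E(3)
proof (intro nn_integral_cong_AE, eventually_elim)
 case (elim x)
 then obtain k where k: "x ~: E k" by blast
 then have k': "x ~: E (n + k)" using dec[of k "n + k"] by auto
 have "?f m x <= ?f k x" for m using k' by (auto split: split_indicator)
 then have "(SUP m. ?f m x) = ?f k x" by (intro antisym SUP_least SUP_upper) auto
 then show ?case using k' by (auto split: split_indicator)
qed
finally have "\<forall>\<^sub>F m in sequentially. t < integral\<^sup>N lebesgue (?f m)" using gt by (rule order_tendstoD)
then obtain m where "t < integral\<^sup>N lebesgue (?f m)" by (meson eventually_sequentially order_refl)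
then show ?thesis by (intro exI[of _ "n + m"]) simp
qed

context maximal_function_space
begin

abbreviation "X' \<equiv> associate_space X N"
abbreviation "N' \<equiv> associate_norm X N"

lemma assoc_measurable: "g \<in> X' ==> g \<in> Lmeas"
 by (simp add: associate_space_def L0_def)

lemma assoc_enorm: "g \<in> X' ==> associate_enorm X N g = ennreal (N' g)"
 by (simp add: associate_space_def associate_norm_def)

lemma assoc_nonneg: "0 <= N' g"
 by (simp add: associate_norm_def)

lemma hoelder_unit:
 assumes "f \<in> X" "N f <= 1" "g \<in> X'"
 shows "(LN x. enorm (f x * g x)) <= ennreal (N' g)"
 unfolding assoc_enorm[OF assms(3), symmetric] associate_enorm_def
 by (rule SUP_upper) (use assms in blast)

lemma hoelder:
 assumes f: "f \<in> X" and g: "g \<in> X'"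
 shows "(LN x. enorm (f x * g x)) <= ennreal (N f * N' g)"
proof (cases "N f = 0")
case True
then have "AE x. f x = 0" using N_eq_0[OF f] by blast
then have "(LN x. enorm (f x * g x)) = (\<integral>\<^sup>+x. 0 \<partial>(lebesgue::'a measure))"
 by (intro nn_integral_cong_AE) (auto elim: eventually_mono)
then show ?thesis by simp
next
case False
then have pos: "0 < N f" using N_nonneg[OF f] by linarith
let ?f = "%x. of_real (1 / N f) * f x"
note [measurable] = X_measurable[OF f] assoc_measurable[OF g]
have fX: "?f \<in> X" by (rule X_cmult[OF f])
have "N ?f = 1" using N_cmult[OF f, of "of_real (1 / N f)"] pos by (simp add: norm_divide)
then have le: "(LN x. enorm (?f x * g x)) <= ennreal (N' g)"
 by (intro hoelder_unit fX g) simp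
have "(LN x. enorm (f x * g x)) = (LN x. ennreal (N f) * enorm (?f x * g x))"
 using pos by (intro nn_integral_cong) (simp add: norm_mult norm_divide ennreal_mult[symmetric])
also have "... = ennreal (N f) * (LN x. enorm (?f x * g x))"
 by (rule nn_integral_cmult) measurable
also have "... <= ennreal (N f) * ennreal (N' g)" by (intro mult_left_mono le) simp
also have "... = ennreal (N f * N' g)" using pos assoc_nonneg[of g] by (simp add: ennreal_mult)
finally show ?thesis .
qed

lemma assoc_le:
 assumes "g \<in> Lmeas" "0 <= c"
  "!!f. f \<in> X ==> N f <= 1 ==> (LN x. enorm (f x * g x)) <= ennreal c"
 shows "g \<in> X'" "N' g <= c"
proof -
have le: "associate_enorm X N g <= ennreal c"
 unfolding associate_enorm_def by (rule SUP_least) (use assms(3) in blast)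
then show "g \<in> X'"
 using assms(1) le_less_trans[OF le ennreal_less_top] by (simp add: associate_space_def L0_def)
show "N' g <= c"
 using enn2real_mono[OF le] assms(2) by (simp add: associate_norm_def)
qed

lemma assoc_ideal:
 assumes g: "g \<in> X'" and h: "h \<in> Lmeas" and C: "0 <= C"
  and le: "AE x. norm (h x) <= C * norm (g x)"
 shows "h \<in> X'" "N' h <= C * N' g"
proof -
note [measurable] = assoc_measurable[OF g] h
have "(LN x. enorm (f x * h x)) <= ennreal (C * N' g)" if f: "f \<in> X" "N f <= 1" for f
proof -
 note [measurable] = X_measurable[OF f(1)]
 have "(LN x. enorm (f x * h x)) <= (LN x. ennreal C * enorm (f x * g x))"
  using le
 proof (intro nn_integral_mono_AE, eventually_elim)
  case (elim x)
  have "norm (f x) * norm (h x) <= norm (f x) * (C * norm (g x))" by (intro mult_left_mono elim) simp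
  then show ?case using C by (simp add: norm_mult ennreal_mult[symmetric] ennreal_leI mult_ac)
 qed
 also have "... = ennreal C * (LN x. enorm (f x * g x))" by (rule nn_integral_cmult) measurable
 also have "... <= ennreal C * ennreal (N' g)" by (intro mult_left_mono hoelder_unit f g) simp
 also have "... = ennreal (C * N' g)" using C assoc_nonneg[of g] by (simp add: ennreal_mult)
 finally show ?thesis .
qed
then show "h \<in> X'" "N' h <= C * N' g"
 using assoc_le[OF h, of "C * N' g"] C assoc_nonneg[of g] by auto
qed

lemma Linf_c_in_assoc:
 assumes "g \<in> Linf_c"
 shows "g \<in> X'"
proof -
obtain B R where BR: "0 < B" "0 < R" "!!x. norm (g x) <= B" "!!x. g x ~= 0 ==> norm x <= R"
 using Linf_cE[OF assms] by blast
let ?P = "hcube ((- (R + 1)) *\<^sub>R One) (2 * (R + 1)) :: 'a set"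
have inP: "x \<in> ?P" if "norm x <= R" for x :: 'a
 unfolding hcube_def
proof (intro CollectI ballI)
 fix i :: 'a assume i: "i \<in> Basis"
 have "\<bar>x \<bullet> i\<bar> <= R" using Basis_le_norm[OF i, of x] that by linarith
 then show "((- (R + 1)) *\<^sub>R One) \<bullet> i <= x \<bullet> i \<and> x \<bullet> i < ((- (R + 1)) *\<^sub>R One) \<bullet> i + 2 * (R + 1)"
  using i by (simp add: abs_le_iff)
qed
have l: "0 < 2 * (R + 1)" using BR(2) by simp
obtain C where C: "0 <= C" "!!f. f \<in> X ==> mass f ?P <= ennreal (C * N f)"
 by (rule X_cube_bound[OF l, of "(- (R + 1)) *\<^sub>R One"]) (rule that)
show ?thesis
proof (rule assoc_le(1)[of g "B * C"])
 fix f assume f: "f \<in> X" "N f <= 1"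
 note [measurable] = X_measurable[OF f(1)]
 have "(LN x. enorm (f x * g x)) <= (LN x. ennreal B * (enorm (f x) * ind ?P x))"
 proof (rule nn_integral_mono)
  fix x
  show "enorm (f x * g x) <= ennreal B * (enorm (f x) * ind ?P x)"
  proof (cases "g x = 0")
   case False
   then have "x \<in> ?P" using BR(4) inP by blast
   moreover have "norm (f x) * norm (g x) <= norm (f x) * B" by (intro mult_left_mono BR(3)) simp
   ultimately show ?thesis using BR(1) by (simp add: norm_mult ennreal_mult[symmetric] ennreal_leI mult_ac)
  qed simp
 qed
 also have "... = ennreal B * mass f ?P" by (rule nn_integral_cmult) measurable
 also have "... <= ennreal B * ennreal (C * N f)" by (intro mult_left_mono C(2) f) simp
 also have "... <= ennreal B * ennreal (C * 1)" using C(1) f(2) by (intro mult_left_mono ennreal_leI) auto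
 also have "... = ennreal (B * C)" using BR(1) C(1) by (simp add: ennreal_mult)
 finally show "(LN x. enorm (f x * g x)) <= ennreal (B * C)" .
qed (use assms BR(1) C(1) in \<open>auto simp: Linf_c_measurable\<close>)
qed

lemma real_Linf_c_mult_integrable:
 fixes u v :: "'a => real"
 assumes "(%x. complex_of_real (u x)) \<in> Linf_c" "(%x. complex_of_real (v x)) \<in> Linf_c"
 shows "integrable lebesgue (%x. u x * v x)"
proof -
obtain B R where BR: "0 < B" "0 < R" "!!x. norm (complex_of_real (u x)) <= B"
 "!!x. complex_of_real (u x) ~= 0 ==> norm x <= R"
 using Linf_cE[OF assms(1)] by blast
have "(%x. complex_of_real (u x) * complex_of_real (v x)) \<in> Linf_c"
 by (rule Linf_c_mult[OF assms(2) Linf_c_measurable[OF assms(1)] BR(3)])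
then have "integrable lebesgue (%x. Re (complex_of_real (u x) * complex_of_real (v x)))"
 by (intro integrable_Re Linf_c_integrable)
then show ?thesis by simp
qed

text \<open>
 Suppose \<open>c < c' < N h\<close>. Let \<open>q\<close> be the point nearest to \<open>h\<close>
 in the mean square among all \<open>k\<close> with \<open>0 \<le> k \<le> h\<close> and \<open>N k
 \<le> c'\<close>; it exists by the parallelogram law and the Fatou property. Then \<open>g = h -
 q\<close> satisfies \<open>\<integral> g v \<le> m = \<integral> g q\<close> whenever \<open>N v
 \<le> c'\<close>, that is, \<open>N' g \<le> m / c'\<close>. The hypothesis gives
 \<open>\<integral> g\<^sup>2 + m = \<integral> h g \<le> c m / c' \<le> m\<close>. Thus \<open>g =
 0\<close> and \<open>N h = N q \<le> c'\<close>, a contradiction.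
\<close>

lemma X_duality_bounded:
 fixes h :: "'a => real"
 assumes h: "(%x. complex_of_real (h x)) \<in> Linf_c" "!!x. 0 <= h x" and c: "0 <= c"
  and dual: "!!g. g \<in> Linf_c ==> (LN x. enorm (complex_of_real (h x) * g x)) <= ennreal (c * N' g)"
 shows "N (%x. complex_of_real (h x)) <= c"
proof (rule ccontr)
let ?o = "%k x. complex_of_real (k x)"
assume "\<not> ?thesis"
then have gt: "c < N (?o h)" by simp
define c' where "c' = (c + N (?o h)) / 2"
have c': "c < c'" "c' < N (?o h)" "0 < c'" using gt c by (auto simp: c'_def)
define S where "S = {k. k \<in> Lmeas \<and> (ALL x. 0 <= k x \<and> k x <= h x) \<and> N (?o k) <= c'}"
have hm[measurable]: "h \<in> Lmeas"
proof -
 have "(%x. Re (?o h x)) \<in> Lmeas" using Linf_c_measurable[OF h(1)] by measurable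
 then show ?thesis by simp
qed
have domL: "?o k \<in> Linf_c" if "k \<in> Lmeas" "!!x. \<bar>k x\<bar> <= C * h x" for k C
proof (rule Linf_c_dominated[OF h(1), of _ C])
 show "?o k \<in> Lmeas" using that(1) by simp
 show "norm (?o k x) <= C * norm (?o h x)" for x using that(2)[of x] h(2)[of x] by simp
qed
have SL: "?o k \<in> Linf_c" if "k \<in> S" for k
 by (rule domL[of k 1]) (use that in \<open>auto simp: S_def\<close>)
define J where "J k = (LI x. (h x - k x) * (h x - k x))" for k
have J0: "0 <= J k" for k unfolding J_def by (rule integral_nonneg_AE) simp
have zS: "(%x. 0) \<in> S" using h(2) c'(3) N_eq_0[OF X_zero] by (simp add: S_def)
define D where "D = (INF k\<in>S. J k)"
have bdd: "bdd_below (J ` S)" by (intro bdd_belowI[of _ 0]) (use J0 in auto)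
have DJ: "D <= J k" if "k \<in> S" for k unfolding D_def by (rule cINF_lower[OF bdd that])
have "\<exists>k\<in>S. J k < D + (1/4) ^ n" for n
proof (rule ccontr)
 assume "\<not> ?thesis"
 then have "!!k. k \<in> S ==> D + (1/4) ^ n <= J k" by (auto simp: not_less)
 then have "D + (1/4) ^ n <= D" unfolding D_def using zS by (intro cINF_greatest) auto
 then show False using zero_less_power[of "1/4::real" n] by linarith
qed
then obtain k where k: "!!n. k n \<in> S" "!!n. J (k n) < D + (1/4) ^ n" by metis
have km[measurable]: "k n \<in> Lmeas" and k0: "0 <= k n x" and kh: "k n x <= h x"
 and kN: "N (?o (k n)) <= c'" for n x using k(1)[of n] by (auto simp: S_def)
have dL: "?o (%x. h x - k n x) \<in> Linf_c" for n
 by (rule domL[of _ 1]) (use k0 kh in auto)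
have uL: "?o (%x. k (Suc n) x - k n x) \<in> Linf_c" for n
proof (rule domL[of _ 1])
 show "\<bar>k (Suc n) x - k n x\<bar> <= 1 * h x" for x
  using k0[of n x] kh[of n x] k0[of "Suc n" x] kh[of "Suc n" x] by (simp add: abs_le_iff)
qed measurable
have para: "(LI x. (k (Suc n) x - k n x) * (k (Suc n) x - k n x)) <= 4 * (1/4) ^ n" for n
proof -
 let ?m = "%x. (k (Suc n) x + k n x) / 2"
 have "?m \<in> S"
 proof -
  have kX: "?o (k j) \<in> X" for j by (intro Linf_c_in_X SL k)
  have "N (%x. ?o (k (Suc n)) x + ?o (k n) x) <= c' + c'"
   using N_add[OF kX[of "Suc n"] kX[of n]] kN[of n] kN[of "Suc n"] by linarith
  moreover have "N (%x. of_real (1/2) * (?o (k (Suc n)) x + ?o (k n) x)) = norm (complex_of_real (1/2)) * N (%x. ?o (k (Suc n)) x + ?o (k n) x)"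
   by (rule N_cmult[OF X_add[OF kX kX]])
  moreover have "(%x. of_real (1/2) * (?o (k (Suc n)) x + ?o (k n) x)) = ?o ?m" by (simp add: fun_eq_iff)
  moreover have "norm (complex_of_real (1/2)) = 1/2" by (simp only: norm_of_real)
  ultimately have "N (?o ?m) <= c'" by (simp only:)
  moreover have "0 <= ?m x \<and> ?m x <= h x" for x
   using k0[of n x] kh[of n x] k0[of "Suc n" x] kh[of "Suc n" x] by auto
  moreover have "?m \<in> Lmeas" by measurable
  ultimately show ?thesis by (simp add: S_def)
 qed
 then have Dm: "D <= J ?m" by (rule DJ)
 have mL: "?o (%x. h x - ?m x) \<in> Linf_c"
 proof (rule domL[of _ 1])
  show "\<bar>h x - ?m x\<bar> <= 1 * h x" for x
   using k0[of n x] kh[of n x] k0[of "Suc n" x] kh[of "Suc n" x] by (auto simp: abs_le_iff field_simps)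
 qed measurable
 note i1 = real_Linf_c_mult_integrable[OF dL[of n] dL[of n]] real_Linf_c_mult_integrable[OF dL[of "Suc n"] dL[of "Suc n"]]
  real_Linf_c_mult_integrable[OF mL mL]
 have "(LI x. (k (Suc n) x - k n x) * (k (Suc n) x - k n x))
   = (LI x. (2 * ((h x - k n x) * (h x - k n x)) + 2 * ((h x - k (Suc n) x) * (h x - k (Suc n) x))) - 4 * ((h x - ?m x) * (h x - ?m x)))"
  by (rule Bochner_Integration.integral_cong[OF refl]) (simp add: field_simps)
 also have "... = 2 * J (k n) + 2 * J (k (Suc n)) - 4 * J ?m"
  unfolding J_def using i1 by (simp only: Bochner_Integration.integral_diff Bochner_Integration.integral_add integral_mult_right_zero
   integrable_mult_right Bochner_Integration.integrable_add)
 also have "... <= 2 * (D + (1/4) ^ n) + 2 * (D + (1/4) ^ Suc n) - 4 * D"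
  by (rule parallelogram_gap[OF k(2) k(2) Dm])
 also have "... <= 4 * (1/4) ^ n" by simp
 finally show ?thesis .
qed
define P where "P = {x. h x ~= 0}"
have Pm[measurable]: "P \<in> sets lebesgue"
proof -
 have "P = {x \<in> space lebesgue. h x ~= 0}" by (simp add: P_def)
 also have "... \<in> sets lebesgue" by measurable
 finally show ?thesis .
qed
have Pb: "bounded P" using h(1) by (simp add: Linf_c_def P_def)
have PL: "(%x. 1 * ind P x) \<in> Linf_c" by (rule Linf_c_indicator[OF Pm Pb])
define p :: real where "p = (LI x. ind P x)"
have Pint: "integrable lebesgue (%x. ind P x :: real)"
proof -
 have "integrable lebesgue (%x. Re (1 * ind P x))" by (intro integrable_Re Linf_c_integrable PL)
 moreover have "(%x. Re (1 * ind P x)) = (%x. ind P x :: real)"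
  by (auto simp: fun_eq_iff split: split_indicator)
 ultimately show ?thesis by simp
qed
have p0: "0 <= p" unfolding p_def by (rule integral_nonneg_AE) simp
have u1: "(LN x. ennreal \<bar>k (Suc n) x - k n x\<bar>) <= ennreal ((4 + p) * (1/2) ^ n)" for n
proof -
 let ?u = "%x. k (Suc n) x - k n x"
 have i: "integrable lebesgue (%x. ?u x * ?u x)" by (rule real_Linf_c_mult_integrable[OF uL uL])
 have ib: "integrable lebesgue (%x. 2 ^ n * (?u x * ?u x) + (1/2) ^ n * ind P x)"
  by (intro Bochner_Integration.integrable_add integrable_mult_right i Pint)
 have "(LN x. ennreal \<bar>?u x\<bar>) <= (LN x. ennreal (2 ^ n * (?u x * ?u x) + (1/2) ^ n * ind P x))"
 proof (intro nn_integral_mono ennreal_leI)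
  fix x
  show "\<bar>?u x\<bar> <= 2 ^ n * (?u x * ?u x) + (1/2) ^ n * ind P x"
  proof (cases "x \<in> P")
   case True
   show ?thesis
   proof (cases "(1/2) ^ n <= \<bar>?u x\<bar>")
    case big: True
    then have "1 <= 2 ^ n * \<bar>?u x\<bar>" by (simp add: power_one_over field_simps)
    then have "1 * \<bar>?u x\<bar> <= 2 ^ n * \<bar>?u x\<bar> * \<bar>?u x\<bar>" by (intro mult_right_mono) auto
    then have "\<bar>?u x\<bar> <= 2 ^ n * (?u x * ?u x)" by (simp add: mult.assoc)
    then show ?thesis by (simp add: add_increasing2)
   next
    case False
    then have a: "\<bar>?u x\<bar> <= (1/2) ^ n" by simp
    have b: "0 <= 2 ^ n * (?u x * ?u x)" by simp
    have i: "ind P x = (1::real)" using True by simp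
    show ?thesis unfolding i mult_1_right by (rule add_increasing[OF b a])
   qed
  next
   case False
   then have "h x = 0" by (simp add: P_def)
   then have "k n x = 0" "k (Suc n) x = 0" using k0[of n x] kh[of n x] k0[of "Suc n" x] kh[of "Suc n" x] by auto
   then show ?thesis by simp
  qed
 qed
 also have "... = ennreal (LI x. 2 ^ n * (?u x * ?u x) + (1/2) ^ n * ind P x)"
  by (rule nn_integral_eq_integral[OF ib]) simp
 also have "(LI x. 2 ^ n * (?u x * ?u x) + (1/2) ^ n * ind P x) = 2 ^ n * (LI x. ?u x * ?u x) + (1/2) ^ n * p"
  unfolding p_def using i Pint by (simp only: Bochner_Integration.integral_add integral_mult_right_zero integrable_mult_right)
 also have "ennreal ... <= ennreal (2 ^ n * (4 * (1/4) ^ n) + (1/2) ^ n * p)"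
  using para[of n] by (intro ennreal_leI add_right_mono mult_left_mono) auto
 also have "2 ^ n * (4 * (1/4::real) ^ n) = 4 * (1/2) ^ n"
  by (simp add: power_mult_distrib[symmetric])
 finally show ?thesis by (simp add: algebra_simps)
qed
have "(LN x. (\<Sum>n. ennreal \<bar>k (Suc n) x - k n x\<bar>)) = (\<Sum>n. LN x. ennreal \<bar>k (Suc n) x - k n x\<bar>)"
 by (rule nn_integral_suminf) measurable
also have "... <= (\<Sum>n. ennreal ((4 + p) * (1/2) ^ n))" by (intro suminf_le summableI u1)
also have "... = ennreal (\<Sum>n. (4 + p) * (1/2) ^ n)"
 using p0 by (intro suminf_ennreal2 summable_mult summable_geometric) auto
also have "... < \<infinity>" by simp
finally have "AE x. (\<Sum>n. ennreal \<bar>k (Suc n) x - k n x\<bar>) ~= \<infinity>"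
 by (intro nn_integral_PInf_AE) auto
then have conv: "AE x. convergent (%n. k n x)"
proof eventually_elim
 case (elim x)
 have "summable (%n. \<bar>k (Suc n) x - k n x\<bar>)"
  using elim by (intro summable_suminf_not_top) auto
 then have "summable (%n. k (Suc n) x - k n x)" by (rule summable_norm_cancel[of "%n. k (Suc n) x - k n x", unfolded real_norm_def])
 then have "convergent (%n. \<Sum>i<n. k (Suc i) x - k i x)" by (simp only: summable_iff_convergent)
 then have "convergent (%n. k n x - k 0 x)" by (simp only: sum_lessThan_telescope[of "%n. k n x"])
 then show ?case by (simp only: convergent_diff_const_right_iff)
qed
define q where "q x = max 0 (min (h x) (lim (%n. k n x)))" for x
have qm[measurable]: "q \<in> Lmeas" unfolding q_def by measurable
have q0: "0 <= q x" "q x <= h x" for x using h(2)[of x] by (auto simp: q_def)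
have lim: "AE x. (%n. k n x) ---> q x"
 using conv
proof eventually_elim
 case (elim x)
 then have l: "(%n. k n x) ---> lim (%n. k n x)" by (simp add: convergent_LIMSEQ_iff)
 have "0 <= lim (%n. k n x)" by (rule LIMSEQ_le_const[OF l]) (use k0 in auto)
 moreover have "lim (%n. k n x) <= h x" by (rule LIMSEQ_le_const2[OF l]) (use kh in auto)
 ultimately show ?case using l by (simp add: q_def)
qed
have qN: "N (?o q) <= c'"
proof (rule X_fatou(2)[of "%n. ?o (k n)"])
 show "?o (k n) \<in> X" for n by (intro Linf_c_in_X SL k)
 show "AE x. (%n. ?o (k n) x) ---> ?o q x"
  using lim by eventually_elim (rule tendsto_of_real)
qed (use kN in auto)
have qS: "q \<in> S" using q0 qN by (simp add: S_def)
have Jq: "J q <= D"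
proof -
 have "(%n. J (k n)) ---> J q"
  unfolding J_def
 proof (rule integral_dominated_convergence)
  show "integrable lebesgue (%x. h x * h x)" by (rule real_Linf_c_mult_integrable[OF h(1) h(1)])
  show "AE x. (%n. (h x - k n x) * (h x - k n x)) ---> (h x - q x) * (h x - q x)"
   using lim by eventually_elim (intro tendsto_intros)
  show "AE x. norm ((h x - k n x) * (h x - k n x)) <= h x * h x" for n
   using k0 kh h(2) by (intro AE_I2) (auto intro!: mult_mono)
 qed measurable
 moreover have "(%n. D + (1/4) ^ n) ---> D + 0" by (intro tendsto_intros LIMSEQ_power_zero) auto
 ultimately show ?thesis using k(2) by (intro LIMSEQ_le[of "%n. J (k n)" _ "%n. D + (1/4) ^ n"]) (auto intro: less_imp_le)
qed
define g where "g x = h x - q x" for x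
have g0: "0 <= g x" for x using q0 by (simp add: g_def)
have gm[measurable]: "g \<in> Lmeas" unfolding g_def by measurable
have gL: "?o g \<in> Linf_c" by (rule domL[of _ 1]) (use q0 in \<open>auto simp: g_def\<close>)
have qL: "?o q \<in> Linf_c" by (rule SL[OF qS])
define m where "m = (LI x. g x * q x)"
have m0: "0 <= m" unfolding m_def by (rule integral_nonneg_AE) (use g0 q0 in auto)
have var: "(LI x. g x * v x) <= m" if v: "?o v \<in> Linf_c" "!!x. 0 <= v x" "N (?o v) <= c'" for v
proof -
 have vm[measurable]: "v \<in> Lmeas"
 proof -
  have "(%x. Re (?o v x)) \<in> Lmeas" using Linf_c_measurable[OF v(1)] by measurable
  then show ?thesis by simp
 qed
 have wL: "?o (%x. v x - q x) \<in> Linf_c" using Linf_c_diff[OF v(1) qL] by simp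
 let ?I = "LI x. g x * (v x - q x)" and ?Q = "LI x. (v x - q x) * (v x - q x)"
 note i = real_Linf_c_mult_integrable[OF gL gL] real_Linf_c_mult_integrable[OF gL wL] real_Linf_c_mult_integrable[OF wL wL]
  real_Linf_c_mult_integrable[OF gL v(1)] real_Linf_c_mult_integrable[OF gL qL]
 have Q0: "0 <= ?Q" by (rule integral_nonneg_AE) simp
 have step: "2 * ?I <= t * ?Q" if t: "0 < t" "t <= 1" for t
 proof -
  let ?k = "%x. (1 - t) * q x + t * v x"
  let ?n = "%x. min (?k x) (h x)"
  have k0': "0 <= ?k x" for x using t q0[of x] v(2)[of x] by simp
  have kL: "?o ?k \<in> Linf_c"
   using Linf_c_add[OF Linf_c_cmult[OF qL, of "of_real (1 - t)"] Linf_c_cmult[OF v(1), of "of_real t"]] by simp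
  have qX: "?o q \<in> X" and vX: "?o v \<in> X" using Linf_c_in_X qL v(1) by auto
  have "N (%x. of_real (1 - t) * ?o q x + of_real t * ?o v x) <= N (%x. of_real (1 - t) * ?o q x) + N (%x. of_real t * ?o v x)"
   by (rule N_add[OF X_cmult[OF qX] X_cmult[OF vX]])
  also have "... = (1 - t) * N (?o q) + t * N (?o v)"
   unfolding N_cmult[OF qX] N_cmult[OF vX] norm_of_real using t by simp
  also have "... <= (1 - t) * c' + t * c'" using t qN v(3) by (intro add_mono mult_left_mono) auto
  finally have kN': "N (?o ?k) <= c'" by (simp add: algebra_simps)
  have "N (?o ?n) <= N (?o ?k)"
  proof (rule X_ideal(2)[OF Linf_c_in_X[OF kL]])
   show "AE x. norm (?o ?n x) <= norm (?o ?k x)"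
    unfolding norm_of_real using k0' h(2) by (intro AE_I2) (auto simp: min_def)
  qed measurable
  then have "?n \<in> S" using kN' k0' h(2) by (auto simp: S_def)
  then have "D <= J ?n" by (rule DJ)
  also have "J ?n <= (LI x. (h x - ?k x) * (h x - ?k x))"
   unfolding J_def
  proof (rule integral_mono)
   have a: "?o (%x. h x - ?k x) \<in> Linf_c" using Linf_c_diff[OF h(1) kL] by simp
   show "integrable lebesgue (%x. (h x - ?k x) * (h x - ?k x))" by (rule real_Linf_c_mult_integrable[OF a a])
   have b: "?o (%x. h x - ?n x) \<in> Linf_c" by (rule domL[of _ 1]) (use k0' h(2) in \<open>auto simp: min_def\<close>)
   show "integrable lebesgue (%x. (h x - ?n x) * (h x - ?n x))" by (rule real_Linf_c_mult_integrable[OF b b])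
   show "(h x - ?n x) * (h x - ?n x) <= (h x - ?k x) * (h x - ?k x)" for x by (simp add: min_def)
  qed
  also have "... = (LI x. (g x * g x - 2 * t * (g x * (v x - q x))) + t * t * ((v x - q x) * (v x - q x)))"
   by (rule Bochner_Integration.integral_cong[OF refl]) (simp add: g_def algebra_simps)
  also have "... = J q - 2 * t * ?I + t * t * ?Q"
   unfolding J_def g_def[symmetric] using i by (simp only: Bochner_Integration.integral_diff Bochner_Integration.integral_add integral_mult_right_zero
    integrable_mult_right Bochner_Integration.integrable_diff)
  finally have "2 * t * ?I <= t * t * ?Q" using Jq by linarith
  then have "t * (2 * ?I) <= t * (t * ?Q)" by (simp add: mult_ac)
  then show ?thesis using t(1) by simp
 qed
 have "?I <= 0"
 proof (rule ccontr)
  assume "\<not> ?thesis"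
  then have I: "0 < ?I" by simp
  define t where "t = min 1 (?I / (?Q + 1))"
  have t: "0 < t" "t <= 1"
   using divide_pos_pos[OF I add_nonneg_pos[OF Q0 zero_less_one]] by (auto simp: t_def)
  have "t * ?Q <= ?I / (?Q + 1) * ?Q" using Q0 by (intro mult_right_mono) (auto simp: t_def)
  also have "... <= ?I" using Q0 I by (simp add: field_simps)
  finally show False using step[OF t] I by linarith
 qed
 moreover have "?I = (LI x. g x * v x) - m"
  unfolding m_def using i by (simp add: right_diff_distrib)
 ultimately show ?thesis by simp
qed
have gN: "N' (?o g) <= m / c'"
proof (rule assoc_le(2))
 fix f assume f: "f \<in> X" "N f <= 1"
 note [measurable] = X_measurable[OF f(1)]
 let ?v = "%n x. c' * min (norm (f x)) (real n) * ind P x"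
 have vle: "\<bar>?v n x\<bar> <= c' * norm (f x)" for n x
  using c'(3) by (auto simp: abs_mult split: split_indicator)
 have vL: "?o (?v n) \<in> Linf_c" for n
 proof (rule Linf_c_dominated[OF PL, of _ "c' * real n"])
  show "norm (?o (?v n) x) <= c' * real n * norm (1 * ind P x :: complex)" for x
   unfolding norm_of_real using c'(3) by (auto simp: abs_mult split: split_indicator)
 qed measurable
 have "N (?o (?v n)) <= c' * N f" for n
  using vle c'(3) by (intro X_ideal_mult(2)[OF f(1)] AE_I2) (auto simp: norm_of_real simp del: of_real_mult)
 then have vN: "N (?o (?v n)) <= c'" for n using f(2) c'(3) by (meson mult_left_le order_trans less_imp_le)
 have each: "(LN x. ennreal (g x * ?v n x)) <= ennreal m" for n
 proof -
  have "(LN x. ennreal (g x * ?v n x)) = ennreal (LI x. g x * ?v n x)"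
   using g0 c'(3) by (intro nn_integral_eq_integral real_Linf_c_mult_integrable[OF gL vL] AE_I2) auto
  also have "... <= ennreal m" using vL vN c'(3) by (intro ennreal_leI var) auto
  finally show ?thesis .
 qed
 have "(%n. LN x. ennreal (g x * ?v n x)) ---> (LN x. ennreal (c' * (norm (f x) * g x)))"
 proof (rule nn_integral_LIMSEQ)
  show "incseq (%n x. ennreal (g x * ?v n x))"
   using g0 c'(3) by (intro incseq_SucI le_funI ennreal_leI mult_left_mono mult_right_mono) auto
  fix x
  show "(%n. ennreal (g x * ?v n x)) ---> ennreal (c' * (norm (f x) * g x))"
  proof (cases "x \<in> P")
   case True
   obtain n0 :: nat where n0: "norm (f x) <= real n0" using real_arch_simple by blast
   have "\<forall>\<^sub>F n in sequentially. ennreal (c' * (norm (f x) * g x)) = ennreal (g x * ?v n x)"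
    unfolding eventually_sequentially
   proof (intro exI[of _ n0] allI impI)
    fix n assume "n0 <= n"
    then have "real n0 <= real n" by simp
    then have "norm (f x) <= real n" using n0 by linarith
    then show "ennreal (c' * (norm (f x) * g x)) = ennreal (g x * ?v n x)" using True by (simp add: mult_ac)
   qed
   with tendsto_const show ?thesis by (rule Lim_transform_eventually)
  next
   case False
   then have "h x = 0" by (simp add: P_def)
   then have "g x = 0" using g0[of x] q0[of x] by (simp add: g_def)
   then show ?thesis by simp
  qed
 qed measurable
 then have le: "(LN x. ennreal (c' * (norm (f x) * g x))) <= ennreal m"
  by (rule LIMSEQ_le_const2) (use each in auto)
 have "ennreal c' * (LN x. enorm (f x * ?o g x)) = (LN x. ennreal c' * enorm (f x * ?o g x))"
  by (rule nn_integral_cmult[symmetric]) measurable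
 also have "... = (LN x. ennreal (c' * (norm (f x) * g x)))"
  using c'(3) g0 by (intro nn_integral_cong) (simp add: norm_mult ennreal_mult)
 finally have "ennreal c' * (LN x. enorm (f x * ?o g x)) <= ennreal m" using le by simp
 then have "ennreal (1 / c') * (ennreal c' * (LN x. enorm (f x * ?o g x))) <= ennreal (1 / c') * ennreal m"
  by (rule mult_left_mono) simp
 also have "ennreal (1 / c') * ennreal m = ennreal (m / c')" using c'(3) m0 by (simp add: ennreal_mult[symmetric])
 also have "ennreal (1 / c') * (ennreal c' * (LN x. enorm (f x * ?o g x))) = (LN x. enorm (f x * ?o g x))"
  using c'(3) by (simp add: mult.assoc[symmetric] ennreal_mult[symmetric])
 finally show "(LN x. enorm (f x * ?o g x)) <= ennreal (m / c')" .
qed (use m0 c' gL in \<open>auto simp: Linf_c_measurable\<close>)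
have ihg: "(LI x. h x * g x) = (LI x. g x * g x) + m"
proof -
 have "(LI x. h x * g x) = (LI x. g x * g x + g x * q x)"
  by (rule Bochner_Integration.integral_cong[OF refl]) (simp add: g_def algebra_simps)
 then show ?thesis
  unfolding m_def using real_Linf_c_mult_integrable[OF gL gL] real_Linf_c_mult_integrable[OF gL qL] by simp
qed
have "ennreal (LI x. h x * g x) = (LN x. ennreal (h x * g x))"
 using h(2) g0 by (intro nn_integral_eq_integral[symmetric] real_Linf_c_mult_integrable[OF h(1) gL] AE_I2) auto
also have "... = (LN x. enorm (?o h x * ?o g x))"
 using h(2) g0 by (intro nn_integral_cong) (simp add: norm_mult)
also have "... <= ennreal (c * N' (?o g))" by (rule dual[OF gL])
also have "... <= ennreal (c * (m / c'))" using c gN by (intro ennreal_leI mult_left_mono)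
finally have "(LI x. h x * g x) <= c * (m / c')"
 using c m0 c'(3) by (subst (asm) ennreal_le_iff) auto
also have "... <= m"
proof -
 have "c * m <= c' * m" using c'(1) m0 by (intro mult_right_mono) auto
 then show ?thesis using c'(3) by (simp add: field_simps)
qed
finally have gg: "(LI x. g x * g x) <= 0" using ihg by linarith
have "0 <= (LI x. g x * g x)" by (rule integral_nonneg_AE) simp
then have "(LI x. g x * g x) = 0" by (rule antisym[OF gg])
then have "AE x. g x * g x = 0"
 by (subst (asm) integral_nonneg_eq_0_iff_AE[OF real_Linf_c_mult_integrable[OF gL gL]]) auto
then have "AE x. ?o h x = ?o q x" by eventually_elim (simp add: g_def)
then have "N (?o h) = N (?o q)" by (intro X_cong(2)[OF Linf_c_in_X[OF qL] Linf_c_measurable[OF h(1)]])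
then show False using qN c'(2) by simp
qed

text \<open>
 The Lorentz--Luxemburg theorem: the norm of \<open>X\<close> is the norm of its second associate
 space, and bounded functions of bounded support suffice for testing.
\<close>

theorem X_duality:
 assumes hm: "h \<in> Lmeas" and c: "0 <= c"
  and dual: "!!g. g \<in> Linf_c ==> (LN x. enorm (h x * g x)) <= ennreal (c * N' g)"
 shows "h \<in> X" "N h <= c"
proof -
note hm[measurable]
let ?h = "%n x. min (norm (h x)) (real n) * ind (cball 0 (real n)) x"
let ?H = "%n x. complex_of_real (?h n x)"
have HL: "?H n \<in> Linf_c" for n
proof (rule Linf_cI[of _ "real n" "real n"])
 show "norm (?H n x) <= real n" for x unfolding norm_of_real by (auto split: split_indicator)
 show "norm x <= real n" if "?H n x ~= 0" for x using that by (auto split: split_indicator_asm)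
qed measurable
have le: "\<bar>?h n x\<bar> <= norm (h x)" for n x by (auto split: split_indicator)
have HN: "N (?H n) <= c" for n
proof (rule X_duality_bounded[OF HL _ c])
 fix g :: "'a => complex" assume g: "g \<in> Linf_c"
 have "(LN x. enorm (?H n x * g x)) <= (LN x. enorm (h x * g x))"
  unfolding norm_mult norm_of_real by (intro nn_integral_mono ennreal_leI mult_right_mono le) simp
 also have "... <= ennreal (c * N' g)" by (rule dual[OF g])
 finally show "(LN x. enorm (?H n x * g x)) <= ennreal (c * N' g)" .
qed simp
have lim: "AE x. (%n. ?H n x) ---> complex_of_real (norm (h x))"
proof (rule AE_I2)
 fix x
 obtain n0 :: nat where n0: "max (norm (h x)) (norm x) <= real n0" using real_arch_simple by blast
 have "\<forall>\<^sub>F n in sequentially. complex_of_real (norm (h x)) = ?H n x"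
  unfolding eventually_sequentially
 proof (intro exI[of _ n0] allI impI)
  fix n assume "n0 <= n"
  then have "real n0 <= real n" by simp
  then have "norm (h x) <= real n" "norm x <= real n" using n0 by auto
  then show "complex_of_real (norm (h x)) = ?H n x" by simp
 qed
 with tendsto_const show "(%n. ?H n x) ---> complex_of_real (norm (h x))" by (rule Lim_transform_eventually)
qed
have nm: "(%x. complex_of_real (norm (h x))) \<in> Lmeas" by measurable
note F = X_fatou[OF Linf_c_in_X[OF HL] HN lim nm]
show "h \<in> X" by (rule X_ideal(1)[OF F(1) hm]) simp
have "N h <= N (%x. complex_of_real (norm (h x)))" by (rule X_ideal(2)[OF F(1) hm]) simp
then show "N h <= c" using F(2) by simp
qed

text \<open>
 If all tails of \<open>g\<close> had norm at least \<open>delta\<close>, there would be disjointly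
 supported functions in the unit ball of \<open>X\<close>, each pairing with \<open>g\<close> to at
 least \<open>delta / 2\<close>. By \<open>r\<close>-convexity the sum of \<open>J\<close> of them
 has norm at most \<open>J\<^bsup>1/r\<^esup>\<close>, while its pairing with \<open>g\<close> is
 at least \<open>J delta / 2\<close>; this is impossible for large \<open>J\<close> as \<open>r >
 1\<close>.
\<close>

lemma assoc_tail:
 assumes conv: "r_convex r X N" and r: "1 < r" and g: "g \<in> X'"
  and E: "!!n::nat. E n \<in> sets lebesgue" "!!n. E (Suc n) \<subseteq> E n" "AE x. EX n. x ~: E n"
  and delta: "0 < delta"
 shows "EX n. N' (restr (E n) g) < delta"
proof (rule ccontr)
assume "\<not> ?thesis"
then have ge: "delta <= N' (restr (E n) g)" for n by (simp add: not_less)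
note gm[measurable] = assoc_measurable[OF g]
note E(1)[measurable]
have dec: "E m \<subseteq> E n" if "n <= m" for n m using that by (rule lift_Suc_antimono_le[of E, OF E(2)])
have rX: "restr (E n) g \<in> X'" for n
 by (rule assoc_ideal(1)[OF g, of _ 1]) (auto simp: restr_def)
have piece: "\<exists>m\<ge>n. \<exists>f\<in>X. N f <= 1 \<and> (ALL x. x ~: E n - E m --> f x = 0) \<and>
  ennreal (delta / 2) <= (LN x. enorm (f x * g x))" for n
proof -
 have "ennreal (delta / 2) < ennreal (N' (restr (E n) g))"
  using ge[of n] delta by (intro ennreal_lessI) auto
 then obtain f where f: "f \<in> X" "N f <= 1"
  "ennreal (delta / 2) < (LN x. enorm (f x * restr (E n) g x))"
  unfolding assoc_enorm[OF rX, symmetric] associate_enorm_def less_SUP_iff by blast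
 note [measurable] = X_measurable[OF f(1)]
 have "(LN x. enorm (f x * restr (E n) g x)) = (LN x\<in>E n. enorm (f x * g x))"
  by (intro nn_integral_cong) (auto simp: restr_def split: split_indicator)
 then obtain m where m: "n <= m" "ennreal (delta / 2) < (LN x\<in>E n - E m. enorm (f x * g x))"
  using nn_integral_restr_sup[of "%x. enorm (f x * g x)" E "E n" "ennreal (delta / 2)" n] E f(3) by auto
 have "(LN x\<in>E n - E m. enorm (f x * g x)) = (LN x. enorm (restr (E n - E m) f x * g x))"
  by (intro nn_integral_cong) (auto simp: restr_def split: split_indicator)
 moreover have "restr (E n - E m) f \<in> X" "N (restr (E n - E m) f) <= N f" using f(1) by (auto intro: X_restr N_restr)
 ultimately show ?thesis
  using m f(2) by (intro exI[of _ m] conjI bexI[of _ "restr (E n - E m) f"]) (auto simp: restr_def)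
qed
have claim: "\<exists>m\<ge>n. \<exists>f\<in>X. N f powr r <= real J \<and> (ALL x. x ~: E n - E m --> f x = 0) \<and>
  ennreal (real J * (delta / 2)) <= (LN x. enorm (f x * g x))" for n J
proof (induction J)
 case 0
 have "N (%x. 0) = 0" using N_eq_0[OF X_zero] by simp
 then show ?case using X_zero r by (intro exI[of _ n] conjI bexI[of _ "%x. 0"]) auto
next
 case (Suc J)
 then obtain m f where mf: "n <= m" "f \<in> X" "N f powr r <= real J" "!!x. x ~: E n - E m ==> f x = 0"
  "ennreal (real J * (delta / 2)) <= (LN x. enorm (f x * g x))" by blast
 obtain m' f' where mf': "m <= m'" "f' \<in> X" "N f' <= 1" "!!x. x ~: E m - E m' ==> f' x = 0"
  "ennreal (delta / 2) <= (LN x. enorm (f' x * g x))" using piece[of m] by blast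
 note [measurable] = X_measurable[OF mf(2)] X_measurable[OF mf'(2)]
 let ?s = "%x. f x + f' x"
 have disj: "f x = 0 \<or> f' x = 0" for x using mf(4)[of x] mf'(4)[of x] by blast
 have eq: "(norm (f x) powr r + norm (f' x) powr r) powr (1 / r) = norm (?s x)" for x
  using disj[of x] r by (auto simp: powr_powr)
 have sX: "?s \<in> X" by (rule X_add[OF mf(2) mf'(2)])
 have "N (%x. of_real (norm (?s x))) <= (N f powr r + N f' powr r) powr (1 / r)"
  using conv mf(2) mf'(2) unfolding r_convex_def eq[symmetric] by blast
 then have "N ?s <= (N f powr r + N f' powr r) powr (1 / r)" using X_norm(2)[OF sX] by simp
 then have "N ?s powr r <= ((N f powr r + N f' powr r) powr (1 / r)) powr r"
  using r N_nonneg[OF sX] by (intro powr_mono2) auto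
 also have "... = N f powr r + N f' powr r" using r by (simp add: powr_powr)
 also have "... <= real J + 1 powr r"
  using mf(3) mf'(3) r N_nonneg[OF mf'(2)] by (intro add_mono powr_mono2) auto
 finally have N1: "N ?s powr r <= real (Suc J)" by simp
 have "(LN x. enorm (?s x * g x)) =
   (LN x. enorm (f x * g x) + enorm (f' x * g x))"
  using disj by (intro nn_integral_cong) (metis add.left_neutral add.right_neutral ennreal_0 mult_zero_left norm_zero)
 also have "... = (LN x. enorm (f x * g x)) + (LN x. enorm (f' x * g x))"
  by (rule nn_integral_add) measurable
 finally have "ennreal (real J * (delta / 2)) + ennreal (delta / 2) <= (LN x. enorm (?s x * g x))"
  using add_mono[OF mf(5) mf'(5)] by simp
 moreover have "ennreal (real J * (delta / 2)) + ennreal (delta / 2) = ennreal (real (Suc J) * (delta / 2))"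
 proof -
  have "ennreal (real J * (delta / 2)) + ennreal (delta / 2) = ennreal (real J * (delta / 2) + delta / 2)"
   by (rule ennreal_plus[symmetric]) (use delta in auto)
  also have "real J * (delta / 2) + delta / 2 = real (Suc J) * (delta / 2)" by (simp add: algebra_simps)
  finally show ?thesis .
 qed
 moreover have "?s x = 0" if "x ~: E n - E m'" for x
 proof -
  have "x ~: E n - E m" "x ~: E m - E m'" using that dec[OF mf(1)] dec[OF mf'(1)] by blast+
  then show ?thesis using mf(4) mf'(4) by simp
 qed
 ultimately show ?case
  using N1 sX mf(1) mf'(1) by (intro exI[of _ m'] conjI bexI[of _ ?s]) auto
qed
define e where "e = 1 - 1 / r"
have e: "0 < e" using r by (simp add: e_def)
obtain J :: nat where J: "max 1 ((2 * N' g / delta + 1) powr (1 / e)) < real J" using reals_Archimedean2 by blast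
obtain m f where mf: "f \<in> X" "N f powr r <= real J"
  "ennreal (real J * (delta / 2)) <= (LN x. enorm (f x * g x))" using claim[of 0 J] by blast
have "ennreal (real J * (delta / 2)) <= ennreal (N f * N' g)" using mf(3) hoelder[OF mf(1) g] by order
then have 1: "real J * (delta / 2) <= N f * N' g"
 using N_nonneg[OF mf(1)] assoc_nonneg[of g] by (subst (asm) ennreal_le_iff) auto
have "N f = (N f powr r) powr (1 / r)" using r N_nonneg[OF mf(1)] by (simp add: powr_powr)
also have "... <= real J powr (1 / r)" using r mf(2) by (intro powr_mono2) auto
finally have 2: "N f <= real J powr (1 / r)" .
have J1: "1 < real J" using J by simp
have "real J = real J powr (1 / r) * real J powr e" using J1 by (simp add: e_def powr_add[symmetric])
then have "real J powr (1 / r) * real J powr e * (delta / 2) <= real J powr (1 / r) * N' g"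
 using 1 mult_right_mono[OF 2 assoc_nonneg[of g]] by simp
then have 3: "real J powr e * (delta / 2) <= N' g" using J1 by (simp add: mult.assoc)
have "2 * N' g / delta + 1 = ((2 * N' g / delta + 1) powr (1 / e)) powr e"
 using e delta assoc_nonneg[of g] by (simp add: powr_powr add_nonneg_pos)
also have "... <= real J powr e" using J e by (intro powr_mono2) auto
finally have "2 * N' g / delta + 1 <= real J powr e" .
then have "(2 * N' g / delta + 1) * (delta / 2) <= real J powr e * (delta / 2)" using delta by (intro mult_right_mono) auto
moreover have "(2 * N' g / delta + 1) * (delta / 2) = N' g + delta / 2" using delta by (simp add: field_simps)
ultimately show False using 3 delta by linarith
qed

end

section \<open>The form bound for the commutator\<close>

lemma ennreal_mult_lin:
 fixes a p q s t :: real
 assumes "0 <= a" "0 <= p" "0 <= q" "0 <= s" "0 <= t"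
 shows "ennreal (a * (p * s + q * t)) = ennreal a * (ennreal p * ennreal s + ennreal q * ennreal t)"
 using assms by (simp add: ennreal_mult)

lemma ennreal_mult_four:
 fixes a b k :: real
 assumes "0 <= a" "0 <= b" "0 <= k"
 shows "ennreal a * ennreal b * (ennreal k * ennreal k) = ennreal (a * b * (k * k))"
 using assms by (simp add: ennreal_mult)

text \<open>
 Up to a factor \<open>2\<close> the condition that the \<open>BMO\<close> norm is at most
 \<open>beta\<close>; with free constants it passes to truncations of \<open>b\<close>.
\<close>

definition osc_le :: "('a::euclidean_space => complex) => real => bool" where
 "osc_le b beta \<longleftrightarrow> (ALL a l. 0 < l --> (EX c. mass (%x. b x - c) (hcube a l) <= ennreal (beta * l ^ DIM('a))))"

text \<open>
 Subcubes of total measure at most half of the cube leave enough room to absorb a constant that is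
 a lower bound for \<open>W\<close>.
\<close>

lemma half_cube_average:
 fixes a :: "'a::euclidean_space"
 assumes l: "0 < l" and U: "U \<in> sets lebesgue" "U \<subseteq> hcube a l" "vol U <= ennreal (l ^ DIM('a) / 2)"
  and W: "W \<in> Lmeas" and u: "!!x. x \<in> hcube a l ==> u <= W x"
 shows "ennreal (l ^ DIM('a)) * u <= 2 * (LN x\<in>hcube a l - U. W x)"
proof -
have ld: "0 < l ^ DIM('a)" using l by simp
have DUm: "hcube a l - U \<in> sets lebesgue" using U(1) by (intro sets.Diff) auto
have "ennreal (l ^ DIM('a)) = vol (hcube a l)" using l by (simp only: emeasure_hcube less_imp_le)
also have "... = vol U + vol (hcube a l - U)"
 using plus_emeasure[OF U(1) DUm] U(2) by (simp add: Un_absorb1)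
also have "... <= ennreal (l ^ DIM('a) / 2) + vol (hcube a l - U)" by (intro add_right_mono U(3))
finally have 1: "ennreal (l ^ DIM('a)) <= ennreal (l ^ DIM('a) / 2) + vol (hcube a l - U)" .
have 2: "ennreal (l ^ DIM('a)) = ennreal (l ^ DIM('a) / 2) + ennreal (l ^ DIM('a) / 2)"
 using ld by (simp flip: ennreal_plus)
have 3: "ennreal (l ^ DIM('a) / 2) <= vol (hcube a l - U)"
 using 1 unfolding 2 by (simp add: ennreal_add_left_cancel_le)
have 4: "ennreal (l ^ DIM('a)) = 2 * ennreal (l ^ DIM('a) / 2)"
 using ld ennreal_mult[of 2 "l ^ DIM('a) / 2"] by simp
have "ennreal (l ^ DIM('a)) * u = 2 * (u * ennreal (l ^ DIM('a) / 2))" unfolding 4 by (simp only: mult_ac)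
also have "... <= 2 * (u * vol (hcube a l - U))" by (intro mult_left_mono 3) auto
also have "... <= 2 * (LN x\<in>hcube a l - U. W x)"
 by (intro mult_left_mono chebyshev_ennreal[OF W DUm] u) auto
finally show ?thesis .
qed

lemma nn_integral_hcube_split:
 assumes f[measurable]: "f \<in> Lmeas" and p: "packing c r a l"
 shows "(LN x\<in>hcube a l. f x) = (LN x\<in>hcube a l - (UQ c r). f x)
   + (\<Sum>k. LN x\<in>hcube (c k) (r k). f x)"
proof -
let ?U = "\<Union>k. hcube (c k) (r k)"
have Um: "?U \<in> sets lebesgue" by (rule packing_sets)
have sub: "?U \<subseteq> hcube a l" using p by (auto simp: packing_def)
have "(LN x\<in>hcube a l. f x) = (LN x\<in>(hcube a l - ?U) \<union> ?U. f x)"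
 using sub by (simp add: Un_absorb2)
also have "... = (LN x\<in>hcube a l - ?U. f x) + (LN x\<in>?U. f x)"
 by (rule nn_integral_disjoint_pair[OF f]) (use Um in auto)
also have "(LN x\<in>?U. f x) = (\<Sum>k. LN x\<in>hcube (c k) (r k). f x)"
 by (rule nn_integral_disjoint_family[OF f]) (use p in \<open>auto simp: packing_def\<close>)
finally show ?thesis .
qed

lemma mass_diff_const:
 fixes b :: "'a::euclidean_space => complex"
 assumes [measurable]: "b \<in> Lmeas" and l: "0 < l"
  and 1: "mass (%x. b x - c) (hcube a l) <= ennreal (p * l ^ DIM('a))" "0 <= p"
  and 2: "mass (%x. b x - c') (hcube a l) <= ennreal (q * l ^ DIM('a))" "0 <= q"
 shows "norm (c - c') <= p + q"
proof -
have ld: "0 < l ^ DIM('a)" using l by simp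
have "ennreal (norm (c - c') * l ^ DIM('a)) = (LN x\<in>hcube a l. enorm (c - c'))"
 using l by (intro nn_integral_const_hcube[symmetric]) auto
also have "... <= (LN x. enorm (b x - c) * ind (hcube a l) x + enorm (b x - c') * ind (hcube a l) x)"
proof (rule nn_integral_mono)
 fix x
 have "norm (c - c') <= norm (b x - c) + norm (b x - c')"
  using norm_triangle_ineq4[of "b x - c'" "b x - c"] by simp
 then have "enorm (c - c') <= enorm (b x - c) + enorm (b x - c')"
  by (simp add: ennreal_plus[symmetric] ennreal_leI del: ennreal_plus)
 then show "enorm (c - c') * ind (hcube a l) x <= enorm (b x - c) * ind (hcube a l) x + enorm (b x - c') * ind (hcube a l) x"
  by (auto split: split_indicator)
qed
also have "... = mass (%x. b x - c) (hcube a l) + mass (%x. b x - c') (hcube a l)"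
 by (rule nn_integral_add) measurable
also have "... <= ennreal (p * l ^ DIM('a)) + ennreal (q * l ^ DIM('a))" by (intro add_mono 1 2)
also have "... = ennreal ((p + q) * l ^ DIM('a))"
 using ld 1 2 by (simp add: distrib_right flip: ennreal_plus)
finally have "norm (c - c') * l ^ DIM('a) <= (p + q) * l ^ DIM('a)"
 using ld 1 2 by (subst (asm) ennreal_le_iff) auto
then show ?thesis using ld by simp
qed

text \<open>
 Stop where the mean of \<open>|b - c|\<close> is a large multiple of \<open>beta\<close>. Off the
 stopping cubes \<open>|b - c|\<close> is at most that multiple and \<open>|f|\<close> is at most
 its maximal function; on a stopping cube the constant changes by a multiple of
 \<open>beta\<close>, and the argument repeats.
\<close>

lemma oscillation_against_maximal:
 fixes b f :: "'a::euclidean_space => complex"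
 assumes bm[measurable]: "b \<in> Lmeas" and B: "!!x. norm (b x) <= B"
  and beta: "0 < beta" and osc: "osc_le b beta" and f: "f \<in> Linf_c"
  and l: "0 < l" and c: "mass (%x. b x - c) (hcube a l) <= ennreal (beta * l ^ DIM('a))"
 shows "(LN x\<in>hcube a l. ennreal (norm (b x - c) * norm (f x)))
   <= (LN x\<in>hcube a l. ennreal (6 * 2 ^ DIM('a) * beta) * maximal f x)"
proof -
let ?d = "DIM('a)"
note fm[measurable] = Linf_c_measurable[OF f]
have ex: "EX c. mass (%x. b x - c) (hcube a' l') <= ennreal (beta * l' ^ ?d)" if "0 < l'" for a' l'
 using osc that unfolding osc_le_def by blast
have someI': "mass (%x. b x - (SOME c. mass (%x. b x - c) (hcube a' l') <= ennreal (beta * l' ^ ?d))) (hcube a' l') <= ennreal (beta * l' ^ ?d)"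
 if "0 < l'" for a' l' by (rule someI_ex[OF ex[OF that]])
define m where "m a' l' = (if a' = a \<and> l' = l then c else (SOME c. mass (%x. b x - c) (hcube a' l') <= ennreal (beta * l' ^ ?d)))" for a' l'
have m: "mass (%x. b x - m a' l') (hcube a' l') <= ennreal (beta * l' ^ ?d)" if "0 < l'" for a' l'
 using someI'[OF that] c by (auto simp: m_def)
have B0: "0 <= B" using B[of undefined] norm_ge_zero order_trans by blast
obtain Bf where Bf: "0 < Bf" "!!x. norm (f x) <= Bf" using Linf_cE[OF f] by metis
define I where "I a' l' = (LN x\<in>hcube a' l'. ennreal (norm (b x - m a' l') * norm (f x)))" for a' l'
have "I a l <= (LN x\<in>hcube a l. ennreal (6 * 2 ^ ?d * beta) * maximal f x)"
proof (rule cube_iteration[where C = "(2 * B + beta) * Bf", OF _ _ _ _ l])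
 show "0 <= (2 * B + beta) * Bf" using B0 beta Bf by simp
 show "(%x. ennreal (6 * 2 ^ ?d * beta) * maximal f x) \<in> Lmeas" by measurable
 fix a' :: 'a and l' :: real assume l': "0 < l'"
 let ?Q = "hcube a' l'" and ?m = "m a' l'"
 have ld: "0 < l' ^ ?d" using l' by simp
 have "mass (%x. b x - 0) ?Q <= (LN x\<in>?Q. ennreal B)"
  using B by (intro nn_integral_mono mult_right_mono ennreal_leI) auto
 also have "... = ennreal (B * l' ^ ?d)" using l' B0 by (intro nn_integral_const_hcube) auto
 finally have "norm (?m - 0) <= beta + B"
  using m[OF l', of a'] beta B0 l' by (intro mass_diff_const[OF bm l']) auto
 then have bmb: "norm (b x - ?m) <= 2 * B + beta" for x
  using norm_triangle_ineq4[of "b x" ?m] B[of x] by simp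
 have "I a' l' <= (LN x\<in>?Q. ennreal ((2 * B + beta) * Bf))"
  unfolding I_def using bmb Bf B0 beta by (intro nn_integral_mono mult_right_mono ennreal_leI mult_mono) auto
 also have "... = ennreal ((2 * B + beta) * Bf * l' ^ ?d)"
  using l' B0 beta Bf by (intro nn_integral_const_hcube) auto
 finally show "I a' l' <= ennreal ((2 * B + beta) * Bf * l' ^ ?d)" .
 have hm: "(%x. enorm (b x - ?m)) \<in> Lmeas" by measurable
 have mu: "0 < 2 * beta" using beta by simp
 have avg: "mass (%x. b x - ?m) ?Q <= ennreal (2 * beta * l' ^ ?d)"
  by (rule order_trans[OF m[OF l']]) (use beta ld in \<open>auto intro!: ennreal_leI\<close>)
 obtain c r where cr: "packing c r a' l'"
  "!!k. 0 < r k ==> ennreal (2 * beta * r k ^ ?d) <= mass (%x. b x - ?m) (hcube (c k) (r k))"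
  "!!k. 0 < r k ==> mass (%x. b x - ?m) (hcube (c k) (r k)) <= ennreal (2 ^ ?d * (2 * beta) * r k ^ ?d)"
  "ennreal (2 * beta) * vol (UQ c r) <= mass (%x. b x - ?m) ?Q"
  "AE x. x \<in> ?Q - (UQ c r) --> enorm (b x - ?m) <= ennreal (2 * beta)"
  by (rule calderon_zygmund_cubes[OF hm l' mu avg]) (rule that)
 let ?U = "\<Union>k. hcube (c k) (r k)" and ?w = "3 * 2 ^ ?d * beta"
 have w: "0 <= ?w" "2 * beta <= ?w"
 proof -
  have "2 * beta <= 1 * (3 * beta)" using beta by simp
  also have "... <= 2 ^ ?d * (3 * beta)" using beta by (intro mult_right_mono) auto
  also have "... = ?w" by simp
  finally show "2 * beta <= ?w" .
 qed (use beta in simp)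
 have Usub: "?U \<subseteq> ?Q" using cr(1) by (auto simp: packing_def)
 have half: "vol ?U <= ennreal (l' ^ ?d / 2)"
 proof -
  have "vol ?U <= ennreal (beta * l' ^ ?d / (2 * beta))"
   by (rule ennreal_le_divideI[OF mu _ order_trans[OF cr(4) m[OF l']]]) (use beta ld in auto)
  then show ?thesis using beta by simp
 qed
 have off: "(LN x\<in>?Q - ?U. ennreal (norm (b x - ?m) * norm (f x))) <= (LN x\<in>?Q - ?U. ennreal ?w * enorm (f x))"
  using cr(5)
 proof (intro nn_integral_mono_AE, eventually_elim)
  case (elim x)
  show ?case
  proof (cases "x \<in> ?Q - ?U")
   case True
   then have "norm (b x - ?m) <= 2 * beta" using elim beta by (simp add: ennreal_le_iff)
   then have "norm (b x - ?m) * norm (f x) <= ?w * norm (f x)" using w by (intro mult_right_mono) auto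
   then show ?thesis using True w by (simp add: ennreal_mult[symmetric] ennreal_leI)
  qed simp
 qed
 have on: "(LN x\<in>hcube (c k) (r k). ennreal (norm (b x - ?m) * norm (f x)))
   <= (if 0 < r k then I (c k) (r k) else 0) + (LN x\<in>hcube (c k) (r k). ennreal ?w * enorm (f x))" for k
 proof (cases "0 < r k")
  case True
  let ?mk = "m (c k) (r k)"
  have "norm (?mk - ?m) <= beta + 2 ^ ?d * (2 * beta)"
   using beta by (intro mass_diff_const[OF bm True m[OF True] _ cr(3)[OF True]]) auto
  also have "... <= ?w"
  proof -
   have "1 * beta <= 2 ^ ?d * beta" using beta by (intro mult_right_mono) auto
   then show ?thesis by (simp add: algebra_simps)
  qed
  finally have mk: "norm (?mk - ?m) <= ?w" .
  have "(LN x\<in>hcube (c k) (r k). ennreal (norm (b x - ?m) * norm (f x)))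
    <= (LN x. ennreal (norm (b x - ?mk) * norm (f x)) * ind (hcube (c k) (r k)) x + ennreal ?w * enorm (f x) * ind (hcube (c k) (r k)) x)"
  proof (rule nn_integral_mono)
   fix x
   have "norm (b x - ?m) <= norm (b x - ?mk) + ?w"
    using norm_triangle_ineq[of "b x - ?mk" "?mk - ?m"] mk by simp
   then have "norm (b x - ?m) * norm (f x) <= (norm (b x - ?mk) + ?w) * norm (f x)" by (intro mult_right_mono) auto
   then have "ennreal (norm (b x - ?m) * norm (f x)) <= ennreal (norm (b x - ?mk) * norm (f x) + ?w * norm (f x))"
    by (intro ennreal_leI) (simp add: distrib_right)
   also have "... = ennreal (norm (b x - ?mk) * norm (f x)) + ennreal ?w * enorm (f x)"
    using w(1) by (subst ennreal_plus) (auto simp: ennreal_mult)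
   finally show "ennreal (norm (b x - ?m) * norm (f x)) * ind (hcube (c k) (r k)) x
     <= ennreal (norm (b x - ?mk) * norm (f x)) * ind (hcube (c k) (r k)) x + ennreal ?w * enorm (f x) * ind (hcube (c k) (r k)) x"
    by (auto split: split_indicator)
  qed
  also have "... = I (c k) (r k) + (LN x\<in>hcube (c k) (r k). ennreal ?w * enorm (f x))"
   unfolding I_def by (rule nn_integral_add) measurable
  finally show ?thesis using True by simp
 qed simp
 have fin: "I a' l' <= (LN x\<in>?Q. ennreal ?w * enorm (f x)) + (\<Sum>k. if 0 < r k then I (c k) (r k) else 0)"
 proof -
  have "I a' l' = (LN x\<in>?Q - ?U. ennreal (norm (b x - ?m) * norm (f x)))
    + (\<Sum>k. LN x\<in>hcube (c k) (r k). ennreal (norm (b x - ?m) * norm (f x)))"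
   unfolding I_def by (rule nn_integral_hcube_split[OF _ cr(1)]) measurable
  also have "... <= (LN x\<in>?Q - ?U. ennreal ?w * enorm (f x))
    + (\<Sum>k. (if 0 < r k then I (c k) (r k) else 0) + (LN x\<in>hcube (c k) (r k). ennreal ?w * enorm (f x)))"
   by (intro add_mono off suminf_le on summableI)
  also have "(\<Sum>k. (if 0 < r k then I (c k) (r k) else 0) + (LN x\<in>hcube (c k) (r k). ennreal ?w * enorm (f x)))
    = (\<Sum>k. if 0 < r k then I (c k) (r k) else 0) + (\<Sum>k. LN x\<in>hcube (c k) (r k). ennreal ?w * enorm (f x))"
   by (intro suminf_add[symmetric] summableI)
  also have "(LN x\<in>?Q - ?U. ennreal ?w * enorm (f x)) +
    ((\<Sum>k. if 0 < r k then I (c k) (r k) else 0) + (\<Sum>k. LN x\<in>hcube (c k) (r k). ennreal ?w * enorm (f x)))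
    = (LN x\<in>?Q. ennreal ?w * enorm (f x)) + (\<Sum>k. if 0 < r k then I (c k) (r k) else 0)"
   by (subst nn_integral_hcube_split[OF _ cr(1), of "%x. ennreal ?w * enorm (f x)"]) (auto simp: add_ac)
  finally show ?thesis .
 qed
 have "(LN x\<in>?Q. ennreal ?w * enorm (f x)) = ennreal ?w * mass f ?Q"
  by (subst nn_integral_cmult[symmetric]) (auto simp: mult.assoc)
 also have "... = ennreal (l' ^ ?d) * (ennreal ?w * ennreal (rmass f ?Q / l' ^ ?d))"
 proof -
  have r0: "0 <= rmass f ?Q / l' ^ ?d" using ld rmass_nonneg[of f ?Q] by simp
  have "ennreal (l' ^ ?d) * (ennreal ?w * ennreal (rmass f ?Q / l' ^ ?d)) = ennreal (l' ^ ?d * (?w * (rmass f ?Q / l' ^ ?d)))"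
   by (simp only: ennreal_mult[OF w(1) r0, symmetric] ennreal_mult[OF less_imp_le[OF ld] mult_nonneg_nonneg[OF w(1) r0], symmetric])
  also have "l' ^ ?d * (?w * (rmass f ?Q / l' ^ ?d)) = ?w * rmass f ?Q" using l' by simp
  also have "ennreal (?w * rmass f ?Q) = ennreal ?w * ennreal (rmass f ?Q)" by (rule ennreal_mult[OF w(1) rmass_nonneg])
  finally show ?thesis unfolding mass_eq_rmass[OF f] by (rule sym)
 qed
 also have "... <= 2 * (LN x\<in>?Q - ?U. ennreal ?w * maximal f x)"
 proof (rule half_cube_average[OF l' packing_sets Usub half])
  show "(%x. ennreal ?w * maximal f x) \<in> Lmeas" by measurable
  fix x assume x: "x \<in> ?Q"
  have "ennreal (rmass f ?Q / l' ^ ?d) <= maximal f x"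
  proof (rule ccontr)
   assume "\<not> ?thesis"
   then have lt: "maximal f x < ennreal (rmass f ?Q / l' ^ ?d)" by simp
   then obtain y where y: "maximal f x = ennreal y" "0 <= y" by (cases "maximal f x") auto
   have "ennreal (rmass f ?Q) <= ennreal (l' ^ ?d) * ennreal y"
    using maximal_ge_hcube[OF x, of f] unfolding mass_eq_rmass[OF f] y .
   then have "rmass f ?Q <= l' ^ ?d * y" using ld y(2) by (simp add: ennreal_mult[symmetric])
   then have "rmass f ?Q / l' ^ ?d <= y" using ld by (simp add: field_simps)
   then show False using lt y by (simp add: ennreal_less_iff)
  qed
  then show "ennreal ?w * ennreal (rmass f ?Q / l' ^ ?d) <= ennreal ?w * maximal f x" by (rule mult_left_mono) simp
 qed
 also have "... = (LN x\<in>?Q - ?U. ennreal (6 * 2 ^ ?d * beta) * maximal f x)"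
 proof -
  have e: "ennreal (6 * 2 ^ ?d * beta) = 2 * ennreal ?w"
  proof -
   have "6 * 2 ^ ?d * beta = 2 * ?w" by simp
   then have "ennreal (6 * 2 ^ ?d * beta) = ennreal (2 * ?w)" by (simp only:)
   also have "... = ennreal 2 * ennreal ?w" using w(1) by (intro ennreal_mult) auto
   finally show ?thesis by (simp only: ennreal_numeral)
  qed
  show ?thesis unfolding e by (subst nn_integral_cmult[symmetric]) (auto simp: mult.assoc)
 qed
 finally have "I a' l' <= (LN x\<in>?Q - ?U. ennreal (6 * 2 ^ ?d * beta) * maximal f x) + (\<Sum>k. if 0 < r k then I (c k) (r k) else 0)"
  using fin by (meson add_right_mono order_trans)
 then show "EX c r. packing c r a' l' \<and> vol (UQ c r) <= ennreal (l' ^ ?d / 2) \<and>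
   I a' l' <= (LN x\<in>?Q - (UQ c r). ennreal (6 * 2 ^ ?d * beta) * maximal f x)
    + (\<Sum>k. if 0 < r k then I (c k) (r k) else 0)"
  using cr(1) half by blast
qed
then show ?thesis by (simp add: I_def m_def)
qed

definition mm :: "('a::euclidean_space => complex) => 'a => complex" where
 "mm f x = of_real (enn2real (maximal f x))"

lemma mm_measurable [measurable]: "mm f \<in> Lmeas"
 unfolding mm_def by measurable

lemma mm_eq:
 assumes "!!x. norm (f x) <= B" "0 <= B"
 shows "enorm (mm f x) = maximal f x" "norm (mm f x) <= B"
proof -
have le: "maximal f x <= ennreal B" by (rule maximal_le[OF assms])
then show "enorm (mm f x) = maximal f x"
 using le_less_trans[OF le ennreal_less_top] by (simp add: mm_def)
show "norm (mm f x) <= B" using enn2real_mono[OF le] assms(2) by (simp add: mm_def)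
qed

definition HH :: "('a::euclidean_space => complex) => ('a => complex) => 'a => ennreal" where
 "HH f g x = maximal f x * maximal (mm g) x + maximal (mm f) x * maximal g x"

context dini_operator
begin

lemma commutator_shift:
 assumes u: "u \<in> Linf_c" and b: "b \<in> Lmeas" "!!x. norm (b x) <= B"
 shows "AE x. commutator b T u x = (b x - c) * T u x - T (%y. (b y - c) * u y) x"
proof -
have bu: "(%y. b y * u y) \<in> L2" by (intro Linf_c_subset_L2 Linf_c_mult[OF u b])
have cu: "(%y. c * u y) \<in> L2" by (intro Linf_c_subset_L2 Linf_c_cmult u)
have "AE x. T (%y. b y * u y - c * u y) x = T (%y. b y * u y) x - T (%y. c * u y) x"
 by (rule T_diff[OF bu cu])
with T_cmult[OF Linf_c_subset_L2[OF u], of c] show ?thesis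
 by eventually_elim (simp add: commutator_def left_diff_distrib)
qed

lemma commutator_diff:
 assumes u: "u \<in> Linf_c" "v \<in> Linf_c" and b: "b \<in> Lmeas" "!!x. norm (b x) <= B"
 shows "AE x. commutator b T (%x. u x - v x) x = commutator b T u x - commutator b T v x"
proof -
note L = Linf_c_subset_L2[OF u(1)] Linf_c_subset_L2[OF u(2)]
 Linf_c_subset_L2[OF Linf_c_mult[OF u(1) b]] Linf_c_subset_L2[OF Linf_c_mult[OF u(2) b]]
show ?thesis
 using T_diff[OF L(1,2)] T_diff[OF L(3,4)]
 by eventually_elim (simp add: commutator_def right_diff_distrib)
qed

lemma commutator_measurable:
 assumes "u \<in> L2" "(%y. b y * u y) \<in> L2" "b \<in> Lmeas"
 shows "commutator b T u \<in> Lmeas"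
 unfolding commutator_def using L2_measurable[OF T_L2[OF assms(1)]] L2_measurable[OF T_L2[OF assms(2)]] assms(3)
 by measurable

lemma T_mass_le:
 assumes u: "u \<in> L2" and l: "0 < l"
 shows "mass (T u) (hcube a l) <= ennreal (l ^ DIM('a)) + ennreal (CT\<^sup>2) * (LN x. ennreal ((norm (u x))\<^sup>2))"
proof -
note [measurable] = L2_measurable[OF T_L2[OF u]]
have "mass (T u) (hcube a l) <= (LN x. ind (hcube a l) x + ennreal ((norm (T u x))\<^sup>2))"
proof (rule nn_integral_mono)
 fix x
 have "norm (T u x) <= 1 + (norm (T u x))\<^sup>2"
 proof (cases "norm (T u x) <= 1")
  case False
  then have "norm (T u x) * 1 <= norm (T u x) * norm (T u x)" by (intro mult_left_mono) auto
  then show ?thesis by (simp add: power2_eq_square)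
 qed (simp add: add_increasing2)
 then have "enorm (T u x) <= 1 + ennreal ((norm (T u x))\<^sup>2)"
  by (simp add: ennreal_leI flip: ennreal_plus ennreal_1)
 then show "enorm (T u x) * ind (hcube a l) x <= ind (hcube a l) x + ennreal ((norm (T u x))\<^sup>2)"
  by (auto split: split_indicator)
qed
also have "... = vol (hcube a l) + (LN x. ennreal ((norm (T u x))\<^sup>2))"
 by (subst nn_integral_add) auto
also have "... <= ennreal (l ^ DIM('a)) + ennreal (CT\<^sup>2) * (LN x. ennreal ((norm (u x))\<^sup>2))"
 using l T_bound[OF u] emeasure_hcube[of l a] by (intro add_mono) auto
finally show ?thesis .
qed

definition form_bound :: "real => bool" where
 "form_bound C \<longleftrightarrow> (ALL b B beta f g a l. b \<in> Lmeas --> (ALL x. norm (b x) <= B) --> 0 < beta --> osc_le b beta -->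
   f \<in> Linf_c --> g \<in> Linf_c --> 0 < l -->
   (LN x\<in>hcube a l. enorm (commutator b T (restr (hat a l) f) x * g x))
    <= (LN x\<in>hcube a l. ennreal (C * beta) * HH f g x))"

text \<open>
 With \<open>[b,T]u = (b - c) T u - T ((b - c) u)\<close>, the estimates of
 \<open>stopping_cubes\<close> bound the commutator, off the selected cubes and up to
 \<open>[b,T](f 1\<^bsub>hat P\<^esub>)\<close> on them, by \<open>|b - c|\<close> times the mean
 of \<open>|f|\<close> plus the mean of \<open>|b - c| |f|\<close>. Integrated against
 \<open>|g|\<close>, both terms are handled by \<open>oscillation_against_maximal\<close>, and the
 commutators on the selected cubes are left to the iteration.
\<close>

theorem commutator_form_bound: "\<exists>C>0. form_bound C"
proof -
let ?kappa = "kap TYPE('a)" and ?d = "DIM('a)"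
have kappa: "1 <= ?kappa" by (rule kap_ge_1)
obtain A where A: "0 < A" and stop: "ALL a l f. 0 < l --> (\<forall>i::bool. f i \<in> Linf_c) --> (EX c r. packing c r a l \<and>
 vol (UQ c r) <= ennreal (l ^ ?d / 2) \<and>
 (ALL i. AE x. x \<in> hcube a l - (UQ c r) -->
   l ^ ?d * norm (T (restr (hat a l) (f i)) x) <= A * rmass (f i) (hat a l)) \<and>
 (ALL i k. 0 < r k --> (AE x. x \<in> hcube (c k) (r k) -->
   l ^ ?d * norm (T (%x. restr (hat a l) (f i) x - restr (hat (c k) (r k)) (f i) x) x) <= A * rmass (f i) (hat a l))))"
 using stopping_cubes by blast
define C6 :: real where "C6 = 6 * 2 ^ ?d"
define w where "w = A * C6 * (?kappa ^ ?d * ?kappa ^ ?d)"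
have w: "0 < w" using A kappa by (simp add: w_def C6_def)
show ?thesis unfolding form_bound_def
proof (intro exI[of _ "2 * w"] conjI allI impI)
 show "0 < 2 * w" using w by simp
 fix b :: "'a => complex" and B beta :: real and f g :: "'a => complex" and a0 :: 'a and l0 :: real
 assume bm[measurable]: "b \<in> Lmeas" and "ALL x. norm (b x) <= B" and beta: "0 < beta" and osc: "osc_le b beta"
  and f: "f \<in> Linf_c" and g: "g \<in> Linf_c" and l0: "0 < l0"
 then have B: "!!x. norm (b x) <= B" by blast
 note [measurable] = Linf_c_measurable[OF f] Linf_c_measurable[OF g]
 have B0: "0 <= B" using B[of undefined] norm_ge_zero order_trans by blast
 obtain Bf where Bf: "0 < Bf" "!!x. norm (f x) <= Bf" using Linf_cE[OF f] by metis
 obtain Bg where Bg: "0 < Bg" "!!x. norm (g x) <= Bg" using Linf_cE[OF g] by metis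
 let ?R = "%a l. restr (hat a l) f"
 have RL: "?R a l \<in> Linf_c" for a l by (intro Linf_c_restr f) simp
 have cm[measurable]: "commutator b T u \<in> Lmeas" if "u \<in> Linf_c" for u
  by (intro commutator_measurable Linf_c_subset_L2 that Linf_c_mult[OF that bm B] bm)
 define I where "I a l = (LN x\<in>hcube a l. enorm (commutator b T (?R a l) x * g x))" for a l
 define CC where "CC = Bg * (B * (1 + CT\<^sup>2 * (Bf\<^sup>2 * ?kappa ^ ?d)) + (1 + CT\<^sup>2 * ((B * Bf)\<^sup>2 * ?kappa ^ ?d)))"
 have CC: "0 <= CC" using B0 Bf Bg kappa by (simp add: CC_def)
 have Tb: "mass (T u) (hcube a l) <= ennreal ((1 + CT\<^sup>2 * (q\<^sup>2 * ?kappa ^ ?d)) * l ^ ?d)"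
  if l: "0 < l" and u: "u \<in> Linf_c" "!!x. norm (u x) <= q" "!!x. x ~: hat a l ==> u x = 0" for u q a l
 proof -
  have "(LN x. ennreal ((norm (u x))\<^sup>2)) <= (LN x\<in>hat a l. ennreal (q\<^sup>2))"
   using u by (intro nn_integral_mono) (auto split: split_indicator intro!: ennreal_leI power_mono)
  also have "... = ennreal (q\<^sup>2 * (?kappa * l) ^ ?d)"
   using l kappa by (subst nn_integral_const_hcube) (auto simp: hatr_eq)
  finally have 1: "(LN x. ennreal ((norm (u x))\<^sup>2)) <= ennreal (q\<^sup>2 * (?kappa * l) ^ ?d)" .
  have "mass (T u) (hcube a l) <= ennreal (l ^ ?d) + ennreal (CT\<^sup>2) * (LN x. ennreal ((norm (u x))\<^sup>2))"
   by (rule T_mass_le[OF Linf_c_subset_L2[OF u(1)] l])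
  also have "... <= ennreal (l ^ ?d) + ennreal (CT\<^sup>2) * ennreal (q\<^sup>2 * (?kappa * l) ^ ?d)"
   by (intro add_left_mono mult_left_mono 1) simp
  also have "... = ennreal (l ^ ?d + CT\<^sup>2 * (q\<^sup>2 * (?kappa * l) ^ ?d))"
   using l kappa by (simp add: ennreal_mult[symmetric] flip: ennreal_plus)
  also have "l ^ ?d + CT\<^sup>2 * (q\<^sup>2 * (?kappa * l) ^ ?d) = (1 + CT\<^sup>2 * (q\<^sup>2 * ?kappa ^ ?d)) * l ^ ?d"
   by (simp add: power_mult_distrib algebra_simps)
  finally show ?thesis .
 qed
 have "I a0 l0 <= (LN x\<in>hcube a0 l0. ennreal (2 * w * beta) * HH f g x)"
 proof (rule cube_iteration[where C = CC, OF _ CC _ _ l0])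
  show "(%x. ennreal (2 * w * beta) * HH f g x) \<in> Lmeas" unfolding HH_def by measurable
  fix a :: 'a and l :: real assume l: "0 < l"
  let ?Q = "hcube a l"
  have ld: "0 < l ^ ?d" using l by simp
  have bRL: "(%y. b y * ?R a l y) \<in> Linf_c" by (rule Linf_c_mult[OF RL bm B])
  note [measurable] = L2_measurable[OF T_L2[OF Linf_c_subset_L2[OF RL[of a l]]]] L2_measurable[OF T_L2[OF Linf_c_subset_L2[OF bRL]]]
  have "I a l <= (LN x. ennreal Bg * (ennreal B * (enorm (T (?R a l) x) * ind ?Q x) + enorm (T (%y. b y * ?R a l y) x) * ind ?Q x))"
   unfolding I_def
  proof (rule nn_integral_mono)
   fix x
   have "norm (commutator b T (?R a l) x) <= norm (b x) * norm (T (?R a l) x) + norm (T (%y. b y * ?R a l y) x)"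
    unfolding commutator_def using norm_triangle_ineq4[of "b x * T (?R a l) x"] by (simp add: norm_mult)
   also have "... <= B * norm (T (?R a l) x) + norm (T (%y. b y * ?R a l y) x)"
    by (intro add_right_mono mult_right_mono B) simp
   finally have "norm (commutator b T (?R a l) x) * norm (g x) <= (B * norm (T (?R a l) x) + norm (T (%y. b y * ?R a l y) x)) * Bg"
    using Bg B0 by (intro mult_mono) auto
   then have "enorm (commutator b T (?R a l) x * g x) <= ennreal (Bg * (B * norm (T (?R a l) x) + norm (T (%y. b y * ?R a l y) x)))"
    by (intro ennreal_leI) (simp add: norm_mult mult.commute)
   also have "... = ennreal Bg * (ennreal B * enorm (T (?R a l) x) + enorm (T (%y. b y * ?R a l y) x))"
    using Bg(1) B0 by (simp add: ennreal_mult)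
   finally show "enorm (commutator b T (?R a l) x * g x) * ind ?Q x <=
     ennreal Bg * (ennreal B * (enorm (T (?R a l) x) * ind ?Q x) + enorm (T (%y. b y * ?R a l y) x) * ind ?Q x)"
    by (auto split: split_indicator)
  qed
  also have "... = ennreal Bg * (ennreal B * mass (T (?R a l)) ?Q + mass (T (%y. b y * ?R a l y)) ?Q)"
   by (simp add: nn_integral_cmult nn_integral_add)
  also have "... <= ennreal Bg * (ennreal B * ennreal ((1 + CT\<^sup>2 * (Bf\<^sup>2 * ?kappa ^ ?d)) * l ^ ?d) + ennreal ((1 + CT\<^sup>2 * ((B * Bf)\<^sup>2 * ?kappa ^ ?d)) * l ^ ?d))"
  proof (intro mult_left_mono add_mono Tb[OF l] RL bRL)
   show "norm (?R a l x) <= Bf" for x using Bf(2)[of x] Bf(1) by (simp add: restr_def)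
   show "norm (b x * ?R a l x) <= B * Bf" for x
    unfolding norm_mult using B[of x] Bf(2)[of x] Bf(1) B0 by (intro mult_mono) (auto simp: restr_def)
  qed (auto simp: restr_def)
  also have "... = ennreal (CC * l ^ ?d)"
   using Bg(1) B0 Bf(1) kappa ld by (simp add: CC_def ennreal_mult[symmetric] algebra_simps flip: ennreal_plus)
  finally show "I a l <= ennreal (CC * l ^ ?d)" .
  have lam: "0 < hatr TYPE('a) l" by (rule hatr_pos[OF l])
  obtain c where c: "mass (%x. b x - c) (hat a l) <= ennreal (beta * hatr TYPE('a) l ^ ?d)"
   using osc lam unfolding osc_le_def by blast
  let ?h = "%x. (b x - c) * f x"
  define F where "F i = (if i then f else ?h)" for i :: bool
  have bcm: "(%x. b x - c) \<in> Lmeas" by measurable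
  have bcb: "norm (b x - c) <= B + norm c" for x using norm_triangle_ineq4[of "b x" c] B[of x] by linarith
  have hL: "?h \<in> Linf_c" by (rule Linf_c_mult[OF f bcm bcb])
  have FL: "F i \<in> Linf_c" for i using f hL by (simp add: F_def)
  have FLall: "ALL i. F i \<in> Linf_c" using FL by blast
  obtain cc r where cr: "packing cc r a l" "vol (UQ cc r) <= ennreal (l ^ ?d / 2)"
   "!!i. AE x. x \<in> ?Q - (UQ cc r) --> l ^ ?d * norm (T (restr (hat a l) (F i)) x) <= A * rmass (F i) (hat a l)"
   "!!i k. 0 < r k ==> AE x. x \<in> hcube (cc k) (r k) -->
     l ^ ?d * norm (T (%x. restr (hat a l) (F i) x - restr (hat (cc k) (r k)) (F i) x) x) <= A * rmass (F i) (hat a l)"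
   using stop[THEN spec, of a, THEN spec, of l, THEN spec, of F, THEN mp, OF l, THEN mp, OF FLall]
   by (elim exE conjE) (rule that, assumption, assumption, erule spec, (drule spec, drule spec, erule mp, assumption))
  let ?U = "\<Union>k. hcube (cc k) (r k)"
  define m1 where "m1 = rmass f (hat a l)"
  define m2 where "m2 = rmass ?h (hat a l)"
  have m0: "0 <= m1" "0 <= m2" by (simp_all add: m1_def m2_def rmass_nonneg)
  define G where "G x = A / l ^ ?d * (norm (b x - c) * m1 + m2)" for x
  have G0: "0 <= G x" for x using A ld m0 by (simp add: G_def)
  have Gm[measurable]: "G \<in> Lmeas" unfolding G_def by measurable
  have Gbound: "norm ((b x - c) * s - t) <= G x" if "l ^ ?d * norm s <= A * m1" "l ^ ?d * norm t <= A * m2" for x s t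
  proof -
   have "norm s <= A * m1 / l ^ ?d" "norm t <= A * m2 / l ^ ?d" using that ld by (simp_all add: field_simps)
   then have "norm (b x - c) * norm s + norm t <= norm (b x - c) * (A * m1 / l ^ ?d) + A * m2 / l ^ ?d"
    by (intro add_mono mult_left_mono) auto
   also have "... = G x" by (simp add: G_def distrib_left mult_ac)
   finally show ?thesis using norm_triangle_ineq4[of "(b x - c) * s" t] by (simp add: norm_mult)
  qed
  have Fr: "rmass (F True) (hat a l) = m1" "rmass (F False) (hat a l) = m2" by (simp_all add: F_def m1_def m2_def)
  have eqF: "restr S (F True) = restr S f" "restr S (F False) = (%y. (b y - c) * restr S f y)" for S
   by (auto simp: F_def restr_def fun_eq_iff)
  have offU: "AE x. x \<in> ?Q - ?U --> norm (commutator b T (?R a l) x) <= G x"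
   using cr(3)[of True] cr(3)[of False] commutator_shift[OF RL bm B, of a l c]
   unfolding Fr eqF by eventually_elim (simp add: Gbound)
  have onP: "AE x. x \<in> hcube (cc k) (r k) -->
    norm (commutator b T (?R a l) x) <= norm (commutator b T (?R (cc k) (r k)) x) + G x" if r: "0 < r k" for k
  proof -
   let ?D = "%x. ?R a l x - ?R (cc k) (r k) x"
   have DL: "?D \<in> Linf_c" by (rule Linf_c_diff[OF RL RL])
   have e: "(%x. (b x - c) * ?R a l x - (b x - c) * ?R (cc k) (r k) x) = (%x. (b x - c) * ?D x)"
    by (simp add: fun_eq_iff right_diff_distrib)
   show ?thesis
    using cr(4)[OF r, of True] cr(4)[OF r, of False] commutator_shift[OF DL bm B, of c]
     commutator_diff[OF RL[of a l] RL[of "cc k" "r k"] bm B]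
    unfolding Fr eqF e
   proof eventually_elim
    case (elim x)
    show ?case
    proof
     assume x: "x \<in> hcube (cc k) (r k)"
     have "norm (commutator b T ?D x) <= G x" using Gbound[of "T ?D x" "T (%y. (b y - c) * ?D y) x" x] elim x by simp
     then show "norm (commutator b T (?R a l) x) <= norm (commutator b T (?R (cc k) (r k)) x) + G x"
      using norm_triangle_ineq[of "commutator b T (?R (cc k) (r k)) x" "commutator b T ?D x"] elim(4) by simp
    qed
   qed
  qed
  have offI: "(LN x\<in>?Q - ?U. enorm (commutator b T (?R a l) x * g x)) <= (LN x\<in>?Q - ?U. ennreal (G x * norm (g x)))"
   using offU
  proof (intro nn_integral_mono_AE, eventually_elim)
   case (elim x)
   then show ?case by (auto split: split_indicator simp: norm_mult intro!: ennreal_leI mult_right_mono)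
  qed
  have onI: "(LN x\<in>hcube (cc k) (r k). enorm (commutator b T (?R a l) x * g x))
    <= (if 0 < r k then I (cc k) (r k) else 0) + (LN x\<in>hcube (cc k) (r k). ennreal (G x * norm (g x)))" for k
  proof (cases "0 < r k")
   case True
   note [measurable] = cm[OF RL[of "cc k" "r k"]]
   have "(LN x\<in>hcube (cc k) (r k). enorm (commutator b T (?R a l) x * g x))
    <= (LN x. enorm (commutator b T (?R (cc k) (r k)) x * g x) * ind (hcube (cc k) (r k)) x + ennreal (G x * norm (g x)) * ind (hcube (cc k) (r k)) x)"
    using onP[OF True]
   proof (intro nn_integral_mono_AE, eventually_elim)
    case (elim x)
    show ?case
    proof (cases "x \<in> hcube (cc k) (r k)")
     case x: True
     then have "norm (commutator b T (?R a l) x) * norm (g x) <= (norm (commutator b T (?R (cc k) (r k)) x) + G x) * norm (g x)"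
      using elim by (intro mult_right_mono) auto
     then have "enorm (commutator b T (?R a l) x * g x) <= ennreal (norm (commutator b T (?R (cc k) (r k)) x * g x) + G x * norm (g x))"
      by (intro ennreal_leI) (simp add: norm_mult distrib_right)
     also have "... = enorm (commutator b T (?R (cc k) (r k)) x * g x) + ennreal (G x * norm (g x))"
      using G0[of x] by (intro ennreal_plus) auto
     finally show ?thesis using x by simp
    qed simp
   qed
   also have "... = I (cc k) (r k) + (LN x\<in>hcube (cc k) (r k). ennreal (G x * norm (g x)))"
    unfolding I_def by (rule nn_integral_add) measurable
   finally show ?thesis using True by simp
  qed simp
  note cm[OF RL[of a l], measurable]
  have fin: "I a l <= (LN x\<in>?Q. ennreal (G x * norm (g x))) + (\<Sum>k. if 0 < r k then I (cc k) (r k) else 0)"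
  proof -
   have "I a l = (LN x\<in>?Q - ?U. enorm (commutator b T (?R a l) x * g x))
     + (\<Sum>k. LN x\<in>hcube (cc k) (r k). enorm (commutator b T (?R a l) x * g x))"
    unfolding I_def by (rule nn_integral_hcube_split[OF _ cr(1)]) measurable
   also have "... <= (LN x\<in>?Q - ?U. ennreal (G x * norm (g x)))
     + (\<Sum>k. (if 0 < r k then I (cc k) (r k) else 0) + (LN x\<in>hcube (cc k) (r k). ennreal (G x * norm (g x))))"
    by (intro add_mono offI suminf_le onI summableI)
   also have "(\<Sum>k. (if 0 < r k then I (cc k) (r k) else 0) + (LN x\<in>hcube (cc k) (r k). ennreal (G x * norm (g x))))
     = (\<Sum>k. if 0 < r k then I (cc k) (r k) else 0) + (\<Sum>k. LN x\<in>hcube (cc k) (r k). ennreal (G x * norm (g x)))"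
    by (intro suminf_add[symmetric] summableI)
   also have "(LN x\<in>?Q - ?U. ennreal (G x * norm (g x))) +
     ((\<Sum>k. if 0 < r k then I (cc k) (r k) else 0) + (\<Sum>k. LN x\<in>hcube (cc k) (r k). ennreal (G x * norm (g x))))
     = (LN x\<in>?Q. ennreal (G x * norm (g x))) + (\<Sum>k. if 0 < r k then I (cc k) (r k) else 0)"
    by (subst nn_integral_hcube_split[OF _ cr(1), of "%x. ennreal (G x * norm (g x))"]) (auto simp: add_ac)
   finally show ?thesis .
  qed
  have JN: "(LN x\<in>hat a l. ennreal (norm (b x - c) * norm (v x))) <= ennreal (C6 * beta) * (ennreal ((?kappa * l) ^ ?d) * maximal (mm v) z)"
   if v: "v \<in> Linf_c" and z: "z \<in> ?Q" for v z
  proof -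
   obtain Bv where Bv: "0 < Bv" "!!x. norm (v x) <= Bv" using Linf_cE[OF v] by metis
   have mv: "enorm (mm v x) = maximal v x" for x by (rule mm_eq(1)[OF Bv(2)]) (use Bv(1) in simp)
   have "(LN x\<in>hat a l. ennreal (norm (b x - c) * norm (v x))) <= (LN x\<in>hat a l. ennreal (6 * 2 ^ ?d * beta) * maximal v x)"
    by (rule oscillation_against_maximal[OF bm B beta osc v lam c])
   also have "... = ennreal (C6 * beta) * mass (mm v) (hat a l)"
    unfolding C6_def mv by (subst nn_integral_cmult[symmetric]) (auto simp: mult.assoc)
   also have "... <= ennreal (C6 * beta) * (ennreal ((?kappa * l) ^ ?d) * maximal (mm v) z)"
    using maximal_ge_hcube[of z "hatc a l" "hatr TYPE('a) l" "mm v"] hcube_subset_hat z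
    by (intro mult_left_mono) (auto simp: hatr_eq)
   finally show ?thesis .
  qed
  have GI: "(LN x\<in>?Q. ennreal (G x * norm (g x))) <= ennreal (l ^ ?d) * (ennreal (w * beta) * HH f g z)" if z: "z \<in> ?Q" for z
  proof -
   let ?K = "ennreal ((?kappa * l) ^ ?d)"
   have sub: "?Q \<subseteq> hat a l" by (rule hcube_subset_hat)
   have "(LN x\<in>?Q. ennreal (G x * norm (g x))) =
     (LN x. ennreal (A / l ^ ?d) * (ennreal m1 * (ennreal (norm (b x - c) * norm (g x)) * ind ?Q x) + ennreal m2 * (enorm (g x) * ind ?Q x)))"
   proof (rule nn_integral_cong)
    fix x
    have "ennreal (G x * norm (g x)) = ennreal (A / l ^ ?d * (m1 * (norm (b x - c) * norm (g x)) + m2 * norm (g x)))"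
     by (simp add: G_def algebra_simps)
    also have "... = ennreal (A / l ^ ?d) * (ennreal m1 * ennreal (norm (b x - c) * norm (g x)) + ennreal m2 * enorm (g x))"
     using A ld m0 by (intro ennreal_mult_lin) auto
    finally show "ennreal (G x * norm (g x)) * ind ?Q x = ennreal (A / l ^ ?d) * (ennreal m1 * (ennreal (norm (b x - c) * norm (g x)) * ind ?Q x) + ennreal m2 * (enorm (g x) * ind ?Q x))"
     by (auto split: split_indicator)
   qed
   also have "... = ennreal (A / l ^ ?d) * (ennreal m1 * (LN x\<in>?Q. ennreal (norm (b x - c) * norm (g x))) + ennreal m2 * mass g ?Q)"
    by (simp add: nn_integral_cmult nn_integral_add)
   also have "... <= ennreal (A / l ^ ?d) * ((?K * maximal f z) * (ennreal (C6 * beta) * (?K * maximal (mm g) z)) + (ennreal (C6 * beta) * (?K * maximal (mm f) z)) * (?K * maximal g z))"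
   proof (intro mult_left_mono add_mono mult_mono)
    have zh: "z \<in> hat a l" using z sub by blast
    show "ennreal m1 <= ?K * maximal f z"
     using maximal_ge_hcube[OF zh, of f] unfolding m1_def mass_eq_rmass[OF f] by (simp add: hatr_eq)
    show "mass g ?Q <= ?K * maximal g z"
     using order_trans[OF mass_mono[OF sub, of g] maximal_ge_hcube[OF zh, of g]] by (simp add: hatr_eq)
    have "(LN x\<in>?Q. ennreal (norm (b x - c) * norm (g x))) <= (LN x\<in>hat a l. ennreal (norm (b x - c) * norm (g x)))"
     using sub by (intro nn_integral_mono) (auto split: split_indicator)
    then show "(LN x\<in>?Q. ennreal (norm (b x - c) * norm (g x))) <= ennreal (C6 * beta) * (?K * maximal (mm g) z)"
     using JN[OF g z] by (rule order_trans)
    have "ennreal m2 = (LN x\<in>hat a l. ennreal (norm (b x - c) * norm (f x)))"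
     unfolding m2_def mass_eq_rmass[OF hL, symmetric] by (simp add: norm_mult)
    then show "ennreal m2 <= ennreal (C6 * beta) * (?K * maximal (mm f) z)" using JN[OF f z] by simp
   qed auto
   also have "... = (ennreal (A / l ^ ?d) * ennreal (C6 * beta) * (?K * ?K)) * HH f g z"
    by (simp add: HH_def algebra_simps)
   also have "ennreal (A / l ^ ?d) * ennreal (C6 * beta) * (?K * ?K) = ennreal (A / l ^ ?d * (C6 * beta) * ((?kappa * l) ^ ?d * (?kappa * l) ^ ?d))"
    using A l beta kappa by (intro ennreal_mult_four) (auto simp: C6_def)
   also have "A / l ^ ?d * (C6 * beta) * ((?kappa * l) ^ ?d * (?kappa * l) ^ ?d) = l ^ ?d * (w * beta)"
    using l by (simp add: w_def power_mult_distrib)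
   also have "ennreal (l ^ ?d * (w * beta)) * HH f g z = ennreal (l ^ ?d) * (ennreal (w * beta) * HH f g z)"
    using ld w beta by (simp add: ennreal_mult mult.assoc)
   finally show ?thesis .
  qed
  have Hm[measurable]: "HH f g \<in> Lmeas" unfolding HH_def by measurable
  let ?GI = "LN x\<in>?Q. ennreal (G x * norm (g x))"
  have Usub: "?U \<subseteq> ?Q" using cr(1) by (auto simp: packing_def)
  have nz: "ennreal (l ^ ?d) ~= 0" "ennreal (l ^ ?d) ~= top" using l by auto
  have "?GI = ennreal (l ^ ?d) * (?GI / ennreal (l ^ ?d))"
   using ennreal_mult_divide_eq[OF nz, of ?GI] by (simp add: ennreal_times_divide mult.commute)
  also have "... <= 2 * (LN x\<in>?Q - ?U. ennreal (w * beta) * HH f g x)"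
  proof (rule half_cube_average[OF l packing_sets Usub cr(2)])
   fix z assume "z \<in> ?Q"
   then have "?GI / ennreal (l ^ ?d) <= (ennreal (l ^ ?d) * (ennreal (w * beta) * HH f g z)) / ennreal (l ^ ?d)"
    by (intro divide_right_mono_ennreal GI)
   also have "... = ennreal (w * beta) * HH f g z"
    using ennreal_mult_divide_eq[OF nz] by (simp only: mult.commute[of "ennreal (l ^ ?d)"])
   finally show "?GI / ennreal (l ^ ?d) <= ennreal (w * beta) * HH f g z" .
  qed measurable
  also have "... = (LN x\<in>?Q - ?U. ennreal (2 * w * beta) * HH f g x)"
  proof -
   have e: "ennreal (2 * w * beta) = 2 * ennreal (w * beta)" using w beta ennreal_mult[of 2 "w * beta"] by (simp add: mult.assoc)
   show ?thesis unfolding e by (subst nn_integral_cmult[symmetric]) (auto simp: mult.assoc)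
  qed
  finally have "I a l <= (LN x\<in>?Q - ?U. ennreal (2 * w * beta) * HH f g x) + (\<Sum>k. if 0 < r k then I (cc k) (r k) else 0)"
   using fin by (meson add_right_mono order_trans)
  then show "EX c r. packing c r a l \<and> vol (UQ c r) <= ennreal (l ^ ?d / 2) \<and>
    I a l <= (LN x\<in>?Q - (UQ c r). ennreal (2 * w * beta) * HH f g x)
     + (\<Sum>k. if 0 < r k then I (c k) (r k) else 0)"
   using cr(1,2) by blast
 qed
 then show "(LN x\<in>hcube a0 l0. enorm (commutator b T (?R a0 l0) x * g x))
   <= (LN x\<in>hcube a0 l0. ennreal (2 * w * beta) * HH f g x)"
  by (simp add: I_def)
qed
qed

end

section \<open>Boundedness of the commutator\<close>

lemma bmo_osc:
 assumes b: "BMO_norm b < ennreal beta"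
 shows "osc_le b beta"
 unfolding osc_le_def
proof (intro allI impI)
fix a :: 'a and l :: real assume l: "0 < l"
let ?Q = "cbox a (a + l *\<^sub>R One)"
let ?m = "LN x\<in>?Q. enorm (b x - cube_mean b ?Q)"
have Q: "?Q \<in> cubes" using l by (auto simp: cubes_def)
have em: "vol ?Q = ennreal (l ^ DIM('a))" using l emeasure_cube_cbox[of l a] by simp
have "?m / vol ?Q <= BMO_norm b"
 unfolding BMO_norm_def by (rule SUP_upper[OF Q])
then have le: "?m / ennreal (l ^ DIM('a)) <= ennreal beta" using b em by simp
have "?m <= ennreal beta * ennreal (l ^ DIM('a))"
 using mult_right_mono[OF le, of "ennreal (l ^ DIM('a))"] l
 by (simp add: ennreal_divide_times ennreal_times_divide[symmetric] divide_mult_eq)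
then have "mass (%x. b x - cube_mean b ?Q) (hcube a l) <= ennreal (beta * l ^ DIM('a))"
 using l b by (simp add: nn_integral_hcube_eq_cbox ennreal_mult'')
then show "EX c. mass (%x. b x - c) (hcube a l) <= ennreal (beta * l ^ DIM('a))" by blast
qed

definition clamp :: "nat => complex => complex" where
 "clamp n = closest_point (cball 0 (real n))"

lemma clamp_bound: "norm (clamp n z) <= real n"
 using closest_point_in_set[of "cball 0 (real n)" z] by (simp add: clamp_def)

lemma clamp_same: "norm z <= real n ==> clamp n z = z"
 unfolding clamp_def by (rule closest_point_self) simp

lemma clamp_lipschitz: "norm (clamp n z - clamp n w) <= norm (z - w)"
 using closest_point_lipschitz[of "cball 0 (real n)" z w] by (simp add: clamp_def dist_norm)

lemma clamp_measurable:
 assumes [measurable]: "b \<in> borel_measurable M"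
 shows "(%x. clamp n (b x)) \<in> borel_measurable M"
proof -
have "continuous_on UNIV (clamp n)" unfolding clamp_def by (rule continuous_on_closest_point) auto
then have [measurable]: "clamp n \<in> borel_measurable borel" by (rule borel_measurable_continuous_onI)
show ?thesis by measurable
qed

lemma clamp_osc:
 assumes "osc_le b beta"
 shows "osc_le (%x. clamp n (b x)) beta"
 unfolding osc_le_def
proof (intro allI impI)
fix a :: 'a and l :: real assume "0 < l"
then obtain c where c: "mass (%x. b x - c) (hcube a l) <= ennreal (beta * l ^ DIM('a))"
 using assms unfolding osc_le_def by blast
have "mass (%x. clamp n (b x) - clamp n c) (hcube a l) <= mass (%x. b x - c) (hcube a l)"
 by (intro nn_integral_mono mult_right_mono ennreal_leI clamp_lipschitz) auto
then show "EX c. mass (%x. clamp n (b x) - c) (hcube a l) <= ennreal (beta * l ^ DIM('a))"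
 using c order_trans by blast
qed

lemma hcube_exhausts:
 fixes x :: "'a::euclidean_space"
 assumes "norm x <= R" "R < l"
 shows "x \<in> hcube (- (l *\<^sub>R One)) (2 * l)"
proof -
have "- l <= x \<bullet> i \<and> x \<bullet> i < l" if "i \<in> Basis" for i using Basis_le_norm[OF that, of x] assms by linarith
then show ?thesis by (auto simp: hcube_def inner_diff_left inner_add_left)
qed

locale commutator_on_function_space = dini_operator T K omega CT + maximal_function_space X N
 for T :: "('a::euclidean_space => complex) => ('a => complex)" and K omega CT
  and X :: "('a => complex) set" and N +
 assumes MX': "maximal_bounded_on (associate_space X N) (associate_norm X N)"
begin

lemma M'_bound: "\<exists>C\<ge>0. \<forall>g\<in>X'. mm g \<in> X' \<and> N' (mm g) <= C * N' g"
proof -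
obtain C where C: "\<forall>g\<in>X'. mm g \<in> X' \<and> N' (mm g) <= C * N' g"
 using MX' unfolding maximal_bounded_on_def mm_def[abs_def] by blast
have "N' (mm g) <= \<bar>C\<bar> * N' g" if "g \<in> X'" for g
 using C[rule_format, OF that] mult_right_mono[OF abs_ge_self[of C] assoc_nonneg[of g]] by linarith
then show ?thesis using C by (intro exI[of _ "\<bar>C\<bar>"]) auto
qed

lemma mm_bound: "f \<in> X ==> mm f \<in> X" "f \<in> X ==> N (mm f) <= \<bar>M_const\<bar> * N f"
proof -
assume f: "f \<in> X"
show "mm f \<in> X" using M_bound(2)[OF f] by (simp add: mm_def[abs_def])
have "N (mm f) <= M_const * N f" using M_bound(3)[OF f] by (simp add: mm_def[abs_def])
then show "N (mm f) <= \<bar>M_const\<bar> * N f"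
 using mult_right_mono[OF abs_ge_self[of M_const] N_nonneg[OF f]] by linarith
qed

lemma HH_integral_bound:
 "\<exists>C>0. \<forall>f\<in>Linf_c. \<forall>g\<in>Linf_c. (LN x. HH f g x) <= ennreal (C * N f * N' g)"
proof -
obtain C' where C': "0 <= C'" "!!g. g \<in> X' ==> mm g \<in> X'" "!!g. g \<in> X' ==> N' (mm g) <= C' * N' g"
 using M'_bound by blast
define C where "C = \<bar>M_const\<bar>"
have C0: "0 <= C" by (simp add: C_def)
have "(LN x. HH f g x) <= ennreal ((C * C' * C' + C * C * C' + 1) * N f * N' g)"
 if f: "f \<in> Linf_c" and g: "g \<in> Linf_c" for f g
proof -
 obtain Bf Rf where Bf: "0 < Bf" "!!x. norm (f x) <= Bf" using Linf_cE[OF f] by metis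
 obtain Bg Rg where Bg: "0 < Bg" "!!x. norm (g x) <= Bg" using Linf_cE[OF g] by metis
 have Bf0: "0 <= Bf" and Bg0: "0 <= Bg" using Bf Bg by auto
 note m1 = mm_eq[of f Bf, OF Bf(2) Bf0] and m2 = mm_eq[of g Bg, OF Bg(2) Bg0]
 have fX: "f \<in> X" and gX: "g \<in> X'" using f g Linf_c_in_X Linf_c_in_assoc by auto
 note a = mm_bound[OF fX] and a2 = mm_bound[OF mm_bound(1)[OF fX]]
 note b = C'(2,3)[OF gX] and b2 = C'(2,3)[OF C'(2)[OF gX]]
 have mmfL: "enorm (mm (mm f) x) = maximal (mm f) x" for x by (rule mm_eq(1)[OF m1(2) Bf0])
 have mmgL: "enorm (mm (mm g) x) = maximal (mm g) x" for x by (rule mm_eq(1)[OF m2(2) Bg0])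
 have eq: "HH f g x = enorm (mm f x * mm (mm g) x) + enorm (mm (mm f) x * mm g x)" for x
  by (simp add: HH_def norm_mult ennreal_mult m1(1) m2(1) mmfL mmgL)
 have "(LN x. HH f g x) <= ennreal (N (mm f) * N' (mm (mm g))) + ennreal (N (mm (mm f)) * N' (mm g))"
  unfolding eq by (subst nn_integral_add) (auto intro!: add_mono hoelder a(1) b(1) a2(1) b2(1))
 also have "... = ennreal (N (mm f) * N' (mm (mm g)) + N (mm (mm f)) * N' (mm g))"
  by (rule ennreal_plus[symmetric]) (auto intro!: mult_nonneg_nonneg N_nonneg assoc_nonneg a a2)
 also have "... <= ennreal ((C * N f) * (C' * (C' * N' g)) + (C * (C * N f)) * (C' * N' g))"
 proof (intro ennreal_leI add_mono mult_mono)
  show "N (mm f) <= C * N f" using a(2) by (simp add: C_def)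
  show "N' (mm g) <= C' * N' g" by (rule b(2))
  show "N' (mm (mm g)) <= C' * (C' * N' g)" using b2(2) mult_left_mono[OF b(2) C'(1)] by linarith
  have "C * N (mm f) <= C * (C * N f)" using a(2) C0 by (intro mult_left_mono) (auto simp: C_def)
  then show "N (mm (mm f)) <= C * (C * N f)" using a2(2) by (simp add: C_def)
 qed (auto intro!: mult_nonneg_nonneg N_nonneg assoc_nonneg fX a C0 C'(1))
 also have "... <= ennreal ((C * C' * C' + C * C * C' + 1) * N f * N' g)"
  using N_nonneg[OF fX] assoc_nonneg[of g] by (intro ennreal_leI) (simp add: algebra_simps)
 finally show ?thesis .
qed
then show ?thesis using C0 C'(1)
 by (intro exI[of _ "C * C' * C' + C * C * C' + 1"]) (auto intro!: add_nonneg_pos)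
qed

lemma bounded_symbol_commutator:
 "\<exists>C>0. ALL b B beta. \<forall>f\<in>Linf_c. b \<in> Lmeas --> (ALL x. norm (b x) <= B) --> 0 < beta --> osc_le b beta -->
   commutator b T f \<in> X \<and> N (commutator b T f) <= C * beta * N f"
proof -
obtain C1 where C1: "0 < C1" and form: "form_bound C1" using commutator_form_bound by blast
note form = form[unfolded form_bound_def]
obtain C2 where C2: "0 < C2" and HHb: "!!f g. f \<in> Linf_c ==> g \<in> Linf_c ==> (LN x. HH f g x) <= ennreal (C2 * N f * N' g)"
 using HH_integral_bound by blast
have "commutator b T f \<in> X \<and> N (commutator b T f) <= C1 * C2 * beta * N f"
 if f: "f \<in> Linf_c" and b: "b \<in> Lmeas" and B: "ALL x. norm (b x) <= B" and beta: "0 < beta" and osc: "osc_le b beta"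
 for b B beta f
proof -
 note [measurable] = b Linf_c_measurable[OF f]
 have fX: "f \<in> X" by (rule Linf_c_in_X[OF f])
 obtain Bf Rf where Rf: "0 < Rf" "!!x. f x ~= 0 ==> norm x <= Rf" using Linf_cE[OF f] by metis
 have bf: "(%y. b y * f y) \<in> Linf_c" by (rule Linf_c_mult[OF f b]) (use B in blast)
 have m: "commutator b T f \<in> Lmeas"
  by (intro commutator_measurable Linf_c_subset_L2 f bf b)
 have dual: "(LN x. enorm (commutator b T f x * g x)) <= ennreal ((C1 * C2 * beta * N f) * N' g)"
  if g: "g \<in> Linf_c" for g
 proof -
  note [measurable] = Linf_c_measurable[OF g]
  obtain Bg Rg where Rg: "0 < Rg" "!!x. g x ~= 0 ==> norm x <= Rg" using Linf_cE[OF g] by metis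
  define l where "l = Rf + Rg + 1"
  define a :: 'a where "a = - (l *\<^sub>R One)"
  have l: "0 < l" "Rf < l" "Rg < l" using Rf(1) Rg(1) by (auto simp: l_def)
  have inQ: "x \<in> hcube a (2 * l)" if "norm x <= Rf \<or> norm x <= Rg" for x
   using that hcube_exhausts l unfolding a_def by blast
  have fr: "restr (hat a (2 * l)) f = f"
   using inQ Rf(2) hcube_subset_hat[of a "2 * l"] by (auto simp: restr_def fun_eq_iff)
  have "(LN x. enorm (commutator b T f x * g x))
    = (LN x\<in>hcube a (2 * l). enorm (commutator b T (restr (hat a (2 * l)) f) x * g x))"
   unfolding fr using inQ Rg(2) by (intro nn_integral_cong) (auto simp: indicator_def)
  also have "... <= (LN x\<in>hcube a (2 * l). ennreal (C1 * beta) * HH f g x)"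
   by (rule form[rule_format, OF b _ beta osc f g]) (use B l in auto)
  also have "... <= (LN x. ennreal (C1 * beta) * HH f g x)"
   by (intro nn_integral_mono) (auto simp: indicator_def)
  also have "... = ennreal (C1 * beta) * (LN x. HH f g x)"
   by (rule nn_integral_cmult) (simp add: HH_def)
  also have "... <= ennreal (C1 * beta) * ennreal (C2 * N f * N' g)" by (intro mult_left_mono HHb f g) auto
  also have "... = ennreal ((C1 * C2 * beta * N f) * N' g)"
   using C1 C2 beta N_nonneg[OF fX] assoc_nonneg[of g] by (simp add: ennreal_mult[symmetric] mult_ac)
  finally show ?thesis .
 qed
 have "0 <= C1 * C2 * beta * N f" using C1 C2 beta N_nonneg[OF fX] by simp
 then show ?thesis using X_duality[OF m _ dual] by blast
qed
then show ?thesis using C1 C2 by (intro exI[of _ "C1 * C2"]) auto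
qed

text \<open>
 On these functions the commutator with an unbounded symbol agrees with the one for a truncated
 symbol, and they are dense in \<open>X\<close>.
\<close>

definition tame :: "('a => complex) => ('a => complex) set" where
 "tame b = {f \<in> Linf_c. EX B. ALL x. f x ~= 0 --> norm (b x) <= B}"

lemma tame_Linf_c: "f \<in> tame b ==> f \<in> Linf_c"
 by (simp add: tame_def)

lemma tame_mult:
 assumes f: "f \<in> tame b" and [measurable]: "b \<in> Lmeas"
 shows "(%x. b x * f x) \<in> Linf_c"
proof -
obtain B where B: "!!x. f x ~= 0 ==> norm (b x) <= B" using f by (auto simp: tame_def)
note [measurable] = Linf_c_measurable[OF tame_Linf_c[OF f]]
have "norm (b x * f x) <= B * norm (f x)" for x
 using B[of x] by (cases "f x = 0") (auto simp: norm_mult intro: mult_right_mono)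
then show ?thesis by (intro Linf_c_dominated[OF tame_Linf_c[OF f]]) auto
qed

lemma tame_add:
 assumes "f \<in> tame b" "g \<in> tame b"
 shows "(%x. f x + g x) \<in> tame b"
proof -
obtain B B' where B: "!!x. f x ~= 0 ==> norm (b x) <= B" "!!x. g x ~= 0 ==> norm (b x) <= B'"
 using assms by (auto simp: tame_def)
have "norm (b x) <= max B B'" if "f x + g x ~= 0" for x
 using B[of x] that by (cases "f x = 0") (auto simp: le_max_iff_disj)
then show ?thesis using assms Linf_c_add[of f g] by (auto simp: tame_def)
qed

lemma tame_cmult: "f \<in> tame b ==> (%x. c * f x) \<in> tame b"
 by (auto simp: tame_def Linf_c_cmult)

lemma tame_commutator:
 assumes b: "b \<in> Lmeas" and f: "f \<in> tame b"
 shows "commutator b T f \<in> Lmeas"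
 by (intro commutator_measurable Linf_c_subset_L2 tame_Linf_c[OF f] tame_mult[OF f b] b)

lemma tame_commutator_linear:
 assumes b: "b \<in> Lmeas" and f: "f \<in> tame b" and g: "g \<in> tame b"
 shows "AE x. commutator b T (%x. f x + g x) x = commutator b T f x + commutator b T g x"
  and "AE x. commutator b T (%x. c * f x) x = c * commutator b T f x"
proof -
note f2 = Linf_c_subset_L2[OF tame_Linf_c[OF f]] and bf = Linf_c_subset_L2[OF tame_mult[OF f b]]
 and g2 = Linf_c_subset_L2[OF tame_Linf_c[OF g]] and bg = Linf_c_subset_L2[OF tame_mult[OF g b]]
have 1: "(%y. b y * (f y + g y)) = (%y. b y * f y + b y * g y)" "(%y. b y * (c * f y)) = (%y. c * (b y * f y))"
 by (auto simp: algebra_simps)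
show "AE x. commutator b T (%x. f x + g x) x = commutator b T f x + commutator b T g x"
 using T_add[OF f2 g2] T_add[OF bf bg] unfolding commutator_def 1 by eventually_elim (simp add: algebra_simps)
show "AE x. commutator b T (%x. c * f x) x = c * commutator b T f x"
 using T_cmult[OF f2, of c] T_cmult[OF bf, of c] unfolding commutator_def 1 by eventually_elim (simp add: algebra_simps)
qed

text \<open>
 Truncating \<open>b\<close> does not increase its oscillation, and on the support of
 \<open>f\<close> a truncation at a high level changes nothing; the values of \<open>b\<close>
 elsewhere are recovered by the Fatou property.
\<close>

theorem commutator_bound:
 "\<exists>C>0. ALL b beta. \<forall>f\<in>tame b. b \<in> Lmeas --> 0 < beta --> osc_le b beta -->
   commutator b T f \<in> X \<and> N (commutator b T f) <= C * beta * N f"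
proof -
obtain C where C: "0 < C" and bound: "ALL b B beta. \<forall>f\<in>Linf_c. b \<in> Lmeas --> (ALL x. norm (b x) <= B) --> 0 < beta --> osc_le b beta -->
  commutator b T f \<in> X \<and> N (commutator b T f) <= C * beta * N f"
 using bounded_symbol_commutator by blast
have "commutator b T f \<in> X \<and> N (commutator b T f) <= C * beta * N f"
 if f: "f \<in> tame b" and b: "b \<in> Lmeas" and beta: "0 < beta" and osc: "osc_le b beta" for b beta f
proof -
 define bn where "bn n x = clamp n (b x)" for n :: nat and x
 have bnm: "bn n \<in> Lmeas" for n unfolding bn_def[abs_def] by (rule clamp_measurable[OF b])
 have bnB: "ALL x. norm (bn n x) <= real n" for n by (simp add: bn_def clamp_bound)
 have bno: "osc_le (bn n) beta" for n unfolding bn_def[abs_def] by (rule clamp_osc[OF osc])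
 have each: "commutator (bn n) T f \<in> X \<and> N (commutator (bn n) T f) <= C * beta * N f" for n
  using bound tame_Linf_c[OF f] bnm bnB bno beta by blast
 obtain B where B: "!!x. f x ~= 0 ==> norm (b x) <= B" using f by (auto simp: tame_def)
 have "(%n. commutator (bn n) T f x) ---> commutator b T f x" for x
 proof (rule tendsto_eventually, unfold eventually_sequentially, intro exI allI impI)
  fix n :: nat assume n: "nat \<lceil>max B (norm (b x))\<rceil> <= n"
  have mx: "max B (norm (b x)) <= real n" using n by linarith
  have "bn n x = b x" unfolding bn_def by (rule clamp_same) (use mx in simp)
  moreover have "(%y. bn n y * f y) = (%y. b y * f y)"
  proof
   show "bn n y * f y = b y * f y" for y
    using B[of y] mx by (cases "f y = 0") (auto simp: bn_def clamp_same)
  qed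
  ultimately show "commutator (bn n) T f x = commutator b T f x" by (simp add: commutator_def)
 qed
 then have lim: "AE x. (%n. commutator (bn n) T f x) ---> commutator b T f x" by simp
 have e1: "!!n. commutator (bn n) T f \<in> X" and e2: "!!n. N (commutator (bn n) T f) <= C * beta * N f" using each by auto
 show ?thesis using X_fatou[OF e1 e2 lim tame_commutator[OF b f]] by blast
qed
then show ?thesis using C by blast
qed

end

section \<open>The commutator with a continuous symbol\<close>

lemma nn_integral_cells:
 fixes W :: "'a::euclidean_space => ennreal"
 assumes h: "0 < h" and G: "finite G" "G \<subseteq> range (gridc a h)" and [measurable]: "W \<in> Lmeas"
 shows "(\<Sum>c\<in>G. LN x\<in>hcube c h. W x) = (LN x. (if gridc a h x \<in> G then W x else 0))"
proof -
have mem: "x \<in> hcube c h \<longleftrightarrow> gridc a h x = c" if "c \<in> G" for x c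
 using that G(2) mem_cell_iff[OF h] by fastforce
have "(\<Sum>c\<in>G. LN x\<in>hcube c h. W x) = (LN x. (\<Sum>c\<in>G. W x * ind (hcube c h) x))"
 by (rule nn_integral_sum[symmetric]) measurable
also have "... = (LN x. (if gridc a h x \<in> G then W x else 0))"
proof (rule nn_integral_cong)
 fix x :: 'a
 have "(\<Sum>c\<in>G. W x * ind (hcube c h) x) = (\<Sum>c\<in>G. if gridc a h x = c then W x else 0)"
  by (rule sum.cong) (auto simp: mem indicator_def)
 then show "(\<Sum>c\<in>G. W x * ind (hcube c h) x) = (if gridc a h x \<in> G then W x else 0)"
  using G(1) by simp
qed
finally show ?thesis .
qed

context dini_operator
begin

text \<open>
 The part of \<open>f\<close> outside the dilated cell vanishes in a neighbourhood of the cell,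
 where its image under \<open>T\<close> is given by the kernel.
\<close>

lemma commutator_off_diagonal:
 assumes f: "f \<in> Linf_c" and h: "0 < h" and phi: "phi \<in> Lmeas" "!!x. norm (phi x) <= B"
 shows "AE x. x \<in> hcube c h --> commutator phi T f x = commutator phi T (restr (hat c h) f) x
   + (LI y. (phi x - phi y) * K x y * restr (- hat c h) f y)"
proof -
note [measurable] = phi(1) Linf_c_measurable[OF f]
let ?R = "restr (hat c h) f" and ?P = "restr (- hat c h) f"
let ?F = "- box (hatc c h) (hatc c h + hatr TYPE('a) h *\<^sub>R One)"
have RL: "?R \<in> Linf_c" and PL: "?P \<in> Linf_c" by (auto intro!: Linf_c_restr f)
have pP: "(%y. phi y * ?P y) \<in> Linf_c" by (rule Linf_c_mult[OF PL phi])
have F: "closed ?F" by (intro closed_Compl open_box)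
have van: "?P y = 0" if "y ~: ?F" for y using that box_subset_hcube[of "hatc c h"] by (auto simp: restr_def)
have van2: "phi y * ?P y = 0" if "y ~: ?F" for y using van[OF that] by simp
have notF: "x ~: ?F" if x: "x \<in> hcube c h" for x
proof -
 have "hatc c h \<bullet> i < x \<bullet> i \<and> x \<bullet> i < (hatc c h + hatr TYPE('a) h *\<^sub>R One) \<bullet> i" if i: "i \<in> Basis" for i
 proof -
  have "c \<bullet> i <= x \<bullet> i" "x \<bullet> i < c \<bullet> i + h" using x i by (auto simp: hcube_def inner_add_left)
  moreover have "0 < real DIM('a) * h" using h by simp
  moreover have "hatc c h \<bullet> i = c \<bullet> i - 4 * (real DIM('a) * h)"
   "(hatc c h + hatr TYPE('a) h *\<^sub>R One) \<bullet> i = c \<bullet> i + h + 4 * (real DIM('a) * h)"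
   using i by (simp_all add: hatc_def hatr_def inner_add_left inner_diff_left algebra_simps)
  ultimately show ?thesis by linarith
 qed
 then show ?thesis by (simp add: mem_box)
qed
have eq: "(%y. f y - ?R y) = ?P" by (auto simp: restr_def fun_eq_iff)
have k1: "AE x. x ~: ?F --> T ?P x = (LI y. K x y * ?P y)"
 by (rule kernel_representation[OF PL F]) (rule van)
have k2: "AE x. x ~: ?F --> T (%y. phi y * ?P y) x = (LI y. K x y * (phi y * ?P y))"
 by (rule kernel_representation[OF pP F]) (rule van2)
show ?thesis
 using k1 k2 commutator_diff[OF f RL phi] unfolding eq
proof eventually_elim
 case (elim x)
 show ?case
 proof
  assume x: "x \<in> hcube c h"
  have delta: "0 < 4 * (real DIM('a) * h)" using h by simp
  have off: "4 * (real DIM('a) * h) <= norm (x - y)" if "?P y ~= 0" for y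
   using that far_off_hat[OF x, of y] by (auto simp: restr_def split: if_splits)
  have i1: "integrable lebesgue (%y. K x y * ?P y)"
   by (intro Linf_c_integrable K_mult_Linf_c[OF PL delta] off)
  have i2: "integrable lebesgue (%y. K x y * (phi y * ?P y))"
   by (intro Linf_c_integrable K_mult_Linf_c[OF pP delta] off) auto
  have "(LI y. (phi x - phi y) * K x y * ?P y) = (LI y. phi x * (K x y * ?P y) - K x y * (phi y * ?P y))"
   by (rule Bochner_Integration.integral_cong) (auto simp: algebra_simps)
  also have "... = phi x * (LI y. K x y * ?P y) - (LI y. K x y * (phi y * ?P y))"
   using i1 i2 by simp
  also have "... = commutator phi T ?P x" using elim(1,2) notF[OF x] by (simp add: commutator_def)
  finally show "commutator phi T f x = commutator phi T ?R x + (LI y. (phi x - phi y) * K x y * ?P y)"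
   using elim(3) by simp
 qed
qed
qed

text \<open>
 \<open>z\<close> is the integral with \<open>x\<close> moved to the corner \<open>p\<close> of its
 fine cell and \<open>y\<close> restricted to the ball of radius \<open>A\<close>. The three error
 terms come from moving \<open>x\<close>, from \<open>|y| > A\<close> (then \<open>|x| \<le>
 R\<close>, so \<open>|x - y| \<ge> |y| / 2\<close>), and from \<open>|x| > A\<close> (then
 \<open>|y| \<le> R\<close>).
\<close>

lemma off_diagonal_kernel_bound:
 assumes f: "f \<in> Linf_c" and h: "0 < h" "0 < h'" "h' <= h" "h' <= 4 * h * theta"
  and C0: "0 <= C0" "!!x y. x ~= y ==> norm (K x y) <= C0 / norm (x - y) ^ DIM('a)"
  and phi: "phi \<in> Lmeas" "!!x. norm (phi x) <= B"
   "!!x. phi x ~= 0 ==> norm x <= R" "!!u v. norm (u - v) <= real DIM('a) * h' ==> norm (phi u - phi v) <= eta"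
  and omega: "!!t. 0 <= t ==> t <= theta ==> omega t < eta" and eta: "0 < eta" and A: "0 < R" "2 * R <= A"
  and x: "x \<in> hcube c h" "x \<in> hcube p h'"
 defines "z \<equiv> LI y. (phi p - phi y) * K p y * restr (cball 0 A - hat c h) f y"
 shows "enorm ((LI y. (phi x - phi y) * K x y * restr (- hat c h) f y) - (if norm x <= A then z else 0))
   <= ennreal ((eta * C0 + 2 * B * eta) / (4 * (real DIM('a) * h)) ^ DIM('a)) * mass f (cball 0 A) * ind (cball 0 A) x
    + ennreal (B * C0 * 2 ^ DIM('a)) * (LN y\<in>- cball 0 A. ennreal (norm (f y) / norm y ^ DIM('a))) * ind (cball 0 R) x
    + ennreal (B * C0 * 2 ^ DIM('a) / norm x ^ DIM('a)) * mass f (cball 0 R) * ind (- cball 0 A) x"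
  (is "_ <= ennreal ?kappa * _ * _ + ennreal ?b * ?tail * _ + _")
  and "norm x <= A ==> ennreal (norm z) <= ennreal (2 * B * (C0 / (2 * (real DIM('a) * h)) ^ DIM('a))) * mass f (cball 0 A)"
proof -
let ?d = "DIM('a)"
note [measurable] = phi(1) Linf_c_measurable[OF f]
have [measurable]: "(%y::'a. norm y) \<in> Lmeas" by (rule measurable_completion) measurable
have [measurable]: "- cball (0::'a) A \<in> sets lebesgue" by (simp add: Compl_in_sets_lebesgue cball_lebesgue)
define rho where "rho = real ?d * h"
have rho: "0 < rho" using h by (simp add: rho_def)
have B0: "0 <= B" using phi(2)[of 0] norm_ge_zero order_trans by blast
have xp: "norm (x - p) <= real ?d * h'" by (rule norm_diff_hcube[OF x(2) corner_in_hcube[OF h(2)]])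
have xprho: "norm (x - p) <= rho" using xp h(3) by (simp add: rho_def) (meson mult_left_mono of_nat_0_le_iff order_trans)
have far: "4 * rho <= norm (x - y)" if "y ~: hat c h" for y using far_off_hat[OF x(1) that] by (simp add: rho_def)
have farp: "2 * rho <= norm (p - y)" if "y ~: hat c h" for y
 using far[OF that] xprho rho norm_triangle_ineq[of "x - p" "p - y"] by simp
have Kle: "norm (K u y) <= C0 / t ^ ?d" if "t <= norm (u - y)" "0 < t" for u y t
proof -
 have "norm (K u y) <= C0 / norm (u - y) ^ ?d" using that by (intro C0(2)) auto
 also have "... <= C0 / t ^ ?d" using that C0(1) by (intro divide_left_mono power_mono mult_pos_pos zero_less_power) auto
 finally show ?thesis .
qed
have Kdiff: "norm (K x y - K p y) <= eta / (4 * rho) ^ ?d" if y: "y ~: hat c h" for y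
proof -
 have n: "0 < norm (x - y)" using far[OF y] rho by linarith
 have lt: "norm (x - p) < 1/2 * norm (x - y)" using far[OF y] xprho rho by linarith
 have "real ?d * h' <= theta * (4 * rho)" using mult_left_mono[OF h(4), of "real ?d"] by (simp add: rho_def mult_ac)
 also have "0 <= theta" using h by (metis less_le_trans mult_pos_pos not_less zero_less_mult_pos zero_less_numeral less_imp_le)
 then have "theta * (4 * rho) <= theta * norm (x - y)" using far[OF y] by (intro mult_left_mono)
 finally have "norm (x - p) / norm (x - y) <= theta" using xp n by (simp add: divide_le_eq)
 then have w: "omega (norm (x - p) / norm (x - y)) <= eta" by (intro less_imp_le[OF omega]) auto
 have "norm (K x y - K p y) <= 1 / norm (x - y) ^ ?d * omega (norm (x - p) / norm (x - y))" by (rule K_smooth_x[OF lt])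
 also have "... <= 1 / norm (x - y) ^ ?d * eta" by (intro mult_left_mono w) auto
 also have "... = eta / norm (x - y) ^ ?d" by simp
 also have "... <= eta / (4 * rho) ^ ?d"
  using far[OF y] rho eta n by (intro divide_left_mono power_mono mult_pos_pos zero_less_power) auto
 finally show ?thesis .
qed
have phid: "norm (phi u - phi v) <= 2 * B" for u v using norm_triangle_ineq4[of "phi u" "phi v"] phi(2)[of u] phi(2)[of v] by linarith
let ?P = "restr (- hat c h) f" and ?Q = "restr (cball 0 A - hat c h) f"
have PL: "?P \<in> Linf_c" and QL: "?Q \<in> Linf_c" by (auto intro!: Linf_c_restr f)
have int: "integrable lebesgue (%y. (phi u - phi y) * K u y * w y)"
 if w: "w \<in> Linf_c" and off: "!!y. w y ~= 0 ==> 2 * rho <= norm (u - y)" for u w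
proof -
 have "(%y. (phi u - phi y) * (K u y * w y)) \<in> Linf_c"
  by (rule Linf_c_mult[OF K_mult_Linf_c[OF w _ off] _ phid]) (use rho in auto)
 then show ?thesis using Linf_c_integrable by (simp add: mult.assoc)
qed
have offP: "2 * rho <= norm (x - y)" if "?P y ~= 0" for y using that far[of y] rho by (force simp: restr_def split: if_splits)
have offQ: "2 * rho <= norm (p - y)" if "?Q y ~= 0" for y using that farp[of y] by (auto simp: restr_def split: if_splits)
note iP = int[OF PL offP] and iQ = int[OF QL offQ]
show "ennreal (norm z) <= ennreal (2 * B * (C0 / (2 * (real DIM('a) * h)) ^ DIM('a))) * mass f (cball 0 A)"
proof -
 define q where "q = 2 * B * (C0 / (2 * rho) ^ ?d)"
 have q: "0 <= q" using B0 C0 rho by (simp add: q_def)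
 have "ennreal (norm z) <= (LN y. enorm ((phi p - phi y) * K p y * ?Q y))"
  unfolding z_def by (rule integral_norm_bound_ennreal[OF iQ])
 also have "... <= (LN y. ennreal q * (enorm (f y) * ind (cball 0 A) y))"
 proof (rule nn_integral_mono)
  fix y
  have "norm ((phi p - phi y) * K p y) <= q" if "y ~: hat c h"
   unfolding norm_mult q_def using Kle[OF farp[OF that]] rho B0 C0 by (intro mult_mono phid) auto
  then have "norm ((phi p - phi y) * K p y) * norm (?Q y) <= q * (norm (f y) * ind (cball 0 A) y)"
   using q by (cases "y \<in> cball 0 A - hat c h") (auto simp: restr_def mult_right_mono)
  then have "norm ((phi p - phi y) * K p y * ?Q y) <= q * (norm (f y) * ind (cball 0 A) y)"
   by (simp only: norm_mult[of _ "?Q y"])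
  from ennreal_leI[OF this] show "enorm ((phi p - phi y) * K p y * ?Q y) <= ennreal q * (enorm (f y) * ind (cball 0 A) y)"
   using q by (auto simp: ennreal_mult[symmetric] indicator_def split: if_splits)
 qed
 also have "... = ennreal q * mass f (cball 0 A)"
  by (rule nn_integral_cmult) measurable
 finally show ?thesis by (simp only: q_def rho_def)
qed
define k where "k = ?kappa"
define q where "q = ?b"
have k0: "0 <= k" using B0 C0 eta h by (simp add: k_def)
have q0: "0 <= q" using B0 C0 by (simp add: q_def)
have main: "enorm ((LI y. (phi x - phi y) * K x y * ?P y) - (if norm x <= A then z else 0))
  <= ennreal k * mass f (cball 0 A) * ind (cball 0 A) x + ennreal q * ?tail * ind (cball 0 R) x
   + ennreal (q / norm x ^ ?d) * mass f (cball 0 R) * ind (- cball 0 A) x"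
proof (cases "norm x <= A")
 case True
 let ?J = "%y. (phi x - phi y) * K x y * ?P y - (phi p - phi y) * K p y * ?Q y"
 let ?i = "ind (cball 0 R) x :: real"
 have J: "norm (?J y) <= k * (norm (f y) * ind (cball 0 A) y) + q * ?i * (norm (f y) / norm y ^ ?d * ind (- cball 0 A) y)" for y
 proof (cases "y \<in> hat c h")
  case True
  then show ?thesis using k0 q0 by (simp add: restr_def)
 next
  case y: False
  show ?thesis
  proof (cases "norm y <= A")
   case True
   have "?J y = ((phi x - phi p) * K x y + (phi p - phi y) * (K x y - K p y)) * f y"
    using y True by (simp add: restr_def algebra_simps)
   moreover have "norm ((phi x - phi p) * K x y + (phi p - phi y) * (K x y - K p y)) <= eta * (C0 / (4 * rho) ^ ?d) + 2 * B * (eta / (4 * rho) ^ ?d)"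
   proof (intro order_trans[OF norm_triangle_ineq] add_mono)
    have "norm (K x y) <= C0 / (4 * rho) ^ ?d" using far[OF y] rho by (intro Kle) auto
    then show "norm ((phi x - phi p) * K x y) <= eta * (C0 / (4 * rho) ^ ?d)"
     unfolding norm_mult using eta by (intro mult_mono phi(4) xp) auto
    show "norm ((phi p - phi y) * (K x y - K p y)) <= 2 * B * (eta / (4 * rho) ^ ?d)"
     unfolding norm_mult using B0 by (intro mult_mono phid Kdiff y) auto
   qed
   moreover have "eta * (C0 / (4 * rho) ^ ?d) + 2 * B * (eta / (4 * rho) ^ ?d) = k" by (simp add: rho_def k_def add_divide_distrib)
   ultimately have "norm (?J y) <= k * norm (f y)" by (simp only: norm_mult) (rule mult_right_mono, auto)
   then show ?thesis using True by simp
  next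
   case yA: False
   have phiy: "phi y = 0" using phi(3)[of y] yA A by linarith
   have Jy: "?J y = phi x * K x y * f y" using y yA phiy by (simp add: restr_def)
   show ?thesis
   proof (cases "phi x = 0")
    case True
    then show ?thesis using Jy k0 q0 by simp
   next
    case False
    then have xR: "norm x <= R" by (rule phi(3))
    have ny: "0 < norm y" using yA A by linarith
    have ny2: "norm y / 2 <= norm (x - y)" using norm_triangle_ineq2[of y x] xR yA A by (simp add: norm_minus_commute)
    have "norm (K x y) <= C0 / (norm y / 2) ^ ?d" using ny ny2 by (intro Kle) auto
    then have "norm (phi x * K x y) <= B * (C0 / (norm y / 2) ^ ?d)" unfolding norm_mult using B0 by (intro mult_mono phi(2)) auto
    then have "norm (?J y) <= B * (C0 / (norm y / 2) ^ ?d) * norm (f y)" unfolding Jy norm_mult[of _ "f y"] by (rule mult_right_mono) simp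
    then show ?thesis using xR yA by (simp add: q_def power_divide mult_ac)
   qed
  qed
 qed
 have "enorm ((LI y. (phi x - phi y) * K x y * ?P y) - z) = enorm (LI y. ?J y)"
  unfolding z_def using iP iQ by simp
 also have "... <= (LN y. enorm (?J y))" by (intro integral_norm_bound_ennreal Bochner_Integration.integrable_diff iP iQ)
 also have "... <= (LN y. ennreal k * (enorm (f y) * ind (cball 0 A) y) + ennreal (q * ?i) * (ennreal (norm (f y) / norm y ^ ?d) * ind (- cball 0 A) y))"
 proof (rule nn_integral_mono)
  fix y
  have "enorm (?J y) <= ennreal (k * (norm (f y) * ind (cball 0 A) y) + q * ?i * (norm (f y) / norm y ^ ?d * ind (- cball 0 A) y))"
   by (rule ennreal_leI[OF J])
  also have "... = ennreal k * (enorm (f y) * ind (cball 0 A) y) + ennreal (q * ?i) * (ennreal (norm (f y) / norm y ^ ?d) * ind (- cball 0 A) y)"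
   using k0 q0 by (subst ennreal_plus) (auto simp: ennreal_mult[symmetric] indicator_def)
  finally show "enorm (?J y) <= ..." .
 qed
 also have "... = ennreal k * mass f (cball 0 A) + ennreal (q * ?i) * ?tail"
  by (subst nn_integral_add, measurable) (simp add: nn_integral_cmult)
 finally show ?thesis using True by (auto simp: indicator_def mult_ac)
next
 case False
 have phix: "phi x = 0" using phi(3)[of x] False A by linarith
 have nx: "0 < norm x" using False A by linarith
 have "enorm (LI y. (phi x - phi y) * K x y * ?P y) <= (LN y. enorm ((phi x - phi y) * K x y * ?P y))"
  by (rule integral_norm_bound_ennreal[OF iP])
 also have "... <= (LN y. ennreal (q / norm x ^ ?d) * (enorm (f y) * ind (cball 0 R) y))"
 proof (rule nn_integral_mono)
  fix y
  have "norm ((phi x - phi y) * K x y * ?P y) <= q / norm x ^ ?d * (norm (f y) * ind (cball 0 R) y)"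
  proof (cases "phi y = 0 \<or> y \<in> hat c h")
   case True
   then show ?thesis using phix q0 by (auto simp: restr_def)
  next
   case y: False
   then have yR: "norm y <= R" using phi(3) by blast
   have ny: "norm x / 2 <= norm (x - y)" using norm_triangle_ineq2[of x y] yR False A by simp
   have "norm (K x y) <= C0 / (norm x / 2) ^ ?d" using ny nx by (intro Kle) auto
   then have "norm ((phi x - phi y) * K x y) <= B * (C0 / (norm x / 2) ^ ?d)"
    unfolding norm_mult phix using B0 phi(2)[of y] by (intro mult_mono) auto
   moreover have Py: "?P y = f y" using y by (simp add: restr_def)
   ultimately have "norm ((phi x - phi y) * K x y * ?P y) <= B * (C0 / (norm x / 2) ^ ?d) * norm (f y)"
    unfolding Py norm_mult[of _ "f y"] by (intro mult_right_mono) auto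
   then show ?thesis using yR by (simp add: q_def power_divide mult_ac)
  qed
  from ennreal_leI[OF this] show "enorm ((phi x - phi y) * K x y * ?P y) <= ennreal (q / norm x ^ ?d) * (enorm (f y) * ind (cball 0 R) y)"
   using q0 by (auto simp: ennreal_mult[symmetric] indicator_def split: if_splits)
 qed
 also have "... = ennreal (q / norm x ^ ?d) * mass f (cball 0 R)" by (rule nn_integral_cmult) measurable
 finally show ?thesis using False by (simp add: add_increasing)
qed
then show "enorm ((LI y. (phi x - phi y) * K x y * ?P y) - (if norm x <= A then z else 0))
  <= ennreal ?kappa * mass f (cball 0 A) * ind (cball 0 A) x + ennreal ?b * ?tail * ind (cball 0 R) x
   + ennreal (?b / norm x ^ ?d) * mass f (cball 0 R) * ind (- cball 0 A) x"
 by (simp only: k_def q_def)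
qed

end

context commutator_on_function_space
begin

definition local_bound :: "real => bool" where
 "local_bound C \<longleftrightarrow> (ALL phi B h eta f g. phi \<in> Lmeas --> (ALL x. norm (phi x) <= B) --> 0 < h --> 0 < eta -->
   (ALL x y. norm (x - y) <= real DIM('a) * hatr TYPE('a) h --> norm (phi x - phi y) <= eta) --> f \<in> Linf_c --> g \<in> Linf_c -->
   (\<Sum>c\<in>gridc 0 h ` {x. g x ~= 0}. LN x\<in>hcube c h. enorm (commutator phi T (restr (hat c h) f) x * g x))
    <= ennreal (C * eta * N f * N' g))"

text \<open>
 On each cell \<open>phi\<close> may be replaced, outside the dilated cell, by its value at the
 corner. The new symbol deviates from a constant by at most \<open>eta\<close> everywhere, so its
 oscillation is at most \<open>eta\<close> and the form bound applies with \<open>beta =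
 eta\<close>.
\<close>

lemma local_part_bound: "\<exists>C>0. local_bound C"
proof -
obtain C1 where C1: "0 < C1" and form: "form_bound C1" using commutator_form_bound by blast
note form = form[unfolded form_bound_def]
obtain C2 where C2: "0 < C2" and HHb: "!!f g. f \<in> Linf_c ==> g \<in> Linf_c ==> (LN x. HH f g x) <= ennreal (C2 * N f * N' g)"
 using HH_integral_bound by blast
have "(\<Sum>c\<in>gridc 0 h ` {x. g x ~= 0}. LN x\<in>hcube c h. enorm (commutator phi T (restr (hat c h) f) x * g x))
   <= ennreal (C1 * C2 * eta * N f * N' g)"
 if phi: "phi \<in> Lmeas" and B: "ALL x. norm (phi x) <= B" and h: "0 < h" and eta: "0 < eta"
  and mod: "ALL x y. norm (x - y) <= real DIM('a) * hatr TYPE('a) h --> norm (phi x - phi y) <= eta"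
  and f: "f \<in> Linf_c" and g: "g \<in> Linf_c" for phi B h eta f g
proof -
 note [measurable] = phi
 let ?G = "gridc 0 h ` {x. g x ~= 0}"
 have G: "finite ?G" "?G \<subseteq> range (gridc 0 h)" using finite_gridc[OF h] g by (auto simp: Linf_c_def)
 have each: "(LN x\<in>hcube c h. enorm (commutator phi T (restr (hat c h) f) x * g x))
   <= (LN x\<in>hcube c h. ennreal (C1 * eta) * HH f g x)" for c
 proof -
  define psi where "psi x = (if x \<in> hat c h then phi x else phi c)" for x
  have cin: "c \<in> hat c h" using corner_in_hcube[OF h] hcube_subset_hat by blast
  have [measurable]: "psi \<in> Lmeas" unfolding psi_def by measurable
  have psiB: "ALL x. norm (psi x) <= B" using B by (simp add: psi_def)
  have dev: "norm (psi x - phi c) <= eta" for x using mod norm_diff_hcube[OF _ cin, of x] eta by (auto simp: psi_def)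
  have "mass (%x. psi x - phi c) (hcube a l) <= ennreal (eta * l ^ DIM('a))" if l: "0 < l" for a l
  proof -
   have "mass (%x. psi x - phi c) (hcube a l) <= (LN x\<in>hcube a l. ennreal eta)"
    by (intro nn_integral_mono mult_right_mono ennreal_leI dev) auto
   also have "... = ennreal (eta * l ^ DIM('a))" using l eta by (simp add: nn_integral_cmult_indicator ennreal_mult emeasure_hcube)
   finally show ?thesis .
  qed
  then have osc: "osc_le psi eta" unfolding osc_le_def by blast
  have r: "(%y. phi y * restr (hat c h) f y) = (%y. psi y * restr (hat c h) f y)" by (auto simp: restr_def psi_def)
  have "phi x = psi x" if "x \<in> hcube c h" for x using that hcube_subset_hat[of c h] by (auto simp: psi_def)
  then have "(LN x\<in>hcube c h. enorm (commutator phi T (restr (hat c h) f) x * g x))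
    = (LN x\<in>hcube c h. enorm (commutator psi T (restr (hat c h) f) x * g x))"
   by (intro nn_integral_cong) (auto simp: commutator_def r indicator_def)
  also have "... <= (LN x\<in>hcube c h. ennreal (C1 * eta) * HH f g x)"
   by (rule form[rule_format, OF _ _ eta osc f g h]) (use psiB in auto)
  finally show ?thesis .
 qed
 have "(\<Sum>c\<in>?G. LN x\<in>hcube c h. enorm (commutator phi T (restr (hat c h) f) x * g x))
   <= (\<Sum>c\<in>?G. LN x\<in>hcube c h. ennreal (C1 * eta) * HH f g x)" by (rule sum_mono[OF each])
 also have "... = (LN x. (if gridc 0 h x \<in> ?G then ennreal (C1 * eta) * HH f g x else 0))"
  by (rule nn_integral_cells[OF h G]) (simp add: HH_def)
 also have "... <= (LN x. ennreal (C1 * eta) * HH f g x)" by (intro nn_integral_mono) auto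
 also have "... = ennreal (C1 * eta) * (LN x. HH f g x)" by (rule nn_integral_cmult) (simp add: HH_def)
 also have "... <= ennreal (C1 * eta) * ennreal (C2 * N f * N' g)" by (intro mult_left_mono HHb f g) auto
 also have "... = ennreal (C1 * C2 * eta * N f * N' g)"
  using C1 C2 eta N_nonneg[OF Linf_c_in_X[OF f]] assoc_nonneg[of g] by (simp add: ennreal_mult[symmetric] mult_ac)
 finally show ?thesis .
qed
then show ?thesis unfolding local_bound_def using C1 C2 by (intro exI[of _ "C1 * C2"]) auto
qed

end

context function_space
begin

text \<open>
 The coefficients range over a disc, which has a finite net.
\<close>

lemma finite_rank_net:
 fixes e :: "'i => 'a => complex"
 assumes I: "finite I" and e: "!!i. i \<in> I ==> e i \<in> X" and eps: "0 < eps"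
 shows "EX S. finite S \<and> S \<subseteq> X \<and>
   (ALL z. (\<forall>i\<in>I. norm (z i) <= C) --> (\<exists>s\<in>S. N (%x. (\<Sum>i\<in>I. z i * e i x) - s x) <= eps))"
proof -
define E where "E = (\<Sum>i\<in>I. N (e i)) + 1"
have E: "0 < E" using e by (auto simp: E_def intro!: add_nonneg_pos sum_nonneg N_nonneg)
define delta where "delta = eps / E"
have delta: "0 < delta" using eps E by (simp add: delta_def)
obtain Z where Z: "finite Z" "cball (0::complex) C \<subseteq> (\<Union>k\<in>Z. ball k delta)"
 using compact_cball[of "0::complex" C] delta unfolding compact_eq_totally_bounded by blast
let ?L = "%zeta x. \<Sum>i\<in>I. zeta i * e i x"
have LX: "?L zeta \<in> X" and LNb: "N (?L zeta) <= (\<Sum>i\<in>I. norm (zeta i) * N (e i))" for zeta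
proof -
 have "?L zeta \<in> X \<and> N (?L zeta) <= (\<Sum>i\<in>I. N (%x. zeta i * e i x))" by (rule X_sum[OF I]) (rule X_cmult[OF e])
 moreover have "(\<Sum>i\<in>I. N (%x. zeta i * e i x)) = (\<Sum>i\<in>I. norm (zeta i) * N (e i))" by (rule sum.cong[OF refl]) (rule N_cmult[OF e])
 ultimately show "?L zeta \<in> X" "N (?L zeta) <= (\<Sum>i\<in>I. norm (zeta i) * N (e i))" by simp_all
qed
let ?S = "?L ` (PiE I (%_. Z))"
have "finite ?S" using I Z(1) by (intro finite_imageI finite_PiE) auto
moreover have "?S \<subseteq> X" using LX by auto
moreover have "\<exists>s\<in>?S. N (%x. ?L z x - s x) <= eps" if z: "\<forall>i\<in>I. norm (z i) <= C" for z
proof -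
 have "\<forall>i\<in>I. \<exists>k\<in>Z. norm (z i - k) <= delta"
 proof
  fix i assume "i \<in> I"
  then have "z i \<in> (\<Union>k\<in>Z. ball k delta)" using z Z(2) by force
  then show "\<exists>k\<in>Z. norm (z i - k) <= delta" by (auto simp: dist_norm norm_minus_commute intro: less_imp_le)
 qed
 then obtain k where k: "\<forall>i\<in>I. k i \<in> Z \<and> norm (z i - k i) <= delta" by metis
 let ?k = "restrict k I"
 have eq: "(%x. ?L z x - ?L ?k x) = ?L (%i. z i - k i)"
  by (auto simp: fun_eq_iff left_diff_distrib sum_subtractf)
 have le: "N (?L (%i. z i - k i)) <= eps"
 proof -
  have "N (?L (%i. z i - k i)) <= (\<Sum>i\<in>I. delta * N (e i))"
   by (intro order_trans[OF LNb] sum_mono mult_right_mono N_nonneg e) (use k in auto)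
  also have "... <= delta * E" using delta by (simp add: E_def sum_distrib_left[symmetric] distrib_left)
  finally show ?thesis using E by (simp add: delta_def)
 qed
 have "N (%x. ?L z x - ?L ?k x) <= eps" using le by (simp only: eq)
 moreover have "?L ?k \<in> ?S" using k by (intro imageI) auto
 ultimately show ?thesis by (rule bexI)
qed
ultimately show ?thesis by blast
qed

end

definition unit_bump :: "'a::euclidean_space => complex" where
 "unit_bump = (%x. 1 * ind (hcube 0 1) x)"

lemma unit_bump_Linf_c: "unit_bump \<in> Linf_c"
 unfolding unit_bump_def by (intro Linf_c_indicator bounded_hcube) auto

lemma unit_bump_le: "norm (unit_bump x) <= 1"
 by (simp add: unit_bump_def indicator_def)

text \<open>
 The cube of side \<open>4 |x|\<close> about the origin contains \<open>x\<close> and the unit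
 cube.
\<close>

lemma inverse_power_le_maximal:
 fixes x :: "'a::euclidean_space"
 assumes x: "1 <= norm x"
 shows "1 / norm x ^ DIM('a) <= 4 ^ DIM('a) * norm (mm unit_bump x)"
proof -
let ?Q = "hcube (- ((2 * norm x) *\<^sub>R One)) (2 * (2 * norm x)) :: 'a set"
have xQ: "x \<in> ?Q" using x by (intro hcube_exhausts[of _ "norm x"]) auto
have sub: "hcube 0 1 \<subseteq> ?Q" using x by (auto simp: hcube_def inner_add_left)
have "(1::ennreal) = mass unit_bump (hcube (0::'a) 1)"
proof -
 have "mass unit_bump (hcube (0::'a) 1) = (LN x. ind (hcube (0::'a) 1) x)"
  by (intro nn_integral_cong) (auto simp: unit_bump_def indicator_def)
 then show ?thesis using emeasure_hcube[of 1 "0::'a"] by simp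
qed
also have "... <= mass unit_bump ?Q" by (rule mass_mono[OF sub])
also have "... <= ennreal ((2 * (2 * norm x)) ^ DIM('a)) * maximal unit_bump x" by (rule maximal_ge_hcube[OF xQ])
also have "maximal unit_bump x = enorm (mm unit_bump x)" by (rule mm_eq(1)[of unit_bump 1, symmetric]) (auto simp: unit_bump_le)
finally have "ennreal 1 <= ennreal ((2 * (2 * norm x)) ^ DIM('a) * norm (mm unit_bump x))" by (simp add: ennreal_mult)
then have "1 <= (2 * (2 * norm x)) ^ DIM('a) * norm (mm unit_bump x)" by (subst (asm) ennreal_le_iff) auto
then have "1 <= 4 ^ DIM('a) * norm (mm unit_bump x) * norm x ^ DIM('a)" by (simp add: power_mult_distrib mult_ac)
then show ?thesis using x by (subst divide_le_eq) (auto intro: zero_less_power)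
qed

context commutator_on_function_space
begin

lemma X_ball_bound:
 assumes R: "0 < R"
 obtains C where "0 <= C" "!!f. f \<in> X ==> mass f (cball 0 R) <= ennreal (C * N f)"
proof -
have l: "0 < 2 * (R + 1)" using R by simp
obtain C where C: "0 <= C" "!!f. f \<in> X ==> mass f (hcube (- ((R + 1) *\<^sub>R One)) (2 * (R + 1))) <= ennreal (C * N f)"
 using X_cube_bound[OF l] by blast
have "cball 0 R \<subseteq> hcube (- ((R + 1) *\<^sub>R One)) (2 * (R + 1))" using hcube_exhausts[of _ R "R + 1"] by auto
then show ?thesis using that[OF C(1)] C(2) mass_mono order_trans by blast
qed

lemma ball_in_X: "ind (cball 0 R) \<in> X"
 using Linf_c_in_X[OF Linf_c_indicator[of "cball 0 R" 1]] by simp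

text \<open>
 The commutator is compared with a sum over pairs of a coarse and a fine cell, with coefficients
 bounded uniformly in \<open>f\<close>. The error is tested against \<open>g\<close> cell by cell,
 where it splits into the local part, bounded by hypothesis, and the function \<open>E\<close>
 collecting the three errors of \<open>off_diagonal_kernel_bound\<close>.
\<close>

lemma finite_rank_error:
 assumes f: "f \<in> Linf_c" "N f <= 1"
  and h: "0 < h" "0 < h'" "h' <= h" "h' <= 4 * h * theta"
  and C0: "0 <= C0" "!!x y. x ~= y ==> norm (K x y) <= C0 / norm (x - y) ^ DIM('a)"
  and phi: "phi \<in> Lmeas" "!!x. norm (phi x) <= B" "!!x. phi x ~= 0 ==> norm x <= R"
  and mod: "!!u v. norm (u - v) <= real DIM('a) * h' ==> norm (phi u - phi v) <= eta"
  and omega: "!!t. 0 <= t ==> t <= theta ==> omega t < eta" and eta: "0 < eta" and A: "0 < R" "2 * R <= A" "1 <= A"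
  and CA: "0 <= CA" "!!f. f \<in> X ==> mass f (cball 0 A) <= ennreal (CA * N f)"
  and CR: "0 <= CR" "!!f. f \<in> X ==> mass f (cball 0 R) <= ennreal (CR * N f)"
  and loc: "!!g. g \<in> Linf_c ==> (\<Sum>c\<in>gridc 0 h ` {x. g x ~= 0}.
    LN x\<in>hcube c h. enorm (commutator phi T (restr (hat c h) f) x * g x)) <= ennreal (L * N' g)" and L: "0 <= L"
  and W: "mm unit_bump \<in> X'"
 defines "kappa \<equiv> (eta * C0 + 2 * B * eta) / (4 * (real DIM('a) * h)) ^ DIM('a)" and "q \<equiv> B * C0 * 2 ^ DIM('a)"
  and "I \<equiv> (%x. (gridc 0 h x, gridc 0 h' x)) ` cball 0 A"
  and "e \<equiv> %i. ind (cball 0 A \<inter> hcube (fst i) h \<inter> hcube (snd i) h')"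
 shows "EX z. (\<forall>i\<in>I. norm (z i) <= 2 * B * (C0 / (2 * (real DIM('a) * h)) ^ DIM('a)) * CA) \<and>
   (%x. commutator phi T f x - (\<Sum>i\<in>I. z i * e i x)) \<in> X \<and>
   N (%x. commutator phi T f x - (\<Sum>i\<in>I. z i * e i x)) <= L + kappa * CA * N (ind (cball 0 A))
    + q * 4 ^ DIM('a) * N' (restr (- cball 0 A) (mm unit_bump)) * N (ind (cball 0 R))
    + q * 4 ^ DIM('a) * CR * N (restr (- cball 0 A) (mm unit_bump))"
proof -
let ?d = "DIM('a)" and ?w = "restr (- cball 0 A) (mm unit_bump) :: 'a => complex"
note [measurable] = phi(1) Linf_c_measurable[OF f(1)]
have fX: "f \<in> X" by (rule Linf_c_in_X[OF f(1)])
have I: "finite I" unfolding I_def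
 by (rule finite_subset[of _ "gridc 0 h ` cball 0 A \<times> gridc 0 h' ` cball 0 A"]) (auto intro!: finite_gridc h)
have B0: "0 <= B" using phi(2)[of 0] norm_ge_zero order_trans by blast
have q0: "0 <= q" and kappa0: "0 <= kappa" using B0 C0 eta h by (simp_all add: q_def kappa_def)
define z where "z i = (LI y. (phi (snd i) - phi y) * K (snd i) y * restr (cball 0 A - hat (fst i) h) f y)" for i
have mA: "mass f (cball 0 A) <= ennreal CA"
 by (rule order_trans[OF CA(2)[OF fX] ennreal_leI]) (use mult_left_mono[OF f(2) CA(1)] in simp)
have mR: "mass f (cball 0 R) <= ennreal CR"
 by (rule order_trans[OF CR(2)[OF fX] ennreal_leI]) (use mult_left_mono[OF f(2) CR(1)] in simp)
have zb: "norm (z i) <= 2 * B * (C0 / (2 * (real ?d * h)) ^ ?d) * CA" if i: "i \<in> I" for i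
proof -
 obtain x where x: "norm x <= A" "i = (gridc 0 h x, gridc 0 h' x)" using i by (auto simp: I_def)
 let ?c = "2 * B * (C0 / (2 * (real ?d * h)) ^ ?d)"
 have c0: "0 <= ?c" using B0 C0 h by simp
 have "enorm (z i) <= ennreal ?c * mass f (cball 0 A)"
  unfolding z_def x(2) fst_conv snd_conv
  by (rule off_diagonal_kernel_bound(2)[OF f(1) h C0(1) _ phi(1) phi(2) _ _ _ eta A(1,2) mem_own_cell[OF h(1)] mem_own_cell[OF h(2)] x(1)])
   (rule C0(2) phi(3) mod omega; assumption)+
 also have "... <= ennreal ?c * ennreal CA" by (rule mult_left_mono[OF mA]) simp
 finally have "enorm (z i) <= ennreal (?c * CA)" using c0 CA(1) by (simp only: ennreal_mult)
 then show ?thesis using mult_nonneg_nonneg[OF c0 CA(1)] by (simp only: ennreal_le_iff)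
qed
have sumz: "(\<Sum>i\<in>I. z i * e i x) = (if norm x <= A then z (gridc 0 h x, gridc 0 h' x) else 0)" for x
proof -
 have "z i * e i x = (if (gridc 0 h x, gridc 0 h' x) = i then (if norm x <= A then z i else 0) else 0)" if i: "i \<in> I" for i
 proof -
  obtain y where y: "i = (gridc 0 h y, gridc 0 h' y)" using i by (auto simp: I_def)
  show ?thesis unfolding e_def y using mem_cell_iff[OF h(1), of x 0 y] mem_cell_iff[OF h(2), of x 0 y] by (auto simp: indicator_def)
 qed
 then have "(\<Sum>i\<in>I. z i * e i x) = (\<Sum>i\<in>I. if (gridc 0 h x, gridc 0 h' x) = i then (if norm x <= A then z i else 0) else 0)"
  by (rule sum.cong[OF refl])
 also have "... = (if norm x <= A then z (gridc 0 h x, gridc 0 h' x) else 0)" using I by (auto simp: I_def)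
 finally show ?thesis .
qed
have eX: "e i \<in> X" for i
proof -
 have "bounded (cball 0 A \<inter> hcube (fst i) h \<inter> hcube (snd i) h')" by (rule bounded_subset[OF bounded_cball[of 0 A]]) auto
 then show ?thesis using Linf_c_in_X[OF Linf_c_indicator[of "cball 0 A \<inter> hcube (fst i) h \<inter> hcube (snd i) h'" 1]] by (simp add: e_def)
qed
let ?S = "%x. \<Sum>i\<in>I. z i * e i x"
have SX: "?S \<in> X" using X_sum[OF I, of "%i x. z i * e i x"] X_cmult[OF eX] by blast
note [measurable] = X_measurable[OF SX]
have Cm[measurable]: "commutator phi T f \<in> Lmeas"
 by (intro commutator_measurable Linf_c_subset_L2 f(1) Linf_c_mult[OF f(1) phi(1,2)] phi(1))
have [measurable]: "- cball (0::'a) A \<in> sets lebesgue" by (simp add: Compl_in_sets_lebesgue cball_lebesgue)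
have wX': "?w \<in> X'" by (rule assoc_ideal(1)[OF W, of _ 1]) (auto simp: restr_def)
have wX: "?w \<in> X" by (intro X_restr mm_bound Linf_c_in_X unit_bump_Linf_c) measurable
define tau where "tau = 4 ^ ?d * N' ?w"
have tau0: "0 <= tau" by (simp add: tau_def assoc_nonneg)
have wle: "1 / norm y ^ ?d <= 4 ^ ?d * norm (?w y)" if "norm y > A" for y
 using inverse_power_le_maximal[of y] that A by (simp add: restr_def)
have tail: "(LN y\<in>- cball 0 A. ennreal (norm (f y) / norm y ^ ?d)) <= ennreal tau"
proof -
 have "(LN y\<in>- cball 0 A. ennreal (norm (f y) / norm y ^ ?d)) <= (LN y. ennreal (4 ^ ?d) * enorm (f y * ?w y))"
 proof (intro nn_integral_mono)
  fix y :: 'a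
  show "ennreal (norm (f y) / norm y ^ ?d) * ind (- cball 0 A) y <= ennreal (4 ^ ?d) * enorm (f y * ?w y)"
   using mult_left_mono[OF wle[of y] norm_ge_zero[of "f y"]]
   by (auto simp: indicator_def ennreal_mult[symmetric] norm_mult mult_ac intro!: ennreal_leI)
 qed
 also have "... = ennreal (4 ^ ?d) * (LN y. enorm (f y * ?w y))" by (rule nn_integral_cmult) (use assoc_measurable[OF wX'] in measurable)
 also have "... <= ennreal (4 ^ ?d) * ennreal (N f * N' ?w)" by (intro mult_left_mono hoelder fX wX') simp
 also have "... = ennreal (4 ^ ?d * (N f * N' ?w))" using N_nonneg[OF fX] assoc_nonneg[of ?w] by (intro ennreal_mult[symmetric]) auto
 also have "... <= ennreal tau" unfolding tau_def using mult_right_mono[OF f(2) assoc_nonneg[of ?w]] by (intro ennreal_leI mult_left_mono) auto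
 finally show ?thesis .
qed
define E :: "'a => complex" where "E x = of_real (kappa * CA) * ind (cball 0 A) x + of_real (q * tau) * ind (cball 0 R) x + of_real (q * 4 ^ ?d * CR) * of_real (norm (?w x))" for x
have EX: "E \<in> X" unfolding E_def[abs_def] by (intro X_add X_cmult ball_in_X X_norm wX)
have EN: "N E <= kappa * CA * N (ind (cball 0 A)) + q * tau * N (ind (cball 0 R)) + q * 4 ^ ?d * CR * N ?w"
proof -
 have "N E <= N (%x. of_real (kappa * CA) * ind (cball 0 A) x) + N (%x. of_real (q * tau) * ind (cball 0 R) x) + N (%x. of_real (q * 4 ^ ?d * CR) * of_real (norm (?w x)))"
  unfolding E_def[abs_def] by (intro order_trans[OF N_add] add_mono X_add X_cmult ball_in_X X_norm wX N_add order_refl)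
 also have "... = kappa * CA * N (ind (cball 0 A)) + q * tau * N (ind (cball 0 R)) + q * 4 ^ ?d * CR * N ?w"
  using N_cmult[OF ball_in_X[of A], of "of_real (kappa * CA)"] N_cmult[OF ball_in_X[of R], of "of_real (q * tau)"] N_cmult[OF X_norm(1)[OF wX], of "of_real (q * 4 ^ ?d * CR)"] X_norm(2)[OF wX] kappa0 q0 tau0 CA(1) CR(1)
  by (simp add: norm_mult norm_power)
 finally show ?thesis .
qed
have Enorm: "norm (E x) = kappa * CA * ind (cball 0 A) x + q * tau * ind (cball 0 R) x + q * 4 ^ ?d * CR * norm (?w x)" for x
proof -
 have "E x = of_real (kappa * CA * ind (cball 0 A) x + q * tau * ind (cball 0 R) x + q * 4 ^ ?d * CR * norm (?w x))"
  by (simp add: E_def indicator_def)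
 moreover have "0 <= kappa * CA * ind (cball 0 A) x + q * tau * ind (cball 0 R) x + q * 4 ^ ?d * CR * norm (?w x)"
  using kappa0 q0 tau0 CA(1) CR(1) by (intro add_nonneg_nonneg mult_nonneg_nonneg) auto
 ultimately show ?thesis by (simp only: norm_of_real abs_of_nonneg)
qed
have off: "norm ((LI y. (phi x - phi y) * K x y * restr (- hat c h) f y) - ?S x) <= norm (E x)" if x: "x \<in> hcube c h" and c: "c \<in> range (gridc 0 h)" for x c
proof -
 obtain y where "c = gridc 0 h y" using c by blast
 then have cx: "c = gridc 0 h x" using x mem_cell_iff[OF h(1), of x 0 y] by simp
 have zx: "z (gridc 0 h x, gridc 0 h' x) = (LI y. (phi (gridc 0 h' x) - phi y) * K (gridc 0 h' x) y * restr (cball 0 A - hat (gridc 0 h x) h) f y)"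
  by (simp add: z_def)
 let ?J = "(LI y. (phi x - phi y) * K x y * restr (- hat c h) f y) - ?S x"
 have "ennreal (norm ?J) <= ennreal kappa * mass f (cball 0 A) * ind (cball 0 A) x
   + ennreal q * (LN y\<in>- cball 0 A. ennreal (norm (f y) / norm y ^ ?d)) * ind (cball 0 R) x
   + ennreal (q / norm x ^ ?d) * mass f (cball 0 R) * ind (- cball 0 A) x"
  unfolding sumz zx cx kappa_def q_def
  by (rule off_diagonal_kernel_bound(1)[OF f(1) h C0(1) _ phi(1) phi(2) _ _ _ eta A(1,2) _ mem_own_cell[OF h(2)]])
   (rule C0(2) phi(3) mod omega mem_own_cell[OF h(1)]; assumption?)+
 also have "... <= ennreal kappa * ennreal CA * ind (cball 0 A) x + ennreal q * ennreal tau * ind (cball 0 R) x + ennreal (q * 4 ^ ?d * norm (?w x)) * ennreal CR"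
 proof (intro add_mono mult_right_mono mult_left_mono mA tail)
  show "ennreal (q / norm x ^ ?d) * mass f (cball 0 R) * ind (- cball 0 A) x <= ennreal (q * 4 ^ ?d * norm (?w x)) * ennreal CR"
  proof (cases "norm x <= A")
   case False
   then show ?thesis using mult_left_mono[OF wle[of x] q0] mR by (auto intro!: mult_mono ennreal_leI simp: mult.assoc)
  qed simp
 qed auto
 also have "... = enorm (E x)"
  unfolding Enorm using kappa0 q0 tau0 CA(1) CR(1) by (simp add: ennreal_mult'' ennreal_mult ennreal_plus mult_ac indicator_def)
 finally show ?thesis by (simp add: ennreal_le_iff)
qed
let ?h = "%x. commutator phi T f x - ?S x"
have EN0: "0 <= N E" by (rule N_nonneg[OF EX])
have dual: "(LN x. enorm (?h x * g x)) <= ennreal ((L + N E) * N' g)" if g: "g \<in> Linf_c" for g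
proof -
 note [measurable] = Linf_c_measurable[OF g] X_measurable[OF EX]
 let ?G = "gridc 0 h ` {x. g x ~= 0}"
 have G: "finite ?G" "?G \<subseteq> range (gridc 0 h)" using finite_gridc[OF h(1)] g by (auto simp: Linf_c_def)
 have cell: "(LN x\<in>hcube c h. enorm (?h x * g x)) <=
   (LN x\<in>hcube c h. enorm (commutator phi T (restr (hat c h) f) x * g x)) + (LN x\<in>hcube c h. enorm (E x * g x))"
  if c: "c \<in> ?G" for c
 proof -
  have RL: "restr (hat c h) f \<in> Linf_c" by (intro Linf_c_restr f(1)) simp
  have [measurable]: "commutator phi T (restr (hat c h) f) \<in> Lmeas"
   by (intro commutator_measurable Linf_c_subset_L2 RL Linf_c_mult[OF RL phi(1,2)] phi(1))
  have "AE x. enorm (?h x * g x) * ind (hcube c h) x <=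
    enorm (commutator phi T (restr (hat c h) f) x * g x) * ind (hcube c h) x + enorm (E x * g x) * ind (hcube c h) x"
   using commutator_off_diagonal[OF f(1) h(1) phi(1,2), of c]
  proof eventually_elim
   case (elim x)
   show ?case
   proof (cases "x \<in> hcube c h")
    case True
    have e1: "commutator phi T f x = commutator phi T (restr (hat c h) f) x + (LI y. (phi x - phi y) * K x y * restr (- hat c h) f y)"
     using elim True by blast
    have "norm (?h x) <= norm (commutator phi T (restr (hat c h) f) x) + norm (E x)"
     using off[OF True subsetD[OF G(2) c]] norm_triangle_ineq[of "commutator phi T (restr (hat c h) f) x" "(LI y. (phi x - phi y) * K x y * restr (- hat c h) f y) - ?S x"]
     unfolding e1 by (simp add: add_diff_eq)
    then have "norm (?h x * g x) <= norm (commutator phi T (restr (hat c h) f) x * g x) + norm (E x * g x)"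
     unfolding norm_mult distrib_right[symmetric] by (rule mult_right_mono) simp
    then show ?thesis using True by (simp add: ennreal_leI flip: ennreal_plus)
   qed simp
  qed
  then have "(LN x\<in>hcube c h. enorm (?h x * g x)) <= (LN x. enorm (commutator phi T (restr (hat c h) f) x * g x) * ind (hcube c h) x + enorm (E x * g x) * ind (hcube c h) x)"
   by (rule nn_integral_mono_AE)
  then show ?thesis by (subst (asm) nn_integral_add) auto
 qed
 have "(LN x. enorm (?h x * g x)) = (LN x. (if gridc 0 h x \<in> ?G then enorm (?h x * g x) else 0))"
  by (intro nn_integral_cong) auto
 also have "... = (\<Sum>c\<in>?G. LN x\<in>hcube c h. enorm (?h x * g x))"
  by (rule nn_integral_cells[OF h(1) G, symmetric]) measurable
 also have "... <= (\<Sum>c\<in>?G. LN x\<in>hcube c h. enorm (commutator phi T (restr (hat c h) f) x * g x)) + (\<Sum>c\<in>?G. LN x\<in>hcube c h. enorm (E x * g x))"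
  unfolding sum.distrib[symmetric] by (rule sum_mono[OF cell])
 also have "(\<Sum>c\<in>?G. LN x\<in>hcube c h. enorm (E x * g x)) = (LN x. (if gridc 0 h x \<in> ?G then enorm (E x * g x) else 0))"
  by (rule nn_integral_cells[OF h(1) G]) measurable
 also have "... <= (LN x. enorm (E x * g x))" by (intro nn_integral_mono) auto
 also have "... <= ennreal (N E * N' g)" by (rule hoelder[OF EX Linf_c_in_assoc[OF g]])
 also note loc[OF g]
 also have "ennreal (L * N' g) + ennreal (N E * N' g) = ennreal ((L + N E) * N' g)"
  using L EN0 assoc_nonneg[of g] by (simp add: distrib_right)
 finally show ?thesis by (simp add: add_mono)
qed
have hm: "?h \<in> Lmeas" by measurable
have "0 <= L + N E" using L EN0 by simp
note dd = X_duality[OF hm this dual]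
have "N ?h <= L + kappa * CA * N (ind (cball 0 A)) + q * 4 ^ ?d * N' ?w * N (ind (cball 0 R)) + q * 4 ^ ?d * CR * N ?w"
 using dd(2) EN by (simp add: tau_def mult.assoc)
then show ?thesis using zb dd(1) by (intro exI[of _ z]) blast
qed

end

lemma compact_support_modulus:
 fixes phi :: "'a::euclidean_space => complex"
 assumes cont: "continuous_on UNIV phi" and R: "!!x. phi x ~= 0 ==> norm x <= R" and eta: "0 < eta"
 obtains delta where "0 < delta" "!!u v. norm (u - v) < delta ==> norm (phi u - phi v) <= eta"
proof -
have "uniformly_continuous_on (cball 0 (R + 1)) phi"
 by (rule compact_uniformly_continuous[OF continuous_on_subset[OF cont]]) auto
then have "\<exists>d>0. \<forall>v\<in>cball 0 (R + 1). \<forall>u\<in>cball 0 (R + 1). dist u v < d --> dist (phi u) (phi v) < eta"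
 using eta by (simp only: uniformly_continuous_on_def)
then obtain d where d: "0 < d" "\<forall>v\<in>cball 0 (R + 1). \<forall>u\<in>cball 0 (R + 1). dist u v < d --> dist (phi u) (phi v) < eta"
 by blast
have "norm (phi u - phi v) <= eta" if uv: "norm (u - v) < min d 1" for u v
proof (cases "phi u = 0 \<and> phi v = 0")
 case False
 then have "norm u <= R \<or> norm v <= R" using R by blast
 then have "norm u <= R + 1" "norm v <= R + 1"
  using uv norm_triangle_ineq2[of u v] norm_triangle_ineq2[of v u] by (auto simp: norm_minus_commute)
 then have "dist (phi u) (phi v) < eta" using uv by (intro d(2)[rule_format]) (auto simp: dist_norm)
 then show ?thesis by (simp add: dist_norm)
qed (use eta in simp)
then show ?thesis using that[of "min d 1"] d(1) by simp
qed

lemma small_multiple: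
 fixes c eps :: real
 assumes "0 <= c" "0 < eps"
 shows "\<exists>t>0. \<forall>u\<le>t. c * u <= eps"
proof (intro exI[of _ "eps / (c + 1)"] conjI allI impI)
show "0 < eps / (c + 1)" using assms by simp
fix u assume "u <= eps / (c + 1)"
then have "c * u <= c * (eps / (c + 1))" using assms(1) by (rule mult_left_mono)
also have "... <= eps" using assms by (simp add: field_simps)
finally show "c * u <= eps" .
qed

context commutator_on_function_space
begin

lemma continuous_symbol_net:
 assumes conv: "r_convex r X N" "1 < r" and conc: "s_concave s X N" "0 < s"
  and cont: "continuous_on UNIV phi" and R: "0 < R" "!!x. phi x ~= 0 ==> norm x <= R" and eps: "0 < eps"
 shows "EX S. finite S \<and> S \<subseteq> X \<and>
  (\<forall>f\<in>Linf_c. N f <= 1 --> commutator phi T f \<in> X \<and> (\<exists>s\<in>S. N (%x. commutator phi T f x - s x) <= eps))"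
proof -
let ?d = "DIM('a)" and ?W = "mm unit_bump :: 'a => complex" and ?m = "4 ^ DIM('a) :: real"
have phim: "phi \<in> Lmeas"
 by (rule measurable_completion) (use cont in \<open>simp add: borel_measurable_continuous_onI\<close>)
have "compact (phi ` cball 0 R)" by (intro compact_continuous_image continuous_on_subset[OF cont]) auto
then obtain B where B: "0 < B" "!!x. x \<in> cball 0 R ==> norm (phi x) <= B"
 using compact_imp_bounded[of "phi ` cball 0 R"] unfolding bounded_pos by blast
have phiB: "norm (phi x) <= B" for x using B R(2)[of x] by (cases "phi x = 0") auto
obtain C1 where C1: "0 < C1" and loc: "local_bound C1" using local_part_bound by blast
note loc = loc[unfolded local_bound_def]
obtain C0 where C0: "0 <= C0" "!!x y. x ~= y ==> norm (K x y) <= C0 / norm (x - y) ^ ?d" using kernel_size by blast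
obtain CR where CR: "0 <= CR" "!!f. f \<in> X ==> mass f (cball 0 R) <= ennreal (CR * N f)" using X_ball_bound[OF R(1)] by blast
define q where "q = B * C0 * 2 ^ ?d"
have q0: "0 <= q" using B C0 by (simp add: q_def)
have N1: "0 <= N (ind (cball 0 t))" for t by (rule N_nonneg[OF ball_in_X])
have eps8: "0 < eps / 8" using eps by simp
\<comment> \<open>The coarse side \<open>h\<close> makes the local part small.\<close>
obtain eta1 where eta1: "0 < eta1" "C1 * eta1 <= eps / 8" using small_multiple[OF less_imp_le[OF C1] eps8] by blast
obtain delta1 where delta1: "0 < delta1" "!!u v. norm (u - v) < delta1 ==> norm (phi u - phi v) <= eta1"
 using compact_support_modulus[OF cont R(2) eta1(1)] by blast
have pd: "0 < real ?d * (8 * real ?d + 1)" by simp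
have "0 < delta1 / 2" using delta1(1) by simp
then obtain h where h: "0 < h" "real ?d * (8 * real ?d + 1) * h <= delta1 / 2"
 using small_multiple[OF less_imp_le[OF pd]] by blast
have mod1: "norm (phi u - phi v) <= eta1" if "norm (u - v) <= real ?d * hatr TYPE('a) h" for u v
proof -
 have "real ?d * hatr TYPE('a) h <= delta1 / 2" using h(2) by (simp add: hatr_def mult.assoc)
 then show ?thesis using that delta1(1) by (intro delta1(2)) linarith
qed
\<comment> \<open>The radius \<open>A\<close> is chosen before the fine grid: the tail terms do not involve \<open>h\<close>.\<close>
have WX: "?W \<in> X" by (intro mm_bound Linf_c_in_X unit_bump_Linf_c)
have WX': "?W \<in> X'" using M'_bound Linf_c_in_assoc[OF unit_bump_Linf_c] by blast
define E where "E n = - cball (0::'a) (real n)" for n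
have Em[measurable]: "E n \<in> sets lebesgue" for n by (simp add: E_def Compl_in_sets_lebesgue cball_lebesgue)
have Ed: "E (Suc n) \<subseteq> E n" for n by (auto simp: E_def)
have Ev: "AE x. EX n. x ~: E n" by (auto simp: E_def intro: real_arch_simple)
have m0: "0 <= q * ?m * N (ind (cball 0 R))" "0 <= q * ?m * CR" using q0 N1[of R] CR(1) by simp_all
obtain tau where tau: "0 < tau" "!!u. u <= tau ==> q * ?m * N (ind (cball 0 R)) * u <= eps / 8"
 using small_multiple[OF m0(1) eps8] by blast
obtain sig where sig: "0 < sig" "!!u. u <= sig ==> q * ?m * CR * u <= eps / 8"
 using small_multiple[OF m0(2) eps8] by blast
obtain n1 where n1: "N' (restr (E n1) ?W) < tau" using assoc_tail[OF conv WX' Em Ed Ev tau(1)] by blast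
have "(%n. N (restr (E n) ?W)) ---> 0" by (rule X_order_continuous[OF conc WX Em Ed Ev])
then obtain n2 where n2: "!!n. n2 <= n ==> N (restr (E n) ?W) < sig"
 using order_tendstoD(2)[of "%n. N (restr (E n) ?W)" 0 sequentially sig] sig(1) unfolding eventually_sequentially by blast
define n where "n = max n1 (max n2 (nat \<lceil>max 1 (2 * R)\<rceil>))"
define A where "A = real n"
have "max 1 (2 * R) <= real (nat \<lceil>max 1 (2 * R)\<rceil>)" by (rule real_nat_ceiling_ge)
also have "... <= A" by (simp add: A_def n_def)
finally have A: "2 * R <= A" "1 <= A" by auto
have EA: "E n = - cball 0 A" by (simp add: E_def A_def)
have t1: "N' (restr (- cball 0 A) ?W) <= tau"
proof -
 have "restr (E n1) ?W \<in> X'" by (rule assoc_ideal(1)[OF WX', of _ 1]) (auto simp: restr_def)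
 moreover have "E n \<subseteq> E n1" unfolding E_def n_def by (intro Compl_anti_mono subset_cball) simp
 ultimately have "N' (restr (E n) ?W) <= 1 * N' (restr (E n1) ?W)"
  by (intro assoc_ideal(2)) (auto simp: restr_def)
 then show ?thesis using n1 by (simp add: EA)
qed
have t2: "N (restr (- cball 0 A) ?W) <= sig"
proof -
 have "n2 <= n" by (simp add: n_def)
 from n2[OF this] show ?thesis unfolding EA by simp
qed
obtain CA where CA: "0 <= CA" "!!f. f \<in> X ==> mass f (cball 0 A) <= ennreal (CA * N f)" using X_ball_bound[OF less_le_trans[OF zero_less_one A(2)]] by blast
\<comment> \<open>The fine side \<open>h'\<close> comes last, as the error from moving \<open>x\<close> grows with \<open>1 / h\<close> and \<open>A\<close>.\<close>
let ?k = "(C0 + 2 * B) / (4 * (real ?d * h)) ^ ?d * CA * N (ind (cball 0 A))"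
have k0: "0 <= ?k" using C0(1) B(1) h(1) CA(1) N1[of A] by (intro mult_nonneg_nonneg divide_nonneg_nonneg zero_le_power) auto
obtain eta2 where eta2: "0 < eta2" "?k * eta2 <= eps / 8" using small_multiple[OF k0 eps8] by blast
obtain theta where theta: "0 < theta" "!!t. 0 <= t ==> t <= theta ==> omega t < eta2" by (rule om_small[OF eta2(1)]) (rule that)
obtain delta2 where delta2: "0 < delta2" "!!u v. norm (u - v) < delta2 ==> norm (phi u - phi v) <= eta2"
 using compact_support_modulus[OF cont R(2) eta2(1)] by blast
have "0 < delta2 / 2" using delta2(1) by simp
then obtain h0 where h0: "0 < h0" "!!u. u <= h0 ==> real ?d * u <= delta2 / 2"
 using small_multiple[OF of_nat_0_le_iff[of ?d]] by blast
define h' where "h' = min h0 (min h (4 * h * theta))"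
have h': "0 < h'" "h' <= h" "h' <= 4 * h * theta" "h' <= h0" using h0 h theta(1) by (auto simp: h'_def)
have mod2: "norm (phi u - phi v) <= eta2" if "norm (u - v) <= real ?d * h'" for u v
 using that h0(2)[OF h'(4)] delta2(1) by (intro delta2(2)) linarith
define I where "I = (%x. (gridc (0::'a) h x, gridc (0::'a) h' x)) ` cball 0 A"
define e :: "'a \<times> 'a => 'a => complex" where "e i = ind (cball 0 A \<inter> hcube (fst i) h \<inter> hcube (snd i) h')" for i
let ?Z = "2 * B * (C0 / (2 * (real ?d * h)) ^ ?d) * CA"
have fin: "EX z. (\<forall>i\<in>I. norm (z i) <= ?Z) \<and> (%x. commutator phi T f x - (\<Sum>i\<in>I. z i * e i x)) \<in> X \<and>
  N (%x. commutator phi T f x - (\<Sum>i\<in>I. z i * e i x)) <= eps / 2" if f: "f \<in> Linf_c" "N f <= 1" for f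
proof -
 have fX: "f \<in> X" by (rule Linf_c_in_X[OF f(1)])
 have L: "(\<Sum>c\<in>gridc 0 h ` {x. g x ~= 0}. LN x\<in>hcube c h. enorm (commutator phi T (restr (hat c h) f) x * g x))
   <= ennreal (C1 * eta1 * N' g)" if g: "g \<in> Linf_c" for g
 proof -
  have a: "C1 * eta1 * N f * N' g <= C1 * eta1 * 1 * N' g" using C1 eta1 f(2) by (intro mult_right_mono mult_left_mono assoc_nonneg) auto
  have b: "(\<Sum>c\<in>gridc 0 h ` {x. g x ~= 0}. LN x\<in>hcube c h. enorm (commutator phi T (restr (hat c h) f) x * g x))
    <= ennreal (C1 * eta1 * N f * N' g)" by (rule loc[rule_format, OF phim phiB h(1) eta1(1) _ f(1) g]) (rule mod1)
  show ?thesis using order_trans[OF b ennreal_leI[OF a]] by (simp only: mult_1_right)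
 qed
 have L0: "0 <= C1 * eta1" using C1 eta1 by simp
 have "EX z. (\<forall>i\<in>I. norm (z i) <= ?Z) \<and> (%x. commutator phi T f x - (\<Sum>i\<in>I. z i * e i x)) \<in> X \<and>
   N (%x. commutator phi T f x - (\<Sum>i\<in>I. z i * e i x)) <= C1 * eta1 + (eta2 * C0 + 2 * B * eta2) / (4 * (real ?d * h)) ^ ?d * CA * N (ind (cball 0 A))
    + B * C0 * 2 ^ ?d * ?m * N' (restr (- cball 0 A) ?W) * N (ind (cball 0 R)) + B * C0 * 2 ^ ?d * ?m * CR * N (restr (- cball 0 A) ?W)"
  unfolding I_def e_def
  by (rule finite_rank_error[OF f h(1) h'(1,2,3) C0(1) _ phim phiB _ _ _ eta2(1) R(1) A CA(1) _ CR(1) _ _ L0 WX'])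
   (rule C0(2) R(2) mod2 theta(2) CA(2) CR(2) L; assumption)+
 moreover have "(eta2 * C0 + 2 * B * eta2) / (4 * (real ?d * h)) ^ ?d * CA * N (ind (cball 0 A)) <= eps / 8"
  using eta2(2) by (simp add: algebra_simps add_divide_distrib)
 moreover have "B * C0 * 2 ^ ?d * ?m * N' (restr (- cball 0 A) ?W) * N (ind (cball 0 R)) <= eps / 8"
  using tau(2)[OF t1] by (simp add: q_def mult_ac)
 moreover have "B * C0 * 2 ^ ?d * ?m * CR * N (restr (- cball 0 A) ?W) <= eps / 8"
  using sig(2)[OF t2] by (simp add: q_def mult_ac)
 ultimately show ?thesis using eta1(2) by (elim ex_forward conj_forward) linarith+
qed
have I: "finite I" unfolding I_def
 by (rule finite_subset[of _ "gridc 0 h ` cball 0 A \<times> gridc 0 h' ` cball 0 A"]) (auto intro!: finite_gridc h h')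
have eX: "e i \<in> X" for i
proof -
 have "bounded (cball 0 A \<inter> hcube (fst i) h \<inter> hcube (snd i) h')" by (rule bounded_subset[OF bounded_cball[of 0 A]]) auto
 then show ?thesis using Linf_c_in_X[OF Linf_c_indicator[of "cball 0 A \<inter> hcube (fst i) h \<inter> hcube (snd i) h'" 1]] by (simp add: e_def)
qed
have eps2: "0 < eps / 2" using eps by simp
obtain S where SS: "finite S \<and> S \<subseteq> X \<and> (ALL z. (\<forall>i\<in>I. norm (z i) <= ?Z) --> (\<exists>s\<in>S. N (%x. (\<Sum>i\<in>I. z i * e i x) - s x) <= eps / 2))"
 using finite_rank_net[of I e, OF I eX eps2, of ?Z] by (elim exE) (rule that)
note S = SS[THEN conjunct1] SS[THEN conjunct2, THEN conjunct1] SS[THEN conjunct2, THEN conjunct2, THEN spec, THEN mp]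
have "commutator phi T f \<in> X \<and> (\<exists>s\<in>S. N (%x. commutator phi T f x - s x) <= eps)" if f: "f \<in> Linf_c" "N f <= 1" for f
proof -
 obtain z where z: "\<forall>i\<in>I. norm (z i) <= ?Z" "(%x. commutator phi T f x - (\<Sum>i\<in>I. z i * e i x)) \<in> X"
  "N (%x. commutator phi T f x - (\<Sum>i\<in>I. z i * e i x)) <= eps / 2" using fin[OF f] by blast
 have zX: "(%x. \<Sum>i\<in>I. z i * e i x) \<in> X" using X_sum[OF I, of "%i x. z i * e i x"] X_cmult[OF eX] by blast
 have cX: "commutator phi T f \<in> X" using X_add[OF z(2) zX] by simp
 obtain s where s: "s \<in> S" "N (%x. (\<Sum>i\<in>I. z i * e i x) - s x) <= eps / 2" using S(3)[OF z(1)] by blast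
 have "N (%x. commutator phi T f x - s x) <= eps"
  using N_triangle[OF cX zX subsetD[OF S(2) s(1)]] z(3) s(2) by linarith
 then show ?thesis using cX s(1) by blast
qed
then show ?thesis using S(1,2) by blast
qed

end

context function_space
begin

section \<open>Completeness, compactness and extension by density\<close>

lemma N_cong:
 assumes "f \<in> X" "g \<in> X" "AE x. g x = f x"
 shows "N g = N f"
 using X_cong(2)[OF assms(1) X_measurable[OF assms(2)] assms(3)] .

lemma N_diff_cong:
 assumes "f \<in> X" "f' \<in> X" "g \<in> X" "AE x. f' x = f x"
 shows "N (%x. f' x - g x) = N (%x. f x - g x)"
 by (rule N_cong[OF X_diff(1)[OF assms(1,3)] X_diff(1)[OF assms(2,3)]]) (use assms(4) in eventually_elim, simp)

lemma AE_eq_if_N_small: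
 assumes fg: "f \<in> X" "g \<in> X" and le: "!!eps. 0 < eps ==> N (%x. f x - g x) <= c * eps"
 shows "AE x. f x = g x"
proof -
have X: "(%x. f x - g x) \<in> X" by (rule X_diff(1)[OF fg])
have "N (%x. f x - g x) <= 0 + eps" if "0 < eps" for eps
proof -
 have "N (%x. f x - g x) <= c * (eps / (\<bar>c\<bar> + 1))" using that by (intro le) simp
 also have "... <= \<bar>c\<bar> * (eps / (\<bar>c\<bar> + 1))" using that by (intro mult_right_mono) auto
 also have "... <= eps" using that by (simp add: field_simps)
 finally show ?thesis by simp
qed
then have "N (%x. f x - g x) <= 0" by (rule field_le_epsilon)
then have "N (%x. f x - g x) = 0" using N_nonneg[OF X] by simp
then show ?thesis using N_eq_0[OF X] by simp
qed

lemma topspace_norm_topology: "topspace (norm_topology X N) = X"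
proof -
have "openin (norm_topology X N) X" unfolding openin_norm_topology by (auto intro: exI[of _ 1])
then show ?thesis
 using openin_subset[of "norm_topology X N" X] openin_topspace[of "norm_topology X N"] unfolding openin_norm_topology by blast
qed

lemma norm_open_ball:
 "openin (norm_topology X N) U ==> f \<in> U ==> \<exists>e>0. \<forall>g\<in>X. N (%x. g x - f x) < e --> g \<in> U"
 by (simp add: openin_norm_topology)

lemma norm_topology_closure_of:
 assumes A: "A \<subseteq> X"
 shows "norm_topology X N closure_of A = {f \<in> X. \<forall>eps>0. \<exists>a\<in>A. N (%x. f x - a x) < eps}" (is "_ = ?C")
proof (intro set_eqI iffI)
fix f assume f: "f \<in> norm_topology X N closure_of A"
then have fX: "f \<in> X" using closure_of_subset_topspace[of "norm_topology X N" A] topspace_norm_topology by blast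
have "\<exists>a\<in>A. N (%x. f x - a x) < eps" if eps: "0 < eps" for eps
proof -
 let ?V = "{g \<in> X. N (%x. g x - f x) < eps}"
 have op: "openin (norm_topology X N) ?V" unfolding openin_norm_topology
 proof (intro conjI ballI)
  fix g assume g: "g \<in> ?V"
  then have "h \<in> ?V" if "h \<in> X" "N (%x. h x - g x) < eps - N (%x. g x - f x)" for h
   using N_triangle[of h g f] that fX by auto
  then show "\<exists>e>0. \<forall>h\<in>X. N (%x. h x - g x) < e --> h \<in> ?V"
   using g by (intro exI[of _ "eps - N (%x. g x - f x)"]) auto
 qed auto
 have "N (%x. f x - f x) = 0" using N_eq_0[OF X_zero] by simp
 then have fV: "f \<in> ?V" using fX eps by simp
 obtain a where a: "a \<in> A" "a \<in> ?V"
  using f[unfolded in_closure_of, THEN conjunct2, THEN spec, of ?V, THEN mp, OF conjI[OF fV op]] by (elim exE conjE) (rule that)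
 then show ?thesis using N_diff_commute[OF fX, of a] by (intro bexI[of _ a]) auto
qed
then show "f \<in> ?C" using fX by blast
next
fix f assume f: "f \<in> ?C"
then have fX: "f \<in> X" by blast
have "\<exists>a\<in>A. a \<in> V" if V: "f \<in> V" "openin (norm_topology X N) V" for V
proof -
 obtain e where e: "0 < e" "\<forall>g\<in>X. N (%x. g x - f x) < e --> g \<in> V" using norm_open_ball[OF V(2,1)] by blast
 obtain a where a: "a \<in> A" "N (%x. f x - a x) < e" using f e(1) by blast
 then have "a \<in> V" using A N_diff_commute[OF fX, of a] by (intro e(2)[rule_format]) auto
 then show ?thesis using a(1) by blast
qed
then show "f \<in> norm_topology X N closure_of A" using fX by (auto simp: in_closure_of topspace_norm_topology)
qed

text \<open>
 A representative of the class of \<open>f\<close> modulo equality almost everywhere. On the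
 representatives the norm is a genuine metric, so results on metric spaces apply.
\<close>

definition canon :: "('a => complex) => 'a => complex" where
 "canon f = (SOME g. g \<in> X \<and> (AE x. g x = f x))"

lemma canon:
 assumes "f \<in> X"
 shows "canon f \<in> X" "AE x. canon f x = f x"
proof -
have "canon f \<in> X \<and> (AE x. canon f x = f x)"
 unfolding canon_def by (rule someI[of _ f]) (use assms in simp)
then show "canon f \<in> X" "AE x. canon f x = f x" by auto
qed

lemma canon_eq:
 assumes "AE x. f x = g x"
 shows "canon f = canon g"
proof -
have "(AE x. h x = f x) \<longleftrightarrow> (AE x. h x = g x)" for h :: "'a => complex"
proof
 assume "AE x. h x = f x"
 then show "AE x. h x = g x" using assms by eventually_elim simp
next
 assume "AE x. h x = g x"
 then show "AE x. h x = f x" using assms by eventually_elim simp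
qed
then show ?thesis by (simp add: canon_def)
qed

definition ndist :: "('a => complex) => ('a => complex) => real" where
 "ndist f g = (if f \<in> X \<and> g \<in> X then N (%x. f x - g x) else 0)"

lemma ndist_canon:
 assumes "f \<in> X" "g \<in> X"
 shows "ndist f (canon g) = N (%x. f x - g x)" "ndist (canon f) g = N (%x. f x - g x)"
proof -
have 2: "ndist (canon f) g = N (%x. f x - g x)" if "f \<in> X" "g \<in> X" for f g
 using N_diff_cong[OF that(1) canon(1)[OF that(1)] that(2) canon(2)[OF that(1)]] canon(1)[OF that(1)] that by (simp add: ndist_def)
show "ndist (canon f) g = N (%x. f x - g x)" by (rule 2[OF assms])
show "ndist f (canon g) = N (%x. f x - g x)"
 using 2[OF assms(2,1)] N_diff_commute[OF assms] N_diff_commute[OF assms(1) canon(1)[OF assms(2)]] canon(1)[OF assms(2)] assms by (simp add: ndist_def)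
qed

lemma canon_metric: "Metric_space (canon ` X) ndist"
proof
show "0 <= ndist f g" for f g by (auto simp: ndist_def intro!: N_nonneg X_diff)
show "ndist f g = ndist g f" for f g using N_diff_commute by (auto simp: ndist_def)
fix f g assume "f \<in> canon ` X" "g \<in> canon ` X"
then obtain f' g' where e: "f = canon f'" "g = canon g'" "f' \<in> X" "g' \<in> X" by blast
have fg: "f \<in> X" "g \<in> X" using e canon by auto
have id: "canon f = f" "canon g = g" unfolding e using canon_eq[OF canon(2)] e by auto
show "ndist f g = 0 \<longleftrightarrow> f = g"
proof
 assume "ndist f g = 0"
 then have "AE x. f x - g x = 0" using N_eq_0[OF X_diff(1)[OF fg]] fg by (simp add: ndist_def)
 then have "AE x. f x = g x" by simp
 from canon_eq[OF this] show "f = g" unfolding id .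
next
 show "f = g ==> ndist f g = 0" using N_eq_0[OF X_zero] by (simp add: ndist_def)
qed
next
fix f g h assume "f \<in> canon ` X" "g \<in> canon ` X" "h \<in> canon ` X"
then have "f \<in> X" "g \<in> X" "h \<in> X" using canon by auto
then show "ndist f h <= ndist f g + ndist g h" using N_triangle[of f g h] by (simp add: ndist_def)
qed

end

context maximal_function_space
begin

lemma canon_complete: "Metric_space.mcomplete (canon ` X) ndist"
proof -
interpret Q: Metric_space "canon ` X" ndist by (rule canon_metric)
show ?thesis unfolding Q.mcomplete_def
proof (intro allI impI)
 fix sig assume "Q.MCauchy sig"
 then have sig: "!!n. sig n \<in> canon ` X" "\<forall>e>0. EX m. ALL n n'. m <= n --> m <= n' --> ndist (sig n) (sig n') < e"
  unfolding Q.MCauchy_def by auto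
 have sigX: "sig n \<in> X" for n using sig(1)[of n] canon by auto
 have "ALL k. EX m. ALL n n'. m <= n --> m <= n' --> ndist (sig n) (sig n') < (1/2) ^ k" using sig(2) by simp
 then obtain m where m: "!!k n n'. m k <= n ==> m k <= n' ==> ndist (sig n) (sig n') < (1/2) ^ k" by metis
 define r where "r k = (\<Sum>i\<le>k. m i)" for k :: nat
 have r1: "m k <= r k" for k by (simp add: r_def member_le_sum)
 have r2: "m k <= r (Suc k)" for k using r1[of k] by (simp add: r_def)
 have step: "N (%x. sig (r (Suc k)) x - sig (r k) x) <= (1/2) ^ k" for k
  using m[OF r2 r1, of k] sigX by (simp add: ndist_def)
 obtain g where g: "g \<in> X" "!!k. N (%x. sig (r k) x - g x) <= 2 * (1/2) ^ k"
  by (rule X_complete[of "%k. sig (r k)", OF sigX step]) (rule that)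
 have "EX n0. \<forall>n\<ge>n0. ndist (sig n) (canon g) < eps" if eps: "0 < eps" for eps
 proof -
  obtain k where k: "(1/2 :: real) ^ k < eps / 3" using real_arch_pow_inv[of "eps / 3" "1/2"] eps by auto
  have "ndist (sig n) (canon g) < eps" if "r k <= n" for n
  proof -
   have "ndist (sig n) (sig (r k)) < (1/2) ^ k" using that r1[of k] by (intro m) auto
   then have "N (%x. sig n x - sig (r k) x) < (1/2) ^ k" using sigX by (simp add: ndist_def)
   then show ?thesis
    using N_triangle[OF sigX sigX g(1), of n "r k"] g(2)[of k] k unfolding ndist_canon(1)[OF sigX g(1)] by linarith
  qed
  then show ?thesis by blast
 qed
 then have "limitin Q.mtopology sig (canon g) sequentially"
  unfolding Q.limitin_metric eventually_sequentially using sig(1) g(1) by auto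
 then show "EX x. limitin Q.mtopology sig x sequentially" by blast
qed
qed

text \<open>
 Open sets of the norm topology are unions of classes, so covers may be tested on representatives,
 and there compactness is completeness and total boundedness.
\<close>

lemma compact_closure_if_totally_bounded:
 assumes A: "A \<subseteq> X" and net: "!!eps. 0 < eps ==> EX S. finite S \<and> S \<subseteq> X \<and> (\<forall>a\<in>A. \<exists>s\<in>S. N (%x. a x - s x) <= eps)"
 shows "compactin (norm_topology X N) (norm_topology X N closure_of A)"
proof -
interpret Q: Metric_space "canon ` X" ndist by (rule canon_metric)
let ?C = "norm_topology X N closure_of A" and ?A = "canon ` A"
have "Q.mtotally_bounded ?A" unfolding Q.mtotally_bounded_def
proof (intro allI impI)
 fix eps :: real assume "0 < eps"
 then have "0 < eps / 3" by simp
 from net[OF this] obtain S where S: "finite S" "S \<subseteq> X" "\<forall>a\<in>A. \<exists>s\<in>S. N (%x. a x - s x) <= eps / 3" by blast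
 let ?P = "%s a. a \<in> A \<and> N (%x. a x - s x) <= eps / 3"
 define p where "p s = (SOME a. ?P s a)" for s
 let ?S = "{s \<in> S. EX a. ?P s a}"
 have p: "?P s (p s)" if "s \<in> ?S" for s using that unfolding p_def by (intro someI_ex[of "?P s"]) blast
 let ?K = "(%s. canon (p s)) ` ?S"
 have "finite ?K" using S(1) by simp
 moreover have "?K \<subseteq> ?A" using p by blast
 moreover have "?A \<subseteq> (\<Union>x\<in>?K. Q.mball x eps)"
 proof
  fix y assume "y \<in> ?A"
  then obtain a where a: "a \<in> A" "y = canon a" by blast
  obtain s where s: "s \<in> S" "N (%x. a x - s x) <= eps / 3" using S(3) a(1) by blast
  then have sS: "s \<in> ?S" using a(1) by blast
  note ps = p[OF sS]
  have X: "a \<in> X" "s \<in> X" "p s \<in> X" using A S(2) a(1) s(1) ps by auto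
  have "N (%x. p s x - a x) < eps"
   using N_triangle[OF X(3,2,1)] N_diff_commute[OF X(1,2)] ps s(2) \<open>0 < eps\<close> by linarith
  then have "ndist (canon (p s)) y < eps" unfolding a(2) using ndist_canon(1)[OF canon(1)[OF X(3)] X(1)] ndist_canon(2)[OF X(3,1)] canon(1)[OF X(3)] X(1) by (simp add: ndist_def)
  then show "y \<in> (\<Union>x\<in>?K. Q.mball x eps)" using sS X a(2) by auto
 qed
 ultimately show "EX K. finite K \<and> K \<subseteq> ?A \<and> ?A \<subseteq> (\<Union>x\<in>K. Q.mball x eps)" by blast
qed
then have comp: "compactin Q.mtopology (Q.mtopology closure_of ?A)"
 using Q.mtotally_bounded_eq_compact_closure_of[OF canon_complete] by blast
have cl: "canon f \<in> Q.mtopology closure_of ?A \<longleftrightarrow> f \<in> ?C" if f: "f \<in> X" for f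
proof -
 have nd: "ndist (canon f) (canon a) = N (%x. f x - a x)" if "a \<in> A" for a
  using that A f ndist_canon(1)[OF canon(1)[OF f], of a] ndist_canon(2)[OF f, of a] canon(1)[OF f] by (auto simp: ndist_def)
 have m: "canon f \<in> canon ` X" "!!a. a \<in> A ==> canon a \<in> canon ` X" using f A by auto
 have "(\<exists>y\<in>?A. y \<in> Q.mball (canon f) r) \<longleftrightarrow> (\<exists>a\<in>A. N (%x. f x - a x) < r)" for r
  using nd m by auto
 then show ?thesis unfolding Q.metric_closure_of norm_topology_closure_of[OF A] using f m(1) by simp
qed
have CX: "?C \<subseteq> X" unfolding norm_topology_closure_of[OF A] by blast
show ?thesis unfolding compactin_def topspace_norm_topology
proof (intro conjI CX allI impI)
 fix \<U> assume \<U>: "(\<forall>U\<in>\<U>. openin (norm_topology X N) U) \<and> ?C \<subseteq> \<Union>\<U>"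
 let ?V = "(%U. U \<inter> canon ` X) ` \<U>"
 have op: "openin Q.mtopology V" if V: "V \<in> ?V" for V
 proof -
  obtain U where U: "U \<in> \<U>" "V = U \<inter> canon ` X" using V by blast
  have "\<exists>r>0. Q.mball f r \<subseteq> V" if f: "f \<in> V" for f
  proof -
   have "openin (norm_topology X N) U" "f \<in> U" using \<U> U f by auto
   from norm_open_ball[OF this] obtain e where e: "0 < e" "\<forall>g\<in>X. N (%x. g x - f x) < e --> g \<in> U" by blast
   have "Q.mball f e \<subseteq> V"
   proof
    fix g assume "g \<in> Q.mball f e"
    then have g: "g \<in> canon ` X" "f \<in> canon ` X" "ndist f g < e" by auto
    then have X: "g \<in> X" "f \<in> X" using canon by auto
    then have "N (%x. g x - f x) < e" using g(3) N_diff_commute[OF X] by (simp add: ndist_def)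
    then show "g \<in> V" using e(2)[rule_format, OF X(1)] g(1) U(2) by blast
   qed
   then show ?thesis using e(1) by blast
  qed
  then show ?thesis unfolding Q.openin_mtopology using U(2) by blast
 qed
 have cov: "Q.mtopology closure_of ?A \<subseteq> \<Union>?V"
 proof
  fix f assume f: "f \<in> Q.mtopology closure_of ?A"
  then have "f \<in> canon ` X" using Q.metric_closure_of by blast
  then obtain f' where f': "f' \<in> X" "f = canon f'" by blast
  have "canon f = f" unfolding f'(2) by (rule canon_eq[OF canon(2)[OF f'(1)]])
  moreover have "f \<in> X" using f' canon by blast
  ultimately have "f \<in> ?C" using cl[of f] f by simp
  then show "f \<in> \<Union>?V" using \<U> \<open>f \<in> canon ` X\<close> by blast
 qed
 obtain \<F> where \<F>: "finite \<F>" "\<F> \<subseteq> ?V" "Q.mtopology closure_of ?A \<subseteq> \<Union>\<F>"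
  using comp op cov unfolding compactin_def by meson
 obtain \<G> where \<G>: "finite \<G>" "\<G> \<subseteq> \<U>" "\<F> = (%U. U \<inter> canon ` X) ` \<G>" using finite_subset_image[OF \<F>(1,2)] by blast
 have "?C \<subseteq> \<Union>\<G>"
 proof
  fix f assume f: "f \<in> ?C"
  then have fX: "f \<in> X" using CX by blast
  have "canon f \<in> \<Union>\<F>" using cl[OF fX] f \<F>(3) by blast
  then obtain U where U: "U \<in> \<G>" "canon f \<in> U" using \<G>(3) by blast
  have "openin (norm_topology X N) U" using \<U> \<G>(2) U by blast
  from norm_open_ball[OF this U(2)] obtain e where e: "0 < e" "\<forall>g\<in>X. N (%x. g x - canon f x) < e --> g \<in> U" by blast
  have "N (%x. f x - canon f x) = N (%x. f x - f x)" using ndist_canon(1)[OF fX fX] canon(1)[OF fX] fX by (simp add: ndist_def)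
  also have "... = 0" using N_eq_0[OF X_zero] by simp
  finally have "f \<in> U" using e fX by simp
  then show "f \<in> \<Union>\<G>" using U(1) by blast
 qed
 then show "\<exists>\<F>. finite \<F> \<and> \<F> \<subseteq> \<U> \<and> ?C \<subseteq> \<Union>\<F>" using \<G>(1,2) by blast
qed
qed

text \<open>
 \<open>S f\<close> is the limit of \<open>U (u n)\<close> for any \<open>u n\<close> tending to
 \<open>f\<close>. The estimate in the conclusion determines \<open>S f\<close> up to equality
 almost everywhere, and linearity follows from it.
\<close>

lemma extend_densely_defined:
 assumes D: "D \<subseteq> X" "!!u v. u \<in> D ==> v \<in> D ==> (%x. u x + v x) \<in> D" "!!c u. u \<in> D ==> (%x. c * u x) \<in> D"
  and dense: "!!f eps. f \<in> X ==> 0 < eps ==> \<exists>u\<in>D. N (%x. f x - u x) < eps"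
  and U: "!!u. u \<in> D ==> U u \<in> X"
  and Uadd: "!!u v. u \<in> D ==> v \<in> D ==> AE x. U (%x. u x + v x) x = U u x + U v x"
  and Ucmult: "!!c u. u \<in> D ==> AE x. U (%x. c * u x) x = c * U u x"
  and bound: "!!u. u \<in> D ==> N (U u) <= C * N u" and C: "0 < C"
 shows "EX S. linear_operator X X S \<and> (\<forall>f\<in>X. \<forall>u\<in>D. N (%x. S f x - U u x) <= C * N (%x. f x - u x))"
proof -
have DX: "u \<in> X" if "u \<in> D" for u using D(1) that by blast
have Udiff: "N (%x. U u x - U v x) <= C * N (%x. u x - v x)" if u: "u \<in> D" and v: "v \<in> D" for u v
proof -
 note v' = D(3)[OF v, of "-1"]
 have w: "(%x. u x + (-1) * v x) \<in> D" by (rule D(2)[OF u v'])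
 have "AE x. U u x - U v x = U (%x. u x + (-1) * v x) x"
  using Uadd[OF u v'] Ucmult[OF v, of "-1"] by eventually_elim simp
 then have "N (%x. U u x - U v x) = N (U (%x. u x + (-1) * v x))" by (intro N_cong U w X_diff u v)
 also have "... <= C * N (%x. u x + (-1) * v x)" by (rule bound[OF w])
 finally show ?thesis by simp
qed
have "\<exists>g\<in>X. \<forall>u\<in>D. N (%x. g x - U u x) <= C * N (%x. f x - u x)" if f: "f \<in> X" for f
proof -
 define delta where "delta n = (1/2) ^ n / (2 * C)" for n :: nat
 have delta: "0 < delta n" for n using C by (simp add: delta_def)
 obtain u where u: "!!n. u n \<in> D" "!!n. N (%x. f x - u n x) < delta n" using dense[OF f delta] by metis
 note uX = DX[OF u(1)]
 have "N (%x. U (u (Suc n)) x - U (u n) x) <= (1/2) ^ n" for n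
 proof -
  have "delta (Suc n) = delta n / 2" by (simp add: delta_def)
  then have "delta (Suc n) <= delta n" using delta[of n] by linarith
  then have "N (%x. u (Suc n) x - u n x) <= 2 * delta n"
   using N_triangle[OF uX f uX, of "Suc n" n] u(2)[of n] u(2)[of "Suc n"] N_diff_commute[OF f uX, of "Suc n"] by linarith
  then have "C * N (%x. u (Suc n) x - u n x) <= C * (2 * delta n)" using C by (intro mult_left_mono) auto
  also have "... = (1/2) ^ n" using C by (simp add: delta_def)
  finally show ?thesis using Udiff[OF u(1) u(1), of "Suc n" n] by linarith
 qed
 then obtain g where g: "g \<in> X" "!!n. N (%x. U (u n) x - g x) <= 2 * (1/2) ^ n"
  by (rule X_complete[of "%n. U (u n)", OF U[OF u(1)]]) (rule that)
 have "N (%x. g x - U v x) <= C * N (%x. f x - v x)" if v: "v \<in> D" for v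
 proof (rule LIMSEQ_le_const)
  have "(%n. 2 * (1/2) ^ n + C * (delta n + N (%x. f x - v x))) ---> 2 * 0 + C * (0 / (2 * C) + N (%x. f x - v x))"
   unfolding delta_def by (intro tendsto_intros LIMSEQ_realpow_zero) (use C in auto)
  then show "(%n. 2 * (1/2) ^ n + C * (delta n + N (%x. f x - v x))) ---> C * N (%x. f x - v x)" by simp
  have "N (%x. g x - U v x) <= 2 * (1/2) ^ n + C * (delta n + N (%x. f x - v x))" for n
  proof -
   have "N (%x. u n x - v x) <= delta n + N (%x. f x - v x)"
    using N_triangle[OF uX f DX[OF v], of n] u(2)[of n] N_diff_commute[OF f uX, of n] by linarith
   then have "C * N (%x. u n x - v x) <= C * (delta n + N (%x. f x - v x))" using C by (intro mult_left_mono) auto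
   then show ?thesis
    using N_triangle[OF g(1) U[OF u(1)] U[OF v], of n] g(2)[of n] N_diff_commute[OF g(1) U[OF u(1)], of n] Udiff[OF u(1) v, of n] by linarith
  qed
  then show "EX n0. \<forall>n\<ge>n0. N (%x. g x - U v x) <= 2 * (1/2) ^ n + C * (delta n + N (%x. f x - v x))" by blast
 qed
 then show ?thesis using g(1) by blast
qed
then obtain S where S: "!!f. f \<in> X ==> S f \<in> X" "!!f u. f \<in> X ==> u \<in> D ==> N (%x. S f x - U u x) <= C * N (%x. f x - u x)" by metis
have "linear_operator X X S" unfolding linear_operator_def
proof (intro conjI ballI allI impI S(1))
 fix f g assume f: "f \<in> X" and g: "g \<in> X"
 {
  assume eq: "AE x. f x = g x"
  show "AE x. S f x = S g x"
  proof (rule AE_eq_if_N_small[OF S(1)[OF f] S(1)[OF g], of "2 * C"])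
   fix eps :: real assume "0 < eps"
   then obtain u where u: "u \<in> D" "N (%x. f x - u x) < eps" using dense[OF f] by blast
   have gf: "N (%x. g x - u x) = N (%x. f x - u x)" by (rule N_diff_cong[OF f g DX[OF u(1)]]) (use eq in eventually_elim, simp)
   then have "N (%x. S f x - S g x) <= C * N (%x. f x - u x) + C * N (%x. f x - u x)"
    using N_triangle[OF S(1)[OF f] U[OF u(1)] S(1)[OF g]] S(2)[OF f u(1)] S(2)[OF g u(1), unfolded gf] N_diff_commute[OF S(1)[OF g] U[OF u(1)]] by linarith
   also have "... = 2 * C * N (%x. f x - u x)" by simp
   also have "... <= 2 * C * eps" using u(2) C by (intro mult_left_mono) auto
   finally show "N (%x. S f x - S g x) <= 2 * C * eps" .
  qed
 }
 note fg = X_add[OF f g] and Sfg = X_add[OF S(1)[OF f] S(1)[OF g]]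
 show "AE x. S (%x. f x + g x) x = S f x + S g x"
 proof (rule AE_eq_if_N_small[OF S(1)[OF fg] Sfg, of "4 * C"])
  fix eps :: real assume "0 < eps"
  then obtain u v where u: "u \<in> D" "N (%x. f x - u x) < eps" and v: "v \<in> D" "N (%x. g x - v x) < eps" using dense f g by metis
  note w = D(2)[OF u(1) v(1)] and Uuv = X_add[OF U[OF u(1)] U[OF v(1)]]
  have "N (%x. (f x + g x) - (u x + v x)) <= N (%x. f x - u x) + N (%x. g x - v x)"
   using N_add[OF X_diff(1)[OF f DX[OF u(1)]] X_diff(1)[OF g DX[OF v(1)]]] by (simp add: algebra_simps)
  then have "N (%x. (f x + g x) - (u x + v x)) <= 2 * eps" using u(2) v(2) by linarith
  then have 1: "C * N (%x. (f x + g x) - (u x + v x)) <= C * (2 * eps)" using C by (intro mult_left_mono) auto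
  have 2: "N (%x. S (%x. f x + g x) x - U (%x. u x + v x) x) <= C * N (%x. (f x + g x) - (u x + v x))" by (rule S(2)[OF fg w])
  have 3: "N (%x. (S f x + S g x) - U (%x. u x + v x) x) = N (%x. (S f x - U u x) + (S g x - U v x))"
   by (rule N_cong[OF X_add[OF X_diff(1)[OF S(1)[OF f] U[OF u(1)]] X_diff(1)[OF S(1)[OF g] U[OF v(1)]]] X_diff(1)[OF Sfg U[OF w]]])
    (use Uadd[OF u(1) v(1)] in eventually_elim, simp)
  have 4: "N (%x. (S f x - U u x) + (S g x - U v x)) <= N (%x. S f x - U u x) + N (%x. S g x - U v x)"
   by (intro N_add X_diff S(1) U f g u v)
  have 5: "C * N (%x. f x - u x) <= C * eps" "C * N (%x. g x - v x) <= C * eps" using u(2) v(2) C by (auto intro!: mult_left_mono)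
  have "N (%x. S (%x. f x + g x) x - (S f x + S g x)) <= C * (2 * eps) + C * eps + C * eps"
   using N_triangle[OF S(1)[OF fg] U[OF w] Sfg] N_diff_commute[OF Sfg U[OF w]] 1 2 3 4 5 S(2)[OF f u(1)] S(2)[OF g v(1)] by linarith
  then show "N (%x. S (%x. f x + g x) x - (S f x + S g x)) <= 4 * C * eps" by simp
 qed
next
 fix c f assume f: "f \<in> X"
 note cf = X_cmult[OF f, of c] and cSf = X_cmult[OF S(1)[OF f], of c]
 show "AE x. S (%x. c * f x) x = c * S f x"
 proof (rule AE_eq_if_N_small[OF S(1)[OF cf] cSf, of "2 * C * norm c"])
  fix eps :: real assume "0 < eps"
  then obtain u where u: "u \<in> D" "N (%x. f x - u x) < eps" using dense[OF f] by blast
  note w = D(3)[OF u(1), of c]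
  have 1: "N (%x. c * f x - c * u x) = norm c * N (%x. f x - u x)"
   using N_cmult[OF X_diff(1)[OF f DX[OF u(1)]], of c] by (simp add: right_diff_distrib)
  have "N (%x. c * S f x - U (%x. c * u x) x) = N (%x. c * (S f x - U u x))"
   by (rule N_cong[OF X_cmult[OF X_diff(1)[OF S(1)[OF f] U[OF u(1)]]] X_diff(1)[OF cSf U[OF w]]])
    (use Ucmult[OF u(1), of c] in eventually_elim, simp add: right_diff_distrib)
  also have "... = norm c * N (%x. S f x - U u x)" by (intro N_cmult X_diff S(1) U f u)
  also have "... <= norm c * (C * N (%x. f x - u x))" by (intro mult_left_mono S(2) f u) simp
  finally have 2: "N (%x. c * S f x - U (%x. c * u x) x) <= C * norm c * N (%x. f x - u x)" by (simp add: mult_ac)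
  have 3: "N (%x. S (%x. c * f x) x - U (%x. c * u x) x) <= C * norm c * N (%x. f x - u x)" using S(2)[OF cf w] unfolding 1 by (simp add: mult_ac)
  have 4: "C * norm c * N (%x. f x - u x) <= C * norm c * eps" using u(2) C by (intro mult_left_mono) auto
  have "N (%x. S (%x. c * f x) x - c * S f x) <= C * norm c * eps + C * norm c * eps"
   using N_triangle[OF S(1)[OF cf] U[OF w] cSf] N_diff_commute[OF cSf U[OF w]] 2 3 4 by linarith
  then show "N (%x. S (%x. c * f x) x - c * S f x) <= 2 * C * norm c * eps" by (simp add: mult_ac)
 qed
qed auto
then show ?thesis using S(2) by blast
qed

end

context commutator_on_function_space
begin

section \<open>Compactness of the commutator\<close>

text \<open>
 \<open>E n\<close> is the set where \<open>|f|\<close>, \<open>|b|\<close> or \<open>|x|\<close>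
 exceeds \<open>n\<close>; these sets decrease to the empty set.
\<close>

lemma truncations:
 assumes conc: "s_concave s X N" "0 < s" and b: "b \<in> Lmeas" and f: "f \<in> X"
 obtains E where "!!n::nat. E n \<in> sets lebesgue" "!!n. restr (- E n) f \<in> tame b" "(%n. N (%x. f x - restr (- E n) f x)) ---> 0"
  "!!x. (%n. restr (- E n) f x) ---> f x"
proof -
note [measurable] = b X_measurable[OF f]
have [measurable]: "(%x::'a. norm x) \<in> Lmeas" by (rule measurable_completion) measurable
define w where "w x = max (norm (f x)) (max (norm (b x)) (norm x))" for x
have [measurable]: "w \<in> Lmeas" unfolding w_def by measurable
define E where "E n = {x. real n < w x}" for n :: nat
have E1: "E n \<in> sets lebesgue" for n
proof -
 have "{x \<in> space lebesgue. real n < w x} \<in> sets lebesgue" by measurable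
 then show ?thesis by (simp add: E_def)
qed
have E2: "E (Suc n) \<subseteq> E n" for n by (auto simp: E_def)
have ex: "EX n. x ~: E n" for x using real_arch_simple[of "w x"] by (auto simp: E_def not_less)
have bd: "norm (f x) <= real n \<and> norm (b x) <= real n \<and> norm x <= real n" if "x ~: E n" for n x using that by (simp add: E_def w_def not_less)
have [measurable]: "- E n \<in> sets lebesgue" for n using E1[of n] by (simp add: Compl_in_sets_lebesgue)
have "restr (- E n) f \<in> Linf_c" for n
 by (rule Linf_cI[of _ "real n" "real n"]) (use bd in \<open>auto simp: restr_def split: if_splits\<close>)
moreover have "norm (b x) <= real n" if "restr (- E n) f x ~= 0" for n x using that bd[of x n] by (auto simp: restr_def split: if_splits)
ultimately have t: "restr (- E n) f \<in> tame b" for n unfolding tame_def by blast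
have "(%x. f x - restr (- E n) f x) = restr (E n) f" for n by (auto simp: restr_def fun_eq_iff)
then have l: "(%n. N (%x. f x - restr (- E n) f x)) ---> 0"
 using X_order_continuous[where E = E, OF conc f E1 E2] ex by simp
have "(%n. restr (- E n) f x) ---> f x" for x
proof (rule tendsto_eventually)
 obtain m where "x ~: E m" using ex by blast
 then have "x ~: E n" if "m <= n" for n using that lift_Suc_antimono_le[of E, OF E2] by blast
 then show "\<forall>\<^sub>F n in sequentially. restr (- E n) f x = f x"
  unfolding eventually_sequentially by (auto simp: restr_def)
qed
from that[OF E1 t l this] show ?thesis .
qed

text \<open>
 Approximating \<open>b\<close> by continuous symbols makes the image of the unit ball of truncated
 functions totally bounded, and density transfers this to the extension. On the domain of the
 commutator the extension agrees with the formula, because along the truncations of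
 \<open>f\<close> the formula converges almost everywhere for a subsequence, while the extension
 converges in \<open>X\<close>.
\<close>

theorem commutator_compact:
 assumes conv: "r_convex r X N" "1 < r" and conc: "s_concave s X N" "0 < s"
  and b: "b \<in> Lmeas" and osc: "osc_le b beta" "0 < beta"
  and approx: "!!eps. 0 < eps ==> EX phi. continuous_on UNIV phi \<and> bounded {x. phi x ~= 0} \<and> osc_le (%x. b x - phi x) eps"
 shows "commutator_compact_on X N b T"
proof -
let ?U = "commutator b T" and ?D = "tame b"
obtain C where C: "0 < C" and bound: "ALL b beta. \<forall>f\<in>tame b. b \<in> Lmeas --> 0 < beta --> osc_le b beta -->
  commutator b T f \<in> X \<and> N (commutator b T f) <= C * beta * N f" using commutator_bound by blast
have DX: "?D \<subseteq> X" using tame_Linf_c Linf_c_in_X by blast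
have UX: "?U u \<in> X" and UN: "N (?U u) <= C * beta * N u" if "u \<in> ?D" for u using bound that b osc by auto
have Cbeta: "0 < C * beta" using C osc by simp
have dense: "\<exists>u\<in>?D. N (%x. f x - u x) < eps" if f: "f \<in> X" and eps: "0 < eps" for f eps
proof -
 obtain E where E: "!!n::nat. restr (- E n) f \<in> ?D" "(%n. N (%x. f x - restr (- E n) f x)) ---> 0"
  by (rule truncations[OF conc b f]) (rule that)
 obtain n where "N (%x. f x - restr (- E n) f x) < eps"
  using order_tendstoD(2)[OF E(2) eps] unfolding eventually_sequentially by blast
 then show ?thesis using E(1) by blast
qed
have "EX S. linear_operator X X S \<and> (\<forall>f\<in>X. \<forall>u\<in>?D. N (%x. S f x - ?U u x) <= C * beta * N (%x. f x - u x))"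
 by (rule extend_densely_defined[OF DX _ _ _ _ _ _ _ Cbeta])
  (rule tame_add tame_cmult dense UX tame_commutator_linear[OF b] UN; assumption)+
then obtain S where S: "linear_operator X X S" "!!f u. f \<in> X ==> u \<in> ?D ==> N (%x. S f x - ?U u x) <= C * beta * N (%x. f x - u x)"
 by blast
have SX: "S f \<in> X" if "f \<in> X" for f using S(1) that by (simp add: linear_operator_def)
have netU: "EX F. finite F \<and> F \<subseteq> X \<and> (\<forall>u\<in>?D. N u <= 1 --> (\<exists>s\<in>F. N (%x. ?U u x - s x) <= eps))" if eps: "0 < eps" for eps
proof -
 have "0 < eps / (2 * C)" using eps C by simp
 from approx[OF this] obtain phi where phi: "continuous_on UNIV phi" "bounded {x. phi x ~= 0}" "osc_le (%x. b x - phi x) (eps / (2 * C))" by blast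
 obtain R where R: "0 < R" "!!x. phi x ~= 0 ==> norm x <= R" using phi(2) unfolding bounded_pos by auto
 have phim[measurable]: "phi \<in> Lmeas"
  by (rule measurable_completion) (use phi(1) in \<open>simp add: borel_measurable_continuous_onI\<close>)
 have "bounded (phi ` cball 0 R)" by (intro compact_imp_bounded compact_continuous_image continuous_on_subset[OF phi(1)]) auto
 then obtain B where B0: "0 < B" "!!x. x \<in> cball 0 R ==> norm (phi x) <= B" unfolding bounded_pos by blast
 have B: "norm (phi x) <= B" for x using B0 R(2)[of x] by (cases "phi x = 0") auto
 have eps2: "0 < eps / 2" using eps by simp
 obtain F where F: "finite F" "F \<subseteq> X" "\<forall>f\<in>Linf_c. N f <= 1 --> commutator phi T f \<in> X \<and> (\<exists>s\<in>F. N (%x. commutator phi T f x - s x) <= eps / 2)"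
  using continuous_symbol_net[OF conv conc phi(1) R eps2] by blast
 have "\<exists>s\<in>F. N (%x. ?U u x - s x) <= eps" if u: "u \<in> ?D" "N u <= 1" for u
 proof -
  note uL = tame_Linf_c[OF u(1)]
  let ?psi = "%x. b x - phi x"
  obtain Bu where Bu: "!!x. u x ~= 0 ==> norm (b x) <= Bu" using u(1) by (auto simp: tame_def)
  have "norm (?psi x) <= Bu + B" if "u x ~= 0" for x using Bu[OF that] B[of x] norm_triangle_ineq4[of "b x" "phi x"] by linarith
  then have upsi: "u \<in> tame ?psi" using uL unfolding tame_def by blast
  have psi: "commutator ?psi T u \<in> X" "N (commutator ?psi T u) <= C * (eps / (2 * C)) * N u"
   using bound[rule_format, OF upsi _ \<open>0 < eps / (2 * C)\<close> phi(3)] b by auto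
  have psiN: "N (commutator ?psi T u) <= eps / 2" using psi(2) mult_left_mono[OF u(2) less_imp_le[OF eps2]] C by simp
  obtain s where s: "commutator phi T u \<in> X" "s \<in> F" "N (%x. commutator phi T u x - s x) <= eps / 2" using F(3) uL u(2) by blast
  have pu: "(%y. phi y * u y) \<in> L2" by (intro Linf_c_subset_L2 Linf_c_mult[OF uL phim B])
  have qu: "(%y. ?psi y * u y) \<in> L2" by (intro Linf_c_subset_L2 tame_mult[OF upsi]) (use b in measurable)
  have eq: "(%y. b y * u y) = (%y. phi y * u y + ?psi y * u y)" by (auto simp: algebra_simps)
  have sX: "s \<in> X" using s(2) F(2) by blast
  have "AE x. ?U u x - s x = (commutator phi T u x - s x) + commutator ?psi T u x"
   using T_add[OF pu qu] unfolding commutator_def eq by eventually_elim (simp add: algebra_simps)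
  then have "N (%x. ?U u x - s x) = N (%x. (commutator phi T u x - s x) + commutator ?psi T u x)"
   by (intro N_cong X_add X_diff UX u psi(1) s(1) sX)
  also have "... <= eps / 2 + eps / 2" using N_add[OF X_diff(1)[OF s(1) sX] psi(1)] s(3) psiN by linarith
  finally show ?thesis using s(2) by auto
 qed
 then show ?thesis using F(1,2) by blast
qed
have "compact_operator X N S" unfolding compact_operator_def
proof (intro conjI S(1) compact_closure_if_totally_bounded)
 show "S ` {f \<in> X. N f <= 1} \<subseteq> X" using SX by blast
 fix eps :: real assume eps: "0 < eps"
 then have "0 < eps / 2" by simp
 from netU[OF this] obtain F where F: "finite F" "F \<subseteq> X" "\<forall>u\<in>?D. N u <= 1 --> (\<exists>s\<in>F. N (%x. ?U u x - s x) <= eps / 2)" by blast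
 have "\<exists>s\<in>F. N (%x. S f x - s x) <= eps" if f: "f \<in> X" "N f <= 1" for f
 proof -
  define delta where "delta = eps / (4 * (C * beta))"
  have delta: "0 < delta" using eps Cbeta by (simp add: delta_def)
  obtain u where u: "u \<in> ?D" "N (%x. f x - u x) < delta" using dense[OF f(1) delta] by blast
  have uX: "u \<in> X" using u(1) DX by blast
  have Nu: "N u <= 1 + delta"
   using N_triangle[OF uX f(1) X_zero] N_diff_commute[OF f(1) uX] u(2) f(2) by simp
  \<comment> \<open>The approximant \<open>u\<close> may leave the unit ball slightly and is scaled back by \<open>t\<close>.\<close>
  define t where "t = 1 / (1 + delta)"
  have t: "0 < t" "t * (1 + delta) = 1" using delta by (simp_all add: t_def)
  let ?v = "%x. of_real t * u x"
  have v: "?v \<in> ?D" by (rule tame_cmult[OF u(1)])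
  then have vX: "?v \<in> X" using DX by blast
  have "N ?v = t * N u" using N_cmult[OF uX, of "of_real t"] t(1) by simp
  moreover have "t * N u <= t * (1 + delta)" using Nu t(1) by (intro mult_left_mono) auto
  ultimately have Nv: "N ?v <= 1" using t(2) by simp
  have "(%x. u x - ?v x) = (%x. of_real (1 - t) * u x)" by (auto simp: algebra_simps)
  then have uv: "N (%x. u x - ?v x) = \<bar>1 - t\<bar> * N u" using N_cmult[OF uX, of "of_real (1 - t)"] by (simp only: norm_of_real)
  have t1: "1 - t = t * delta" using t(2) by (simp add: algebra_simps)
  have "\<bar>1 - t\<bar> * N u = delta * (t * N u)" unfolding t1 using t(1) delta by (simp add: abs_mult)
  also have "... <= delta * 1" using \<open>t * N u <= t * (1 + delta)\<close> t(2) delta by (intro mult_left_mono) auto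
  finally have "N (%x. f x - ?v x) <= 2 * delta" using N_triangle[OF f(1) uX vX] u(2) uv by linarith
  then have "C * beta * N (%x. f x - ?v x) <= C * beta * (2 * delta)" using Cbeta by (intro mult_left_mono) auto
  also have "... = eps / 2" using C osc(2) by (simp add: delta_def)
  finally have 1: "N (%x. S f x - ?U ?v x) <= eps / 2" using S(2)[OF f(1) v] by linarith
  obtain s where s: "s \<in> F" "N (%x. ?U ?v x - s x) <= eps / 2" using F(3) v Nv by blast
  have "N (%x. S f x - s x) <= eps" using N_triangle[OF SX[OF f(1)] UX[OF v] subsetD[OF F(2) s(1)]] 1 s(2) by linarith
  then show ?thesis using s(1) by blast
 qed
 then show "EX F. finite F \<and> F \<subseteq> X \<and> (\<forall>a\<in>S ` {f \<in> X. N f <= 1}. \<exists>s\<in>F. N (%x. a x - s x) <= eps)" using F(1,2) by blast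
qed
moreover have "AE x. S f x = ?U f x" if f: "f \<in> commutator_domain X b" for f
proof -
 have fX: "f \<in> X" and f2: "f \<in> L2" and bf2: "(%x. b x * f x) \<in> L2" using f by (auto simp: commutator_domain_def)
 note [measurable] = b X_measurable[OF fX]
 obtain E where E: "!!n::nat. E n \<in> sets lebesgue" "!!n. restr (- E n) f \<in> ?D" "(%n. N (%x. f x - restr (- E n) f x)) ---> 0"
  "!!x. (%n. restr (- E n) f x) ---> f x"
  by (rule truncations[OF conc b fX]) (rule that)
 define u where "u n = restr (- E n) f" for n
 have [measurable]: "- E n \<in> sets lebesgue" for n using E(1)[of n] by (simp add: Compl_in_sets_lebesgue)
 have um[measurable]: "u n \<in> Lmeas" for n unfolding u_def by measurable
 have ule: "norm (u n x) <= norm (f x)" for n x by (simp add: u_def restr_def)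
 have ulim: "(%n. u n x) ---> f x" for x using E(4) by (simp add: u_def)
 have uD: "u n \<in> ?D" for n using E(2) by (simp add: u_def)
 obtain r where r: "strict_mono r" "AE x. (%k. T (u (r k)) x) ---> T f x"
  using T_dominated[OF f2, of u f] um ule ulim by auto
 have blim: "(%k. b x * u (r k) x) ---> b x * f x" for x
  by (intro tendsto_mult tendsto_const LIMSEQ_subseq_LIMSEQ[OF ulim r(1), unfolded o_def])
 have ble: "norm (b x * u (r k) x) <= norm (b x * f x)" for k x unfolding norm_mult by (intro mult_left_mono ule) simp
 obtain r' where r': "strict_mono r'" "AE x. (%k. T (%y. b y * u (r (r' k)) y) x) ---> T (%y. b y * f y) x"
  using T_dominated[OF bf2, of "%k x. b x * u (r k) x" "%x. b x * f x"] ble blim by auto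
 have lim: "AE x. (%k. ?U (u (r (r' k))) x) ---> ?U f x"
  using r(2) r'(2)
 proof eventually_elim
  case (elim x)
  have "(%k. T (u (r (r' k))) x) ---> T f x" using LIMSEQ_subseq_LIMSEQ[OF elim(1) r'(1)] by (simp add: o_def)
  then show ?case unfolding commutator_def by (intro tendsto_intros elim(2))
 qed
 have Ufm: "?U f \<in> Lmeas" by (rule commutator_measurable[OF f2 bf2 b])
 note SfX = SX[OF fX]
 note [measurable] = Ufm X_measurable[OF SfX]
 have "(%n. C * beta * N (%x. f x - u n x)) ---> C * beta * 0" unfolding u_def by (intro tendsto_intros E(3))
 then have N0: "(%n. C * beta * N (%x. f x - u n x)) ---> 0" by simp
 have key: "(%x. ?U f x - S f x) \<in> X \<and> N (%x. ?U f x - S f x) <= eps" if eps: "0 < eps" for eps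
 proof -
  obtain n0 where n0: "!!n. n0 <= n ==> C * beta * N (%x. f x - u n x) < eps"
   using order_tendstoD(2)[OF N0 eps] unfolding eventually_sequentially by blast
  define v where "v k = u (r (r' (k + n0)))" for k
  have idx: "n0 <= r (r' (k + n0))" for k
   using seq_suble[OF r(1), of "r' (k + n0)"] seq_suble[OF r'(1), of "k + n0"] by linarith
  have vD: "v k \<in> ?D" for k using uD by (simp add: v_def)
  have h: "(%x. ?U (v k) x - S f x) \<in> X" for k by (rule X_diff(1)[OF UX[OF vD] SfX])
  have hN: "N (%x. ?U (v k) x - S f x) <= eps" for k
   using S(2)[OF fX vD, of k] n0[OF idx, of k] N_diff_commute[OF SfX UX[OF vD], of k] by (simp add: v_def)
  have hl: "AE x. (%k. ?U (v k) x - S f x) ---> ?U f x - S f x"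
   using lim
  proof eventually_elim
   case (elim x)
   then have "(%k. ?U (v k) x) ---> ?U f x" unfolding v_def by (rule LIMSEQ_ignore_initial_segment)
   then show ?case by (intro tendsto_intros)
  qed
  have hm: "(%x. ?U f x - S f x) \<in> Lmeas" by measurable
  show ?thesis using X_fatou[OF h hN hl hm] by blast
 qed
 have "(%x. (?U f x - S f x) + S f x) \<in> X" using key[OF zero_less_one] SfX by (intro X_add) auto
 then have UfX: "?U f \<in> X" by simp
 have "AE x. ?U f x = S f x" by (rule AE_eq_if_N_small[OF UfX SfX, of 1]) (use key in simp)
 then show ?thesis by eventually_elim simp
qed
moreover have "norm_topology X N closure_of commutator_domain X b = X"
proof -
 have dX: "commutator_domain X b \<subseteq> X" by (auto simp: commutator_domain_def)
 have "?D \<subseteq> commutator_domain X b"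
  unfolding commutator_domain_def using DX Linf_c_subset_L2 tame_Linf_c tame_mult[OF _ b] by blast
 then show ?thesis unfolding norm_topology_closure_of[OF dX] using dense by blast
qed
ultimately show ?thesis unfolding commutator_compact_on_def by blast
qed

end

theorem theorem6p1:
  fixes T :: "('a::euclidean_space \<Rightarrow> complex) \<Rightarrow> ('a \<Rightarrow> complex)"
    and X :: "('a \<Rightarrow> complex) set"
    and N :: "('a \<Rightarrow> complex) \<Rightarrow> real"
    and b :: "'a \<Rightarrow> complex"
    and r s :: real
  assumes "dini_calderon_zygmund T"
    and "1 < r" and "r < s"
    and "banach_function_space X N"
    and "r_convex r X N" and "s_concave s X N"
    and "maximal_bounded_on X N"
    and "maximal_bounded_on (associate_space X N) (associate_norm X N)"
    and "b \<in> CMO"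
  shows "commutator_compact_on X N b T"
proof -
have lin: "linear_operator L2 L2 T" using assms(1) by (simp add: dini_calderon_zygmund_def)
obtain C where C: "!!f. f \<in> L2 ==> L2_norm (T f) <= C * L2_norm f"
 using assms(1) unfolding dini_calderon_zygmund_def by blast
obtain K where K: "dini_kernel K" and rep: "\<forall>f\<in>Cc_infty. AE x. x ~: supp f --> T f x = (LI y. K x y * f y)"
 using assms(1) unfolding dini_calderon_zygmund_def by blast
obtain omega where omega: "dini_modulus omega"
 and Kx: "ALL x x' y. 0 < norm (x - x') \<and> norm (x - x') < 1/2 * norm (x - y) -->
   norm (K x y - K x' y) <= 1 / norm (x - y) ^ DIM('a) * omega (norm (x - x') / norm (x - y))"
 and Ky: "ALL x y y'. 0 < norm (y - y') \<and> norm (y - y') < 1/2 * norm (x - y) -->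
   norm (K x y - K x y') <= 1 / norm (x - y) ^ DIM('a) * omega (norm (y - y') / norm (x - y))"
 using K unfolding dini_kernel_def by blast
have bd: "L2_norm (T f) <= \<bar>C\<bar> * L2_norm f" if "f \<in> L2" for f
proof -
 have "0 <= L2_norm f" by (simp add: L2_norm_def)
 then have "C * L2_norm f <= \<bar>C\<bar> * L2_norm f" by (intro mult_right_mono) auto
 then show ?thesis using C[OF that] by linarith
qed
interpret commutator_on_function_space T K omega "\<bar>C\<bar>" X N
proof unfold_locales
 show "linear_operator L2 L2 T" by (rule lin)
 show "L2_norm (T f) <= \<bar>C\<bar> * L2_norm f" if "f \<in> L2" for f by (rule bd[OF that])
qed (use omega Kx Ky rep assms in auto)
have bm: "b \<in> Lmeas" and bB: "BMO_norm b < \<infinity>"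
 using assms(9) by (auto simp: CMO_def BMO_def L1_loc_def L0_def)
define beta where "beta = enn2real (BMO_norm b) + 1"
have "BMO_norm b = ennreal (enn2real (BMO_norm b))" using bB by (simp add: less_top)
also have "... < ennreal beta" by (intro ennreal_lessI) (auto simp: beta_def intro: add_nonneg_pos)
finally have osc: "osc_le b beta" by (rule bmo_osc)
have beta: "0 < beta" by (simp add: beta_def add_nonneg_pos)
have app: "EX phi. continuous_on UNIV phi \<and> bounded {x. phi x ~= 0} \<and> osc_le (%x. b x - phi x) eps" if "0 < eps" for eps
proof -
 obtain phi where phi: "phi \<in> Cc_infty" "BMO_norm (%x. b x - phi x) < ennreal eps"
  using assms(9) \<open>0 < eps\<close> unfolding CMO_def by blast
 have "Ck 0 phi" using phi(1) unfolding Cc_infty_def by blast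
 moreover have "bounded {x. phi x ~= 0}"
  using phi(1) compact_imp_bounded bounded_subset[OF _ closure_subset] unfolding Cc_infty_def supp_def by blast
 ultimately show ?thesis using bmo_osc[OF phi(2)] by auto
qed
have "0 < s" using assms(2,3) by linarith
then show ?thesis by (rule commutator_compact[OF assms(5,2,6) _ bm osc beta app])
qed

end
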